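(* Let $X$ be a Banach space, $A:D(A)\subset X\to X$ the infinitesimal generator of an analytic semigroup on $X$ ($D(A)$ not necessarily dense), $\alpha\in[0,1)$, $X_\alpha$ an intermediate space as described in the context such that the part of $A$ in $X_\alpha$ is sectorial in $X_\alpha$, and let $f:[0,T]\times X_\alpha\to X$ be such that for every $R>0$ there is $L=L(R,T)$ with $$\|f(t_1,v_1)-f(t_2,v_2)\|\leq L\big(|t_1-t_2|+\|v_1-v_2\|_\alpha\big)$$ for all $t_1,t_2\in[0,T]$ and $v_1,v_2\in X_\alpha$ with $\max(\|v_1\|_\alpha,\|v_2\|_\alpha)\le R$. Let $u_0\in X_\alpha$ and let $u$ be the mild solution on $[0,T]$ of $u'=Au+f(t,u)$, $u(0)=u_0$. Let $u_n$ be the numerical solution, with time step $\tau>0$ and $t_n=n\tau$, obtained by an $s$-stage explicit exponential Runge--Kutta method (see context) satisfying $\sum_{i=1}^s b_i(z)=\varphi_1(z)$. Then, for $\tau$ sufficiently small and $0\le t_n\le T$, $$\|u_n-u(t_n)\|_\alpha\leq C\tau^{1-\alpha}(|\log\tau|+1).$$ If further $u_0\in X_\gamma$ for some $\gamma\in(\alpha,1)$ and the part of $A$ in $X_\gamma$ is also sectorial in $X_\gamma$, then the error satisfies (for $\tau$ sufficiently small and $0\le t_n\le T$) $$\|u_n-u(t_n)\|_\alpha\leq C\tau^{1-\alpha},\qquad \|u_n-u(t_n)\|_\gamma\leq C\tau^{1-\gamma}.$$ The constants $C$ depend on $T$, but are independent of $n$ and $\tau$.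
   Context: Analytic semigroups. A linear operator $A:D(A)\subset X\to X$ on a Banach space $X$ (norm $\|\cdot\|$) is sectorial (equivalently, is the infinitesimal generator of an analytic semigroup in the sense used here) if there are $\omega\in\mathbb{R}$, $\theta\in(\pi/2,\pi)$, $M>0$ such that the resolvent set of $A$ contains $\{\lambda\neq\omega:|\arg(\lambda-\omega)|<\theta\}$ and $\|(\lambda I-A)^{-1}\|\le M/|\lambda-\omega|$ there. The domain is not assumed dense. $\mathrm{e}^{tA}$ ($t\ge0$) is the analytic semigroup generated by $A$ (Dunford integral for $t>0$, $\mathrm{e}^{0A}=I$); it need not be strongly continuous at $t=0$. The part of $A$ in a subspace $Y$ is the restriction of $A$ to $\{x\in D(A)\cap Y:Ax\in Y\}$. Interpolation spaces. For $0<\beta<1$, $1\le p\le\infty$, $D_A(\beta,p)=\{x\in X: v(t)=\|t^{1-\beta-1/p}A\mathrm{e}^{tA}x\|\in L^p(0,1)\}$ with norm $\|x\|+\|v\|_{L^p(0,1)}$; also $D_A(0,p)=X$. For $0<\beta<1$, $X_\beta$ is any Banach space with continuous embeddings $D_A(\beta,1)\subset X_\beta\subset D_A(\beta,\infty)$, with norm $\|\cdot\|_\beta$; $X_0=X$. This applies with $\beta=\alpha$ and $\beta=\gamma$. Functions $\varphi_k$. $\varphi_0(z)=\mathrm{e}^z$ and $\varphi_k(z)=\int_0^1\mathrm{e}^{(1-\xi)z}\frac{\xi^{k-1}}{(k-1)!}\,\mathrm{d}\xi$ for $k\ge1$; $\varphi_k(tA)$ is defined by the same formula with $\mathrm{e}^{(1-\xi)tA}$.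 Mild solution. $u(t)=\mathrm{e}^{tA}u_0+\int_0^t\mathrm{e}^{(t-\xi)A}f(\xi,u(\xi))\,\mathrm{d}\xi$. For $u_0\in X_\alpha$ a unique mild solution $u\in L^\infty((0,T);X_\alpha)\cap C((0,T];X_\alpha)$ exists for some $T>0$; throughout, $T>0$ is such that this solution exists on $[0,T]$. Explicit exponential Runge--Kutta (EERK) method. With $t_{ni}=t_n+c_i\tau$, $$u_{n+1}=\mathrm{e}^{\tau A}u_n+\tau\sum_{i=1}^s b_i(\tau A)F_{ni},\quad U_{ni}=\mathrm{e}^{c_i\tau A}u_n+\tau\sum_{j=1}^{i-1}a_{ij}(\tau A)F_{nj}\ (1\le i\le s),\quad F_{nj}=f(t_{nj},U_{nj}),$$ started from $u_0$, where $c_i\in[0,1]$, $c_1=0$, the $b_i(z)$ are linear combinations of the functions $\varphi_k(z)$, and the $a_{ij}(z)$ are linear combinations of the functions $\varphi_k(z)$ and $\varphi_k(c_lz)$ with $c_l>0$. *)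

theory Defs
  imports "HOL-Analysis.Analysis" "HOL-Probability.Essential_Supremum"
begin

section \<open>Complex Banach spaces\<close>

text \<open>The resolvent set is a set of complex numbers, so the ambient space is a complex Banach space.\<close>

class complex_banach = banach +
  fixes scaleC :: "complex \<Rightarrow> 'a \<Rightarrow> 'a"  (infixr "*\<^sub>C" 75)
  assumes scaleC_add_right: "a *\<^sub>C (x + y) = a *\<^sub>C x + a *\<^sub>C y"
    and scaleC_add_left: "(a + b) *\<^sub>C x = a *\<^sub>C x + b *\<^sub>C x"
    and scaleC_scaleC: "a *\<^sub>C (b *\<^sub>C x) = (a * b) *\<^sub>C x"
    and scaleC_of_real: "complex_of_real r *\<^sub>C x = r *\<^sub>R x"
    and norm_scaleC: "norm (a *\<^sub>C x) = cmod a * norm x"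

definition complex_subspace :: "'a::complex_banach set \<Rightarrow> bool" where
  "complex_subspace Y \<longleftrightarrow>
     0 \<in> Y \<and> (\<forall>x\<in>Y. \<forall>y\<in>Y. x + y \<in> Y) \<and> (\<forall>a. \<forall>x\<in>Y. a *\<^sub>C x \<in> Y)"

text \<open>A Banach space contained in the ambient space is a pair of a carrier \<open>Y\<close> and its own norm
  \<open>nY\<close>; the values of \<open>nY\<close> outside \<open>Y\<close> are irrelevant.\<close>

definition banach_norm_on :: "'a::complex_banach set \<Rightarrow> ('a \<Rightarrow> real) \<Rightarrow> bool" where
  "banach_norm_on Y nY \<longleftrightarrow> complex_subspace Y \<and>
     (\<forall>x\<in>Y. 0 \<le> nY x \<and> (nY x = 0 \<longleftrightarrow> x = 0)) \<and>
     (\<forall>a. \<forall>x\<in>Y. nY (a *\<^sub>C x) = cmod a * nY x) \<and>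
     (\<forall>x\<in>Y. \<forall>y\<in>Y. nY (x + y) \<le> nY x + nY y) \<and>
     (\<forall>s. (\<forall>n. s n \<in> Y) \<and> (\<forall>e>0. \<exists>N. \<forall>m\<ge>N. \<forall>n\<ge>N. nY (s m - s n) < e) \<longrightarrow>
          (\<exists>l\<in>Y. (\<lambda>n. nY (s n - l)) \<longlonglongrightarrow> 0))"

section \<open>Sectorial operators and the analytic semigroup\<close>

text \<open>An unbounded operator is a domain \<open>D\<close> together with a total function \<open>A\<close> whose values outside
  \<open>D\<close> are irrelevant.\<close>

definition linear_operator_in ::
    "'a::complex_banach set \<Rightarrow> 'a set \<Rightarrow> ('a \<Rightarrow> 'a) \<Rightarrow> bool" where
  "linear_operator_in Y D A \<longleftrightarrow> complex_subspace D \<and> D \<subseteq> Y \<and> A ` D \<subseteq> Y \<and>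
     (\<forall>x\<in>D. \<forall>y\<in>D. A (x + y) = A x + A y) \<and> (\<forall>a. \<forall>x\<in>D. A (a *\<^sub>C x) = a *\<^sub>C A x)"

definition resolvent ::
    "'a::complex_banach set \<Rightarrow> ('a \<Rightarrow> 'a) \<Rightarrow> complex \<Rightarrow> 'a \<Rightarrow> 'a" where
  "resolvent D A z = inv_into D (\<lambda>x. z *\<^sub>C x - A x)"

definition resolvent_set ::
    "'a::complex_banach set \<Rightarrow> ('a \<Rightarrow> real) \<Rightarrow> 'a set \<Rightarrow> ('a \<Rightarrow> 'a) \<Rightarrow> complex set" where
  "resolvent_set Y nY D A =
     {z. bij_betw (\<lambda>x. z *\<^sub>C x - A x) D Y \<and> (\<exists>K. \<forall>y\<in>Y. nY (resolvent D A z y) \<le> K * nY y)}"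

definition sectorial_with ::
    "'a::complex_banach set \<Rightarrow> ('a \<Rightarrow> real) \<Rightarrow> 'a set \<Rightarrow> ('a \<Rightarrow> 'a) \<Rightarrow> real \<Rightarrow> real \<Rightarrow> real \<Rightarrow> bool" where
  "sectorial_with Y nY D A \<omega> \<theta> M \<longleftrightarrow> pi / 2 < \<theta> \<and> \<theta> < pi \<and> 0 < M \<and>
     (\<forall>z. z \<noteq> of_real \<omega> \<and> \<bar>Arg (z - of_real \<omega>)\<bar> < \<theta> \<longrightarrow>
        z \<in> resolvent_set Y nY D A \<and>
        (\<forall>y\<in>Y. nY (resolvent D A z y) \<le> M / cmod (z - of_real \<omega>) * nY y))"

definition sectorial ::
    "'a::complex_banach set \<Rightarrow> ('a \<Rightarrow> real) \<Rightarrow> 'a set \<Rightarrow> ('a \<Rightarrow> 'a) \<Rightarrow> bool" where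
  "sectorial Y nY D A \<longleftrightarrow>
     linear_operator_in Y D A \<and> (\<exists>\<omega> \<theta> M. sectorial_with Y nY D A \<omega> \<theta> M)"

definition part_domain :: "'a::complex_banach set \<Rightarrow> ('a \<Rightarrow> 'a) \<Rightarrow> 'a set \<Rightarrow> 'a set" where
  "part_domain D A Y = {x \<in> D \<inter> Y. A x \<in> Y}"

text \<open>The Dunford integral
  \<open>1 / (2 pi i) * integral of exp (t z) R(z, A) x dz\<close> over \<open>\<omega> + \<gamma>\<close>, where \<open>\<gamma>\<close> consists of the two rays
  \<open>{|arg z| = \<eta>, |z| \<ge> r}\<close> and the arc \<open>{|arg z| \<le> \<eta>, |z| = r}\<close>, oriented counterclockwise.
  All integrals of vector-valued functions are Henstock-Kurzweil integrals, since the library's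
  Bochner integral is restricted to separable spaces.\<close>

definition dunford_integral ::
    "'a::complex_banach set \<Rightarrow> ('a \<Rightarrow> 'a) \<Rightarrow> real \<Rightarrow> real \<Rightarrow> real \<Rightarrow> real \<Rightarrow> 'a \<Rightarrow> 'a" where
  "dunford_integral D A \<omega> \<eta> r t x =
     (let g = (\<lambda>z. exp (of_real t * (of_real \<omega> + z)) *\<^sub>C resolvent D A (of_real \<omega> + z) x) in
      (1 / (2 * of_real pi * \<i>)) *\<^sub>C
        (integral {r..} (\<lambda>\<rho>. cis \<eta> *\<^sub>C g (of_real \<rho> * cis \<eta>))
         + integral {- \<eta>..\<eta>} (\<lambda>\<phi>. (\<i> * of_real r * cis \<phi>) *\<^sub>C g (of_real r * cis \<phi>))
         - integral {r..} (\<lambda>\<rho>. cis (- \<eta>) *\<^sub>C g (of_real \<rho> * cis (- \<eta>)))))"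

text \<open>For a sectorial operator the Dunford integral does not depend on the admissible \<open>\<omega>, \<eta>, r\<close>;
  hence an arbitrary choice is made.\<close>

definition analytic_semigroup ::
    "'a::complex_banach set \<Rightarrow> ('a \<Rightarrow> 'a) \<Rightarrow> real \<Rightarrow> 'a \<Rightarrow> 'a" where
  "analytic_semigroup D A t x =
     (if t = 0 then x
      else let (\<omega>, \<eta>, r) = (SOME (\<omega>, \<eta>, r). 0 < r \<and> pi / 2 < \<eta> \<and>
                               (\<exists>\<theta> M. \<eta> < \<theta> \<and> sectorial_with UNIV norm D A \<omega> \<theta> M))
           in dunford_integral D A \<omega> \<eta> r t x)"

section \<open>Real interpolation spaces and intermediate spaces\<close>

definition in_Lp01 :: "ennreal \<Rightarrow> (real \<Rightarrow> real) \<Rightarrow> bool" where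
  "in_Lp01 p v \<longleftrightarrow> v \<in> borel_measurable (lebesgue_on {0<..<1}) \<and>
     (if p = \<infinity> then esssup (lebesgue_on {0<..<1}) (\<lambda>t. ereal \<bar>v t\<bar>) < \<infinity>
      else integrable (lebesgue_on {0<..<1}) (\<lambda>t. \<bar>v t\<bar> powr enn2real p))"

definition Lp01_norm :: "ennreal \<Rightarrow> (real \<Rightarrow> real) \<Rightarrow> real" where
  "Lp01_norm p v =
     (if p = \<infinity> then real_of_ereal (esssup (lebesgue_on {0<..<1}) (\<lambda>t. ereal \<bar>v t\<bar>))
      else (LINT t|lebesgue_on {0<..<1}. \<bar>v t\<bar> powr enn2real p) powr (1 / enn2real p))"

definition interp_fun ::
    "'a::complex_banach set \<Rightarrow> ('a \<Rightarrow> 'a) \<Rightarrow> real \<Rightarrow> ennreal \<Rightarrow> 'a \<Rightarrow> real \<Rightarrow> real" where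
  "interp_fun D A \<beta> p x t =
     norm (t powr (1 - \<beta> - enn2real (1 / p)) *\<^sub>R A (analytic_semigroup D A t x))"

definition interp_space ::
    "'a::complex_banach set \<Rightarrow> ('a \<Rightarrow> 'a) \<Rightarrow> real \<Rightarrow> ennreal \<Rightarrow> 'a set" where
  "interp_space D A \<beta> p = {x. in_Lp01 p (interp_fun D A \<beta> p x)}"

definition interp_norm ::
    "'a::complex_banach set \<Rightarrow> ('a \<Rightarrow> 'a) \<Rightarrow> real \<Rightarrow> ennreal \<Rightarrow> 'a \<Rightarrow> real" where
  "interp_norm D A \<beta> p x = norm x + Lp01_norm p (interp_fun D A \<beta> p x)"

definition continuously_embedded ::
    "'a set \<Rightarrow> ('a \<Rightarrow> real) \<Rightarrow> 'a set \<Rightarrow> ('a \<Rightarrow> real) \<Rightarrow> bool" where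
  "continuously_embedded Y nY Z nZ \<longleftrightarrow> Y \<subseteq> Z \<and> (\<exists>C. \<forall>y\<in>Y. nZ y \<le> C * nY y)"

definition intermediate_space ::
    "'a::complex_banach set \<Rightarrow> ('a \<Rightarrow> 'a) \<Rightarrow> real \<Rightarrow> 'a set \<Rightarrow> ('a \<Rightarrow> real) \<Rightarrow> bool" where
  "intermediate_space D A \<beta> Y nY \<longleftrightarrow>
     (if \<beta> = 0 then Y = UNIV \<and> nY = norm
      else banach_norm_on Y nY \<and>
           continuously_embedded (interp_space D A \<beta> 1) (interp_norm D A \<beta> 1) Y nY \<and>
           continuously_embedded Y nY (interp_space D A \<beta> \<infinity>) (interp_norm D A \<beta> \<infinity>))"

section \<open>Mild solutions\<close>

text \<open>The first three conditions say that \<open>u\<close> takes values in \<open>X\<^sub>\<alpha>\<close>, is essentially bounded on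
  \<open>(0,T)\<close> and is continuous on \<open>(0,T]\<close>, both with respect to the norm of \<open>X\<^sub>\<alpha>\<close>;
  the integral is taken in \<open>X\<close>.\<close>

definition mild_solution ::
    "(real \<Rightarrow> 'a::complex_banach \<Rightarrow> 'a) \<Rightarrow> 'a set \<Rightarrow> ('a \<Rightarrow> real) \<Rightarrow> (real \<Rightarrow> 'a \<Rightarrow> 'a) \<Rightarrow>
     'a \<Rightarrow> real \<Rightarrow> (real \<Rightarrow> 'a) \<Rightarrow> bool" where
  "mild_solution S Y nY f u0 T u \<longleftrightarrow>
     (\<forall>t\<in>{0..T}. u t \<in> Y) \<and>
     (\<exists>K. AE t in lebesgue_on {0<..<T}. nY (u t) \<le> K) \<and>
     (\<forall>t\<in>{0<..T}. ((\<lambda>s. nY (u s - u t)) \<longlongrightarrow> 0) (at t within {0<..T})) \<and>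
     (\<forall>t\<in>{0..T}. ((\<lambda>\<xi>. S (t - \<xi>) (f \<xi> (u \<xi>))) has_integral (u t - S t u0)) {0..t})"

section \<open>Explicit exponential Runge--Kutta methods\<close>

definition phi :: "nat \<Rightarrow> complex \<Rightarrow> complex" where
  "phi k z =
     (if k = 0 then exp z
      else integral {0..1} (\<lambda>\<xi>. exp (of_real (1 - \<xi>) * z) * of_real (\<xi> ^ (k - 1) / fact (k - 1))))"

text \<open>\<open>phi_op S k t\<close> is the operator obtained from \<open>phi k (t z)\<close> when \<open>S t\<close> replaces \<open>exp (t z)\<close>.\<close>

definition phi_op :: "(real \<Rightarrow> 'a::complex_banach \<Rightarrow> 'a) \<Rightarrow> nat \<Rightarrow> real \<Rightarrow> 'a \<Rightarrow> 'a" where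
  "phi_op S k t x =
     (if k = 0 then S t x
      else integral {0..1} (\<lambda>\<xi>. (\<xi> ^ (k - 1) / fact (k - 1)) *\<^sub>R S ((1 - \<xi>) * t) x))"

text \<open>The stages are numbered from 1 to \<open>stages\<close>. The weights are given by their coefficients in
  \<open>b\<^sub>i(z) = \<Sum>k. bcoef i k * \<phi>\<^sub>k(z)\<close> and
  \<open>a\<^sub>i\<^sub>j(z) = \<Sum>k. (acoef i j k * \<phi>\<^sub>k(z) + \<Sum>l. ccoef i j l k * \<phi>\<^sub>k(c\<^sub>l z))\<close>, where \<open>k\<close> ranges up to
  \<open>maxphi\<close> and \<open>l\<close> over the stages with \<open>c\<^sub>l > 0\<close>.\<close>

record eerk =
  stages :: nat
  node :: "nat \<Rightarrow> real"
  maxphi :: nat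
  bcoef :: "nat \<Rightarrow> nat \<Rightarrow> complex"
  acoef :: "nat \<Rightarrow> nat \<Rightarrow> nat \<Rightarrow> complex"
  ccoef :: "nat \<Rightarrow> nat \<Rightarrow> nat \<Rightarrow> nat \<Rightarrow> complex"

definition eerk_method :: "eerk \<Rightarrow> bool" where
  "eerk_method m \<longleftrightarrow> 1 \<le> stages m \<and> node m 1 = 0 \<and> (\<forall>i\<in>{1..stages m}. node m i \<in> {0..1})"

definition b_fun :: "eerk \<Rightarrow> nat \<Rightarrow> complex \<Rightarrow> complex" where
  "b_fun m i z = (\<Sum>k\<le>maxphi m. bcoef m i k * phi k z)"

definition b_op :: "(real \<Rightarrow> 'a::complex_banach \<Rightarrow> 'a) \<Rightarrow> eerk \<Rightarrow> nat \<Rightarrow> real \<Rightarrow> 'a \<Rightarrow> 'a" where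
  "b_op S m i \<tau> x = (\<Sum>k\<le>maxphi m. bcoef m i k *\<^sub>C phi_op S k \<tau> x)"

definition a_op ::
    "(real \<Rightarrow> 'a::complex_banach \<Rightarrow> 'a) \<Rightarrow> eerk \<Rightarrow> nat \<Rightarrow> nat \<Rightarrow> real \<Rightarrow> 'a \<Rightarrow> 'a" where
  "a_op S m i j \<tau> x =
     (\<Sum>k\<le>maxphi m. acoef m i j k *\<^sub>C phi_op S k \<tau> x +
        (\<Sum>l\<in>{l\<in>{1..stages m}. 0 < node m l}. ccoef m i j l k *\<^sub>C phi_op S k (node m l * \<tau>) x))"

text \<open>\<open>eerk_stage S f m \<tau> t w i\<close> is the internal stage \<open>U\<^sub>n\<^sub>i\<close> for \<open>t = t\<^sub>n\<close> and \<open>w = u\<^sub>n\<close>.\<close>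

function eerk_stage ::
    "(real \<Rightarrow> 'a::complex_banach \<Rightarrow> 'a) \<Rightarrow> (real \<Rightarrow> 'a \<Rightarrow> 'a) \<Rightarrow> eerk \<Rightarrow> real \<Rightarrow> real \<Rightarrow> 'a \<Rightarrow> nat \<Rightarrow> 'a"
where
  "eerk_stage S f m \<tau> t w i =
     S (node m i * \<tau>) w +
     \<tau> *\<^sub>R (\<Sum>j\<in>{1..<i}. a_op S m i j \<tau> (f (t + node m j * \<tau>) (eerk_stage S f m \<tau> t w j)))"
  by auto
termination
  by (relation "Wellfounded.measure (\<lambda>(S, f, m, \<tau>, t, w, i). i)") auto

declare eerk_stage.simps [simp del]

definition eerk_step ::
    "(real \<Rightarrow> 'a::complex_banach \<Rightarrow> 'a) \<Rightarrow> (real \<Rightarrow> 'a \<Rightarrow> 'a) \<Rightarrow> eerk \<Rightarrow> real \<Rightarrow> real \<Rightarrow> 'a \<Rightarrow> 'a" where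
  "eerk_step S f m \<tau> t w =
     S \<tau> w +
     \<tau> *\<^sub>R (\<Sum>i\<in>{1..stages m}. b_op S m i \<tau> (f (t + node m i * \<tau>) (eerk_stage S f m \<tau> t w i)))"

primrec eerk_solution ::
    "(real \<Rightarrow> 'a::complex_banach \<Rightarrow> 'a) \<Rightarrow> (real \<Rightarrow> 'a \<Rightarrow> 'a) \<Rightarrow> eerk \<Rightarrow> real \<Rightarrow> 'a \<Rightarrow> nat \<Rightarrow> 'a" where
  "eerk_solution S f m \<tau> u0 0 = u0"
| "eerk_solution S f m \<tau> u0 (Suc n) = eerk_step S f m \<tau> (real n * \<tau>) (eerk_solution S f m \<tau> u0 n)"

end

theory Submission
  imports Defs
begin

text \<open>The error is propagated by the discrete variation-of-constants formula. Since the weights sum to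
  \<open>phi 1\<close>, its local terms contain only the variation of \<open>g t = f t (u t)\<close> over one step, which by the Lipschitz
  condition is controlled by \<open>nY (u \<xi> - u t)\<close>, and the previous errors; the smoothing estimate
  \<open>nY (S t x) \<le> C1 * t powr - \<alpha> * norm x\<close> leads to a weakly singular discrete Gronwall inequality.
  The increments of \<open>u\<close> are bounded by \<open>(\<xi> - t) / t\<close>, from \<open>u0\<close>, plus \<open>(\<xi> - t) powr (1 - \<epsilon>) / \<epsilon>\<close> with
  \<open>\<epsilon> \<ge> \<alpha>\<close>, from the convolution integral. For \<open>\<alpha> > 0\<close> one takes \<open>\<epsilon> = \<alpha>\<close>; for \<open>\<alpha> = 0\<close> the choice of \<open>\<epsilon>\<close>
  costs the logarithm, which disappears if \<open>u0\<close> lies in \<open>Xg\<close>, because \<open>g\<close> is then Hoelder continuous.\<close>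

section \<open>Contour integrals of vector-valued functions\<close>

text \<open>The domain of \<open>A\<close> may fail to be dense, so the semigroup need not be
  strongly continuous at 0 and no identity can be extended from a dense set. Identities are verified
  after composition with the resolvent \<open>Q 1\<close> and then cancelled, because
  \<open>Q 1\<close> is injective. Contour integrals enter as limits of integrals over arcs of
  growing radius: by Cauchy's theorem the rays are absorbed into the arc, so independence of the
  contour and the passage of operators under the integral are statements about continuous functions
  on compact intervals. The hypothesis on the weights concerns scalar functions, the method applies
  operators; linear independence of the \<open>phi k\<close> turns the former into equations between
  coefficients. The Lipschitz constant is only local. Hence the Gronwall argument is a strong
  induction with an explicit majorant, which at the same time keeps the numerical values and all
  stages in the ball of radius \<open>Ru + 2\<close>.\<close>

lemma bounded_bilinear_scaleC:
  "bounded_bilinear (scaleC :: complex \<Rightarrow> 'a::complex_banach \<Rightarrow> 'a)"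
proof
  fix a b :: complex and x y :: 'a and r :: real
  show "(a + b) *\<^sub>C x = a *\<^sub>C x + b *\<^sub>C x" by (rule scaleC_add_left)
  show "a *\<^sub>C (x + y) = a *\<^sub>C x + a *\<^sub>C y" by (rule scaleC_add_right)
  show "(r *\<^sub>R a) *\<^sub>C x = r *\<^sub>R (a *\<^sub>C x)"
    by (simp add: scaleR_conv_of_real scaleC_scaleC flip: scaleC_of_real)
  show "a *\<^sub>C (r *\<^sub>R x) = r *\<^sub>R (a *\<^sub>C x)"
    by (simp add: scaleC_scaleC mult.commute flip: scaleC_of_real)
  show "\<exists>K. \<forall>a (x::'a). norm (a *\<^sub>C x) \<le> norm a * norm x * K"
    by (rule exI[of _ 1]) (simp add: norm_scaleC)
qed

interpretation scaleC: bounded_bilinear "scaleC :: complex \<Rightarrow> 'a::complex_banach \<Rightarrow> 'a"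
  by (rule bounded_bilinear_scaleC)

lemma scaleC_one [simp]: "1 *\<^sub>C (x::'a::complex_banach) = x"
  using scaleC_of_real[of 1 x] by simp

lemma has_vector_derivative_compose_complex:
  fixes F :: "complex \<Rightarrow> 'a::complex_banach"
  assumes "(F has_derivative (\<lambda>h. h *\<^sub>C F')) (at (g x) within Z)"
    and "(g has_vector_derivative g') (at x within S)" and "g ` S \<subseteq> Z"
  shows "((\<lambda>x. F (g x)) has_vector_derivative (g' *\<^sub>C F')) (at x within S)"
proof -
  have "((\<lambda>x. F (g x)) has_derivative (\<lambda>h. (h *\<^sub>R g') *\<^sub>C F')) (at x within S)"
    using has_derivative_in_compose[of g "\<lambda>h. h *\<^sub>R g'" x S F "\<lambda>h. h *\<^sub>C F'"]
      has_derivative_subset[OF assms(1) assms(3)] assms(2)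
    by (simp add: has_vector_derivative_def)
  then show ?thesis
    by (simp add: has_vector_derivative_def scaleC.scaleR_left)
qed

lemma has_vector_derivative_cis:
  "((\<lambda>\<phi>. c * cis \<phi>) has_vector_derivative (\<i> * c * cis \<phi>)) (at \<phi> within S)"
proof -
  have "((\<lambda>z. c * exp (\<i> * z)) has_field_derivative (\<i> * c * exp (\<i> * of_real \<phi>))) (at (of_real \<phi>))"
    by (auto intro!: derivative_eq_intros)
  from has_vector_derivative_real_field[OF this, of S] show ?thesis
    by (simp add: cis_conv_exp)
qed

lemma has_vector_derivative_ray:
  "((\<lambda>\<rho>. of_real \<rho> * c) has_vector_derivative c) (at \<rho> within S)" for c :: complex
proof -
  have "((\<lambda>z. z * c) has_field_derivative c) (at (of_real \<rho>))"
    by (auto intro!: derivative_eq_intros)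
  from has_vector_derivative_real_field[OF this, of S] show ?thesis by simp
qed

section \<open>Complex differentiability on sectors and integrals over arcs\<close>

definition csector :: "real \<Rightarrow> complex set" where
  "csector \<eta> = {of_real \<rho> * cis \<phi> |\<rho> \<phi>. 0 < \<rho> \<and> \<bar>\<phi>\<bar> \<le> \<eta>}"

lemma csectorI: "0 < \<rho> \<Longrightarrow> \<bar>\<phi>\<bar> \<le> \<eta> \<Longrightarrow> of_real \<rho> * cis \<phi> \<in> csector \<eta>"
  by (auto simp: csector_def)

lemma csector_nonzero: "z \<in> csector \<eta> \<Longrightarrow> z \<noteq> 0"
  by (auto simp: csector_def)

text \<open>The rays of the integration contour are boundary points of
  \<open>csector \<eta>\<close>, hence the derivative relative to the set. Continuity of the
  derivative is included because the Leibniz rule is applied to it.\<close>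

definition cdifferentiable_on :: "(complex \<Rightarrow> 'a::complex_banach) \<Rightarrow> complex set \<Rightarrow> bool" where
  "cdifferentiable_on F Z \<longleftrightarrow> (\<exists>F'. continuous_on Z F' \<and>
     (\<forall>z\<in>Z. (F has_derivative (\<lambda>h. h *\<^sub>C F' z)) (at z within Z)))"

lemma cdifferentiable_on_continuous: "cdifferentiable_on F Z \<Longrightarrow> continuous_on Z F"
  unfolding cdifferentiable_on_def by (meson has_derivative_continuous_on)

lemma cdifferentiable_on_scaleC:
  fixes F :: "complex \<Rightarrow> 'a::complex_banach"
  assumes f: "continuous_on Z f'" "\<And>z. z \<in> Z \<Longrightarrow> (f has_field_derivative f' z) (at z within Z)"
    and F: "cdifferentiable_on F Z"
  shows "cdifferentiable_on (\<lambda>z. f z *\<^sub>C F z) Z"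
proof -
  obtain F' where F': "continuous_on Z F'"
    "\<And>z. z \<in> Z \<Longrightarrow> (F has_derivative (\<lambda>h. h *\<^sub>C F' z)) (at z within Z)"
    using F unfolding cdifferentiable_on_def by blast
  have cf: "continuous_on Z f" using f(2) by (rule DERIV_continuous_on)
  have "((\<lambda>z. f z *\<^sub>C F z) has_derivative (\<lambda>h. h *\<^sub>C (f z *\<^sub>C F' z + f' z *\<^sub>C F z))) (at z within Z)"
    if z: "z \<in> Z" for z
  proof -
    have "((\<lambda>z. f z *\<^sub>C F z) has_derivative (\<lambda>h. f z *\<^sub>C (h *\<^sub>C F' z) + (f' z * h) *\<^sub>C F z)) (at z within Z)"
      using scaleC.FDERIV[OF f(2)[OF z, unfolded has_field_derivative_def] F'(2)[OF z]] .
    then show ?thesis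
      by (simp add: scaleC_add_right scaleC_scaleC mult.commute)
  qed
  moreover have "continuous_on Z (\<lambda>z. f z *\<^sub>C F' z + f' z *\<^sub>C F z)"
    by (intro continuous_intros scaleC.continuous_on cf f(1) F'(1)
        cdifferentiable_on_continuous[OF F])
  ultimately show ?thesis unfolding cdifferentiable_on_def by blast
qed

text \<open>The factor in front of F is the derivative of the parametrization
  \<open>N * cis \<phi>\<close>; this is the contour integral over the counterclockwise arc of
  radius N.\<close>

definition arc_integral :: "real \<Rightarrow> (complex \<Rightarrow> 'a::complex_banach) \<Rightarrow> real \<Rightarrow> 'a" where
  "arc_integral \<eta> F N =
     integral {- \<eta>..\<eta>} (\<lambda>\<phi>. (\<i> * of_real N * cis \<phi>) *\<^sub>C F (of_real N * cis \<phi>))"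

lemma continuous_on_arc:
  assumes "continuous_on (csector \<eta>) F" "0 < N"
  shows "continuous_on {- \<eta>..\<eta>} (\<lambda>\<phi>. F (of_real N * cis \<phi>))"
  by (rule continuous_on_compose2[OF assms(1)])
    (use assms(2) in \<open>auto intro!: continuous_intros csectorI\<close>)

lemma continuous_on_ray:
  assumes "continuous_on (csector \<eta>) F" "0 < r" "\<bar>\<phi>\<bar> \<le> \<eta>"
  shows "continuous_on {r..} (\<lambda>\<rho>. cis \<phi> *\<^sub>C F (of_real \<rho> * cis \<phi>))"
proof -
  have "continuous_on {r..} (\<lambda>\<rho>. F (of_real \<rho> * cis \<phi>))"
    by (rule continuous_on_compose2[OF assms(1)])
      (use assms(2,3) in \<open>auto intro!: continuous_intros csectorI\<close>)
  then show ?thesis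
    by (intro scaleC.continuous_on continuous_intros)
qed

lemma arc_integrand_continuous:
  assumes "continuous_on (csector \<eta>) F" "0 < N"
  shows "continuous_on {- \<eta>..\<eta>} (\<lambda>\<phi>. (\<i> * of_real N * cis \<phi>) *\<^sub>C F (of_real N * cis \<phi>))"
  by (intro scaleC.continuous_on continuous_intros continuous_on_arc[OF assms])

text \<open>Cauchy's theorem for the boundary of an annular sector: the derivative of the integral over
  the arc with respect to its radius is the difference of the two boundary values on the rays.\<close>

lemma arc_integral_diff:
  fixes F :: "complex \<Rightarrow> 'a::complex_banach"
  assumes F: "cdifferentiable_on F (csector \<eta>)" and \<eta>: "0 \<le> \<eta>" and r: "0 < r" "r \<le> N"
  shows "arc_integral \<eta> F N = arc_integral \<eta> F r
     + integral {r..N} (\<lambda>\<rho>. cis \<eta> *\<^sub>C F (of_real \<rho> * cis \<eta>))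
     - integral {r..N} (\<lambda>\<rho>. cis (- \<eta>) *\<^sub>C F (of_real \<rho> * cis (- \<eta>)))"
proof -
  \<comment> \<open>On the arc dz is i z times the differential of the angle, so the integrand is
    \<open>\<i> *\<^sub>C P z\<close>. The radial and the angular derivative of P differ only by the
    factor \<open>\<i> * \<rho>\<close>, the polar form of the Cauchy-Riemann equations.\<close>
  define P where "P = (\<lambda>z. z *\<^sub>C F z)"
  have "cdifferentiable_on P (csector \<eta>)"
    unfolding P_def
    by (rule cdifferentiable_on_scaleC[where f' = "\<lambda>_. 1"]) (auto intro!: derivative_eq_intros F)
  then obtain P' where cP': "continuous_on (csector \<eta>) P'"
    and P': "\<And>z. z \<in> csector \<eta> \<Longrightarrow> (P has_derivative (\<lambda>h. h *\<^sub>C P' z)) (at z within csector \<eta>)"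
    unfolding cdifferentiable_on_def by blast
  note cF = cdifferentiable_on_continuous[OF F]
  define g where "g = (\<lambda>\<rho> \<phi>. \<i> *\<^sub>C P (of_real \<rho> * cis \<phi>))"
  define g' where "g' = (\<lambda>\<rho> \<phi>. \<i> *\<^sub>C (cis \<phi> *\<^sub>C P' (of_real \<rho> * cis \<phi>)))"
  have arc: "arc_integral \<eta> F \<rho> = integral (cbox (- \<eta>) \<eta>) (g \<rho>)" for \<rho>
    by (simp add: arc_integral_def g_def P_def scaleC_scaleC mult.assoc)
  have D: "((\<lambda>\<rho>. integral (cbox (- \<eta>) \<eta>) (g \<rho>)) has_vector_derivative
      integral (cbox (- \<eta>) \<eta>) (g' \<rho>)) (at \<rho> within {r..N})" if \<rho>: "\<rho> \<in> {r..N}" for \<rho>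
  proof (rule leibniz_rule_vector_derivative)
    fix x t assume x: "x \<in> {r..N}" and t: "t \<in> cbox (- \<eta>) \<eta>"
    have "((\<lambda>x. P (of_real x * cis t)) has_vector_derivative (cis t *\<^sub>C P' (of_real x * cis t)))
        (at x within {r..N})"
      by (rule has_vector_derivative_compose_complex[OF P' has_vector_derivative_ray])
        (use r x t in \<open>auto intro!: csectorI\<close>)
    from bounded_linear.has_vector_derivative[OF scaleC.bounded_linear_right this, of \<i>]
    show "((\<lambda>x. g x t) has_vector_derivative g' x t) (at x within {r..N})"
      by (simp add: g_def g'_def)
  next
    fix x assume "x \<in> {r..N}"
    with r have "continuous_on (cbox (- \<eta>) \<eta>) (g x)"
      using arc_integrand_continuous[OF cF, of x] by (simp add: g_def P_def scaleC_scaleC mult.assoc)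
    then show "g x integrable_on cbox (- \<eta>) \<eta>" by (rule integrable_continuous)
  next
    show "continuous_on ({r..N} \<times> cbox (- \<eta>) \<eta>) (\<lambda>(x, t). g' x t)"
      unfolding g'_def split_beta
      by (intro scaleC.continuous_on continuous_intros continuous_on_compose2[OF cP'])
        (use r in \<open>auto intro!: csectorI\<close>)
  qed (use \<rho> in auto)
  \<comment> \<open>The differentiated integrand is \<open>1 / \<rho>\<close> times an angular
    derivative, so its integral is a difference of boundary values of P.\<close>
  have I: "integral (cbox (- \<eta>) \<eta>) (g' \<rho>) =
      cis \<eta> *\<^sub>C F (of_real \<rho> * cis \<eta>) - cis (- \<eta>) *\<^sub>C F (of_real \<rho> * cis (- \<eta>))"
    if \<rho>: "\<rho> \<in> {r..N}" for \<rho>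
  proof -
    have \<rho>0: "\<rho> > 0" using \<rho> r by simp
    have "((\<lambda>\<phi>. P (of_real \<rho> * cis \<phi>)) has_vector_derivative
        ((\<i> * of_real \<rho> * cis \<phi>) *\<^sub>C P' (of_real \<rho> * cis \<phi>))) (at \<phi> within {- \<eta>..\<eta>})"
      if "\<phi> \<in> {- \<eta>..\<eta>}" for \<phi>
      by (rule has_vector_derivative_compose_complex[OF P' has_vector_derivative_cis])
        (use \<rho>0 that in \<open>auto intro!: csectorI\<close>)
    then have "((\<lambda>\<phi>. (\<i> * of_real \<rho> * cis \<phi>) *\<^sub>C P' (of_real \<rho> * cis \<phi>)) has_integral
        (P (of_real \<rho> * cis \<eta>) - P (of_real \<rho> * cis (- \<eta>)))) {- \<eta>..\<eta>}"
      by (intro fundamental_theorem_of_calculus) (use \<eta> in auto)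
    from has_integral_linear[OF this scaleC.bounded_linear_right, of "of_real (1 / \<rho>)"]
    have "((\<lambda>\<phi>. g' \<rho> \<phi>) has_integral
        (cis \<eta> *\<^sub>C F (of_real \<rho> * cis \<eta>) - cis (- \<eta>) *\<^sub>C F (of_real \<rho> * cis (- \<eta>)))) {- \<eta>..\<eta>}"
      using \<rho>0 by (simp add: o_def g'_def P_def scaleC_scaleC scaleC.diff_right)
    then show ?thesis by (simp add: integral_unique)
  qed
  have "((\<lambda>\<rho>. integral (cbox (- \<eta>) \<eta>) (g' \<rho>)) has_integral
     (arc_integral \<eta> F N - arc_integral \<eta> F r)) {r..N}"
    unfolding arc using D by (intro fundamental_theorem_of_calculus r)
  then have "((\<lambda>\<rho>. cis \<eta> *\<^sub>C F (of_real \<rho> * cis \<eta>) - cis (- \<eta>) *\<^sub>C F (of_real \<rho> * cis (- \<eta>)))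
      has_integral (arc_integral \<eta> F N - arc_integral \<eta> F r)) {r..N}"
    by (rule has_integral_eq[rotated]) (rule I)
  note main = integral_unique[OF this]
  have "(\<lambda>\<rho>. cis \<phi> *\<^sub>C F (of_real \<rho> * cis \<phi>)) integrable_on {r..N}" if "\<bar>\<phi>\<bar> \<le> \<eta>" for \<phi>
    by (intro integrable_continuous_interval continuous_on_subset[OF continuous_on_ray[OF cF r(1) that]]) auto
  from this[of \<eta>] this[of "- \<eta>"] \<eta>
  have "integral {r..N} (\<lambda>\<rho>. cis \<eta> *\<^sub>C F (of_real \<rho> * cis \<eta>) - cis (- \<eta>) *\<^sub>C F (of_real \<rho> * cis (- \<eta>))) =
      integral {r..N} (\<lambda>\<rho>. cis \<eta> *\<^sub>C F (of_real \<rho> * cis \<eta>))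
      - integral {r..N} (\<lambda>\<rho>. cis (- \<eta>) *\<^sub>C F (of_real \<rho> * cis (- \<eta>)))"
    by (intro Henstock_Kurzweil_Integration.integral_diff) auto
  with main show ?thesis by (simp only: diff_eq_eq) (simp only: algebra_simps)
qed

text \<open>A box that contains a large ball cuts the half line in an interval from r to the right
  end of the box, so convergence of the truncated integrals is exactly what the gauge integral over
  an unbounded set asks for.\<close>

lemma has_integral_atLeast_limit:
  fixes f :: "real \<Rightarrow> 'a::banach"
  assumes int: "\<And>N. f integrable_on {r..N}" and lim: "((\<lambda>N. integral {r..N} f) \<longlongrightarrow> L) at_top"
  shows "(f has_integral L) {r..}"
  unfolding has_integral_alt'
proof (intro conjI allI impI)
  have eq: "integral (cbox a b) (\<lambda>x. if x \<in> {r..} then f x else 0) = integral {max a r..b} f"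
    and i: "(\<lambda>x. if x \<in> {r..} then f x else 0) integrable_on cbox a b" for a b :: real
  proof -
    have *: "{max a r..b} = cbox a b \<inter> {r..}" by auto
    have "f integrable_on {max a r..b}"
      by (rule integrable_on_subinterval[OF int[of b]]) auto
    then show "(\<lambda>x. if x \<in> {r..} then f x else 0) integrable_on cbox a b"
      unfolding * by (subst integrable_restrict_Int) (simp add: Int_commute)
    show "integral (cbox a b) (\<lambda>x. if x \<in> {r..} then f x else 0) = integral {max a r..b} f"
      unfolding * by (subst integral_restrict_Int) (simp add: Int_commute)
  qed
  show "(\<lambda>x. if x \<in> {r..} then f x else 0) integrable_on cbox a b" for a b by (rule i)
  fix e :: real assume "e > 0"
  with lim obtain B where B: "\<And>N. N \<ge> B \<Longrightarrow> norm (integral {r..N} f - L) < e"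
    unfolding tendsto_iff eventually_at_top_linorder dist_norm by blast
  show "\<exists>B>0. \<forall>a b. ball 0 B \<subseteq> cbox a b \<longrightarrow>
      norm (integral (cbox a b) (\<lambda>x. if x \<in> {r..} then f x else 0) - L) < e"
  proof (intro exI conjI allI impI)
    show "0 < \<bar>B\<bar> + \<bar>r\<bar> + 1" by simp
    fix a b :: real assume sub: "ball 0 (\<bar>B\<bar> + \<bar>r\<bar> + 1) \<subseteq> cbox a b"
    have "- \<bar>r\<bar> \<in> ball 0 (\<bar>B\<bar> + \<bar>r\<bar> + 1)" "\<bar>B\<bar> \<in> ball 0 (\<bar>B\<bar> + \<bar>r\<bar> + 1)"
      by (auto simp: dist_norm)
    with sub have "- \<bar>r\<bar> \<in> cbox a b" "\<bar>B\<bar> \<in> cbox a b" by blast+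
    then have "max a r = r" "b \<ge> B" by auto
    then show "norm (integral (cbox a b) (\<lambda>x. if x \<in> {r..} then f x else 0) - L) < e"
      using B eq by (simp only:)
  qed
qed

text \<open>The exponential tail makes the truncations at \<open>r + n\<close> a Cauchy sequence;
  its limit inherits the tail bound, and this bound in turn gives convergence along all real
  N.\<close>

lemma integral_exp_decay:
  fixes f :: "real \<Rightarrow> 'a::banach"
  assumes cont: "continuous_on {r..} f" and \<kappa>: "0 < \<kappa>"
    and bound: "\<And>\<rho>. r \<le> \<rho> \<Longrightarrow> norm (f \<rho>) \<le> K * exp (- \<kappa> * \<rho>)"
  shows "((\<lambda>N. integral {r..N} f) \<longlongrightarrow> integral {r..} f) at_top"
    and "r \<le> N \<Longrightarrow> norm (integral {r..} f - integral {r..N} f) \<le> K * exp (- \<kappa> * N) / \<kappa>"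
proof -
  have int: "f integrable_on {a..b}" if "r \<le> a" for a b
    by (intro integrable_continuous_interval continuous_on_subset[OF cont]) (use that in auto)
  have K: "0 \<le> K" using bound[of r] norm_ge_zero[of "f r"]
    by (metis exp_gt_zero order.trans order_refl zero_le_mult_iff not_less)
  have diff: "norm (integral {r..N'} f - integral {r..N} f) \<le> K * exp (- \<kappa> * N) / \<kappa>"
    if N: "r \<le> N" "N \<le> N'" for N N'
  proof -
    have "((\<lambda>\<rho>. K * exp (- \<kappa> * \<rho>)) has_integral
        ((\<lambda>\<rho>. - K * exp (- \<kappa> * \<rho>) / \<kappa>) N' - (\<lambda>\<rho>. - K * exp (- \<kappa> * \<rho>) / \<kappa>) N)) {N..N'}"
      by (intro fundamental_theorem_of_calculus N)
        (use \<kappa> in \<open>auto intro!: derivative_eq_intros simp: has_real_derivative_iff_has_vector_derivative[symmetric]\<close>)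
    then have "norm (integral {N..N'} f) \<le> - K * exp (- \<kappa> * N') / \<kappa> + K * exp (- \<kappa> * N) / \<kappa>"
      using integral_norm_bound_integral[of f "{N..N'}" "\<lambda>\<rho>. K * exp (- \<kappa> * \<rho>)"] int[of N N'] N bound
      by (simp add: has_integral_iff)
    also have "\<dots> \<le> K * exp (- \<kappa> * N) / \<kappa>" using K \<kappa> by simp
    finally show ?thesis
      using Henstock_Kurzweil_Integration.integral_combine[of r N N' f] int[of r N'] N
      by (metis add_diff_cancel_left' order_refl)
  qed
  have lim0: "((\<lambda>N. K * exp (- \<kappa> * N) / \<kappa>) \<longlongrightarrow> 0) at_top"
  proof -
    have "LIM N at_top. - \<kappa> * N :> at_bot"
      by (rule filterlim_tendsto_neg_mult_at_bot[OF tendsto_const _ filterlim_ident]) (use \<kappa> in simp)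
    from filterlim_compose[OF exp_at_bot this]
    have "((\<lambda>N. exp (- \<kappa> * N)) \<longlongrightarrow> 0) at_top" .
    from tendsto_mult[OF tendsto_const[of "K / \<kappa>"] this] show ?thesis by simp
  qed
  define s where "s = (\<lambda>n::nat. integral {r..r + real n} f)"
  have top: "LIM n sequentially. r + real n :> at_top"
    by (rule filterlim_tendsto_add_at_top[OF tendsto_const filterlim_real_sequentially])
  have "Cauchy s"
  proof (rule metric_CauchyI)
    fix e :: real assume e: "e > 0"
    from filterlim_compose[OF lim0 top]
    have "(\<lambda>n. K * exp (- \<kappa> * (r + real n)) / \<kappa>) \<longlonglongrightarrow> 0" .
    from order_tendstoD(2)[OF this e] obtain M
      where M: "\<And>n. n \<ge> M \<Longrightarrow> K * exp (- \<kappa> * (r + real n)) / \<kappa> < e"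
      unfolding eventually_sequentially by blast
    have *: "dist (s n) (s m) < e" if "M \<le> m" "m \<le> n" for m n
      using diff[of "r + real m" "r + real n"] M[of m] that by (simp add: dist_norm s_def)
    show "\<exists>M. \<forall>m\<ge>M. \<forall>n\<ge>M. dist (s m) (s n) < e"
      using * by (metis dist_commute nle_le)
  qed
  then obtain L where L: "s \<longlonglongrightarrow> L" using Cauchy_convergent_iff convergent_def by blast
  have b: "norm (L - integral {r..N} f) \<le> K * exp (- \<kappa> * N) / \<kappa>" if N: "r \<le> N" for N
  proof (rule tendsto_upperbound)
    show "(\<lambda>n. norm (s n - integral {r..N} f)) \<longlonglongrightarrow> norm (L - integral {r..N} f)"
      by (intro tendsto_intros L)
    have "\<forall>\<^sub>F n in sequentially. N \<le> r + real n"
      using top unfolding filterlim_at_top by blast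
    then show "\<forall>\<^sub>F n in sequentially. norm (s n - integral {r..N} f) \<le> K * exp (- \<kappa> * N) / \<kappa>"
      by eventually_elim (use diff N in \<open>auto simp: s_def\<close>)
  qed simp
  have lim: "((\<lambda>N. integral {r..N} f) \<longlongrightarrow> L) at_top"
  proof (rule Lim_transform_eventually[where f = "\<lambda>N. L - (L - integral {r..N} f)"])
    have "((\<lambda>N. L - integral {r..N} f) \<longlongrightarrow> 0) at_top"
      by (rule Lim_null_comparison[OF eventually_mono[OF eventually_ge_at_top[of r] b] lim0])
    from tendsto_diff[OF tendsto_const[of L] this] show "((\<lambda>N. L - (L - integral {r..N} f)) \<longlongrightarrow> L) at_top" by simp
  qed simp
  have "integral {r..} f = L"
    by (rule integral_unique[OF has_integral_atLeast_limit[OF _ lim]]) (rule int, simp)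
  with lim b show "((\<lambda>N. integral {r..N} f) \<longlongrightarrow> integral {r..} f) at_top"
    and "r \<le> N \<Longrightarrow> norm (integral {r..} f - integral {r..N} f) \<le> K * exp (- \<kappa> * N) / \<kappa>" by auto
qed

text \<open>The Dunford contour without the factor 1 / (2 pi i): in along the lower ray, around the
  arc of radius r, out along the upper ray.\<close>

definition keyhole_integral :: "real \<Rightarrow> real \<Rightarrow> (complex \<Rightarrow> 'a::complex_banach) \<Rightarrow> 'a" where
  "keyhole_integral \<eta> r F = integral {r..} (\<lambda>\<rho>. cis \<eta> *\<^sub>C F (of_real \<rho> * cis \<eta>)) + arc_integral \<eta> F r
     - integral {r..} (\<lambda>\<rho>. cis (- \<eta>) *\<^sub>C F (of_real \<rho> * cis (- \<eta>)))"

text \<open>Cauchy's theorem replaces the truncated rays and the inner arc by the outer arc of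
  radius N. The contour integral is therefore a limit of integrals over compact arcs that do not
  mention r, and its independence of r needs no deformation of unbounded contours.\<close>

lemma
  fixes F :: "complex \<Rightarrow> 'a::complex_banach"
  assumes F: "cdifferentiable_on F (csector \<eta>)" and \<eta>: "0 \<le> \<eta>" and r: "0 < r" and \<kappa>: "0 < \<kappa>"
    and bound: "\<And>\<rho>. r \<le> \<rho> \<Longrightarrow> norm (F (of_real \<rho> * cis \<eta>)) \<le> K * exp (- \<kappa> * \<rho>)"
      "\<And>\<rho>. r \<le> \<rho> \<Longrightarrow> norm (F (of_real \<rho> * cis (- \<eta>))) \<le> K * exp (- \<kappa> * \<rho>)"
  shows arc_integral_tendsto_keyhole: "(arc_integral \<eta> F \<longlongrightarrow> keyhole_integral \<eta> r F) at_top"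
    and keyhole_minus_arc_integral: "\<And>N. r \<le> N \<Longrightarrow>
      norm (keyhole_integral \<eta> r F - arc_integral \<eta> F N) \<le> 2 * K * exp (- \<kappa> * N) / \<kappa>"
proof -
  note cF = cdifferentiable_on_continuous[OF F]
  let ?f = "\<lambda>\<phi> \<rho>. cis \<phi> *\<^sub>C F (of_real \<rho> * cis \<phi>)"
  have c1: "continuous_on {r..} (?f \<eta>)" and c2: "continuous_on {r..} (?f (- \<eta>))"
    using continuous_on_ray[OF cF r] \<eta> by auto
  have b: "\<And>\<rho>. r \<le> \<rho> \<Longrightarrow> norm (?f \<eta> \<rho>) \<le> K * exp (- \<kappa> * \<rho>)"
    "\<And>\<rho>. r \<le> \<rho> \<Longrightarrow> norm (?f (- \<eta>) \<rho>) \<le> K * exp (- \<kappa> * \<rho>)"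
    using bound by (auto simp: norm_scaleC)
  note d1 = integral_exp_decay[OF c1 \<kappa> b(1)] and d2 = integral_exp_decay[OF c2 \<kappa> b(2)]
  have diff: "integral {r..N} (?f \<eta>) + arc_integral \<eta> F r - integral {r..N} (?f (- \<eta>)) = arc_integral \<eta> F N"
    if "r \<le> N" for N
    unfolding arc_integral_diff[OF F \<eta> r that] by (simp only: add.commute)
  have "((\<lambda>N. integral {r..N} (?f \<eta>) + arc_integral \<eta> F r - integral {r..N} (?f (- \<eta>)))
      \<longlongrightarrow> keyhole_integral \<eta> r F) at_top"
    unfolding keyhole_integral_def by (intro tendsto_add tendsto_diff tendsto_const d1(1) d2(1))
  then show "(arc_integral \<eta> F \<longlongrightarrow> keyhole_integral \<eta> r F) at_top"
    by (rule Lim_transform_eventually[OF _ eventually_mono[OF eventually_ge_at_top[of r]]])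
      (rule diff)
  fix N assume N: "r \<le> N"
  have "keyhole_integral \<eta> r F - arc_integral \<eta> F N =
     (integral {r..} (?f \<eta>) - integral {r..N} (?f \<eta>)) - (integral {r..} (?f (- \<eta>)) - integral {r..N} (?f (- \<eta>)))"
    by (simp add: arc_integral_diff[OF F \<eta> r N] keyhole_integral_def)
  also have "norm \<dots> \<le> K * exp (- \<kappa> * N) / \<kappa> + K * exp (- \<kappa> * N) / \<kappa>"
    by (intro norm_triangle_le_diff add_mono d1(2) d2(2) N)
  finally show "norm (keyhole_integral \<eta> r F - arc_integral \<eta> F N) \<le> 2 * K * exp (- \<kappa> * N) / \<kappa>"
    by simp
qed

text \<open>The contour integrals of resolvents are taken in the space of operators, so that they
  converge in operator norm and composition with a fixed operator is a bounded linear map of the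
  integral.\<close>

instantiation blinfun :: (real_normed_vector, complex_banach) complex_banach
begin

lift_definition scaleC_blinfun :: "complex \<Rightarrow> 'a \<Rightarrow>\<^sub>L 'b \<Rightarrow> 'a \<Rightarrow>\<^sub>L 'b" is "\<lambda>c f x. c *\<^sub>C f x"
  by (rule bounded_linear_compose[OF scaleC.bounded_linear_right])

instance
proof
  fix a b :: complex and r :: real and f g :: "'a \<Rightarrow>\<^sub>L 'b"
  show "a *\<^sub>C (f + g) = a *\<^sub>C f + a *\<^sub>C g"
    by transfer (simp add: scaleC_add_right)
  show "(a + b) *\<^sub>C f = a *\<^sub>C f + b *\<^sub>C f"
    by transfer (simp add: scaleC_add_left)
  show "a *\<^sub>C b *\<^sub>C f = (a * b) *\<^sub>C f"
    by transfer (simp add: scaleC_scaleC)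
  show "complex_of_real r *\<^sub>C f = r *\<^sub>R f"
    by transfer (simp add: scaleC_of_real)
  have le: "norm (a *\<^sub>C f) \<le> cmod a * norm f" for a and f :: "'a \<Rightarrow>\<^sub>L 'b"
    by (rule norm_blinfun_bound)
      (auto simp: scaleC_blinfun.rep_eq norm_scaleC mult.assoc intro!: mult_left_mono norm_blinfun)
  show "norm (a *\<^sub>C f) = cmod a * norm f"
  proof (cases "a = 0")
    case True
    then have "a *\<^sub>C f = 0"
      by transfer (simp add: scaleC.zero_left)
    with True show ?thesis by simp
  next
    case False
    have "f = inverse a *\<^sub>C (a *\<^sub>C f)"
      using False by transfer (simp add: scaleC_scaleC)
    then have "norm f \<le> cmod (inverse a) * norm (a *\<^sub>C f)"
      using le[of "inverse a" "a *\<^sub>C f"] by simp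
    with False le[of a f] show ?thesis by (simp add: norm_inverse norm_divide field_simps)
  qed
qed

end

lemma scaleC_blinfun_apply [simp]: "blinfun_apply (c *\<^sub>C f) x = c *\<^sub>C blinfun_apply f x"
  by (simp add: scaleC_blinfun.rep_eq)

lemma scaleC_blinfun_compose: "(c *\<^sub>C f) o\<^sub>L g = c *\<^sub>C (f o\<^sub>L g)"
  by (rule blinfun_eqI) simp

lemma exp_neg_linear_tendsto_0:
  assumes "0 < (\<kappa>::real)"
  shows "((\<lambda>N. exp (- \<kappa> * N)) \<longlongrightarrow> 0) at_top"
proof -
  have "LIM N at_top. - \<kappa> * N :> at_bot"
    by (rule filterlim_tendsto_neg_mult_at_bot[OF tendsto_const _ filterlim_ident]) (use assms in simp)
  from filterlim_compose[OF exp_at_bot this] show ?thesis .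
qed

lemma arc_integral_bound:
  fixes F :: "complex \<Rightarrow> 'a::complex_banach"
  assumes F: "continuous_on (csector \<eta>) F" and "0 \<le> \<eta>" "0 < N"
    and b: "\<And>\<phi>. \<bar>\<phi>\<bar> \<le> \<eta> \<Longrightarrow> norm (F (of_real N * cis \<phi>)) \<le> B"
  shows "norm (arc_integral \<eta> F N) \<le> 2 * \<eta> * N * B"
proof -
  have "norm (arc_integral \<eta> F N) \<le> integral {- \<eta>..\<eta>} (\<lambda>_. N * B)"
    unfolding arc_integral_def
  proof (rule integral_norm_bound_integral)
    show "(\<lambda>\<phi>. (\<i> * of_real N * cis \<phi>) *\<^sub>C F (of_real N * cis \<phi>)) integrable_on {- \<eta>..\<eta>}"
      by (intro integrable_continuous_interval arc_integrand_continuous F \<open>0 < N\<close>)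
    fix \<phi> assume "\<phi> \<in> {- \<eta>..\<eta>}"
    then have "\<bar>\<phi>\<bar> \<le> \<eta>" by auto
    then show "norm ((\<i> * of_real N * cis \<phi>) *\<^sub>C F (of_real N * cis \<phi>)) \<le> N * B"
      using b[of \<phi>] \<open>0 < N\<close> by (simp add: norm_scaleC norm_mult mult_left_mono)
  qed (rule integrable_const_ivl)
  then show ?thesis using assms by (simp add: mult_ac)
qed

text \<open>With the radius \<open>1 / t\<close> the product \<open>t * z\<close> has modulus one on
  the arc, where the exponential is at most \<open>exp 1\<close>; since \<open>\<eta>\<close>
  exceeds pi / 2, it decays along the rays at the rate \<open>- t * cos \<eta>\<close>. The two rays
  contribute \<open>2 / (- cos \<eta>)\<close>, the arc of angle \<open>2 * \<eta>\<close> the other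
  summand.\<close>

lemma
  fixes F :: "complex \<Rightarrow> 'a::complex_banach"
  assumes F: "cdifferentiable_on F (csector \<eta>)" and \<eta>: "pi / 2 < \<eta>" "\<eta> < pi" and t: "0 < t"
    and bound: "\<And>z. z \<in> csector \<eta> \<Longrightarrow> 1 / t \<le> cmod z \<Longrightarrow> norm (F z) \<le> K * exp (t * Re z)"
  shows arc_integral_converges: "(arc_integral \<eta> F \<longlongrightarrow> keyhole_integral \<eta> (1 / t) F) at_top"
    and keyhole_integral_bound:
      "norm (keyhole_integral \<eta> (1 / t) F) \<le> K * (2 / (- cos \<eta>) + 2 * \<eta> * exp 1) / t"
    and keyhole_integral_tail: "\<And>N. 1 / t \<le> N \<Longrightarrow>
      norm (keyhole_integral \<eta> (1 / t) F - arc_integral \<eta> F N) \<le> 2 * K * exp (t * cos \<eta> * N) / (t * - cos \<eta>)"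
proof -
  have c: "cos \<eta> < 0" using \<eta> cos_lt_zero_pi[of \<eta>] by auto
  then have \<kappa>: "0 < - (t * cos \<eta>)" using t by (simp add: mult_pos_neg)
  have \<eta>0: "0 \<le> \<eta>" using \<eta> pi_gt_zero by linarith
  have pos: "1 / t \<le> \<rho> \<Longrightarrow> 0 < \<rho>" for \<rho> using t by (meson divide_pos_pos less_le_trans zero_less_one)
  have b: "norm (F (of_real \<rho> * cis \<eta>)) \<le> K * exp (- (- (t * cos \<eta>)) * \<rho>)"
    "norm (F (of_real \<rho> * cis (- \<eta>))) \<le> K * exp (- (- (t * cos \<eta>)) * \<rho>)" if "1 / t \<le> \<rho>" for \<rho>
    using bound[OF csectorI[OF pos[OF that]], of \<eta>] bound[OF csectorI[OF pos[OF that]], of "- \<eta>"]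
      pos[OF that] that \<eta>0
    by (auto simp: norm_mult mult_ac)
  show "(arc_integral \<eta> F \<longlongrightarrow> keyhole_integral \<eta> (1 / t) F) at_top"
    by (rule arc_integral_tendsto_keyhole[OF F \<eta>0 _ \<kappa> b]) (use t in auto)
  show tail: "norm (keyhole_integral \<eta> (1 / t) F - arc_integral \<eta> F N) \<le> 2 * K * exp (t * cos \<eta> * N) / (t * - cos \<eta>)"
    if "1 / t \<le> N" for N
    using keyhole_minus_arc_integral[OF F \<eta>0 _ \<kappa> b that] t by simp
  have K: "0 \<le> K"
  proof -
    have "norm (F (of_real (1 / t) * cis 0)) \<le> K * exp (t * Re (of_real (1 / t) * cis 0))"
      by (rule bound) (use t \<eta>0 in \<open>auto intro!: csectorI simp: norm_mult simp del: of_real_divide cis_zero\<close>)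
    then have "0 \<le> K * exp (t * Re (of_real (1 / t) * cis 0))"
      by (rule order_trans[OF norm_ge_zero])
    then show ?thesis by (simp add: zero_le_mult_iff)
  qed
  have "norm (arc_integral \<eta> F (1 / t)) \<le> 2 * \<eta> * (1 / t) * (K * exp 1)"
  proof (rule arc_integral_bound[OF cdifferentiable_on_continuous[OF F] \<eta>0])
    fix \<phi> :: real assume \<phi>: "\<bar>\<phi>\<bar> \<le> \<eta>"
    have "norm (F (of_real (1 / t) * cis \<phi>)) \<le> K * exp (t * Re (of_real (1 / t) * cis \<phi>))"
      by (rule bound) (use \<phi> t in \<open>auto intro!: csectorI simp: norm_mult simp del: of_real_divide\<close>)
    also have "\<dots> = K * exp (cos \<phi>)" using t by simp
    also have "\<dots> \<le> K * exp 1" using K by (intro mult_left_mono) auto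
    finally show "norm (F (of_real (1 / t) * cis \<phi>)) \<le> K * exp 1" .
  qed (use t in simp)
  moreover have "norm (keyhole_integral \<eta> (1 / t) F - arc_integral \<eta> F (1 / t)) \<le> 2 * K / (t * - cos \<eta>)"
  proof -
    have "exp (t * cos \<eta> * (1 / t)) \<le> 1" using c t by simp
    then have "2 * K * exp (t * cos \<eta> * (1 / t)) / (t * - cos \<eta>) \<le> 2 * K * 1 / (t * - cos \<eta>)"
      using K \<kappa> by (intro divide_right_mono mult_left_mono) auto
    then show ?thesis using tail[of "1 / t"] by simp
  qed
  ultimately have "norm (keyhole_integral \<eta> (1 / t) F) \<le> 2 * K / (t * - cos \<eta>) + 2 * \<eta> * (1 / t) * (K * exp 1)"
    using norm_triangle_sub[of "keyhole_integral \<eta> (1 / t) F" "arc_integral \<eta> F (1 / t)"] by linarith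
  also have "\<dots> = K * (2 / (- cos \<eta>) + 2 * \<eta> * exp 1) / t"
    using c t by (simp add: field_simps)
  finally show "norm (keyhole_integral \<eta> (1 / t) F) \<le> K * (2 / (- cos \<eta>) + 2 * \<eta> * exp 1) / t" .
qed

text \<open>The antiderivative \<open>exp (t * z) / t\<close> reduces the arc to its end points,
  whose real part \<open>N * cos \<eta>\<close> tends to minus infinity. Such terms leave no trace
  in the limit.\<close>

lemma arc_integral_exp_tendsto:
  fixes B :: "'a::complex_banach"
  assumes \<eta>: "pi / 2 < \<eta>" "\<eta> < pi" and t: "0 < t"
  shows "(arc_integral \<eta> (\<lambda>z. exp (of_real t * z) *\<^sub>C B) \<longlongrightarrow> 0) at_top"
proof -
  have c: "cos \<eta> < 0" using \<eta> cos_lt_zero_pi[of \<eta>] by auto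
  then have \<kappa>: "0 < - (t * cos \<eta>)" using t by (simp add: mult_pos_neg)
  have eq: "arc_integral \<eta> (\<lambda>z. exp (of_real t * z) *\<^sub>C B) N =
      (exp (of_real t * (of_real N * cis \<eta>)) / of_real t - exp (of_real t * (of_real N * cis (- \<eta>))) / of_real t) *\<^sub>C B"
    for N
  proof -
    have "((\<lambda>\<phi>. exp (of_real t * (of_real N * cis \<phi>)) / of_real t) has_vector_derivative
        \<i> * of_real N * cis \<phi> * exp (of_real t * (of_real N * cis \<phi>))) (at \<phi> within {- \<eta>..\<eta>})" for \<phi>
    proof -
      have "((\<lambda>x. exp (of_real t * (of_real N * exp (\<i> * x))) / of_real t) has_field_derivative
        \<i> * of_real N * exp (\<i> * of_real \<phi>) * exp (of_real t * (of_real N * exp (\<i> * of_real \<phi>)))) (at (of_real \<phi>))"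
        using t by (auto intro!: derivative_eq_intros)
      from has_vector_derivative_real_field[OF this] show ?thesis by (simp add: cis_conv_exp)
    qed
    then have "((\<lambda>\<phi>. \<i> * of_real N * cis \<phi> * exp (of_real t * (of_real N * cis \<phi>))) has_integral
       (exp (of_real t * (of_real N * cis \<eta>)) / of_real t - exp (of_real t * (of_real N * cis (- \<eta>))) / of_real t)) {- \<eta>..\<eta>}"
      by (intro fundamental_theorem_of_calculus) (use \<eta> pi_gt_zero in auto)
    from has_integral_linear[OF this scaleC.bounded_linear_left]
    show ?thesis unfolding arc_integral_def
      by (intro integral_unique) (simp add: o_def scaleC_scaleC)
  qed
  have "norm (arc_integral \<eta> (\<lambda>z. exp (of_real t * z) *\<^sub>C B) N) \<le> 2 / t * norm B * exp (- (- (t * cos \<eta>)) * N)" for N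
  proof -
    have "cmod (exp (of_real t * (of_real N * cis \<eta>)) / of_real t - exp (of_real t * (of_real N * cis (- \<eta>))) / of_real t)
       \<le> exp (t * N * cos \<eta>) / t + exp (t * N * cos \<eta>) / t"
      by (rule order_trans[OF norm_triangle_ineq4]) (use t in \<open>simp add: norm_divide mult.assoc\<close>)
    then have "cmod (exp (of_real t * (of_real N * cis \<eta>)) / of_real t - exp (of_real t * (of_real N * cis (- \<eta>))) / of_real t) * norm B
       \<le> (exp (t * N * cos \<eta>) / t + exp (t * N * cos \<eta>) / t) * norm B"
      by (intro mult_right_mono) auto
    then show ?thesis unfolding eq norm_scaleC by (simp add: mult_ac)
  qed
  note le = this
  have "((\<lambda>N. 2 / t * norm B * exp (- (- (t * cos \<eta>)) * N)) \<longlongrightarrow> 2 / t * norm B * 0) at_top"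
    by (intro tendsto_mult tendsto_const exp_neg_linear_tendsto_0[OF \<kappa>])
  then have "((\<lambda>N. 2 / t * norm B * exp (- (- (t * cos \<eta>)) * N)) \<longlongrightarrow> 0) at_top"
    by (simp only: mult_zero_right)
  then show ?thesis
    by (rule Lim_null_comparison[OF always_eventually[OF allI[OF le]]])
qed

text \<open>Mean value property of the exponential: the derivative with respect to the radius is the
  integral of the angular derivative of a periodic function and vanishes, so the value at radius 0
  persists.\<close>

lemma integral_exp_cis_circle: "integral {- pi..pi} (\<lambda>\<phi>. exp (of_real R * cis \<phi>)) = 2 * of_real pi"
proof -
  let ?P = "\<lambda>R. integral (cbox (- pi) pi) (\<lambda>\<phi>. exp (of_real R * cis \<phi>))"
  define U where "U = {- \<bar>R\<bar>..\<bar>R\<bar>}"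
  have "(?P has_vector_derivative 0) (at x within U)" if x: "x \<in> U" for x
  proof -
    have "(?P has_vector_derivative integral (cbox (- pi) pi) (\<lambda>\<phi>. cis \<phi> * exp (of_real x * cis \<phi>))) (at x within U)"
    proof (rule leibniz_rule_vector_derivative[where f = "\<lambda>x \<phi>. exp (of_real x * cis \<phi>)"
          and fx = "\<lambda>x \<phi>. cis \<phi> * exp (of_real x * cis \<phi>)"])
      fix x t
      have "((\<lambda>z. exp (z * cis t)) has_field_derivative cis t * exp (of_real x * cis t)) (at (of_real x))"
        by (auto intro!: derivative_eq_intros)
      from has_vector_derivative_real_field[OF this]
      show "((\<lambda>x. exp (of_real x * cis t)) has_vector_derivative cis t * exp (of_real x * cis t)) (at x within U)" .
    next
      show "(\<lambda>\<phi>. exp (of_real x * cis \<phi>)) integrable_on cbox (- pi) pi" for x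
        by (intro integrable_continuous continuous_intros)
      show "continuous_on (U \<times> cbox (- pi) pi) (\<lambda>(x, \<phi>). cis \<phi> * exp (of_real x * cis \<phi>))"
        unfolding split_beta by (intro continuous_intros)
    qed (use x in \<open>auto simp: U_def\<close>)
    moreover have "integral (cbox (- pi) pi) (\<lambda>\<phi>. cis \<phi> * exp (of_real x * cis \<phi>)) = 0"
    proof (cases "x = 0")
      case True
      have "((\<lambda>\<phi>. - \<i> * cis \<phi>) has_vector_derivative cis \<phi>) (at \<phi> within {- pi..pi})" for \<phi>
        using has_vector_derivative_cis[of "- \<i>"] by simp
      then have "(cis has_integral (- \<i> * cis pi - - \<i> * cis (- pi))) {- pi..pi}"
        by (intro fundamental_theorem_of_calculus) auto
      moreover have "cis (- pi) = - 1" by (simp add: complex_eq_iff)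
      ultimately show ?thesis using True by (simp add: integral_unique)
    next
      case False
      have "((\<lambda>\<phi>. exp (of_real x * cis \<phi>) / (\<i> * of_real x)) has_vector_derivative
          cis \<phi> * exp (of_real x * cis \<phi>)) (at \<phi> within {- pi..pi})" for \<phi>
      proof -
        have "((\<lambda>z. exp (of_real x * exp (\<i> * z)) / (\<i> * of_real x)) has_field_derivative
          exp (\<i> * of_real \<phi>) * exp (of_real x * exp (\<i> * of_real \<phi>))) (at (of_real \<phi>))"
          using False by (auto intro!: derivative_eq_intros)
        from has_vector_derivative_real_field[OF this] show ?thesis by (simp add: cis_conv_exp)
      qed
      then have "((\<lambda>\<phi>. cis \<phi> * exp (of_real x * cis \<phi>)) has_integral
         (exp (of_real x * cis pi) / (\<i> * of_real x) - exp (of_real x * cis (- pi)) / (\<i> * of_real x))) {- pi..pi}"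
        by (intro fundamental_theorem_of_calculus) auto
      moreover have "cis (- pi) = cis pi" by (simp add: complex_eq_iff)
      ultimately show ?thesis by (simp add: integral_unique)
    qed
    ultimately show ?thesis by simp
  qed
  then obtain c where c: "\<And>x. x \<in> U \<Longrightarrow> ?P x = c"
    using has_vector_derivative_zero_constant[of U ?P] by (auto simp: U_def)
  have "R \<in> U" "0 \<in> U" by (auto simp: U_def)
  then have "?P R = ?P 0" using c by metis
  then show ?thesis by (simp add: scaleR_conv_of_real)
qed

text \<open>The residue at 0: the full circle gives 2 pi i by the mean value property, and on the
  missing part \<open>cos \<phi> \<le> cos \<eta> < 0\<close> forces the integral to 0.\<close>

lemma arc_integral_exp_over_z_tendsto:
  fixes B :: "'a::complex_banach"
  assumes \<eta>: "pi / 2 < \<eta>" "\<eta> < pi" and t: "0 < t"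
  shows "(arc_integral \<eta> (\<lambda>z. (exp (of_real t * z) / z) *\<^sub>C B) \<longlongrightarrow> (2 * of_real pi * \<i>) *\<^sub>C B) at_top"
proof -
  have c: "cos \<eta> < 0" using \<eta> cos_lt_zero_pi[of \<eta>] by auto
  then have \<kappa>: "0 < - (t * cos \<eta>)" using t by (simp add: mult_pos_neg)
  have \<eta>0: "0 \<le> \<eta>" using \<eta> pi_gt_zero by linarith
  let ?g = "\<lambda>N \<phi>. exp (of_real (t * N) * cis \<phi>)"
  have cg: "continuous_on S (?g N)" for N S by (intro continuous_intros)
  have i: "?g N integrable_on {a..b}" for a b N
    by (intro integrable_continuous_interval cg)
  have split: "integral {- pi..- \<eta>} (?g N) + integral {- \<eta>..\<eta>} (?g N) + integral {\<eta>..pi} (?g N) = 2 * of_real pi" for N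
  proof -
    have "integral {- pi..- \<eta>} (?g N) + integral {- \<eta>..pi} (?g N) = integral {- pi..pi} (?g N)"
      by (rule Henstock_Kurzweil_Integration.integral_combine[OF _ _ i]) (use \<eta> \<eta>0 in auto)
    moreover have "integral {- \<eta>..\<eta>} (?g N) + integral {\<eta>..pi} (?g N) = integral {- \<eta>..pi} (?g N)"
      by (rule Henstock_Kurzweil_Integration.integral_combine[OF _ _ i]) (use \<eta> \<eta>0 in auto)
    ultimately show ?thesis
      unfolding integral_exp_cis_circle[of "t * N", symmetric] by (simp only: add.assoc)
  qed
  have outer: "cmod (integral {a..b} (?g N)) \<le> (b - a) * exp (- (- (t * cos \<eta>)) * N)"
    if N: "0 \<le> N" and ab: "a \<le> b" "\<And>\<phi>. \<phi> \<in> {a..b} \<Longrightarrow> \<eta> \<le> \<bar>\<phi>\<bar> \<and> \<bar>\<phi>\<bar> \<le> pi" for N a b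
  proof -
    have "cmod (?g N \<phi>) \<le> exp (- (- (t * cos \<eta>)) * N)" if "\<phi> \<in> {a..b}" for \<phi>
    proof -
      have "cos \<phi> = cos \<bar>\<phi>\<bar>" by (simp add: abs_if)
      also have "\<dots> \<le> cos \<eta>" using ab(2)[OF that] \<eta>0 by (intro cos_monotone_0_pi_le) auto
      finally have "t * N * cos \<phi> \<le> t * N * cos \<eta>" using t N by (intro mult_left_mono) auto
      then show ?thesis by (simp add: mult_ac)
    qed
    then have "cmod (integral {a..b} (?g N)) \<le> integral {a..b} (\<lambda>_. exp (- (- (t * cos \<eta>)) * N))"
      by (intro integral_norm_bound_integral i) auto
    then show ?thesis using ab(1) by simp
  qed
  have null: "((\<lambda>N. integral {a..b} (?g N)) \<longlongrightarrow> 0) at_top"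
    if ab: "a \<le> b" "\<And>\<phi>. \<phi> \<in> {a..b} \<Longrightarrow> \<eta> \<le> \<bar>\<phi>\<bar> \<and> \<bar>\<phi>\<bar> \<le> pi" for a b
  proof (rule Lim_null_comparison[OF eventually_mono[OF eventually_ge_at_top[of 0]]])
    show "0 \<le> N \<Longrightarrow> cmod (integral {a..b} (?g N)) \<le> (b - a) * exp (- (- (t * cos \<eta>)) * N)" for N
      by (rule outer) (use ab in auto)
    show "((\<lambda>N. (b - a) * exp (- (- (t * cos \<eta>)) * N)) \<longlongrightarrow> 0) at_top"
      using tendsto_mult[OF tendsto_const exp_neg_linear_tendsto_0[OF \<kappa>], of "b - a"] by simp
  qed
  have "((\<lambda>N. 2 * of_real pi - integral {- pi..- \<eta>} (?g N) - integral {\<eta>..pi} (?g N)) \<longlongrightarrow> 2 * of_real pi - 0 - 0) at_top"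
    by (intro tendsto_diff tendsto_const null) (use \<eta> \<eta>0 in auto)
  moreover have "2 * of_real pi - integral {- pi..- \<eta>} (?g N) - integral {\<eta>..pi} (?g N) = integral {- \<eta>..\<eta>} (?g N)" for N
    unfolding split[of N, symmetric] by (simp only: algebra_simps)
  ultimately have lim: "((\<lambda>N. integral {- \<eta>..\<eta>} (?g N)) \<longlongrightarrow> 2 * of_real pi) at_top" by simp
  have "((\<lambda>N. (integral {- \<eta>..\<eta>} (?g N) * \<i>) *\<^sub>C B) \<longlongrightarrow> (2 * of_real pi * \<i>) *\<^sub>C B) at_top"
    by (intro scaleC.tendsto tendsto_mult lim tendsto_const)
  then show ?thesis
  proof (rule Lim_transform_eventually[OF _ eventually_mono[OF eventually_gt_at_top[of 0]]])
    fix N :: real assume N: "0 < N"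
    have "(?g N has_integral integral {- \<eta>..\<eta>} (?g N)) {- \<eta>..\<eta>}" using i by (rule integrable_integral)
    from has_integral_linear[OF has_integral_mult_left[OF this, of \<i>] scaleC.bounded_linear_left, of B]
    have "((\<lambda>\<phi>. (?g N \<phi> * \<i>) *\<^sub>C B) has_integral (integral {- \<eta>..\<eta>} (?g N) * \<i>) *\<^sub>C B) {- \<eta>..\<eta>}"
      by (simp add: o_def)
    moreover have "(?g N \<phi> * \<i>) *\<^sub>C B = (\<i> * of_real N * cis \<phi>) *\<^sub>C ((exp (of_real t * (of_real N * cis \<phi>)) / (of_real N * cis \<phi>)) *\<^sub>C B)" for \<phi>
      using N by (simp add: scaleC_scaleC field_simps)
    ultimately have "((\<lambda>\<phi>. (\<i> * of_real N * cis \<phi>) *\<^sub>C ((exp (of_real t * (of_real N * cis \<phi>)) / (of_real N * cis \<phi>)) *\<^sub>C B))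
        has_integral (integral {- \<eta>..\<eta>} (?g N) * \<i>) *\<^sub>C B) {- \<eta>..\<eta>}"
      by simp
    then show "(integral {- \<eta>..\<eta>} (?g N) * \<i>) *\<^sub>C B = arc_integral \<eta> (\<lambda>z. (exp (of_real t * z) / z) *\<^sub>C B) N"
      unfolding arc_integral_def by (rule integral_unique[symmetric])
  qed
qed

text \<open>Operators of type \<open>blinfun\<close> are only real linear; complex linearity is what
  lets an operator pass the complex factor in the arc integral.\<close>

definition clinear_map :: "('a::complex_banach \<Rightarrow> 'b::complex_banach) \<Rightarrow> bool" where
  "clinear_map L \<longleftrightarrow> bounded_linear L \<and> (\<forall>c x. L (c *\<^sub>C x) = c *\<^sub>C L x)"

lemma cdifferentiable_on_linear:
  assumes L: "clinear_map L" and F: "cdifferentiable_on F Z"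
  shows "cdifferentiable_on (\<lambda>z. L (F z)) Z"
proof -
  have bl: "bounded_linear L" and cl: "\<And>c x. L (c *\<^sub>C x) = c *\<^sub>C L x"
    using L by (auto simp: clinear_map_def)
  obtain F' where F': "continuous_on Z F'"
    "\<And>z. z \<in> Z \<Longrightarrow> (F has_derivative (\<lambda>h. h *\<^sub>C F' z)) (at z within Z)"
    using F unfolding cdifferentiable_on_def by blast
  have "continuous_on Z (\<lambda>z. L (F' z))"
    by (rule bounded_linear.continuous_on[OF bl F'(1)])
  moreover have "((\<lambda>z. L (F z)) has_derivative (\<lambda>h. h *\<^sub>C L (F' z))) (at z within Z)" if "z \<in> Z" for z
    using bounded_linear.has_derivative[OF bl F'(2)[OF that]] by (simp add: cl)
  ultimately show ?thesis unfolding cdifferentiable_on_def by blast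
qed

lemma arc_integral_linear:
  assumes L: "clinear_map L" and F: "continuous_on (csector \<eta>) F" and N: "0 < N"
  shows "arc_integral \<eta> (\<lambda>z. L (F z)) N = L (arc_integral \<eta> F N)"
proof -
  have bl: "bounded_linear L" and cl: "\<And>c x. L (c *\<^sub>C x) = c *\<^sub>C L x"
    using L by (auto simp: clinear_map_def)
  show ?thesis
    using integral_linear[OF integrable_continuous_interval[OF arc_integrand_continuous[OF F N]] bl]
    by (simp add: arc_integral_def o_def cl)
qed

lemma arc_integral_tendsto_linear:
  assumes L: "clinear_map L" and F: "continuous_on (csector \<eta>) F"
    and lim: "(arc_integral \<eta> F \<longlongrightarrow> I) at_top"
  shows "(arc_integral \<eta> (\<lambda>z. L (F z)) \<longlongrightarrow> L I) at_top"
proof (rule Lim_transform_eventually[OF _ eventually_mono[OF eventually_gt_at_top[of 0]]])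
  show "((\<lambda>N. L (arc_integral \<eta> F N)) \<longlongrightarrow> L I) at_top"
    by (rule bounded_linear.tendsto[OF _ lim]) (use L in \<open>simp add: clinear_map_def\<close>)
qed (rule arc_integral_linear[OF L F, symmetric])

lemma arc_integral_add:
  assumes "continuous_on (csector \<eta>) F" "continuous_on (csector \<eta>) G" "0 < N"
  shows "arc_integral \<eta> (\<lambda>z. F z + G z) N = arc_integral \<eta> F N + arc_integral \<eta> G N"
  unfolding arc_integral_def scaleC_add_right
  by (rule Henstock_Kurzweil_Integration.integral_add
      [OF integrable_continuous_interval[OF arc_integrand_continuous[OF assms(1,3)]]
        integrable_continuous_interval[OF arc_integrand_continuous[OF assms(2,3)]]])

lemma arc_integral_diff_integrand:
  assumes "continuous_on (csector \<eta>) F" "continuous_on (csector \<eta>) G" "0 < N"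
  shows "arc_integral \<eta> (\<lambda>z. F z - G z) N = arc_integral \<eta> F N - arc_integral \<eta> G N"
  unfolding arc_integral_def scaleC.diff_right
  by (rule Henstock_Kurzweil_Integration.integral_diff
      [OF integrable_continuous_interval[OF arc_integrand_continuous[OF assms(1,3)]]
        integrable_continuous_interval[OF arc_integrand_continuous[OF assms(2,3)]]])

lemma arc_integral_cong:
  assumes "\<And>z. z \<in> csector \<eta> \<Longrightarrow> F z = G z" "0 < N"
  shows "arc_integral \<eta> F N = arc_integral \<eta> G N"
  unfolding arc_integral_def
proof (rule Henstock_Kurzweil_Integration.integral_cong)
  fix \<phi> assume "\<phi> \<in> {- \<eta>..\<eta>}"
  then have "\<bar>\<phi>\<bar> \<le> \<eta>" by auto
  from assms(1)[OF csectorI[OF assms(2) this]]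
  show "(\<i> * of_real N * cis \<phi>) *\<^sub>C F (of_real N * cis \<phi>) = (\<i> * of_real N * cis \<phi>) *\<^sub>C G (of_real N * cis \<phi>)"
    by (rule arg_cong)
qed

lemma keyhole_integral_cong:
  assumes "\<And>z. z \<in> csector \<eta> \<Longrightarrow> F z = G z" "0 < r" "0 \<le> \<eta>"
  shows "keyhole_integral \<eta> r F = keyhole_integral \<eta> r G"
proof -
  have "integral {r..} (\<lambda>\<rho>. cis \<phi> *\<^sub>C F (of_real \<rho> * cis \<phi>)) = integral {r..} (\<lambda>\<rho>. cis \<phi> *\<^sub>C G (of_real \<rho> * cis \<phi>))"
    if "\<bar>\<phi>\<bar> \<le> \<eta>" for \<phi>
  proof (rule Henstock_Kurzweil_Integration.integral_cong)
    fix \<rho> assume "\<rho> \<in> {r..}"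
    with assms(2) have "0 < \<rho>" by auto
    from assms(1)[OF csectorI[OF this that]]
    show "cis \<phi> *\<^sub>C F (of_real \<rho> * cis \<phi>) = cis \<phi> *\<^sub>C G (of_real \<rho> * cis \<phi>)"
      by (rule arg_cong)
  qed
  from this[of \<eta>] this[of "- \<eta>"] show ?thesis
    using arc_integral_cong[OF assms(1) assms(2), of \<eta>] assms(3) by (simp add: keyhole_integral_def)
qed

lemma clinear_map_compose_right: "clinear_map (\<lambda>X. X o\<^sub>L B)"
  unfolding clinear_map_def scaleC_blinfun_compose
  using bounded_bilinear.bounded_linear_left[OF bounded_bilinear_blinfun_compose] by blast

lemma clinear_map_compose_left:
  assumes "clinear_map (blinfun_apply B)"
  shows "clinear_map (\<lambda>X. B o\<^sub>L X)"
  unfolding clinear_map_def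
proof (intro conjI allI)
  show "bounded_linear ((o\<^sub>L) B)"
    by (rule bounded_bilinear.bounded_linear_right[OF bounded_bilinear_blinfun_compose])
  show "B o\<^sub>L c *\<^sub>C X = c *\<^sub>C (B o\<^sub>L X)" for c and X :: "'c \<Rightarrow>\<^sub>L 'a"
    by (rule blinfun_eqI) (use assms in \<open>simp add: clinear_map_def\<close>)
qed

lemma clinear_map_scaleC: "clinear_map (\<lambda>x. c *\<^sub>C x)"
  unfolding clinear_map_def scaleC_scaleC mult.commute[of c] using scaleC.bounded_linear_right by blast

section \<open>The analytic semigroup of a sectorial operator\<close>

locale sectorial_operator =
  fixes D :: "'a::complex_banach set" and A \<omega> \<theta> M \<eta>
  assumes linear: "linear_operator_in UNIV D A"
    and sectorial: "sectorial_with UNIV norm D A \<omega> \<theta> M"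
    and \<eta>: "pi / 2 < \<eta>" "\<eta> < \<theta>"
begin

lemma \<eta>_pi: "\<eta> < pi" and \<eta>_nonneg: "0 \<le> \<eta>" and M_pos: "0 < M"
  using sectorial \<eta> pi_gt_zero by (auto simp: sectorial_with_def)

text \<open>The shift moves the vertex of the sector to 0, where the resolvent bound reads
  \<open>M / cmod z\<close>. What follows concerns the semigroup of \<open>A - \<omega>\<close>; the
  factor \<open>exp (\<omega> * t)\<close> returns when the Dunford integral is identified.\<close>

definition Q :: "complex \<Rightarrow> 'a \<Rightarrow>\<^sub>L 'a" where
  "Q z = Blinfun (resolvent D A (of_real \<omega> + z))"

lemma
  assumes "z \<in> csector \<eta>"
  shows resolvent_bij: "bij_betw (\<lambda>x. (of_real \<omega> + z) *\<^sub>C x - A x) D UNIV"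
    and resolvent_norm: "norm (resolvent D A (of_real \<omega> + z) y) \<le> M / cmod z * norm y"
proof -
  obtain \<rho> \<phi> where z: "z = of_real \<rho> * cis \<phi>" "0 < \<rho>" "\<bar>\<phi>\<bar> \<le> \<eta>"
    using assms by (auto simp: csector_def)
  have "Arg z = \<phi>"
    by (rule cis_Arg_unique) (use z \<eta>_pi in \<open>auto simp: sgn_mult sgn_of_real\<close>)
  then have "of_real \<omega> + z \<noteq> of_real \<omega> \<and> \<bar>Arg (of_real \<omega> + z - of_real \<omega>)\<bar> < \<theta>"
    using z \<eta> csector_nonzero[OF assms] by simp
  then have *: "of_real \<omega> + z \<in> resolvent_set UNIV norm D A \<and>
      (\<forall>y\<in>UNIV. norm (resolvent D A (of_real \<omega> + z) y) \<le> M / cmod (of_real \<omega> + z - of_real \<omega>) * norm y)"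
    using sectorial unfolding sectorial_with_def by blast
  then show "bij_betw (\<lambda>x. (of_real \<omega> + z) *\<^sub>C x - A x) D UNIV"
    by (simp add: resolvent_set_def)
  show "norm (resolvent D A (of_real \<omega> + z) y) \<le> M / cmod z * norm y"
    using * by simp
qed

lemma
  assumes z: "z \<in> csector \<eta>"
  shows resolvent_in_domain: "resolvent D A (of_real \<omega> + z) y \<in> D"
    and resolvent_right: "(of_real \<omega> + z) *\<^sub>C resolvent D A (of_real \<omega> + z) y - A (resolvent D A (of_real \<omega> + z) y) = y"
    and resolvent_left: "x \<in> D \<Longrightarrow> resolvent D A (of_real \<omega> + z) ((of_real \<omega> + z) *\<^sub>C x - A x) = x"
proof -
  let ?L = "\<lambda>x. (of_real \<omega> + z) *\<^sub>C x - A x"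
  have img: "?L ` D = UNIV" and inj: "inj_on ?L D"
    using resolvent_bij[OF z] by (auto simp: bij_betw_def)
  show "resolvent D A (of_real \<omega> + z) y \<in> D" unfolding resolvent_def
    by (rule inv_into_into) (use img in auto)
  show "?L (resolvent D A (of_real \<omega> + z) y) = y" unfolding resolvent_def
    by (rule f_inv_into_f) (use img in auto)
  show "x \<in> D \<Longrightarrow> resolvent D A (of_real \<omega> + z) (?L x) = x" unfolding resolvent_def
    by (rule inv_into_f_f[OF inj])
qed

lemma domain_add: "x \<in> D \<Longrightarrow> y \<in> D \<Longrightarrow> x + y \<in> D" "x \<in> D \<Longrightarrow> y \<in> D \<Longrightarrow> A (x + y) = A x + A y"
  and domain_scaleC: "x \<in> D \<Longrightarrow> c *\<^sub>C x \<in> D" "x \<in> D \<Longrightarrow> A (c *\<^sub>C x) = c *\<^sub>C A x"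
  using linear by (auto simp: linear_operator_in_def complex_subspace_def)

lemma resolvent_add:
  assumes z: "z \<in> csector \<eta>"
  shows "resolvent D A (of_real \<omega> + z) (x + y) = resolvent D A (of_real \<omega> + z) x + resolvent D A (of_real \<omega> + z) y"
proof -
  define w where "w = of_real \<omega> + z"
  let ?R = "resolvent D A w"
  have dom: "?R x \<in> D" "?R y \<in> D" using resolvent_in_domain[OF z] by (simp_all add: w_def)
  have r: "w *\<^sub>C ?R x - A (?R x) = x" "w *\<^sub>C ?R y - A (?R y) = y"
    using resolvent_right[OF z] by (simp_all add: w_def)
  have "w *\<^sub>C (?R x + ?R y) - A (?R x + ?R y) = x + y"
    unfolding domain_add(2)[OF dom] scaleC_add_right add_diff_add r ..
  then show ?thesis
    using resolvent_left[OF z domain_add(1)[OF dom]] by (simp add: w_def)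
qed

lemma resolvent_scaleC:
  assumes z: "z \<in> csector \<eta>"
  shows "resolvent D A (of_real \<omega> + z) (c *\<^sub>C x) = c *\<^sub>C resolvent D A (of_real \<omega> + z) x"
proof -
  let ?R = "resolvent D A (of_real \<omega> + z)"
  have "c *\<^sub>C x = c *\<^sub>C ((of_real \<omega> + z) *\<^sub>C ?R x - A (?R x))" by (simp add: resolvent_right[OF z])
  also have "\<dots> = (of_real \<omega> + z) *\<^sub>C (c *\<^sub>C ?R x) - A (c *\<^sub>C ?R x)"
    by (simp add: domain_scaleC resolvent_in_domain[OF z] scaleC.diff_right scaleC_scaleC mult.commute)
  finally show ?thesis
    using resolvent_left[OF z, of "c *\<^sub>C ?R x"] by (simp add: domain_scaleC resolvent_in_domain[OF z])
qed

lemma Q_apply: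
  assumes z: "z \<in> csector \<eta>"
  shows "blinfun_apply (Q z) = resolvent D A (of_real \<omega> + z)"
proof -
  have "bounded_linear (resolvent D A (of_real \<omega> + z))"
  proof (rule bounded_linear_intro[where K = "M / cmod z"])
    show "resolvent D A (of_real \<omega> + z) (r *\<^sub>R x) = r *\<^sub>R resolvent D A (of_real \<omega> + z) x" for r x
      using resolvent_scaleC[OF z, of "of_real r" x] by (simp add: scaleC_of_real)
    show "norm (resolvent D A (of_real \<omega> + z) x) \<le> norm x * (M / cmod z)" for x
      using resolvent_norm[OF z, of x] by (simp only: mult.commute)
  qed (rule resolvent_add[OF z])
  then show ?thesis unfolding Q_def by (rule bounded_linear_Blinfun_apply)
qed

lemma Q_norm: "z \<in> csector \<eta> \<Longrightarrow> norm (Q z) \<le> M / cmod z"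
  using M_pos resolvent_norm[of z] by (intro norm_blinfun_bound) (simp_all add: Q_apply)

lemma Q_clinear: "z \<in> csector \<eta> \<Longrightarrow> clinear_map (blinfun_apply (Q z))"
  unfolding clinear_map_def by (simp add: blinfun.bounded_linear_right) (simp add: Q_apply resolvent_scaleC)

lemma resolvent_identity:
  assumes z: "z \<in> csector \<eta>" and w: "w \<in> csector \<eta>"
  shows "Q z - Q w = (w - z) *\<^sub>C (Q z o\<^sub>L Q w)"
proof (rule blinfun_eqI)
  fix x
  define y where "y = Q w x"
  have y: "y \<in> D" "x = (of_real \<omega> + w) *\<^sub>C y - A y"
    unfolding y_def Q_apply[OF w] by (auto simp: resolvent_in_domain[OF w] resolvent_right[OF w])
  have "(of_real \<omega> + z) *\<^sub>C y - A y = x - (w - z) *\<^sub>C y"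
    using y(2) by (simp add: scaleC_add_left scaleC.diff_left algebra_simps)
  then have "y = Q z (x - (w - z) *\<^sub>C y)"
    using resolvent_left[OF z y(1)] by (simp add: Q_apply[OF z])
  also have "\<dots> = Q z x - (w - z) *\<^sub>C Q z y"
    using Q_clinear[OF z] by (simp add: blinfun.diff_right clinear_map_def)
  finally show "blinfun_apply (Q z - Q w) x = blinfun_apply ((w - z) *\<^sub>C (Q z o\<^sub>L Q w)) x"
    by (simp add: blinfun.diff_left y_def algebra_simps)
qed

lemma Q_commute:
  assumes z: "z \<in> csector \<eta>" and w: "w \<in> csector \<eta>"
  shows "Q z o\<^sub>L Q w = Q w o\<^sub>L Q z"
proof (cases "z = w")
  case False
  have "(w - z) *\<^sub>C (Q z o\<^sub>L Q w) = (w - z) *\<^sub>C (Q w o\<^sub>L Q z)"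
    using resolvent_identity[OF z w] resolvent_identity[OF w z]
    by (metis minus_diff_eq scaleC.minus_left)
  then have "inverse (w - z) *\<^sub>C (w - z) *\<^sub>C (Q z o\<^sub>L Q w) = inverse (w - z) *\<^sub>C (w - z) *\<^sub>C (Q w o\<^sub>L Q z)" by simp
  then show ?thesis using False by (simp add: scaleC_scaleC)
qed simp

lemma Q_continuous: "continuous_on (csector \<eta>) Q"
  unfolding continuous_on_def
proof
  fix z assume z: "z \<in> csector \<eta>"
  have "((\<lambda>w. cmod (z - w) * (M / cmod w * (M / cmod z))) \<longlongrightarrow> cmod (z - z) * (M / cmod z * (M / cmod z))) (at z within csector \<eta>)"
    using csector_nonzero[OF z] by (intro tendsto_intros) auto
  then have lim: "((\<lambda>w. cmod (z - w) * (M / cmod w * (M / cmod z))) \<longlongrightarrow> 0) (at z within csector \<eta>)"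
    by simp
  have "((\<lambda>w. Q w - Q z) \<longlongrightarrow> 0) (at z within csector \<eta>)"
  proof (rule Lim_null_comparison[OF _ lim])
    show "\<forall>\<^sub>F w in at z within csector \<eta>. norm (Q w - Q z) \<le> cmod (z - w) * (M / cmod w * (M / cmod z))"
      unfolding eventually_at_filter
    proof (rule always_eventually, intro allI impI)
      fix w assume w: "w \<in> csector \<eta>"
      have "norm (Q w o\<^sub>L Q z) \<le> M / cmod w * (M / cmod z)"
        by (rule order_trans[OF norm_blinfun_compose mult_mono[OF Q_norm[OF w] Q_norm[OF z]]])
          (use M_pos in auto)
      then show "norm (Q w - Q z) \<le> cmod (z - w) * (M / cmod w * (M / cmod z))"
        unfolding resolvent_identity[OF w z] norm_scaleC by (intro mult_left_mono) auto
    qed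
  qed
  then show "(Q \<longlongrightarrow> Q z) (at z within csector \<eta>)" by (simp add: LIM_zero_iff)
qed

text \<open>By the resolvent identity the remainder of the linear approximation is
  \<open>z - w\<close> times \<open>(Q w - Q z) o\<^sub>L Q z\<close>, so continuity of
  \<open>Q\<close> already yields the derivative \<open>- (Q z o\<^sub>L Q z)\<close>.\<close>

lemma Q_cdifferentiable: "cdifferentiable_on Q (csector \<eta>)"
proof -
  have "(Q has_derivative (\<lambda>h. h *\<^sub>C (- (Q z o\<^sub>L Q z)))) (at z within csector \<eta>)" if z: "z \<in> csector \<eta>" for z
    unfolding has_derivative_iff_norm
  proof
    show "bounded_linear (\<lambda>h. h *\<^sub>C (- (Q z o\<^sub>L Q z)))" by (rule scaleC.bounded_linear_left)
    have "((\<lambda>w. norm (Q w - Q z) * norm (Q z)) \<longlongrightarrow> norm (Q z - Q z) * norm (Q z)) (at z within csector \<eta>)"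
      using Q_continuous z by (intro tendsto_intros) (auto simp: continuous_on_def)
    then have "((\<lambda>w. norm (Q w - Q z) * norm (Q z)) \<longlongrightarrow> 0) (at z within csector \<eta>)" by simp
    then show "((\<lambda>w. norm (Q w - Q z - (w - z) *\<^sub>C (- (Q z o\<^sub>L Q z))) / norm (w - z)) \<longlongrightarrow> 0) (at z within csector \<eta>)"
    proof (rule Lim_null_comparison[rotated])
      show "\<forall>\<^sub>F w in at z within csector \<eta>. norm (norm (Q w - Q z - (w - z) *\<^sub>C (- (Q z o\<^sub>L Q z))) / norm (w - z))
          \<le> norm (Q w - Q z) * norm (Q z)"
        unfolding eventually_at_filter
      proof (rule always_eventually, intro allI impI)
        fix w assume wz: "w \<noteq> z" and w: "w \<in> csector \<eta>"
        have "Q w - Q z - (w - z) *\<^sub>C (- (Q z o\<^sub>L Q z)) = (z - w) *\<^sub>C (Q w o\<^sub>L Q z) - (z - w) *\<^sub>C (Q z o\<^sub>L Q z)"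
        proof -
          have "(w - z) *\<^sub>C (- (Q z o\<^sub>L Q z)) = (- (w - z)) *\<^sub>C (Q z o\<^sub>L Q z)"
            by (simp only: scaleC.minus_left scaleC.minus_right)
          then show ?thesis unfolding resolvent_identity[OF w z] by simp
        qed
        also have "\<dots> = (z - w) *\<^sub>C ((Q w - Q z) o\<^sub>L Q z)"
          by (simp add: scaleC.diff_right bounded_bilinear.diff_left[OF bounded_bilinear_blinfun_compose])
        finally have "norm (Q w - Q z - (w - z) *\<^sub>C (- (Q z o\<^sub>L Q z))) \<le> cmod (z - w) * (norm (Q w - Q z) * norm (Q z))"
          by (simp add: norm_scaleC mult_left_mono norm_blinfun_compose)
        then show "norm (norm (Q w - Q z - (w - z) *\<^sub>C (- (Q z o\<^sub>L Q z))) / norm (w - z)) \<le> norm (Q w - Q z) * norm (Q z)"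
          using wz by (simp add: divide_le_eq norm_minus_commute mult_ac)
      qed
    qed
  qed
  moreover have "continuous_on (csector \<eta>) (\<lambda>z. - (Q z o\<^sub>L Q z))"
    by (intro continuous_intros bounded_bilinear.continuous_on[OF bounded_bilinear_blinfun_compose] Q_continuous)
  ultimately show ?thesis unfolding cdifferentiable_on_def by blast
qed

text \<open>With B = A - \<open>\<omega>\<close>, these are the integrands of exp (t B), of B exp (t
  B), and of the primitive of exp (t B) that vanishes at t = 0: a factor z corresponds to B, a
  divisor z to integration in time. The third one controls the behaviour of the semigroup as t tends
  to 0.\<close>

abbreviation FS where "FS t z \<equiv> exp (of_real t * z) *\<^sub>C Q z"
abbreviation FV where "FV t z \<equiv> (z * exp (of_real t * z)) *\<^sub>C Q z"
abbreviation FW where "FW t z \<equiv> (exp (of_real t * z) / z) *\<^sub>C Q z"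

lemma FS_cdifferentiable: "cdifferentiable_on (FS t) (csector \<eta>)"
proof (rule cdifferentiable_on_scaleC[OF _ _ Q_cdifferentiable])
  show "((\<lambda>z. exp (of_real t * z)) has_field_derivative of_real t * exp (of_real t * z)) (at z within csector \<eta>)" for z :: complex
    by (rule derivative_eq_intros refl)+ simp
qed (intro continuous_intros)

lemma FV_cdifferentiable: "cdifferentiable_on (FV t) (csector \<eta>)"
proof (rule cdifferentiable_on_scaleC[OF _ _ Q_cdifferentiable])
  show "((\<lambda>z. z * exp (of_real t * z)) has_field_derivative exp (of_real t * z) + z * (of_real t * exp (of_real t * z)))
      (at z within csector \<eta>)" for z :: complex
    by (rule derivative_eq_intros refl)+ simp
qed (intro continuous_intros)

lemma FW_cdifferentiable: "cdifferentiable_on (FW t) (csector \<eta>)"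
proof (rule cdifferentiable_on_scaleC[OF _ _ Q_cdifferentiable])
  show "((\<lambda>z. exp (of_real t * z) / z) has_field_derivative
      (of_real t * exp (of_real t * z) * z - exp (of_real t * z)) / (z * z)) (at z within csector \<eta>)"
    if "z \<in> csector \<eta>" for z :: complex
    using csector_nonzero[OF that] by (auto intro!: DERIV_divide[THEN DERIV_cong] derivative_eq_intros)
qed (intro continuous_intros, auto dest: csector_nonzero)

lemmas F_continuous = FS_cdifferentiable[THEN cdifferentiable_on_continuous]
  FV_cdifferentiable[THEN cdifferentiable_on_continuous] FW_cdifferentiable[THEN cdifferentiable_on_continuous]

text \<open>Outside the disc of radius \<open>1 / t\<close> one has
  \<open>1 / cmod z \<le> t\<close>, so each divisor z becomes a factor t. Together with the factor
  \<open>1 / t\<close> of the contour estimate this gives the orders 1, \<open>1 / t\<close> and t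
  of the three operators.\<close>

lemma F_bounds:
  assumes t: "0 < t" and z: "z \<in> csector \<eta>" "1 / t \<le> cmod z"
  shows "norm (FS t z) \<le> (M * t) * exp (t * Re z)"
    and "norm (FV t z) \<le> M * exp (t * Re z)"
    and "norm (FW t z) \<le> (M * t * t) * exp (t * Re z)"
proof -
  have z0: "0 < cmod z" using csector_nonzero[OF z(1)] by simp
  have q: "norm (Q z) \<le> M / cmod z" by (rule Q_norm[OF z(1)])
  have i: "1 / cmod z \<le> t" using z(2) t z0 by (simp add: field_simps)
  have e: "cmod (exp (of_real t * z)) = exp (t * Re z)" by simp
  have "M * (1 / cmod z) \<le> M * t" using i M_pos by (intro mult_left_mono) auto
  with q have qt: "norm (Q z) \<le> M * t" by simp
  then show "norm (FS t z) \<le> (M * t) * exp (t * Re z)"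
    unfolding norm_scaleC e by (subst mult.commute) (intro mult_right_mono, auto)
  have "cmod z * norm (Q z) \<le> M" using q z0 by (simp add: field_simps)
  then have "(cmod z * norm (Q z)) * exp (t * Re z) \<le> M * exp (t * Re z)" by (intro mult_right_mono) auto
  then show "norm (FV t z) \<le> M * exp (t * Re z)"
    unfolding norm_scaleC norm_mult e by (simp add: mult_ac)
  have "(1 / cmod z) * norm (Q z) \<le> t * (M * t)" using i qt t by (intro mult_mono) auto
  then have "((1 / cmod z) * norm (Q z)) * exp (t * Re z) \<le> (t * (M * t)) * exp (t * Re z)" by (intro mult_right_mono) auto
  then show "norm (FW t z) \<le> (M * t * t) * exp (t * Re z)"
    unfolding norm_scaleC norm_divide e by (simp add: mult_ac)
qed

text \<open>The radius \<open>1 / t\<close> serves the bounds only; as limits of arc integrals the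
  operators are the same for every radius.\<close>

definition S0 where "S0 t = (1 / (2 * of_real pi * \<i>)) *\<^sub>C keyhole_integral \<eta> (1 / t) (FS t)"
definition V0 where "V0 t = (1 / (2 * of_real pi * \<i>)) *\<^sub>C keyhole_integral \<eta> (1 / t) (FV t)"
definition W0 where "W0 t = (1 / (2 * of_real pi * \<i>)) *\<^sub>C keyhole_integral \<eta> (1 / t) (FW t)"

lemma keyhole_limits:
  assumes t: "0 < t"
  shows "(arc_integral \<eta> (FS t) \<longlongrightarrow> keyhole_integral \<eta> (1 / t) (FS t)) at_top"
    and "(arc_integral \<eta> (FV t) \<longlongrightarrow> keyhole_integral \<eta> (1 / t) (FV t)) at_top"
    and "(arc_integral \<eta> (FW t) \<longlongrightarrow> keyhole_integral \<eta> (1 / t) (FW t)) at_top"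
  using arc_integral_converges[OF FS_cdifferentiable[of t] \<eta>(1) \<eta>_pi t F_bounds(1)[OF t]]
    arc_integral_converges[OF FV_cdifferentiable[of t] \<eta>(1) \<eta>_pi t F_bounds(2)[OF t]]
    arc_integral_converges[OF FW_cdifferentiable[of t] \<eta>(1) \<eta>_pi t F_bounds(3)[OF t]]
  by blast+

definition K0 where "K0 = M * (2 / (- cos \<eta>) + 2 * \<eta> * exp 1)"

lemma norm_twopi: "norm ((1 / (2 * of_real pi * \<i>)) *\<^sub>C x) \<le> norm x"
proof -
  have "norm ((1 / (2 * of_real pi * \<i>)) *\<^sub>C x) = norm x / (2 * pi)"
    by (simp add: norm_scaleC norm_divide norm_mult)
  also have "\<dots> \<le> norm x" using pi_ge_two by (simp add: divide_le_eq mult_le_cancel_left1 order.trans)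
  finally show ?thesis .
qed

lemma
  assumes t: "0 < t"
  shows S0_norm: "norm (S0 t) \<le> K0" and V0_norm: "norm (V0 t) \<le> K0 / t" and W0_norm: "norm (W0 t) \<le> K0 * t"
proof -
  show "norm (S0 t) \<le> K0" unfolding S0_def
    by (rule order_trans[OF norm_twopi])
      (use keyhole_integral_bound[OF FS_cdifferentiable[of t] \<eta>(1) \<eta>_pi t F_bounds(1)[OF t]] t in \<open>simp add: K0_def\<close>)
  show "norm (V0 t) \<le> K0 / t" unfolding V0_def
    by (rule order_trans[OF norm_twopi])
      (use keyhole_integral_bound[OF FV_cdifferentiable[of t] \<eta>(1) \<eta>_pi t F_bounds(2)[OF t]] t in \<open>simp add: K0_def\<close>)
  show "norm (W0 t) \<le> K0 * t" unfolding W0_def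
    by (rule order_trans[OF norm_twopi])
      (use keyhole_integral_bound[OF FW_cdifferentiable[of t] \<eta>(1) \<eta>_pi t F_bounds(3)[OF t]] t in \<open>simp add: K0_def mult_ac\<close>)
qed

end

section \<open>Resolvent relations, domain and differentiability of the semigroup\<close>

context sectorial_operator
begin

abbreviation \<kappa> :: complex where "\<kappa> \<equiv> 1 / (2 * of_real pi * \<i>)"

lemma S0_limit: "0 < t \<Longrightarrow> ((\<lambda>N. \<kappa> *\<^sub>C arc_integral \<eta> (FS t) N) \<longlongrightarrow> S0 t) at_top"
  and V0_limit: "0 < t \<Longrightarrow> ((\<lambda>N. \<kappa> *\<^sub>C arc_integral \<eta> (FV t) N) \<longlongrightarrow> V0 t) at_top"
  and W0_limit: "0 < t \<Longrightarrow> ((\<lambda>N. \<kappa> *\<^sub>C arc_integral \<eta> (FW t) N) \<longlongrightarrow> W0 t) at_top"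
  unfolding S0_def V0_def W0_def
  by (fact scaleC.tendsto[OF tendsto_const keyhole_limits(1)] scaleC.tendsto[OF tendsto_const keyhole_limits(2)]
      scaleC.tendsto[OF tendsto_const keyhole_limits(3)])+

lemma one_in_sector: "1 \<in> csector \<eta>"
  using csectorI[of 1 0 \<eta>] \<eta>_nonneg by simp

text \<open>The resolvent identity with w = 1: after composition with \<open>Q 1\<close> a factor z
  is traded for terms without it. Integrated against exp (t z) or exp (t z) / z, this links
  \<open>V0\<close>, \<open>S0\<close> and \<open>W0\<close>.\<close>

lemma Q_times_Q1: "z \<in> csector \<eta> \<Longrightarrow> z *\<^sub>C (Q z o\<^sub>L Q 1) = (Q z o\<^sub>L Q 1) - Q z + Q 1"
  using resolvent_identity[OF _ one_in_sector, of z] by (simp add: scaleC.diff_left algebra_simps)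

lemma exp_cdifferentiable: "cdifferentiable_on (\<lambda>z. exp (of_real t * z) *\<^sub>C B) (csector \<eta>)"
proof (rule cdifferentiable_on_scaleC)
  show "((\<lambda>z. exp (of_real t * z)) has_field_derivative of_real t * exp (of_real t * z)) (at z within csector \<eta>)" for z :: complex
    by (rule derivative_eq_intros refl)+ simp
  show "cdifferentiable_on (\<lambda>z. B) (csector \<eta>)"
    unfolding cdifferentiable_on_def by (rule exI[of _ "\<lambda>_. 0"]) (simp add: scaleC.zero_right)
qed (intro continuous_intros)

lemma exp_over_z_continuous: "continuous_on (csector \<eta>) (\<lambda>z. (exp (of_real t * z) / z) *\<^sub>C B)"
  by (rule scaleC.continuous_on) (auto intro!: continuous_intros dest: csector_nonzero)

text \<open>For the resolvent R of B = A - \<open>\<omega>\<close> at 1 one has B R = R - I; this is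
  its form under the integral. The additional term \<open>exp (of_real t * z) *\<^sub>C Q 1\<close>
  integrates to 0 in the limit.\<close>

lemma V0_Q1:
  assumes t: "0 < t"
  shows "V0 t o\<^sub>L Q 1 = (S0 t o\<^sub>L Q 1) - S0 t"
proof -
  note cl = clinear_map_compose_right[where B = "Q 1"]
  have cS: "continuous_on (csector \<eta>) (FS t)" and cV: "continuous_on (csector \<eta>) (FV t)"
    and cE: "continuous_on (csector \<eta>) (\<lambda>z. exp (of_real t * z) *\<^sub>C Q 1)"
    using F_continuous exp_cdifferentiable[THEN cdifferentiable_on_continuous] by blast+
  have cS1: "continuous_on (csector \<eta>) (\<lambda>z. FS t z o\<^sub>L Q 1)"
    by (rule bounded_bilinear.continuous_on[OF bounded_bilinear_blinfun_compose cS continuous_on_const])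
  have eq: "FV t z o\<^sub>L Q 1 = ((FS t z o\<^sub>L Q 1) - FS t z) + exp (of_real t * z) *\<^sub>C Q 1" if "z \<in> csector \<eta>" for z
  proof -
    have "FV t z o\<^sub>L Q 1 = exp (of_real t * z) *\<^sub>C (z *\<^sub>C (Q z o\<^sub>L Q 1))"
      by (simp add: scaleC_blinfun_compose scaleC_scaleC mult.commute)
    then show ?thesis
      unfolding Q_times_Q1[OF that] by (simp add: scaleC_add_right scaleC.diff_right scaleC_blinfun_compose)
  qed
  have arc: "\<kappa> *\<^sub>C arc_integral \<eta> (FV t) N o\<^sub>L Q 1 = (\<kappa> *\<^sub>C arc_integral \<eta> (FS t) N o\<^sub>L Q 1) - \<kappa> *\<^sub>C arc_integral \<eta> (FS t) N
      + \<kappa> *\<^sub>C arc_integral \<eta> (\<lambda>z. exp (of_real t * z) *\<^sub>C Q 1) N" if N: "0 < N" for N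
  proof -
    have "arc_integral \<eta> (FV t) N o\<^sub>L Q 1 = arc_integral \<eta> (\<lambda>z. FV t z o\<^sub>L Q 1) N"
      by (rule arc_integral_linear[OF cl cV N, symmetric])
    also have "\<dots> = arc_integral \<eta> (\<lambda>z. ((FS t z o\<^sub>L Q 1) - FS t z) + exp (of_real t * z) *\<^sub>C Q 1) N"
      by (rule arc_integral_cong[OF eq N])
    also have "\<dots> = arc_integral \<eta> (\<lambda>z. (FS t z o\<^sub>L Q 1) - FS t z) N + arc_integral \<eta> (\<lambda>z. exp (of_real t * z) *\<^sub>C Q 1) N"
      by (rule arc_integral_add[OF continuous_on_diff[OF cS1 cS] cE N])
    also have "arc_integral \<eta> (\<lambda>z. (FS t z o\<^sub>L Q 1) - FS t z) N = arc_integral \<eta> (\<lambda>z. FS t z o\<^sub>L Q 1) N - arc_integral \<eta> (FS t) N"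
      by (rule arc_integral_diff_integrand[OF cS1 cS N])
    also have "arc_integral \<eta> (\<lambda>z. FS t z o\<^sub>L Q 1) N = arc_integral \<eta> (FS t) N o\<^sub>L Q 1"
      by (rule arc_integral_linear[OF cl cS N])
    finally show ?thesis
      by (simp add: scaleC_blinfun_compose scaleC_add_right scaleC.diff_right)
  qed
  have "((\<lambda>N. (\<kappa> *\<^sub>C arc_integral \<eta> (FS t) N o\<^sub>L Q 1) - \<kappa> *\<^sub>C arc_integral \<eta> (FS t) N
      + \<kappa> *\<^sub>C arc_integral \<eta> (\<lambda>z. exp (of_real t * z) *\<^sub>C Q 1) N) \<longlongrightarrow> (S0 t o\<^sub>L Q 1) - S0 t + \<kappa> *\<^sub>C 0) at_top"
    by (rule tendsto_add[OF tendsto_diff[OF bounded_bilinear.tendsto[OF bounded_bilinear_blinfun_compose S0_limit[OF t] tendsto_const]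
          S0_limit[OF t]] scaleC.tendsto[OF tendsto_const arc_integral_exp_tendsto[OF \<eta>(1) \<eta>_pi t]]])
  moreover have "((\<lambda>N. (\<kappa> *\<^sub>C arc_integral \<eta> (FS t) N o\<^sub>L Q 1) - \<kappa> *\<^sub>C arc_integral \<eta> (FS t) N
      + \<kappa> *\<^sub>C arc_integral \<eta> (\<lambda>z. exp (of_real t * z) *\<^sub>C Q 1) N) \<longlongrightarrow> V0 t o\<^sub>L Q 1) at_top"
    by (rule Lim_transform_eventually[OF bounded_bilinear.tendsto[OF bounded_bilinear_blinfun_compose V0_limit[OF t] tendsto_const]
          eventually_mono[OF eventually_gt_at_top[of 0] arc]])
  ultimately have "(S0 t o\<^sub>L Q 1) - S0 t + \<kappa> *\<^sub>C 0 = V0 t o\<^sub>L Q 1"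
    by (rule tendsto_unique[OF trivial_limit_at_top_linorder])
  then show ?thesis by (simp add: scaleC.zero_right)
qed

text \<open>The decomposition of \<open>V0_Q1\<close> divided by z. Now the additional term has a
  residue, \<open>Q 1\<close>, which is how the initial value of the semigroup is recovered.\<close>

lemma S0_Q1:
  assumes t: "0 < t"
  shows "S0 t o\<^sub>L Q 1 = (W0 t o\<^sub>L Q 1) - W0 t + Q 1"
proof -
  note cl = clinear_map_compose_right[where B = "Q 1"]
  let ?E = "\<lambda>z. (exp (of_real t * z) / z) *\<^sub>C Q 1"
  have cS: "continuous_on (csector \<eta>) (FS t)" and cV: "continuous_on (csector \<eta>) (FW t)"
    and cE: "continuous_on (csector \<eta>) ?E"
    using F_continuous exp_over_z_continuous by blast+
  have cW1: "continuous_on (csector \<eta>) (\<lambda>z. FW t z o\<^sub>L Q 1)"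
    by (rule bounded_bilinear.continuous_on[OF bounded_bilinear_blinfun_compose cV continuous_on_const])
  have eq: "FS t z o\<^sub>L Q 1 = ((FW t z o\<^sub>L Q 1) - FW t z) + ?E z" if "z \<in> csector \<eta>" for z
  proof -
    have "FS t z o\<^sub>L Q 1 = (exp (of_real t * z) / z) *\<^sub>C (z *\<^sub>C (Q z o\<^sub>L Q 1))"
      using csector_nonzero[OF that] by (simp add: scaleC_blinfun_compose scaleC_scaleC)
    then show ?thesis
      unfolding Q_times_Q1[OF that] by (simp add: scaleC_add_right scaleC.diff_right scaleC_blinfun_compose)
  qed
  have arc: "\<kappa> *\<^sub>C arc_integral \<eta> (FS t) N o\<^sub>L Q 1 = (\<kappa> *\<^sub>C arc_integral \<eta> (FW t) N o\<^sub>L Q 1) - \<kappa> *\<^sub>C arc_integral \<eta> (FW t) N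
      + \<kappa> *\<^sub>C arc_integral \<eta> ?E N" if N: "0 < N" for N
  proof -
    have "arc_integral \<eta> (FS t) N o\<^sub>L Q 1 = arc_integral \<eta> (\<lambda>z. FS t z o\<^sub>L Q 1) N"
      by (rule arc_integral_linear[OF cl cS N, symmetric])
    also have "\<dots> = arc_integral \<eta> (\<lambda>z. ((FW t z o\<^sub>L Q 1) - FW t z) + ?E z) N"
      by (rule arc_integral_cong[OF eq N])
    also have "\<dots> = arc_integral \<eta> (\<lambda>z. (FW t z o\<^sub>L Q 1) - FW t z) N + arc_integral \<eta> ?E N"
      by (rule arc_integral_add[OF continuous_on_diff[OF cW1 cV] cE N])
    also have "arc_integral \<eta> (\<lambda>z. (FW t z o\<^sub>L Q 1) - FW t z) N = arc_integral \<eta> (\<lambda>z. FW t z o\<^sub>L Q 1) N - arc_integral \<eta> (FW t) N"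
      by (rule arc_integral_diff_integrand[OF cW1 cV N])
    also have "arc_integral \<eta> (\<lambda>z. FW t z o\<^sub>L Q 1) N = arc_integral \<eta> (FW t) N o\<^sub>L Q 1"
      by (rule arc_integral_linear[OF cl cV N])
    finally show ?thesis
      by (simp add: scaleC_blinfun_compose scaleC_add_right scaleC.diff_right)
  qed
  have "((\<lambda>N. (\<kappa> *\<^sub>C arc_integral \<eta> (FW t) N o\<^sub>L Q 1) - \<kappa> *\<^sub>C arc_integral \<eta> (FW t) N
      + \<kappa> *\<^sub>C arc_integral \<eta> ?E N) \<longlongrightarrow> (W0 t o\<^sub>L Q 1) - W0 t + \<kappa> *\<^sub>C ((2 * of_real pi * \<i>) *\<^sub>C Q 1)) at_top"
    by (rule tendsto_add[OF tendsto_diff[OF bounded_bilinear.tendsto[OF bounded_bilinear_blinfun_compose W0_limit[OF t] tendsto_const]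
          W0_limit[OF t]] scaleC.tendsto[OF tendsto_const arc_integral_exp_over_z_tendsto[OF \<eta>(1) \<eta>_pi t]]])
  moreover have "((\<lambda>N. (\<kappa> *\<^sub>C arc_integral \<eta> (FW t) N o\<^sub>L Q 1) - \<kappa> *\<^sub>C arc_integral \<eta> (FW t) N
      + \<kappa> *\<^sub>C arc_integral \<eta> ?E N) \<longlongrightarrow> S0 t o\<^sub>L Q 1) at_top"
    by (rule Lim_transform_eventually[OF bounded_bilinear.tendsto[OF bounded_bilinear_blinfun_compose S0_limit[OF t] tendsto_const]
          eventually_mono[OF eventually_gt_at_top[of 0] arc]])
  ultimately have "(W0 t o\<^sub>L Q 1) - W0 t + \<kappa> *\<^sub>C ((2 * of_real pi * \<i>) *\<^sub>C Q 1) = S0 t o\<^sub>L Q 1"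
    by (rule tendsto_unique[OF trivial_limit_at_top_linorder])
  then show ?thesis by (simp add: scaleC_scaleC)
qed

lemma
  assumes B: "clinear_map (blinfun_apply B)" "\<And>z. z \<in> csector \<eta> \<Longrightarrow> B o\<^sub>L Q z = Q z o\<^sub>L B" and t: "0 < t"
  shows S0_commute: "B o\<^sub>L S0 t = S0 t o\<^sub>L B" and V0_commute: "B o\<^sub>L V0 t = V0 t o\<^sub>L B"
proof -
  note cl = clinear_map_compose_left[OF B(1)] and cr = clinear_map_compose_right[where B = B]
  have smul: "B o\<^sub>L (c *\<^sub>C X) = c *\<^sub>C (B o\<^sub>L X)" for c and X :: "'a \<Rightarrow>\<^sub>L 'a"
    using cl unfolding clinear_map_def by blast
  have *: "B o\<^sub>L I = I o\<^sub>L B"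
    if c: "continuous_on (csector \<eta>) (\<lambda>z. f z *\<^sub>C Q z)" and lim: "((\<lambda>N. \<kappa> *\<^sub>C arc_integral \<eta> (\<lambda>z. f z *\<^sub>C Q z) N) \<longlongrightarrow> I) at_top" for f I
  proof -
    have "B o\<^sub>L \<kappa> *\<^sub>C arc_integral \<eta> (\<lambda>z. f z *\<^sub>C Q z) N = \<kappa> *\<^sub>C arc_integral \<eta> (\<lambda>z. f z *\<^sub>C Q z) N o\<^sub>L B" if N: "0 < N" for N
    proof -
      have "B o\<^sub>L arc_integral \<eta> (\<lambda>z. f z *\<^sub>C Q z) N = arc_integral \<eta> (\<lambda>z. B o\<^sub>L f z *\<^sub>C Q z) N"
        by (rule arc_integral_linear[OF cl c N, symmetric])
      also have "\<dots> = arc_integral \<eta> (\<lambda>z. f z *\<^sub>C Q z o\<^sub>L B) N"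
        by (rule arc_integral_cong[OF _ N]) (simp add: smul B(2) scaleC_blinfun_compose)
      also have "\<dots> = arc_integral \<eta> (\<lambda>z. f z *\<^sub>C Q z) N o\<^sub>L B"
        by (rule arc_integral_linear[OF cr c N])
      finally show ?thesis by (simp add: smul scaleC_blinfun_compose)
    qed
    then have "((\<lambda>N. \<kappa> *\<^sub>C arc_integral \<eta> (\<lambda>z. f z *\<^sub>C Q z) N o\<^sub>L B) \<longlongrightarrow> B o\<^sub>L I) at_top"
      by (intro Lim_transform_eventually[OF bounded_bilinear.tendsto[OF bounded_bilinear_blinfun_compose tendsto_const lim]
            eventually_mono[OF eventually_gt_at_top[of 0]]])
    moreover have "((\<lambda>N. \<kappa> *\<^sub>C arc_integral \<eta> (\<lambda>z. f z *\<^sub>C Q z) N o\<^sub>L B) \<longlongrightarrow> I o\<^sub>L B) at_top"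
      by (rule bounded_bilinear.tendsto[OF bounded_bilinear_blinfun_compose lim tendsto_const])
    ultimately show ?thesis by (rule tendsto_unique[OF trivial_limit_at_top_linorder])
  qed
  show "B o\<^sub>L S0 t = S0 t o\<^sub>L B" by (rule *[OF F_continuous(1) S0_limit[OF t]])
  show "B o\<^sub>L V0 t = V0 t o\<^sub>L B" by (rule *[OF F_continuous(2) V0_limit[OF t]])
qed

text \<open>Complex linearity is commutation with the operator of multiplication by c.\<close>

lemma S0_scaleC:
  assumes "0 < t"
  shows "S0 t (c *\<^sub>C x) = c *\<^sub>C S0 t x"
proof -
  define B :: "'a \<Rightarrow>\<^sub>L 'a" where "B = Blinfun (\<lambda>x. c *\<^sub>C x)"
  have B: "blinfun_apply B = (\<lambda>x. c *\<^sub>C x)"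
    unfolding B_def by (rule bounded_linear_Blinfun_apply[OF scaleC.bounded_linear_right])
  have "B o\<^sub>L S0 t = S0 t o\<^sub>L B"
  proof (rule S0_commute[OF _ _ assms])
    show "clinear_map (blinfun_apply B)" unfolding B by (rule clinear_map_scaleC)
    show "B o\<^sub>L Q z = Q z o\<^sub>L B" if "z \<in> csector \<eta>" for z
      by (rule blinfun_eqI) (use Q_clinear[OF that] in \<open>simp add: B clinear_map_def\<close>)
  qed
  then have "blinfun_apply (B o\<^sub>L S0 t) x = blinfun_apply (S0 t o\<^sub>L B) x" by simp
  then show ?thesis by (simp add: B)
qed

lemma Q1_S0: "0 < t \<Longrightarrow> Q 1 o\<^sub>L S0 t = S0 t o\<^sub>L Q 1" and Q1_V0: "0 < t \<Longrightarrow> Q 1 o\<^sub>L V0 t = V0 t o\<^sub>L Q 1"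
  using S0_commute[OF Q_clinear[OF one_in_sector] Q_commute[OF one_in_sector]]
    V0_commute[OF Q_clinear[OF one_in_sector] Q_commute[OF one_in_sector]] by blast+

text \<open>The operator \<open>(\<omega> + 1) - A\<close> undoes \<open>Q 1\<close>. Cancellation
  on the left takes the place of density of the range.\<close>

lemma Q1_cancel:
  assumes "Q 1 o\<^sub>L X = Q 1 o\<^sub>L Y"
  shows "X = Y"
proof (rule blinfun_eqI)
  fix x
  have "Q 1 (X x) = Q 1 (Y x)" using arg_cong[OF assms, of "\<lambda>Z. blinfun_apply Z x"] by simp
  then have eq: "resolvent D A (of_real \<omega> + 1) (X x) = resolvent D A (of_real \<omega> + 1) (Y x)"
    by (simp only: Q_apply[OF one_in_sector])
  show "X x = Y x"
    using resolvent_right[OF one_in_sector, of "X x"] resolvent_right[OF one_in_sector, of "Y x"]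
    unfolding eq by (rule trans[OF sym])
qed

text \<open>Rearranged, \<open>V0_Q1\<close> says that \<open>S0 t\<close> equals \<open>Q 1\<close>
  after \<open>S0 t - V0 t\<close>. So its values lie in the range of a resolvent, and the resolvent
  equation gives \<open>A\<close> there; the unbounded operator is never moved under an
  integral.\<close>

lemma
  assumes t: "0 < t"
  shows S0_in_domain: "S0 t x \<in> D" and A_S0: "A (S0 t x) = \<omega> *\<^sub>R S0 t x + V0 t x"
proof -
  define y where "y = S0 t x - V0 t x"
  have "S0 t = Q 1 o\<^sub>L (S0 t - V0 t)"
    unfolding bounded_bilinear.diff_right[OF bounded_bilinear_blinfun_compose] Q1_S0[OF t] Q1_V0[OF t] V0_Q1[OF t]
    by simp
  then have "S0 t x = blinfun_apply (Q 1 o\<^sub>L (S0 t - V0 t)) x" by simp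
  also have "\<dots> = resolvent D A (of_real \<omega> + 1) y"
    unfolding blinfun_apply_blinfun_compose blinfun.diff_left y_def Q_apply[OF one_in_sector] ..
  finally have eq: "S0 t x = resolvent D A (of_real \<omega> + 1) y" .
  then show "S0 t x \<in> D" using resolvent_in_domain[OF one_in_sector] by simp
  have "(of_real \<omega> + 1) *\<^sub>C S0 t x - A (S0 t x) = y"
    unfolding eq by (rule resolvent_right[OF one_in_sector])
  then show "A (S0 t x) = \<omega> *\<^sub>R S0 t x + V0 t x"
    by (simp add: y_def scaleC_add_left scaleC_of_real algebra_simps)
qed

text \<open>Arc integrals are differentiated under the integral sign, and the explicit remainder of
  the contour integral makes the derivatives converge uniformly near t, so that limit and derivative
  may be interchanged.\<close>

lemma S0_has_derivative:
  assumes t: "0 < t"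
  shows "(S0 has_vector_derivative V0 t) (at t)"
proof -
  \<comment> \<open>Bounded away from 0: on this set the decay rate of the integrand is at least
    \<open>t / 2 * c\<close>.\<close>
  define U where "U = {t / 2..t + 1}"
  have U: "t \<in> U" "convex U" and Upos: "\<And>s. s \<in> U \<Longrightarrow> t / 2 \<le> s" using t by (auto simp: U_def)
  have Upos': "0 < s" if "s \<in> U" for s using Upos[OF that] t by linarith
  \<comment> \<open>The offset \<open>2 / t\<close> dominates \<open>1 / s\<close> for all s in U,
    so that the remainder estimate holds for every n.\<close>
  define N where "N = (\<lambda>n::nat. 2 / t + real n)"
  have Npos: "0 < N n" for n using t by (simp add: N_def add_pos_nonneg)
  have Ntop: "LIM n sequentially. N n :> at_top"
    unfolding N_def by (rule filterlim_tendsto_add_at_top[OF tendsto_const filterlim_real_sequentially])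
  define c where "c = - cos \<eta>"
  have c: "0 < c" using cos_lt_zero_pi[of \<eta>] \<eta> \<eta>_pi by (auto simp: c_def)
  have deriv: "((\<lambda>s. arc_integral \<eta> (FS s) (N n)) has_vector_derivative arc_integral \<eta> (FV s) (N n)) (at s within U)"
    if s: "s \<in> U" for s n
  proof -
    let ?f = "\<lambda>s \<phi>. (\<i> * of_real (N n) * cis \<phi>) *\<^sub>C FS s (of_real (N n) * cis \<phi>)"
    let ?g = "\<lambda>s \<phi>. (\<i> * of_real (N n) * cis \<phi>) *\<^sub>C FV s (of_real (N n) * cis \<phi>)"
    have "((\<lambda>s. integral (cbox (- \<eta>) \<eta>) (?f s)) has_vector_derivative integral (cbox (- \<eta>) \<eta>) (?g s)) (at s within U)"
    proof (rule leibniz_rule_vector_derivative[where f = ?f and fx = ?g])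
      fix x \<phi> :: real
      let ?z = "of_real (N n) * cis \<phi>"
      have "((\<lambda>x. exp (x * ?z)) has_field_derivative ?z * exp (of_real x * ?z)) (at (of_real x))"
        by (rule derivative_eq_intros refl)+ simp
      from has_vector_derivative_real_field[OF this, of U]
      have "((\<lambda>x. exp (of_real x * ?z)) has_vector_derivative ?z * exp (of_real x * ?z)) (at x within U)" .
      from bounded_linear.has_vector_derivative[OF scaleC.bounded_linear_right
          bounded_linear.has_vector_derivative[OF scaleC.bounded_linear_left this]]
      show "((\<lambda>x. ?f x \<phi>) has_vector_derivative ?g x \<phi>) (at x within U)" .
    next
      show "?f x integrable_on cbox (- \<eta>) \<eta>" if "x \<in> U" for x
        using integrable_continuous_interval[OF arc_integrand_continuous[OF F_continuous(1) Npos]] by simp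
      have "continuous_on (U \<times> cbox (- \<eta>) \<eta>) (\<lambda>p. Q (of_real (N n) * cis (snd p)))"
        by (rule continuous_on_compose2[OF Q_continuous])
          (use Npos in \<open>auto intro!: continuous_intros csectorI\<close>)
      then show "continuous_on (U \<times> cbox (- \<eta>) \<eta>) (\<lambda>(x, \<phi>). ?g x \<phi>)"
        unfolding split_beta by (intro scaleC.continuous_on continuous_intros)
    qed (use s U in auto)
    then show ?thesis by (simp add: arc_integral_def)
  qed
  let ?f = "\<lambda>n s. \<kappa> *\<^sub>C arc_integral \<eta> (FS s) (N n)" and ?g = "\<lambda>n s. \<kappa> *\<^sub>C arc_integral \<eta> (FV s) (N n)"
  have tail: "norm (?g n s - V0 s) \<le> 2 * M / (t / 2 * c) * exp (- (t / 2 * c) * N n)" if s: "s \<in> U" for s n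
  proof -
    have sp: "0 < s" and st: "t / 2 \<le> s" using Upos[OF s] t by auto
    have "1 / s \<le> 2 / t" using st t sp by (simp add: field_simps)
    then have Ns: "1 / s \<le> N n" by (simp add: N_def add_increasing2)
    have "norm (V0 s - ?g n s) \<le> norm (keyhole_integral \<eta> (1 / s) (FV s) - arc_integral \<eta> (FV s) (N n))"
      unfolding V0_def scaleC.diff_right[symmetric] by (rule norm_twopi)
    also have "\<dots> \<le> 2 * M * exp (s * cos \<eta> * N n) / (s * - cos \<eta>)"
      by (rule keyhole_integral_tail[OF FV_cdifferentiable \<eta>(1) \<eta>_pi sp F_bounds(2)[OF sp] Ns])
    also have "\<dots> \<le> 2 * M * exp (- (t / 2 * c) * N n) / (t / 2 * c)"
    proof (rule frac_le)
      have "t / 2 * c * N n \<le> s * c * N n" using st c Npos[of n] by (intro mult_right_mono) auto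
      then show "2 * M * exp (s * cos \<eta> * N n) \<le> 2 * M * exp (- (t / 2 * c) * N n)"
        using M_pos by (simp add: c_def)
      show "t / 2 * c \<le> s * - cos \<eta>" using st c by (simp add: c_def[symmetric])
    qed (use M_pos t c in auto)
    finally show ?thesis by (simp add: norm_minus_commute)
  qed
  have lim0: "(\<lambda>n. 2 * M / (t / 2 * c) * exp (- (t / 2 * c) * N n)) \<longlonglongrightarrow> 0"
    using tendsto_mult[OF tendsto_const filterlim_compose[OF exp_neg_linear_tendsto_0 Ntop], of "t / 2 * c" "2 * M / (t / 2 * c)"]
      t c by simp
  have "\<exists>g. \<forall>x\<in>U. (\<lambda>n. ?f n x) \<longlonglongrightarrow> g x \<and> (g has_derivative (\<lambda>h. h *\<^sub>R V0 x)) (at x within U)"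
  proof (rule has_derivative_sequence[OF U(2) _ _ U(1)])
    show "(?f n has_derivative (\<lambda>h. h *\<^sub>R ?g n x)) (at x within U)" if "x \<in> U" for n x
      using bounded_linear.has_vector_derivative[OF scaleC.bounded_linear_right deriv[OF that]]
      unfolding has_vector_derivative_def .
    show "\<forall>\<^sub>F n in sequentially. \<forall>x\<in>U. \<forall>h. norm (h *\<^sub>R ?g n x - h *\<^sub>R V0 x) \<le> e * norm h" if "0 < e" for e :: real
      using order_tendstoD(2)[OF lim0 that]
    proof eventually_elim
      case (elim n)
      show ?case
      proof (intro ballI allI)
        fix x and h :: real assume "x \<in> U"
        have "norm (h *\<^sub>R ?g n x - h *\<^sub>R V0 x) = norm h * norm (?g n x - V0 x)"
          unfolding scaleR_diff_right[symmetric] norm_scaleR by simp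
        also have "\<dots> \<le> norm h * e"
          using tail[OF \<open>x \<in> U\<close>, of n] elim by (intro mult_left_mono) auto
        finally show "norm (h *\<^sub>R ?g n x - h *\<^sub>R V0 x) \<le> e * norm h" by (simp add: mult.commute)
      qed
    qed
    show "(\<lambda>n. ?f n t) \<longlonglongrightarrow> S0 t" by (rule filterlim_compose[OF S0_limit[OF t] Ntop])
  qed
  then obtain g where g: "\<And>x. x \<in> U \<Longrightarrow> (\<lambda>n. ?f n x) \<longlonglongrightarrow> g x"
    "\<And>x. x \<in> U \<Longrightarrow> (g has_derivative (\<lambda>h. h *\<^sub>R V0 x)) (at x within U)" by blast
  have gS: "g x = S0 x" if "x \<in> U" for x
    using LIMSEQ_unique[OF g(1)[OF that] filterlim_compose[OF S0_limit[OF Upos'[OF that]] Ntop]] .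
  have "(S0 has_derivative (\<lambda>h. h *\<^sub>R V0 t)) (at t within U)"
    by (rule has_derivative_transform[OF U(1) _ g(2)[OF U(1)]]) (simp add: gS)
  moreover have "at t within U = at t"
    by (rule at_within_interior) (use t in \<open>auto simp: U_def\<close>)
  ultimately show ?thesis by (simp add: has_vector_derivative_def)
qed

end

text \<open>\<open>V t\<close> stands for \<open>A\<close> composed with \<open>S t\<close>.\<close>

locale smoothing_semigroup =
  fixes S V :: "real \<Rightarrow> 'a::complex_banach \<Rightarrow> 'a" and Tm C :: real
  assumes Tm: "0 < Tm" and C: "1 \<le> C"
    and S_zero [simp]: "S 0 x = x"
    and S_bounded_linear: "0 \<le> t \<Longrightarrow> bounded_linear (S t)"
    and S_scaleC: "0 \<le> t \<Longrightarrow> S t (c *\<^sub>C x) = c *\<^sub>C S t x"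
    and S_add: "0 \<le> s \<Longrightarrow> 0 \<le> t \<Longrightarrow> S (s + t) x = S s (S t x)"
    and S_norm: "0 \<le> t \<Longrightarrow> t \<le> Tm \<Longrightarrow> norm (S t x) \<le> C * norm x"
    and V_bounded_linear: "0 < t \<Longrightarrow> bounded_linear (V t)"
    and V_norm: "0 < t \<Longrightarrow> t \<le> Tm \<Longrightarrow> norm (V t x) \<le> C / t * norm x"
    and V_S: "0 < s \<Longrightarrow> 0 \<le> t \<Longrightarrow> V s (S t x) = V (s + t) x"
    and S_V: "0 \<le> s \<Longrightarrow> 0 < t \<Longrightarrow> S s (V t x) = V (s + t) x"
    and S_derivative: "0 < t \<Longrightarrow> ((\<lambda>t. S t x) has_vector_derivative V t x) (at t)"

section \<open>The semigroup law and the identification with the Dunford integral\<close>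

context sectorial_operator
begin

lemma Q1_S0_apply: "0 < t \<Longrightarrow> Q 1 (S0 t x) = S0 t (Q 1 x)"
  using arg_cong[OF Q1_S0, of t "\<lambda>Z. blinfun_apply Z x"] by simp

lemma Q1_V0_apply: "0 < t \<Longrightarrow> Q 1 (V0 t x) = S0 t (Q 1 x) - S0 t x"
  using arg_cong[OF Q1_V0, of t "\<lambda>Z. blinfun_apply Z x"] arg_cong[OF V0_Q1, of t "\<lambda>Z. blinfun_apply Z x"]
  by (simp add: blinfun.diff_left)

text \<open>After composition with \<open>Q 1\<close> both sides become \<open>S0 a\<close> applied
  to \<open>S0 b (Q 1 x) - S0 b x\<close>; the order of \<open>S0 a\<close> and \<open>S0 b\<close>
  is never exchanged.\<close>

lemma V0_S0:
  assumes "0 < a" "0 < b"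
  shows "V0 a o\<^sub>L S0 b = S0 a o\<^sub>L V0 b"
  by (rule Q1_cancel, rule blinfun_eqI)
    (simp add: Q1_V0_apply Q1_S0_apply assms blinfun.diff_right)

text \<open>Continuity at 0 on the range of \<open>Q 1\<close>: by \<open>S0_Q1\<close> the
  deviation is controlled by \<open>W0 h\<close>, which is O(h).\<close>

lemma S0_Q1_tendsto: "((\<lambda>h. S0 h o\<^sub>L Q 1) \<longlongrightarrow> Q 1) (at_right 0)"
proof -
  have le: "norm ((S0 h o\<^sub>L Q 1) - Q 1) \<le> K0 * h * (norm (Q 1) + 1)" if h: "0 < h" for h
  proof -
    have "norm ((W0 h o\<^sub>L Q 1) - W0 h) \<le> norm (W0 h) * norm (Q 1) + norm (W0 h)"
      by (rule order_trans[OF norm_triangle_ineq4]) (simp add: norm_blinfun_compose)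
    also have "\<dots> = norm (W0 h) * (norm (Q 1) + 1)" by (simp add: algebra_simps)
    also have "\<dots> \<le> K0 * h * (norm (Q 1) + 1)" by (intro mult_right_mono W0_norm h) auto
    finally show ?thesis unfolding S0_Q1[OF h] by simp
  qed
  have "((\<lambda>h. K0 * h * (norm (Q 1) + 1)) \<longlongrightarrow> K0 * 0 * (norm (Q 1) + 1)) (at_right 0)"
    by (intro tendsto_mult tendsto_const tendsto_ident_at)
  then have "((\<lambda>h. K0 * h * (norm (Q 1) + 1)) \<longlongrightarrow> 0) (at_right 0)" by simp
  then have "((\<lambda>h. (S0 h o\<^sub>L Q 1) - Q 1) \<longlongrightarrow> 0) (at_right 0)"
    by (rule Lim_null_comparison[rotated]) (use le in \<open>auto simp: eventually_at_filter\<close>)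
  then show ?thesis by (simp add: LIM_zero_iff)
qed

text \<open>The product of the semigroup at times \<open>t - \<xi>\<close> and \<open>s + \<xi>\<close> does not depend on \<open>\<xi>\<close>. Since the
  domain need not be dense, the limit for \<open>\<xi> \<rightarrow> t\<close> is only available after composition with a
  resolvent, which is injective.\<close>

lemma S0_add:
  assumes s: "0 < s" and t: "0 < t"
  shows "S0 t o\<^sub>L S0 s = S0 (s + t)"
proof -
  let ?\<Phi> = "\<lambda>\<xi>. S0 (t - \<xi>) o\<^sub>L S0 (s + \<xi>)"
  have "(?\<Phi> has_vector_derivative 0) (at \<xi> within {0..<t})" if \<xi>: "\<xi> \<in> {0..<t}" for \<xi>
  proof -
    have pos: "0 < t - \<xi>" "0 < s + \<xi>" using \<xi> s by auto
    have "((\<lambda>\<xi>. t - \<xi>) has_vector_derivative - 1) (at \<xi>)" "((\<lambda>\<xi>. s + \<xi>) has_vector_derivative 1) (at \<xi>)"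
      by (auto intro!: derivative_eq_intros)
    from vector_diff_chain_at[OF this(1) S0_has_derivative[OF pos(1)]]
      vector_diff_chain_at[OF this(2) S0_has_derivative[OF pos(2)]]
    have "((\<lambda>\<xi>. S0 (t - \<xi>)) has_vector_derivative - V0 (t - \<xi>)) (at \<xi>)"
      "((\<lambda>\<xi>. S0 (s + \<xi>)) has_vector_derivative V0 (s + \<xi>)) (at \<xi>)"
      by (simp_all add: o_def)
    from bounded_bilinear.has_vector_derivative[OF bounded_bilinear_blinfun_compose this]
    have "(?\<Phi> has_vector_derivative (S0 (t - \<xi>) o\<^sub>L V0 (s + \<xi>)) + (- V0 (t - \<xi>) o\<^sub>L S0 (s + \<xi>))) (at \<xi>)" .
    moreover have "(S0 (t - \<xi>) o\<^sub>L V0 (s + \<xi>)) + (- V0 (t - \<xi>) o\<^sub>L S0 (s + \<xi>)) = 0"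
      unfolding bounded_bilinear.minus_left[OF bounded_bilinear_blinfun_compose] V0_S0[OF pos] by simp
    ultimately show ?thesis by (simp add: has_vector_derivative_at_within)
  qed
  then obtain c where c: "\<And>\<xi>. \<xi> \<in> {0..<t} \<Longrightarrow> ?\<Phi> \<xi> = c"
    using has_vector_derivative_zero_constant[of "{0..<t}" ?\<Phi>] by auto
  have const: "S0 h o\<^sub>L S0 (s + t - h) = S0 t o\<^sub>L S0 s" if "0 < h" "h \<le> t" for h
    using c[of "t - h"] c[of 0] that t by (simp add: add_diff_eq)
  have cont: "isCont S0 (s + t)"
    using S0_has_derivative[of "s + t"] s t has_vector_derivative_continuous by auto
  have "((\<lambda>h. s + t - h) \<longlongrightarrow> s + t - 0) (at_right 0)" by (intro tendsto_intros)
  then have "((\<lambda>h. S0 (s + t - h)) \<longlongrightarrow> S0 (s + t)) (at_right 0)"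
    by (intro isCont_tendsto_compose[OF cont]) simp
  from bounded_bilinear.tendsto[OF bounded_bilinear_blinfun_compose S0_Q1_tendsto this]
  have "((\<lambda>h. (S0 h o\<^sub>L Q 1) o\<^sub>L S0 (s + t - h)) \<longlongrightarrow> Q 1 o\<^sub>L S0 (s + t)) (at_right 0)" .
  moreover have "\<forall>\<^sub>F h in at_right 0. (S0 h o\<^sub>L Q 1) o\<^sub>L S0 (s + t - h) = Q 1 o\<^sub>L (S0 t o\<^sub>L S0 s)"
    unfolding eventually_at_right_field
  proof (intro exI[of _ t] conjI allI impI t)
    fix h assume h: "0 < h" "h < t"
    have "(S0 h o\<^sub>L Q 1) o\<^sub>L S0 (s + t - h) = Q 1 o\<^sub>L (S0 h o\<^sub>L S0 (s + t - h))"
      by (rule blinfun_eqI) (simp add: Q1_S0_apply h)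
    also have "\<dots> = Q 1 o\<^sub>L (S0 t o\<^sub>L S0 s)" using const h by simp
    finally show "(S0 h o\<^sub>L Q 1) o\<^sub>L S0 (s + t - h) = Q 1 o\<^sub>L (S0 t o\<^sub>L S0 s)" .
  qed
  ultimately have "((\<lambda>h::real. Q 1 o\<^sub>L (S0 t o\<^sub>L S0 s)) \<longlongrightarrow> Q 1 o\<^sub>L S0 (s + t)) (at_right 0)"
    by (rule Lim_transform_eventually)
  then have "Q 1 o\<^sub>L (S0 t o\<^sub>L S0 s) = Q 1 o\<^sub>L S0 (s + t)"
    by (simp add: tendsto_const_iff)
  then show ?thesis by (rule Q1_cancel)
qed

lemma S0_V0:
  assumes "0 < s" "0 < t"
  shows "S0 s (V0 t x) = V0 (s + t) x"
proof -
  have *: "S0 s (S0 t y) = S0 (s + t) y" for y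
    using arg_cong[OF S0_add[OF assms(2,1)], of "\<lambda>Z. blinfun_apply Z y"] by (simp add: add.commute)
  have "Q 1 o\<^sub>L (S0 s o\<^sub>L V0 t) = Q 1 o\<^sub>L V0 (s + t)"
    by (rule blinfun_eqI) (simp add: Q1_S0_apply Q1_V0_apply assms add_pos_pos blinfun.diff_right *)
  from Q1_cancel[OF this] show ?thesis by (metis blinfun_apply_blinfun_compose)
qed

text \<open>Both contours, of radius r and of radius \<open>1 / t\<close>, are limits of the same
  arc integrals. The map L takes the evaluation at x and the factor
  \<open>exp (\<omega> * t)\<close> out of the integral.\<close>

lemma dunford_integral_eq:
  assumes t: "0 < t" and r: "0 < r"
  shows "dunford_integral D A \<omega> \<eta> r t x = exp (\<omega> * t) *\<^sub>R S0 t x"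
proof -
  define c where "c = - cos \<eta>"
  have c: "0 < c" using cos_lt_zero_pi[of \<eta>] \<eta> \<eta>_pi by (auto simp: c_def)
  define L where "L = (\<lambda>X :: 'a \<Rightarrow>\<^sub>L 'a. exp (of_real (\<omega> * t)) *\<^sub>C blinfun_apply X x)"
  have L: "clinear_map L" unfolding clinear_map_def L_def
    by (auto simp: scaleC_scaleC mult.commute intro!: bounded_linear_compose[OF scaleC.bounded_linear_right]
        bounded_bilinear.bounded_linear_left[OF bounded_bilinear_blinfun_apply])
  let ?g = "\<lambda>z. exp (of_real t * (of_real \<omega> + z)) *\<^sub>C resolvent D A (of_real \<omega> + z) x"
  have g: "?g z = L (FS t z)" if "z \<in> csector \<eta>" for z
    by (simp add: L_def scaleC_scaleC Q_apply[OF that] distrib_left exp_add mult_ac)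
  have "dunford_integral D A \<omega> \<eta> r t x = \<kappa> *\<^sub>C keyhole_integral \<eta> r ?g"
    by (simp add: dunford_integral_def keyhole_integral_def arc_integral_def Let_def)
  also have "keyhole_integral \<eta> r ?g = keyhole_integral \<eta> r (\<lambda>z. L (FS t z))"
    by (rule keyhole_integral_cong[OF g r \<eta>_nonneg])
  also have "\<dots> = L (keyhole_integral \<eta> (1 / t) (FS t))"
  proof (rule tendsto_unique[OF trivial_limit_at_top_linorder])
    show "(arc_integral \<eta> (\<lambda>z. L (FS t z)) \<longlongrightarrow> L (keyhole_integral \<eta> (1 / t) (FS t))) at_top"
      by (rule arc_integral_tendsto_linear[OF L F_continuous(1) keyhole_limits(1)[OF t]])
    have b: "norm (L (FS t (of_real \<rho> * cis \<phi>))) \<le> (exp (\<omega> * t) * (M / r) * norm x) * exp (- (t * c) * \<rho>)"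
      if \<rho>: "r \<le> \<rho>" and \<phi>: "\<bar>\<phi>\<bar> = \<eta>" for \<rho> \<phi>
    proof -
      have z: "of_real \<rho> * cis \<phi> \<in> csector \<eta>" using \<rho> \<phi> r by (intro csectorI) auto
      have cosphi: "cos \<phi> = - c" using \<phi> unfolding c_def by (metis cos_abs_real minus_minus)
      have "norm (Q (of_real \<rho> * cis \<phi>)) \<le> M / \<rho>" using Q_norm[OF z] \<rho> r by (simp add: norm_mult)
      also have "\<dots> \<le> M / r" using \<rho> r M_pos by (intro divide_left_mono) auto
      finally have "norm (blinfun_apply (Q (of_real \<rho> * cis \<phi>)) x) \<le> M / r * norm x"
        by (meson norm_blinfun mult_right_mono norm_ge_zero order_trans)
      then have "exp (\<omega> * t) * exp (- (t * c) * \<rho>) * norm (blinfun_apply (Q (of_real \<rho> * cis \<phi>)) x)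
          \<le> exp (\<omega> * t) * exp (- (t * c) * \<rho>) * (M / r * norm x)"
        by (intro mult_left_mono) auto
      then show ?thesis by (simp add: L_def norm_scaleC cosphi mult_ac)
    qed
    show "(arc_integral \<eta> (\<lambda>z. L (FS t z)) \<longlongrightarrow> keyhole_integral \<eta> r (\<lambda>z. L (FS t z))) at_top"
      by (rule arc_integral_tendsto_keyhole[OF cdifferentiable_on_linear[OF L FS_cdifferentiable] \<eta>_nonneg r mult_pos_pos[OF t c] b b])
        (use \<eta>_nonneg in auto)
  qed
  also have "\<kappa> *\<^sub>C L (keyhole_integral \<eta> (1 / t) (FS t)) = L (S0 t)"
    using L unfolding clinear_map_def S0_def by metis
  also have "\<dots> = exp (\<omega> * t) *\<^sub>R S0 t x"
    unfolding L_def exp_of_real scaleC_of_real ..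
  finally show ?thesis .
qed

lemma smoothing_semigroup:
  assumes S: "\<And>t x. 0 \<le> t \<Longrightarrow> S t x = (if t = 0 then x else exp (\<omega> * t) *\<^sub>R S0 t x)" and Tm: "0 < Tm"
  shows "\<exists>C. smoothing_semigroup S (\<lambda>t x. A (S t x)) Tm C"
proof -
  define E where "E = exp (\<bar>\<omega>\<bar> * Tm)"
  \<comment> \<open>Up to the factor \<open>exp (\<omega> * t)\<close>, at most E,
    \<open>A (S t x)\<close> is \<open>\<omega> *\<^sub>R S0 t x + V0 t x\<close>, and t times its
    norm is at most \<open>K0 * (\<bar>\<omega>\<bar> * t + 1) * norm x\<close>. The maximum with 1
    covers t = 0, where S is the identity.\<close>
  define C where "C = max 1 (E * K0 * (\<bar>\<omega>\<bar> * Tm + 1))"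
  have K0: "0 \<le> K0" using S0_norm[of 1] norm_ge_zero order_trans zero_less_one by blast
  have E: "exp (\<omega> * t) \<le> E" if "0 \<le> t" "t \<le> Tm" for t
  proof -
    have "\<omega> * t \<le> \<bar>\<omega>\<bar> * t" using that by (intro mult_right_mono) auto
    also have "\<dots> \<le> \<bar>\<omega>\<bar> * Tm" using that by (intro mult_left_mono) auto
    finally show ?thesis by (simp add: E_def)
  qed
  have E0: "0 < E" by (simp add: E_def)
  have V: "A (S t x) = exp (\<omega> * t) *\<^sub>R (\<omega> *\<^sub>R S0 t x + V0 t x)" if "0 < t" for t x
    using domain_scaleC(2)[OF S0_in_domain[OF that], of "of_real (exp (\<omega> * t))" x] A_S0[OF that] that
    by (simp add: S scaleC_of_real del: of_real_exp)
  have add: "S (s + t) x = S s (S t x)" if "0 \<le> s" "0 \<le> t" for s t x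
  proof (cases "s = 0 \<or> t = 0")
    case False
    with that have st: "0 < s" "0 < t" by auto
    have "S0 s (S0 t x) = S0 (s + t) x"
      using arg_cong[OF S0_add[OF st(2,1)], of "\<lambda>Z. blinfun_apply Z x"] by (simp add: add.commute)
    then show ?thesis using st by (simp add: S blinfun.scaleR_right distrib_left exp_add)
  qed (auto simp: S)
  show ?thesis
  proof (rule exI[of _ C], rule smoothing_semigroup.intro)
    show "0 < Tm" "1 \<le> C" using Tm by (auto simp: C_def)
    show "S 0 x = x" for x by (simp add: S)
    show "bounded_linear (S t)" if "0 \<le> t" for t
    proof (cases "t = 0")
      case True
      then have "S t = (\<lambda>x. x)" by (auto simp: S)
      then show ?thesis by (simp add: bounded_linear_ident)
    next
      case False
      then have "S t = (\<lambda>x. exp (\<omega> * t) *\<^sub>R S0 t x)" using that by (auto simp: S)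
      then show ?thesis using bounded_linear_compose[OF bounded_linear_scaleR_right blinfun.bounded_linear_right] by simp
    qed
    show "S t (c *\<^sub>C x) = c *\<^sub>C S t x" if "0 \<le> t" for t c x
      using that by (auto simp: S S0_scaleC scaleC.scaleR_right)
    show "norm (S t x) \<le> C * norm x" if "0 \<le> t" "t \<le> Tm" for t x
    proof (cases "t = 0")
      case True
      then show ?thesis using mult_right_mono[of 1 C "norm x"] by (simp add: S C_def)
    next
      case False
      with that have t: "0 < t" by simp
      have "norm (S t x) = exp (\<omega> * t) * norm (S0 t x)" using t by (simp add: S)
      also have "\<dots> \<le> E * (K0 * norm x)"
        using S0_norm[OF t] E0
        by (intro mult_mono E that) (auto intro: order_trans[OF norm_blinfun mult_right_mono])
      also have "\<dots> = E * K0 * 1 * norm x" by simp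
      also have "\<dots> \<le> C * norm x"
      proof (rule mult_right_mono)
        have "E * K0 * 1 \<le> E * K0 * (\<bar>\<omega>\<bar> * Tm + 1)" using K0 E0 Tm by (intro mult_left_mono) auto
        then show "E * K0 * 1 \<le> C" by (simp add: C_def)
      qed simp
      finally show ?thesis .
    qed
    show "bounded_linear (\<lambda>x. A (S t x))" if "0 < t" for t
      unfolding V[OF that]
      by (intro bounded_linear_compose[OF bounded_linear_scaleR_right] bounded_linear_add blinfun.bounded_linear_right)
    show "norm (A (S t x)) \<le> C / t * norm x" if "0 < t" "t \<le> Tm" for t x
    proof -
      have b: "norm (S0 t x) \<le> K0 * norm x" "norm (V0 t x) \<le> K0 / t * norm x"
        by (rule order_trans[OF norm_blinfun mult_right_mono[OF S0_norm[OF that(1)] norm_ge_zero]],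
            rule order_trans[OF norm_blinfun mult_right_mono[OF V0_norm[OF that(1)] norm_ge_zero]])
      have "norm (\<omega> *\<^sub>R S0 t x + V0 t x) \<le> \<bar>\<omega>\<bar> * norm (S0 t x) + norm (V0 t x)"
        by (rule order_trans[OF norm_triangle_ineq]) simp
      also have "\<dots> \<le> \<bar>\<omega>\<bar> * (K0 * norm x) + K0 / t * norm x"
        by (intro add_mono mult_left_mono b) auto
      also have "\<dots> = K0 * (\<bar>\<omega>\<bar> * t + 1) / t * norm x" using that by (simp add: field_simps)
      also have "\<dots> \<le> K0 * (\<bar>\<omega>\<bar> * Tm + 1) / t * norm x"
        using that K0 by (intro mult_right_mono divide_right_mono mult_left_mono add_mono) auto
      finally have n: "norm (\<omega> *\<^sub>R S0 t x + V0 t x) \<le> K0 * (\<bar>\<omega>\<bar> * Tm + 1) / t * norm x" .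
      have "norm (A (S t x)) = exp (\<omega> * t) * norm (\<omega> *\<^sub>R S0 t x + V0 t x)"
        unfolding V[OF that(1)] by simp
      also have "\<dots> \<le> E * (K0 * (\<bar>\<omega>\<bar> * Tm + 1) / t * norm x)"
        using that E0 by (intro mult_mono E n) auto
      also have "\<dots> = (E * K0 * (\<bar>\<omega>\<bar> * Tm + 1)) / t * norm x" by simp
      also have "\<dots> \<le> C / t * norm x"
        using that by (intro mult_right_mono divide_right_mono) (auto simp: C_def)
      finally show ?thesis .
    qed
    show "S (s + t) x = S s (S t x)" if "0 \<le> s" "0 \<le> t" for s t x using add[OF that] .
    show "A (S s (S t x)) = A (S (s + t) x)" if "0 < s" "0 \<le> t" for s t x
      using add[of s t x] that by simp
    show "S s (A (S t x)) = A (S (s + t) x)" if "0 \<le> s" "0 < t" for s t x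
    proof (cases "s = 0")
      case False
      with that have s: "0 < s" by simp
      have "S0 s (S0 t x) = S0 (s + t) x"
        using arg_cong[OF S0_add[OF that(2) s], of "\<lambda>Z. blinfun_apply Z x"] by (simp add: add.commute)
      then show ?thesis
        unfolding V[OF that(2)] V[OF add_pos_pos[OF s that(2)]]
        using s by (simp add: S blinfun.scaleR_right blinfun.add_right S0_V0[OF s that(2)] distrib_left exp_add scaleR_add_right mult_ac)
    qed (simp add: S)
    show "((\<lambda>t. S t x) has_vector_derivative A (S t x)) (at t)" if t: "0 < t" for t x
    proof -
      have "((\<lambda>t. S0 t x) has_vector_derivative V0 t x) (at t)"
        by (rule bounded_linear.has_vector_derivative[OF blinfun.bounded_linear_left S0_has_derivative[OF t]])
      moreover have "((\<lambda>t. exp (\<omega> * t)) has_real_derivative \<omega> * exp (\<omega> * t)) (at t)"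
        by (auto intro!: derivative_eq_intros)
      ultimately have "((\<lambda>t. exp (\<omega> * t) *\<^sub>R S0 t x) has_vector_derivative
          exp (\<omega> * t) *\<^sub>R V0 t x + (\<omega> * exp (\<omega> * t)) *\<^sub>R S0 t x) (at t)"
        by (intro has_vector_derivative_scaleR)
      then have "((\<lambda>t. exp (\<omega> * t) *\<^sub>R S0 t x) has_vector_derivative A (S t x)) (at t)"
        unfolding V[OF t] by (simp add: scaleR_add_right mult.commute add.commute)
      then show ?thesis
        by (rule has_vector_derivative_transform_within[OF _ t]) (auto simp: S dist_real_def)
    qed
  qed
qed

end

text \<open>The triple selected by \<open>SOME\<close> is unknown, but every admissible triple
  defines a \<open>sectorial_operator\<close>, and the midpoint angle between pi / 2 and
  \<open>\<theta>\<close> shows that one exists.\<close>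

lemma sectorial_smoothing_semigroup:
  assumes "sectorial UNIV norm D A" and Tm: "0 < Tm"
  shows "\<exists>C. smoothing_semigroup (analytic_semigroup D A) (\<lambda>t x. A (analytic_semigroup D A t x)) Tm C"
proof -
  let ?P = "\<lambda>(\<omega>, \<eta>, r :: real). 0 < r \<and> pi / 2 < \<eta> \<and> (\<exists>\<theta> M. \<eta> < \<theta> \<and> sectorial_with UNIV norm D A \<omega> \<theta> M)"
  obtain \<omega> \<theta> M where "sectorial_with UNIV norm D A \<omega> \<theta> M"
    using assms unfolding sectorial_def by blast
  moreover from this have "pi / 2 < \<theta>" by (simp add: sectorial_with_def)
  ultimately have "pi / 2 < (pi / 2 + \<theta>) / 2" "(pi / 2 + \<theta>) / 2 < \<theta>" "sectorial_with UNIV norm D A \<omega> \<theta> M"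
    by auto
  then have "?P (\<omega>, (pi / 2 + \<theta>) / 2, 1 :: real)" unfolding prod.case by (intro conjI zero_less_one) blast+
  then have "?P (Eps ?P)" by (rule someI[of ?P])
  moreover obtain \<omega> \<eta> r where eps: "Eps ?P = (\<omega>, \<eta>, r)" by (cases "Eps ?P") auto
  ultimately obtain \<theta> M where P: "0 < r" "pi / 2 < \<eta>" "\<eta> < \<theta>" "sectorial_with UNIV norm D A \<omega> \<theta> M" by auto
  interpret sectorial_operator D A \<omega> \<theta> M \<eta>
    by unfold_locales (use P assms in \<open>auto simp: sectorial_def\<close>)
  have "analytic_semigroup D A t x = (if t = 0 then x else exp (\<omega> * t) *\<^sub>R S0 t x)" if "0 \<le> t" for t x
    using dunford_integral_eq[of t r x] that P(1) unfolding analytic_semigroup_def eps by simp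
  from smoothing_semigroup[OF this Tm] show ?thesis .
qed

section \<open>Estimates for smoothing semigroups\<close>

text \<open>A ratio below 1 grows when its exponent drops from 1 to q. One bound thus provides the
  profile for all exponents at once.\<close>

lemma ratio_le_powr:
  fixes s t q :: real
  assumes "0 < s" "0 < t" "0 \<le> q" "q \<le> 1"
  shows "t / (s + t) \<le> (t / s) powr q"
proof -
  have "t / (s + t) = (t / (s + t)) powr 1" using assms by simp
  also have "\<dots> \<le> (t / (s + t)) powr q" using assms by (intro powr_mono') auto
  also have "\<dots> \<le> (t / s) powr q" using assms by (intro powr_mono2) (auto intro!: divide_left_mono)
  finally show ?thesis .
qed

lemma powr_add_le_one_add:
  fixes x q :: real
  assumes "0 \<le> x" "0 < q" "q \<le> 1"
  shows "(1 + x) powr q \<le> 1 + x powr q"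
proof (cases "x = 0")
  case False
  with assms have x: "0 < x" by simp
  have "(1 + x) powr q = (1 + x) powr (q - 1) + x * (1 + x) powr (q - 1)"
    using x powr_add[of "1 + x" "q - 1" 1] by (simp add: algebra_simps)
  also have "\<dots> \<le> 1 + x * x powr (q - 1)"
  proof (intro add_mono mult_left_mono)
    show "(1 + x) powr (q - 1) \<le> 1" using powr_mono2'[of "q - 1" 1 "1 + x"] x assms by simp
    show "(1 + x) powr (q - 1) \<le> x powr (q - 1)" using x assms by (intro powr_mono2') auto
  qed (use x in simp)
  also have "x * x powr (q - 1) = x powr q" using x powr_add[of x "q - 1" 1] by (simp add: mult.commute)
  finally show ?thesis .
qed (use assms in simp)

text \<open>The logarithm equals \<open>ln ((1 + x) powr q) / q\<close>, and
  \<open>ln y \<le> y - 1\<close>. The price of an arbitrarily small power is the factor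
  \<open>1 / q\<close>.\<close>

lemma ln_one_add_le_powr:
  fixes x q :: real
  assumes "0 \<le> x" "0 < q" "q \<le> 1"
  shows "ln (1 + x) \<le> x powr q / q"
proof -
  have "q * ln (1 + x) = ln ((1 + x) powr q)" using assms by (simp add: ln_powr)
  also have "\<dots> \<le> (1 + x) powr q - 1" using assms by (intro ln_le_minus_one) simp
  also have "\<dots> \<le> x powr q" using powr_add_le_one_add[OF assms] by simp
  finally show ?thesis using assms by (simp add: field_simps)
qed

lemma powr_diff_le:
  fixes a b q :: real
  assumes "0 < a" "a \<le> b" "0 < q" "q \<le> 1"
  shows "b powr q - a powr q \<le> (b - a) powr q"
proof -
  have "b powr q = a powr q * (1 + (b - a) / a) powr q"
    using assms by (subst powr_mult[symmetric]) (auto simp: field_simps)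
  also have "\<dots> \<le> a powr q * (1 + ((b - a) / a) powr q)"
    using assms by (intro mult_left_mono powr_add_le_one_add) auto
  also have "\<dots> = a powr q + (b - a) powr q"
    using assms by (simp add: powr_divide field_simps)
  finally show ?thesis by simp
qed

text \<open>Singular majorants such as \<open>(s - \<xi>) powr (q - 1)\<close> take the default
  value 0 at the singularity, so the pointwise bound can fail there; finitely many points do not
  affect the integrals.\<close>

lemma norm_integral_le_except_finite:
  fixes f :: "real \<Rightarrow> 'a::banach"
  assumes f: "f integrable_on T" and g: "(g has_integral J) T" and F: "finite F"
    and le: "\<And>x. x \<in> T \<Longrightarrow> x \<notin> F \<Longrightarrow> norm (f x) \<le> g x"
  shows "norm (integral T f) \<le> J"
proof -
  let ?f = "\<lambda>x. if x \<in> F then 0 else f x" and ?g = "\<lambda>x. if x \<in> F then 0 else g x"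
  have "(?f has_integral integral T f) T"
    by (rule has_integral_spike_finite[OF F _ integrable_integral[OF f]]) simp
  moreover have "(?g has_integral J) T"
    by (rule has_integral_spike_finite[OF F _ g]) simp
  ultimately show ?thesis
    using integral_norm_bound_integral[of ?f T ?g] le by (auto simp: has_integral_iff)
qed

lemma has_integral_inverse_affine:
  fixes \<sigma> \<delta> a b :: real
  assumes "0 < \<sigma>" "0 < \<delta>" "a \<le> b"
  shows "((\<lambda>\<xi>. 1 / (\<sigma> + (b - \<xi>) * \<delta>)) has_integral (ln (1 + \<delta> * (b - a) / \<sigma>) / \<delta>)) {a..b}"
proof -
  have pos: "0 < \<sigma> + (b - \<xi>) * \<delta>" if "\<xi> \<le> b" for \<xi>
    using assms that by (intro add_pos_nonneg mult_nonneg_nonneg) auto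
  have "((\<lambda>\<xi>. - ln (\<sigma> + (b - \<xi>) * \<delta>) / \<delta>) has_real_derivative 1 / (\<sigma> + (b - \<xi>) * \<delta>)) (at \<xi> within {a..b})"
    if "\<xi> \<in> {a..b}" for \<xi>
    using assms pos[of \<xi>] that by (auto intro!: derivative_eq_intros)
  then have "((\<lambda>\<xi>. 1 / (\<sigma> + (b - \<xi>) * \<delta>)) has_integral
      (- ln (\<sigma> + (b - b) * \<delta>) / \<delta> - - ln (\<sigma> + (b - a) * \<delta>) / \<delta>)) {a..b}"
    by (intro fundamental_theorem_of_calculus assms)
      (simp_all add: has_real_derivative_iff_has_vector_derivative[symmetric])
  moreover have "ln (1 + \<delta> * (b - a) / \<sigma>) = ln (\<sigma> + (b - a) * \<delta>) - ln \<sigma>"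
  proof -
    have "1 + \<delta> * (b - a) / \<sigma> = (\<sigma> + (b - a) * \<delta>) / \<sigma>" using assms by (simp add: field_simps)
    then show ?thesis using assms pos[of a] by (simp add: ln_div)
  qed
  ultimately show ?thesis by (simp add: diff_divide_distrib)
qed

lemma has_integral_powr_reflected:
  fixes s q :: real
  assumes "0 \<le> s" "0 < q"
  shows "((\<lambda>\<xi>. (s - \<xi>) powr (q - 1)) has_integral (s powr q / q)) {0..s}"
proof -
  have "((\<lambda>\<xi>. - ((s - \<xi>) powr q / q)) has_vector_derivative (s - \<xi>) powr (q - 1)) (at \<xi>)" if "\<xi> \<in> {0<..<s}" for \<xi>
    unfolding has_real_derivative_iff_has_vector_derivative[symmetric]
    using that assms by (auto intro!: derivative_eq_intros)
  moreover have "continuous_on {0..s} (\<lambda>\<xi>. - ((s - \<xi>) powr q / q))"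
    using assms by (intro continuous_intros continuous_on_powr') auto
  ultimately have "((\<lambda>\<xi>. (s - \<xi>) powr (q - 1)) has_integral (- ((s - s) powr q / q) - - ((s - 0) powr q / q))) {0..s}"
    by (intro fundamental_theorem_of_calculus_interior assms)
  then show ?thesis by simp
qed

lemma has_integral_powr_shifted:
  fixes s q \<sigma> :: real
  assumes "0 \<le> s" "0 < q" "0 < \<sigma>"
  shows "((\<lambda>\<xi>. (\<sigma> + s - \<xi>) powr (- q - 1)) has_integral ((\<sigma> powr - q - (\<sigma> + s) powr - q) / q)) {0..s}"
proof -
  have "((\<lambda>\<xi>. (\<sigma> + s - \<xi>) powr - q / q) has_vector_derivative (\<sigma> + s - \<xi>) powr (- q - 1)) (at \<xi> within {0..s})"
    if "\<xi> \<in> {0..s}" for \<xi>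
    unfolding has_real_derivative_iff_has_vector_derivative[symmetric]
    using that assms by (auto intro!: derivative_eq_intros simp: algebra_simps)
  then have "((\<lambda>\<xi>. (\<sigma> + s - \<xi>) powr (- q - 1)) has_integral ((\<sigma> + s - s) powr - q / q - (\<sigma> + s - 0) powr - q / q)) {0..s}"
    by (intro fundamental_theorem_of_calculus assms)
  then show ?thesis by (simp add: diff_divide_distrib)
qed

text \<open>Meant for \<open>S (b - \<xi>) x\<close> as a function of \<open>\<xi>\<close>, which
  need not have a limit at b. The primitive is Lipschitz and so extends continuously to b, and the
  fundamental theorem asks for derivatives in the interior only.\<close>

lemma integrable_continuous_bounded:
  fixes f :: "real \<Rightarrow> 'a::banach"
  assumes cont: "continuous_on {a..<b} f" and bound: "\<And>x. x \<in> {a..<b} \<Longrightarrow> norm (f x) \<le> B"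
  shows "f integrable_on {a..b}"
proof (cases "a < b")
  case True
  define F where "F = (\<lambda>x. integral {a..x} f)"
  have int: "f integrable_on {c..d}" if "a \<le> c" "d < b" for c d
    by (intro integrable_continuous_interval continuous_on_subset[OF cont]) (use that in auto)
  have B: "0 \<le> B" using order_trans[OF norm_ge_zero bound[of a]] True by simp
  have F_diff: "norm (F y - F x) \<le> B * (y - x)" if "a \<le> x" "x \<le> y" "y < b" for x y
  proof -
    have "F y - F x = integral {x..y} f"
      using Henstock_Kurzweil_Integration.integral_combine[of a x y f] int[of a y] that
      by (simp add: F_def algebra_simps)
    also have "norm \<dots> \<le> integral {x..y} (\<lambda>_. B)"
      by (rule integral_norm_bound_integral) (use int that bound in auto)
    finally show ?thesis using that by (simp add: mult.commute)
  qed
  have F_lip: "norm (F y - F x) \<le> B * \<bar>y - x\<bar>" if "x \<in> {a..<b}" "y \<in> {a..<b}" for x y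
    using F_diff[of x y] F_diff[of y x] that by (cases "x \<le> y") (auto simp: norm_minus_commute)
  have "uniformly_continuous_on {a..<b} F"
    by (rule lipschitz_on_uniformly_continuous[where L = B], rule lipschitz_onI)
      (use F_lip B in \<open>auto simp: dist_norm abs_minus_commute norm_minus_commute\<close>)
  moreover have "b \<in> closure {a..<b}" using True by simp
  ultimately obtain L where L: "(F \<longlongrightarrow> L) (at b within {a..<b})"
    by (rule uniformly_continuous_on_extension_at_closure)
  define G where "G = (\<lambda>x. if x < b then F x else L)"
  have "continuous_on {a..b} G"
    unfolding continuous_on_def
  proof
    fix x assume x: "x \<in> {a..b}"
    show "(G \<longlongrightarrow> G x) (at x within {a..b})"
    proof (cases "x < b")
      case True
      have "continuous_on {a..<b} F" using \<open>uniformly_continuous_on {a..<b} F\<close>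
        by (rule uniformly_continuous_imp_continuous)
      then have "(F \<longlongrightarrow> F x) (at x within {a..<b})" using x True by (auto simp: continuous_on_def)
      moreover have "at x within {a..<b} = at x within {a..b}"
        by (rule at_within_nhd[of _ "{..<b}"]) (use True in auto)
      ultimately have "(F \<longlongrightarrow> G x) (at x within {a..b})" using True by (simp add: G_def)
      then show ?thesis
        by (rule Lim_transform_eventually)
          (use True in \<open>auto simp: G_def eventually_at dist_real_def intro!: exI[of _ "b - x"]\<close>)
    next
      case False
      with x have xb: "x = b" by auto
      have "at b within {a..b} = at b within {a..<b}"
        by (rule at_within_nhd[of _ UNIV]) auto
      moreover have "(G \<longlongrightarrow> L) (at b within {a..<b})"
        by (rule Lim_transform_eventually[OF L]) (auto simp: G_def eventually_at_filter)
      ultimately show ?thesis unfolding xb by (simp add: G_def)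
    qed
  qed
  moreover have "(G has_vector_derivative f x) (at x)" if x: "x \<in> {a<..<b}" for x
  proof -
    obtain c where c: "x < c" "c < b" using x dense by (metis greaterThanLessThan_iff)
    have "((\<lambda>u. integral {a..u} f) has_vector_derivative f x) (at x within {a..c})"
      by (rule integral_has_vector_derivative[OF continuous_on_subset[OF cont]]) (use x c in auto)
    then have "(F has_vector_derivative f x) (at x)"
      unfolding F_def using x c by (subst (asm) at_within_interior) auto
    then show ?thesis
      by (rule has_vector_derivative_transform_within[of _ _ _ _ "b - x"])
        (use x in \<open>auto simp: G_def dist_real_def\<close>)
  qed
  ultimately have "(f has_integral (G b - G a)) {a..b}"
    using True by (intro fundamental_theorem_of_calculus_interior) auto
  then show ?thesis by (rule has_integral_integrable)
next
  case False
  then have "{a..b} = {} \<or> {a..b} = {a}" by auto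
  then show ?thesis by (metis integrable_on_empty integrable_on_refl box_real(2) cbox_idem)
qed

section \<open>Increments of the semigroup and of its derivative\<close>

context smoothing_semigroup
begin

lemma S_plus: "0 \<le> t \<Longrightarrow> S t (x + y) = S t x + S t y"
  and S_minus: "0 \<le> t \<Longrightarrow> S t (x - y) = S t x - S t y"
  and S_scaleR: "0 \<le> t \<Longrightarrow> S t (r *\<^sub>R x) = r *\<^sub>R S t x"
  and S_sum: "0 \<le> t \<Longrightarrow> S t (sum h I) = (\<Sum>i\<in>I. S t (h i))"
  using S_bounded_linear[of t]
  by (auto simp: linear_simps linear_sum bounded_linear.linear)

lemma V_minus: "0 < t \<Longrightarrow> V t (x - y) = V t x - V t y"
  and V_scaleR: "0 < t \<Longrightarrow> V t (r *\<^sub>R x) = r *\<^sub>R V t x"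
  using V_bounded_linear[of t] by (auto simp: linear_simps)

lemma C_pos: "0 < C" and C_nonneg: "0 \<le> C"
  using C by auto

lemma S_continuous_on: "continuous_on {0<..} (\<lambda>t. S t x)"
  by (intro continuous_at_imp_continuous_on ballI has_vector_derivative_continuous[OF S_derivative]) auto

text \<open>Near t the family is the fixed bounded operator \<open>V (t / 2)\<close> after
  \<open>S (s - t / 2)\<close>, whose time stays positive; continuity is inherited from S.\<close>

lemma V_continuous_on: "continuous_on {0<..} (\<lambda>t. V t x)"
proof (intro continuous_at_imp_continuous_on ballI)
  fix t :: real assume "t \<in> {0<..}"
  then have t: "0 < t" by simp
  have "isCont (\<lambda>s. S s x) (t - t / 2)"
    using has_vector_derivative_continuous[OF S_derivative[of "t / 2" x]] t by simp
  moreover have "isCont (\<lambda>s. s - t / 2) t" by (intro continuous_intros)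
  ultimately have "isCont (\<lambda>s. S (s - t / 2) x) t"
    using isCont_o2[of t "\<lambda>s. s - t / 2" "\<lambda>s. S s x"] by simp
  then have "isCont (\<lambda>s. V (t / 2) (S (s - t / 2) x)) t"
    using bounded_linear.isCont[OF V_bounded_linear[of "t / 2"]] t by simp
  then show "isCont (\<lambda>s. V s x) t"
  proof (rule continuous_transform_within[where \<delta> = "t / 2"])
    show "V (t / 2) (S (s - t / 2) x) = V s x" if "dist s t < t / 2" for s
    proof -
      have "0 \<le> s - t / 2" using that unfolding dist_real_def by linarith
      then show ?thesis using V_S[of "t / 2" "s - t / 2" x] t by simp
    qed
  qed (use t in auto)
qed

lemma S_diff_general:
  assumes "0 < a" "a < b"
    and "\<And>s. s \<in> {a..b} \<Longrightarrow> (\<phi> has_real_derivative \<phi>' s) (at s)"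
    and "\<And>s. a < s \<Longrightarrow> s < b \<Longrightarrow> norm (V s x) \<le> \<phi>' s"
  shows "norm (S b x - S a x) \<le> \<phi> b - \<phi> a"
proof (rule differentiable_bound_general[where f' = "\<lambda>s. V s x" and \<phi>' = \<phi>'])
  show "continuous_on {a..b} (\<lambda>t. S t x)"
    by (rule continuous_on_subset[OF S_continuous_on]) (use assms in auto)
  show "continuous_on {a..b} \<phi>"
    using assms(3) by (intro continuous_at_imp_continuous_on ballI) (auto intro: DERIV_isCont)
  show "(\<phi> has_vector_derivative \<phi>' s) (at s)" if "a < s" "s < b" for s
    using assms(3)[of s] that by (simp add: has_real_derivative_iff_has_vector_derivative)
qed (use assms S_derivative in auto)

lemma S_diff_const:
  assumes "0 < a" "a \<le> b" "\<And>s. s \<in> {a..b} \<Longrightarrow> norm (V s x) \<le> B"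
  shows "norm (S b x - S a x) \<le> B * (b - a)"
proof (cases "a = b")
  case False
  then have "norm (S b x - S a x) \<le> B * b - B * a"
    by (intro S_diff_general[where \<phi>' = "\<lambda>_. B"]) (use assms in \<open>auto intro!: derivative_eq_intros\<close>)
  then show ?thesis by (simp add: algebra_simps)
qed simp

lemma S_diff:
  assumes "0 < a" "a \<le> b" "b \<le> Tm"
  shows "norm (S b x - S a x) \<le> C * norm x * (b - a) / a"
proof -
  have "norm (V s x) \<le> C / a * norm x" if "s \<in> {a..b}" for s
  proof -
    have "norm (V s x) \<le> C / s * norm x" using that assms by (intro V_norm) auto
    also have "\<dots> \<le> C / a * norm x"
      using that assms C_pos by (intro mult_right_mono divide_left_mono) auto
    finally show ?thesis .
  qed
  from S_diff_const[OF assms(1,2) this] show ?thesis by (simp add: mult_ac)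
qed

text \<open>Half of the time a is spent on the bound of V, the other half on the increment of S; the
  two halvings give the factor 4.\<close>

lemma V_diff:
  assumes "0 < a" "a \<le> b" "b \<le> Tm"
  shows "norm (V b x - V a x) \<le> 4 * C\<^sup>2 * norm x * (b - a) / a\<^sup>2"
proof -
  have "V b x - V a x = V (a / 2) (S (b - a / 2) x - S (a / 2) x)"
    using assms by (simp add: V_minus V_S)
  also have "norm \<dots> \<le> C / (a / 2) * norm (S (b - a / 2) x - S (a / 2) x)"
    using assms by (intro V_norm) auto
  also have "\<dots> \<le> C / (a / 2) * (C * norm x * (b - a / 2 - a / 2) / (a / 2))"
    using assms C_pos by (intro mult_left_mono S_diff) auto
  also have "\<dots> = 4 * C\<^sup>2 * norm x * (b - a) / a\<^sup>2"
    using assms by (simp add: power2_eq_square)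
  finally show ?thesis .
qed

text \<open>Interpolation in y = (b - a) / a: up to constants the increment bound is y / a and the
  trivial bound 1 / a. The first is used for y \<le> 1, the second otherwise;
  \<open>1 \<le> C\<close> lets \<open>C\<^sup>2\<close> serve both.\<close>

lemma V_diff_min:
  assumes "0 < a" "a \<le> b" "b \<le> Tm" "0 \<le> q" "q \<le> 1"
  shows "norm (V b x - V a x) \<le> 4 * C\<^sup>2 * norm x * (b - a) powr q * a powr (- q - 1)"
proof -
  define y where "y = (b - a) / a"
  have y: "0 \<le> y" using assms by (simp add: y_def)
  have C1: "C \<le> C\<^sup>2" using C by (simp add: power2_eq_square)
  have "norm (V b x - V a x) \<le> 4 * C\<^sup>2 * norm x / a * y powr q"
  proof (cases "y \<le> 1")
    case True
    have "norm (V b x - V a x) \<le> 4 * C\<^sup>2 * norm x / a * y"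
      using V_diff[OF assms(1-3)] by (simp add: y_def power2_eq_square)
    also have "\<dots> \<le> 4 * C\<^sup>2 * norm x / a * y powr q"
      using powr_mono'[of q 1 y] True y assms by (intro mult_left_mono) auto
    finally show ?thesis .
  next
    case False
    have "norm (V b x - V a x) \<le> C / b * norm x + C / a * norm x"
      by (rule order_trans[OF norm_triangle_ineq4 add_mono[OF V_norm V_norm]]) (use assms in auto)
    also have "\<dots> \<le> C / a * norm x + C / a * norm x"
      using assms C_pos by (intro add_mono mult_right_mono divide_left_mono) auto
    also have "\<dots> = 2 * C * norm x / a" by simp
    also have "\<dots> \<le> 4 * C\<^sup>2 * norm x / a"
      using C1 C_pos assms by (intro divide_right_mono mult_right_mono mult_mono) auto
    also have "\<dots> = 4 * C\<^sup>2 * norm x / a * 1" by simp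
    also have "\<dots> \<le> 4 * C\<^sup>2 * norm x / a * y powr q"
      using False assms by (intro mult_left_mono ge_one_powr_ge_zero) auto
    finally show ?thesis .
  qed
  also have "\<dots> = 4 * C\<^sup>2 * norm x * (b - a) powr q * a powr (- q - 1)"
    using assms by (simp add: y_def powr_divide powr_diff powr_minus divide_simps)
  finally show ?thesis .
qed

text \<open>The affine time covers both scalings in use: \<open>\<delta> = 1\<close> on a time
  interval, and a step size \<open>\<delta>\<close> on the unit interval of the phi functions. The
  shift c is the time of a semigroup operator in front.\<close>

lemma integrable_S:
  assumes "0 < \<delta>" "0 \<le> c" "c + \<delta> * (b - a) \<le> Tm" and w: "continuous_on {a..b} w"
  shows "(\<lambda>\<xi>. w \<xi> *\<^sub>R S (c + (b - \<xi>) * \<delta>) x) integrable_on {a..b}"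
proof -
  obtain W where W: "\<And>\<xi>. \<xi> \<in> {a..b} \<Longrightarrow> norm (w \<xi>) \<le> W"
    using compact_continuous_image[OF w compact_Icc] bounded_iff compact_imp_bounded by (metis image_eqI)
  show ?thesis
  proof (rule integrable_continuous_bounded)
    show "continuous_on {a..<b} (\<lambda>\<xi>. w \<xi> *\<^sub>R S (c + (b - \<xi>) * \<delta>) x)"
      by (intro continuous_on_scaleR continuous_on_subset[OF w] continuous_on_compose2[OF S_continuous_on] continuous_intros)
        (use assms in \<open>auto intro!: add_nonneg_pos\<close>)
    fix \<xi> assume \<xi>: "\<xi> \<in> {a..<b}"
    have "(b - \<xi>) * \<delta> \<le> \<delta> * (b - a)" using \<xi> assms by (subst mult.commute) (intro mult_left_mono, auto)
    then have "c + (b - \<xi>) * \<delta> \<le> Tm" "0 \<le> c + (b - \<xi>) * \<delta>" using \<xi> assms(1-3) by (linarith, simp)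
    then have "norm (S (c + (b - \<xi>) * \<delta>) x) \<le> C * norm x" by (intro S_norm)
    then show "norm (w \<xi> *\<^sub>R S (c + (b - \<xi>) * \<delta>) x) \<le> W * (C * norm x)"
      unfolding norm_scaleR using W[of \<xi>] \<xi> by (intro mult_mono) (auto intro: order_trans[OF abs_ge_zero])
  qed
qed

end

section \<open>Intermediate spaces\<close>

text \<open>The hypotheses of \<open>embed\<close> put \<open>y\<close> into \<open>interp_space D A \<alpha> 1\<close>; of the two
  embeddings of an intermediate space, the estimates in the norm \<open>nY\<close> need only this one.\<close>

locale intermediate_scale = smoothing_semigroup S V Tm C
  for S V :: "real \<Rightarrow> 'a::complex_banach \<Rightarrow> 'a" and Tm C :: real +
  fixes \<alpha> :: real and Y :: "'a set" and nY :: "'a \<Rightarrow> real" and CE :: real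
  assumes \<alpha>: "0 \<le> \<alpha>" "\<alpha> < 1" and Tm_ge_1: "1 \<le> Tm" and CE: "0 \<le> CE"
    and Y_add: "y \<in> Y \<Longrightarrow> z \<in> Y \<Longrightarrow> y + z \<in> Y"
    and Y_scaleC: "y \<in> Y \<Longrightarrow> c *\<^sub>C y \<in> Y"
    and nY_nonneg: "y \<in> Y \<Longrightarrow> 0 \<le> nY y"
    and nY_add: "y \<in> Y \<Longrightarrow> z \<in> Y \<Longrightarrow> nY (y + z) \<le> nY y + nY z"
    and nY_scaleC: "y \<in> Y \<Longrightarrow> nY (c *\<^sub>C y) = cmod c * nY y"
    and embed: "0 < d \<Longrightarrow> d \<le> Tm \<Longrightarrow> 0 \<le> K
      \<Longrightarrow> (\<And>\<sigma>. 0 < \<sigma> \<Longrightarrow> \<sigma> < 1 \<Longrightarrow> norm (V \<sigma> y) \<le> K * (d / \<sigma>))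
      \<Longrightarrow> (\<And>\<sigma>. 0 < \<sigma> \<Longrightarrow> \<sigma> < 1 \<Longrightarrow> norm (V \<sigma> y) \<le> K * (d / \<sigma>) powr ((1 - \<alpha>) / 2))
      \<Longrightarrow> y \<in> Y \<and> nY y \<le> CE * (norm y + K * d powr (1 - \<alpha>))"

text \<open>Against the weight \<open>\<sigma> powr - \<alpha>\<close> the profile with exponent 1
  is integrable at infinity but not at 0, the one with exponent q is integrable at 0 since
  \<open>- \<alpha> - q = q - 1\<close>. Changing from one to the other at
  \<open>\<sigma> = d\<close> takes the smaller one throughout and makes the integral scale like
  \<open>d powr (1 - \<alpha>)\<close>.\<close>

lemma integral_min_profile:
  fixes d \<alpha> :: real
  assumes d: "0 < d" and \<alpha>: "0 < \<alpha>" "\<alpha> < 1"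
  defines "q \<equiv> (1 - \<alpha>) / 2"
  defines "h \<equiv> \<lambda>\<sigma>. \<sigma> powr - \<alpha> * (if \<sigma> \<le> d then (d / \<sigma>) powr q else d / \<sigma>)"
  shows "(h has_integral (d powr (1 - \<alpha>) * (1 / q + 1 / \<alpha>))) {0..}"
proof -
  have q: "0 < q" "1 - \<alpha> - q = q" using \<alpha> by (auto simp: q_def field_simps)
  have "((\<lambda>\<sigma>. d powr q * \<sigma> powr (q - 1)) has_integral d powr q * (d powr (q - 1 + 1) / (q - 1 + 1))) {0..d}"
    by (intro has_integral_mult_right has_integral_powr_from_0) (use d q in auto)
  then have "((\<lambda>\<sigma>. d powr q * \<sigma> powr (q - 1)) has_integral d powr (1 - \<alpha>) / q) {0..d}"
    using q by (simp add: powr_add[symmetric])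
  then have 1: "(h has_integral d powr (1 - \<alpha>) / q) {0..d}"
  proof (rule has_integral_spike_finite[of "{0}", rotated 2])
    fix \<sigma> assume "\<sigma> \<in> {0..d} - {0}"
    then have \<sigma>: "0 < \<sigma>" "\<sigma> \<le> d" by auto
    have "h \<sigma> = \<sigma> powr - \<alpha> * (d powr q * \<sigma> powr - q)"
      using \<sigma> d by (simp add: h_def powr_divide powr_minus_divide)
    also have "\<dots> = d powr q * \<sigma> powr (- \<alpha> + - q)" by (simp only: powr_add mult_ac)
    also have "- \<alpha> + - q = q - 1" using q by simp
    finally show "h \<sigma> = d powr q * \<sigma> powr (q - 1)" .
  qed simp
  have "((\<lambda>\<sigma>. d * \<sigma> powr (- \<alpha> - 1)) has_integral d * (- (d powr (- \<alpha> - 1 + 1)) / (- \<alpha> - 1 + 1))) {d..}"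
    by (intro has_integral_mult_right has_integral_powr_to_inf) (use d \<alpha> in auto)
  moreover have "d * (- (d powr (- \<alpha> - 1 + 1)) / (- \<alpha> - 1 + 1)) = d powr (1 - \<alpha>) / \<alpha>"
    using d powr_add[of d 1 "- \<alpha>"] by simp
  ultimately have "((\<lambda>\<sigma>. d * \<sigma> powr (- \<alpha> - 1)) has_integral d powr (1 - \<alpha>) / \<alpha>) {d..}" using \<alpha> by simp
  then have 2: "(h has_integral d powr (1 - \<alpha>) / \<alpha>) {d..}"
  proof (rule has_integral_spike_finite[of "{d}", rotated 2])
    fix \<sigma> assume "\<sigma> \<in> {d..} - {d}"
    then have "d < \<sigma>" by auto
    then show "h \<sigma> = d * \<sigma> powr (- \<alpha> - 1)"
      using d by (simp add: h_def powr_diff)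
  qed simp
  have "{0..d} \<inter> {d..} = {d}" "{0..d} \<union> {d..} = {0..}" using d by auto
  then have "(h has_integral d powr (1 - \<alpha>) / q + d powr (1 - \<alpha>) / \<alpha>) {0..}"
    using has_integral_Un[OF 1 2] by simp
  then show ?thesis by (simp add: distrib_left)
qed

lemma AE_lebesgue_on_ex:
  fixes a b c d :: real
  assumes "AE t in lebesgue_on {a<..<b}. P t" "a \<le> c" "c < d" "d \<le> b"
  shows "\<exists>t\<in>{c<..<d}. P t"
proof (rule ccontr)
  assume *: "\<not> (\<exists>t\<in>{c<..<d}. P t)"
  have "AE t in lebesgue. t \<in> {a<..<b} \<longrightarrow> P t"
    using assms(1) by (simp add: AE_restrict_space_iff)
  from AE_E3[OF this] obtain N where "\<And>t. t \<in> space lebesgue - N \<Longrightarrow> t \<in> {a<..<b} \<longrightarrow> P t"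
    and N: "N \<in> null_sets lebesgue" by blast
  then have N': "{t. \<not> (t \<in> {a<..<b} \<longrightarrow> P t)} \<subseteq> N" by auto
  have "{c<..<d} \<subseteq> N" using * N' assms by (auto simp: subset_eq)
  then have "negligible {c<..<d}"
    using N negligible_subset[of N] by (simp add: negligible_iff_null_sets)
  then show False using open_not_negligible[of "{c<..<d}"] assms by auto
qed

text \<open>For p = 1 the weight exponent is \<open>- \<alpha>\<close>. The two bounds together
  dominate the weighted function by K times the profile of \<open>integral_min_profile\<close>; its
  integral is taken over the whole half line, where it has a closed form.\<close>

lemma (in smoothing_semigroup) interp_space_1:
  fixes D :: "'a set"
  assumes S: "S = analytic_semigroup D A" and V: "\<And>t x. V t x = A (S t x)"
    and \<alpha>: "0 < \<alpha>" "\<alpha> < 1" and d: "0 < d" and K: "0 \<le> K"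
    and le1: "\<And>\<sigma>. 0 < \<sigma> \<Longrightarrow> \<sigma> < 1 \<Longrightarrow> norm (V \<sigma> y) \<le> K * (d / \<sigma>)"
    and leq: "\<And>\<sigma>. 0 < \<sigma> \<Longrightarrow> \<sigma> < 1 \<Longrightarrow> norm (V \<sigma> y) \<le> K * (d / \<sigma>) powr ((1 - \<alpha>) / 2)"
  shows "y \<in> interp_space D A \<alpha> 1"
    and "interp_norm D A \<alpha> 1 y \<le> norm y + K * d powr (1 - \<alpha>) * (2 / (1 - \<alpha>) + 1 / \<alpha>)"
proof -
  define v where "v = interp_fun D A \<alpha> 1 y"
  have v: "v \<sigma> = \<sigma> powr - \<alpha> * norm (V \<sigma> y)" for \<sigma>
    unfolding v_def interp_fun_def V S by simp
  define h where "h = (\<lambda>\<sigma>. \<sigma> powr - \<alpha> * (if \<sigma> \<le> d then (d / \<sigma>) powr ((1 - \<alpha>) / 2) else d / \<sigma>))"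
  have h: "(h has_integral (d powr (1 - \<alpha>) * (2 / (1 - \<alpha>) + 1 / \<alpha>))) {0..}"
    using integral_min_profile[OF d \<alpha>] by (simp add: h_def)
  have h0: "0 \<le> h \<sigma>" if "0 \<le> \<sigma>" for \<sigma> using that d by (simp add: h_def)
  have v0: "0 \<le> v \<sigma>" for \<sigma> by (simp add: v)
  have vh: "v \<sigma> \<le> K * h \<sigma>" if "\<sigma> \<in> {0<..<1}" for \<sigma>
    using le1[of \<sigma>] leq[of \<sigma>] that mult_left_mono[of "norm (V \<sigma> y)" _ "\<sigma> powr - \<alpha>"]
    by (auto simp: v h_def mult.left_commute)
  have meas: "v \<in> borel_measurable (lebesgue_on {0<..<1})"
  proof (rule continuous_imp_measurable_on_sets_lebesgue)
    show "continuous_on {0<..<1} v" unfolding v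
      by (intro continuous_intros continuous_on_subset[OF V_continuous_on]) auto
  qed simp
  have hint: "(\<lambda>\<sigma>. K * h \<sigma>) absolutely_integrable_on {0..}"
    using h h0 K by (intro nonnegative_absolutely_integrable_1) (auto intro: has_integral_mult_right has_integral_integrable)
  then have hint1: "(\<lambda>\<sigma>. K * h \<sigma>) integrable_on {0<..<1}"
    by (intro set_lebesgue_integral_eq_integral(1) set_integrable_subset[OF hint]) auto
  have vabs: "v absolutely_integrable_on {0<..<1}"
    by (rule measurable_bounded_by_integrable_imp_absolutely_integrable[OF meas _ hint1]) (use vh v0 in auto)
  then have vint: "integrable (lebesgue_on {0<..<1}) v"
    by (simp add: integrable_restrict_space set_integrable_def)
  have vabs_eq: "(\<lambda>t. \<bar>v t\<bar> powr enn2real 1) = v" using v0 by (auto simp: fun_eq_iff)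
  show "y \<in> interp_space D A \<alpha> 1"
    unfolding interp_space_def in_Lp01_def using meas vint vabs_eq by (simp add: v_def[symmetric])
  have "integral {0<..<1} v \<le> integral {0..} (\<lambda>\<sigma>. K * h \<sigma>)"
  proof -
    have "integral {0<..<1} v \<le> integral {0<..<1} (\<lambda>\<sigma>. K * h \<sigma>)"
      by (rule integral_le[OF set_lebesgue_integral_eq_integral(1)[OF vabs] hint1 vh])
    also have "\<dots> \<le> integral {0..} (\<lambda>\<sigma>. K * h \<sigma>)"
    proof (rule integral_subset_le[OF _ hint1 set_lebesgue_integral_eq_integral(1)[OF hint]])
      show "\<forall>\<sigma>\<in>{0..}. 0 \<le> K * h \<sigma>" using K h0 by simp
    qed auto
    finally show ?thesis .
  qed
  also have "\<dots> = K * (d powr (1 - \<alpha>) * (2 / (1 - \<alpha>) + 1 / \<alpha>))"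
    by (rule integral_unique[OF has_integral_mult_right[OF h]])
  finally have "(LINT t|lebesgue_on {0<..<1}. v t) \<le> K * d powr (1 - \<alpha>) * (2 / (1 - \<alpha>) + 1 / \<alpha>)"
    using vint by (simp add: lebesgue_integral_eq_integral mult.assoc)
  moreover have "Lp01_norm 1 v = (LINT t|lebesgue_on {0<..<1}. v t)"
    unfolding Lp01_norm_def vabs_eq using v0 by (simp add: integral_nonneg_AE)
  ultimately show "interp_norm D A \<alpha> 1 y \<le> norm y + K * d powr (1 - \<alpha>) * (2 / (1 - \<alpha>) + 1 / \<alpha>)"
    by (simp add: interp_norm_def v_def)
qed

lemma intermediate_scale_ex:
  fixes D :: "'a::complex_banach set"
  assumes sg: "smoothing_semigroup (analytic_semigroup D A) (\<lambda>t x. A (analytic_semigroup D A t x)) Tm C"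
    and \<alpha>: "0 \<le> \<alpha>" "\<alpha> < 1" and Tm1: "1 \<le> Tm" and Y: "intermediate_space D A \<alpha> Y nY"
  shows "\<exists>CE. intermediate_scale (analytic_semigroup D A) (\<lambda>t x. A (analytic_semigroup D A t x)) Tm C \<alpha> Y nY CE"
proof (cases "\<alpha> = 0")
  case True
  then have "Y = UNIV" "nY = norm" using Y by (auto simp: intermediate_space_def)
  then have "intermediate_scale (analytic_semigroup D A) (\<lambda>t x. A (analytic_semigroup D A t x)) Tm C \<alpha> Y nY 1"
    using True Tm1 by (intro intermediate_scale.intro sg intermediate_scale_axioms.intro)
      (auto simp: norm_scaleC norm_triangle_ineq)
  then show ?thesis by blast
next
  case False
  with \<alpha> have \<alpha>0: "0 < \<alpha>" by simp
  interpret smoothing_semigroup "analytic_semigroup D A" "\<lambda>t x. A (analytic_semigroup D A t x)" Tm C by (rule sg)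
  have bn: "banach_norm_on Y nY" using Y False by (simp add: intermediate_space_def)
  obtain K1 where sub: "interp_space D A \<alpha> 1 \<subseteq> Y"
    and K1: "\<And>y. y \<in> interp_space D A \<alpha> 1 \<Longrightarrow> nY y \<le> K1 * interp_norm D A \<alpha> 1 y"
    using Y False unfolding intermediate_space_def continuously_embedded_def by auto
  \<comment> \<open>Since c is at least 1, it may be attached to \<open>norm y\<close> as well,
    which leaves a single constant in \<open>embed\<close>.\<close>
  define c where "c = 2 / (1 - \<alpha>) + 1 / \<alpha>"
  have c: "1 \<le> c" using \<alpha>0 \<alpha> by (simp add: c_def add_increasing2)
  have Kpos: "nY y \<le> max K1 0 * c * (norm y + K * d powr (1 - \<alpha>))"
    if y: "y \<in> interp_space D A \<alpha> 1" and le: "interp_norm D A \<alpha> 1 y \<le> norm y + K * d powr (1 - \<alpha>) * c" and K: "0 \<le> K" for y K d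
  proof -
    have n0: "0 \<le> interp_norm D A \<alpha> 1 y" by (simp add: interp_norm_def Lp01_norm_def)
    \<comment> \<open>An embedding constant may be negative, hence the maximum with 0.\<close>
    have "nY y \<le> max K1 0 * interp_norm D A \<alpha> 1 y"
      using K1[OF y] n0 by (meson max.cobounded1 mult_right_mono order_trans)
    also have "\<dots> \<le> max K1 0 * (norm y * c + K * d powr (1 - \<alpha>) * c)"
    proof (intro mult_left_mono)
      have "norm y \<le> norm y * c" using c by (simp add: mult_le_cancel_left1)
      then show "interp_norm D A \<alpha> 1 y \<le> norm y * c + K * d powr (1 - \<alpha>) * c" using le by linarith
    qed simp
    also have "\<dots> = max K1 0 * c * (norm y + K * d powr (1 - \<alpha>))" by (simp add: algebra_simps)
    finally show ?thesis .
  qed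
  have "intermediate_scale (analytic_semigroup D A) (\<lambda>t x. A (analytic_semigroup D A t x)) Tm C \<alpha> Y nY (max K1 0 * c)"
  proof (intro intermediate_scale.intro sg intermediate_scale_axioms.intro)
    fix d K y
    assume a: "0 < d" "d \<le> Tm" "0 \<le> K"
      "\<And>\<sigma>. 0 < \<sigma> \<Longrightarrow> \<sigma> < 1 \<Longrightarrow> norm (A (analytic_semigroup D A \<sigma> y)) \<le> K * (d / \<sigma>)"
      "\<And>\<sigma>. 0 < \<sigma> \<Longrightarrow> \<sigma> < 1 \<Longrightarrow> norm (A (analytic_semigroup D A \<sigma> y)) \<le> K * (d / \<sigma>) powr ((1 - \<alpha>) / 2)"
    note i = interp_space_1[OF refl refl \<alpha>0 \<alpha>(2) a(1,3,4,5)]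
    show "y \<in> Y \<and> nY y \<le> max K1 0 * c * (norm y + K * d powr (1 - \<alpha>))"
      using Kpos[OF i(1)] i sub a(3) by (auto simp: c_def)
  qed (use \<alpha> Tm1 c bn in \<open>auto simp: banach_norm_on_def complex_subspace_def\<close>)
  then show ?thesis by blast
qed

text \<open>The essential supremum controls \<open>V s x\<close> only for almost every s, and only
  on (0,1). A good s is therefore taken in the upper half of the interval from 0 to
  \<open>min \<sigma> 1\<close>, and \<open>V \<sigma> x = S (\<sigma> - s) (V s x)\<close> carries
  the bound to \<open>\<sigma>\<close>; the factor Tm pays for times beyond 1.\<close>

lemma (in smoothing_semigroup) interp_space_infinity_bound:
  fixes D :: "'a set"
  assumes S: "S = analytic_semigroup D A" and V: "\<And>t x. V t x = A (S t x)" and Tm: "1 \<le> Tm"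
    and \<beta>: "0 \<le> \<beta>" "\<beta> < 1" and x: "x \<in> interp_space D A \<beta> \<infinity>"
  shows "\<exists>K\<ge>0. \<forall>\<sigma>. 0 < \<sigma> \<and> \<sigma> \<le> Tm \<longrightarrow> norm (V \<sigma> x) \<le> K * \<sigma> powr (\<beta> - 1)"
proof -
  define v where "v = interp_fun D A \<beta> \<infinity> x"
  have v: "v \<sigma> = \<sigma> powr (1 - \<beta>) * norm (V \<sigma> x)" for \<sigma>
    unfolding v_def interp_fun_def V S by simp
  have vm: "v \<in> borel_measurable (lebesgue_on {0<..<1})"
    and fin: "esssup (lebesgue_on {0<..<1}) (\<lambda>t. ereal \<bar>v t\<bar>) < \<infinity>"
    using x unfolding interp_space_def in_Lp01_def by (auto simp: v_def)
  obtain K0 :: real where K0: "esssup (lebesgue_on {0<..<1}) (\<lambda>t. ereal \<bar>v t\<bar>) \<le> ereal K0"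
    using fin by (metis less_PInf_Ex_of_nat less_imp_le less_irrefl)
  have "(\<lambda>t. ereal \<bar>v t\<bar>) \<in> borel_measurable (lebesgue_on {0<..<1})" using vm by measurable
  from esssup_AE[of "\<lambda>t. ereal \<bar>v t\<bar>" "lebesgue_on {0<..<1}"]
  have AE: "AE t in lebesgue_on {0<..<1}. v t \<le> max K0 0"
  proof eventually_elim
    case (elim t)
    from order_trans[OF this K0] show ?case by simp
  qed
  show ?thesis
  proof (intro exI[of _ "2 * C * max K0 0 * Tm"] conjI allI impI)
    show "0 \<le> 2 * C * max K0 0 * Tm" using C_pos Tm by auto
    fix \<sigma> assume \<sigma>: "0 < \<sigma> \<and> \<sigma> \<le> Tm"
    define m where "m = min \<sigma> 1"
    have m: "0 < m" "m \<le> \<sigma>" "m \<le> 1" using \<sigma> by (auto simp: m_def)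
    obtain s where s: "m / 2 < s" "s < m" "v s \<le> max K0 0"
      using AE_lebesgue_on_ex[OF AE, of "m / 2" m] m by auto
    have s0: "0 < s" using s m by linarith
    have "norm (V s x) = v s * s powr (\<beta> - 1)"
      using s0 by (simp add: v powr_add[symmetric] mult.assoc mult.left_commute flip: powr_add)
    also have "\<dots> \<le> max K0 0 * (m / 2) powr (\<beta> - 1)"
      using s \<beta> m by (intro mult_mono powr_mono2') (auto simp: v)
    also have "(m / 2) powr (\<beta> - 1) \<le> 2 * (Tm * \<sigma> powr (\<beta> - 1))"
    proof -
      have "(m / 2) powr (\<beta> - 1) = m powr (\<beta> - 1) * 2 powr (1 - \<beta>)"
        using m by (simp add: powr_divide powr_diff field_simps)
      also have "\<dots> \<le> (Tm * \<sigma> powr (\<beta> - 1)) * 2"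
      proof (intro mult_mono)
        show "2 powr (1 - \<beta>) \<le> (2::real)" using powr_mono[of "1 - \<beta>" 1 2] \<beta> by simp
        show "m powr (\<beta> - 1) \<le> Tm * \<sigma> powr (\<beta> - 1)"
        proof (cases "\<sigma> \<le> 1")
          case True
          then show ?thesis using Tm mult_right_mono[of 1 Tm "\<sigma> powr (\<beta> - 1)"] by (simp add: m_def)
        next
          case False
          then have "\<sigma> powr (1 - \<beta>) \<le> \<sigma> powr 1" using \<beta> by (intro powr_mono) auto
          then have "\<sigma> powr (1 - \<beta>) * \<sigma> powr (\<beta> - 1) \<le> Tm * \<sigma> powr (\<beta> - 1)" using \<sigma> by (intro mult_right_mono) auto
          moreover have "\<sigma> powr (1 - \<beta>) * \<sigma> powr (\<beta> - 1) = 1" using \<sigma> by (simp flip: powr_add)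
          ultimately show ?thesis using False by (simp add: m_def)
        qed
      qed (use Tm in auto)
      finally show ?thesis by simp
    qed
    finally have le: "norm (V s x) \<le> max K0 0 * (2 * (Tm * \<sigma> powr (\<beta> - 1)))" by (simp add: mult_left_mono)
    have "V \<sigma> x = S (\<sigma> - s) (V s x)" using s s0 m by (simp add: S_V)
    also have "norm \<dots> \<le> C * norm (V s x)" using s s0 m \<sigma> by (intro S_norm) auto
    also have "\<dots> \<le> C * (max K0 0 * (2 * (Tm * \<sigma> powr (\<beta> - 1))))" using le C_pos by (intro mult_left_mono) auto
    finally show "norm (V \<sigma> x) \<le> 2 * C * max K0 0 * Tm * \<sigma> powr (\<beta> - 1)" by (simp add: mult_ac)
  qed
qed

section \<open>Smoothing estimates in the intermediate norm\<close>

context intermediate_scale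
begin

abbreviation q0 :: real where "q0 \<equiv> (1 - \<alpha>) / 2"

lemma q0: "0 < q0" "q0 \<le> 1"
  using \<alpha> by auto

lemma zero_in_Y: "0 \<in> Y"
proof -
  have "V \<sigma> 0 = 0" if "0 < \<sigma>" for \<sigma>
    using V_scaleR[OF that, of 0 0] by simp
  then show ?thesis using embed[of 1 0 0] Tm_ge_1 by simp
qed

lemma nY_zero: "nY 0 = 0"
  using nY_scaleC[OF zero_in_Y, of 0] by (simp add: scaleC.zero_left)

lemma Y_scaleR: "y \<in> Y \<Longrightarrow> r *\<^sub>R y \<in> Y"
  and nY_scaleR: "y \<in> Y \<Longrightarrow> nY (r *\<^sub>R y) = \<bar>r\<bar> * nY y"
  using Y_scaleC[of y "of_real r"] nY_scaleC[of y "of_real r"] by (simp_all add: scaleC_of_real)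

lemma Y_minus: "y \<in> Y \<Longrightarrow> - y \<in> Y" and nY_minus: "y \<in> Y \<Longrightarrow> nY (- y) = nY y"
  using Y_scaleR[of y "- 1"] nY_scaleR[of y "- 1"] by simp_all

lemma Y_diff: "y \<in> Y \<Longrightarrow> z \<in> Y \<Longrightarrow> y - z \<in> Y"
  and nY_diff: "y \<in> Y \<Longrightarrow> z \<in> Y \<Longrightarrow> nY (y - z) \<le> nY y + nY z"
  using Y_add[of y "- z"] nY_add[of y "- z"] by (simp_all add: Y_minus nY_minus)

lemma Y_sum: "(\<And>i. i \<in> I \<Longrightarrow> h i \<in> Y) \<Longrightarrow> sum h I \<in> Y"
  by (induction I rule: infinite_finite_induct) (auto simp: zero_in_Y Y_add)

lemma nY_sum: "(\<And>i. i \<in> I \<Longrightarrow> h i \<in> Y) \<Longrightarrow> nY (sum h I) \<le> (\<Sum>i\<in>I. nY (h i))"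
proof (induction I rule: infinite_finite_induct)
  case (insert i I)
  then have "nY (h i + sum h I) \<le> nY (h i) + nY (sum h I)"
    by (intro nY_add Y_sum) auto
  with insert show ?case by auto
qed (auto simp: nY_zero)

text \<open>The two hypotheses of \<open>embed\<close> are the cases q = 1 and q = \<open>q0\<close>
  of one estimate, so the applications below carry q as a parameter.\<close>

lemma embed_profile:
  assumes d: "0 < d" "d \<le> Tm" and K: "0 \<le> K"
    and le: "\<And>\<sigma> q. 0 < \<sigma> \<Longrightarrow> \<sigma> < 1 \<Longrightarrow> q0 \<le> q \<Longrightarrow> q \<le> 1 \<Longrightarrow> norm (V \<sigma> y) \<le> K * (d / \<sigma>) powr q"
  shows "y \<in> Y \<and> nY y \<le> CE * (norm y + K * d powr (1 - \<alpha>))"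
proof (rule embed[OF d K])
  show "norm (V \<sigma> y) \<le> K * (d / \<sigma>)" if "0 < \<sigma>" "\<sigma> < 1" for \<sigma>
    using le[of \<sigma> 1] that q0 d by simp
qed (use le q0 in auto)

lemma powr_le_Tm: "0 \<le> t \<Longrightarrow> t \<le> Tm \<Longrightarrow> 0 \<le> a \<Longrightarrow> a \<le> 1 \<Longrightarrow> t powr a \<le> Tm"
  using powr_mono2[of a t Tm] powr_mono[of a 1 Tm] Tm_ge_1 by simp

lemma one_le_powr_neg:
  assumes "0 < t" "t \<le> Tm" "0 \<le> a" "a \<le> 1"
  shows "1 \<le> Tm * t powr - a"
proof -
  have "1 = t powr a * t powr - a" using assms by (simp flip: powr_add)
  also have "\<dots> \<le> Tm * t powr - a" using assms by (intro mult_right_mono powr_le_Tm) auto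
  finally show ?thesis .
qed

definition C1 where "C1 = CE * C * (Tm + 1)"

text \<open>\<open>embed\<close> at the scale d = t: the bound \<open>C / (\<sigma> + t)\<close> for
  V is \<open>C / t\<close> times the ratio \<open>t / (\<sigma> + t)\<close>. The margin in
  \<open>t + 1 \<le> Tm\<close> makes room for \<open>\<sigma>\<close>, which is below 1.\<close>

lemma S_smoothing:
  assumes t: "0 < t" "t + 1 \<le> Tm"
  shows "S t x \<in> Y \<and> nY (S t x) \<le> C1 * t powr - \<alpha> * norm x"
proof -
  have "norm (V \<sigma> (S t x)) \<le> (C * norm x / t) * (t / \<sigma>) powr q"
    if "0 < \<sigma>" "\<sigma> < 1" "q0 \<le> q" "q \<le> 1" for \<sigma> q
  proof -
    have "norm (V \<sigma> (S t x)) \<le> C / (\<sigma> + t) * norm x"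
      using that t by (simp only: V_S) (rule V_norm, auto)
    also have "\<dots> = (C * norm x / t) * (t / (\<sigma> + t))" using t by simp
    also have "\<dots> \<le> (C * norm x / t) * (t / \<sigma>) powr q"
      using that t C_pos q0 by (intro mult_left_mono ratio_le_powr) auto
    finally show ?thesis .
  qed
  from embed_profile[OF t(1) _ _ this]
  have Y: "S t x \<in> Y" and le: "nY (S t x) \<le> CE * (norm (S t x) + C * norm x / t * t powr (1 - \<alpha>))"
    using t C_pos by auto
  have "norm (S t x) \<le> C * norm x * 1" using S_norm[of t x] t by simp
  also have "\<dots> \<le> C * norm x * (Tm * t powr - \<alpha>)"
    using t C_pos \<alpha> by (intro mult_left_mono one_le_powr_neg) auto
  finally have n: "norm (S t x) \<le> C * norm x * (Tm * t powr - \<alpha>)" .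
  have "t powr (1 - \<alpha>) = t * t powr - \<alpha>"
    using t powr_add[of t 1 "- \<alpha>"] by simp
  with n t have "norm (S t x) + C * norm x / t * t powr (1 - \<alpha>) \<le> C * norm x * (Tm * t powr - \<alpha>) + C * norm x * t powr - \<alpha>"
    by simp
  also have "\<dots> = C * (Tm + 1) * t powr - \<alpha> * norm x" by (simp add: algebra_simps)
  finally have "CE * (norm (S t x) + C * norm x / t * t powr (1 - \<alpha>)) \<le> CE * (C * (Tm + 1) * t powr - \<alpha> * norm x)"
    using CE by (rule mult_left_mono)
  with le Y show ?thesis by (simp add: C1_def mult.assoc)
qed

definition C2 where "C2 = CE * C * (Tm + 1 / q0)"

text \<open>The scale is the elapsed time d = \<open>\<delta> * (b - a)\<close>. Moving V inside
  leaves the integral of \<open>1 / (\<sigma> + (b - \<xi>) * \<delta>)\<close>, a logarithm of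
  \<open>1 + d / \<sigma>\<close>, and every admissible power of \<open>d / \<sigma>\<close> absorbs
  it. So the kernel of order 1 is integrated without loss in \<open>d powr (1 - \<alpha>)\<close>.
  The additional time c only decreases the bound for V and is dropped.\<close>

lemma convolution_smoothing:
  assumes \<delta>: "0 < \<delta>" and c: "0 \<le> c" and ab: "a < b" and T: "c + \<delta> * (b - a) + 1 \<le> Tm"
    and int: "(\<lambda>\<xi>. S (c + (b - \<xi>) * \<delta>) (g \<xi>)) integrable_on {a..b}"
    and G: "\<And>\<xi>. \<xi> \<in> {a..b} \<Longrightarrow> norm (g \<xi>) \<le> G"
  defines "y \<equiv> integral {a..b} (\<lambda>\<xi>. S (c + (b - \<xi>) * \<delta>) (g \<xi>))"
  shows "norm y \<le> C * G * (b - a)"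
    and "y \<in> Y" and "nY y \<le> C2 * (G / \<delta>) * (\<delta> * (b - a)) powr (1 - \<alpha>)"
proof -
  have G0: "0 \<le> G" using order_trans[OF norm_ge_zero G[of a]] ab by simp
  define d where "d = \<delta> * (b - a)"
  have d: "0 < d" "d + 1 \<le> Tm" using \<delta> ab T c by (auto simp: d_def)
  have tm: "0 \<le> c + (b - \<xi>) * \<delta>" "c + (b - \<xi>) * \<delta> + 1 \<le> Tm" if "\<xi> \<in> {a..b}" for \<xi>
  proof -
    have "(b - \<xi>) * \<delta> \<le> \<delta> * (b - a)" using that \<delta> by (subst mult.commute) (intro mult_left_mono, auto)
    then show "c + (b - \<xi>) * \<delta> + 1 \<le> Tm" using T by linarith
    show "0 \<le> c + (b - \<xi>) * \<delta>" using that \<delta> c by simp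
  qed
  have "norm y \<le> integral {a..b} (\<lambda>_. C * G)"
    unfolding y_def
  proof (rule integral_norm_bound_integral[OF int])
    fix \<xi> assume \<xi>: "\<xi> \<in> {a..b}"
    have "norm (S (c + (b - \<xi>) * \<delta>) (g \<xi>)) \<le> C * norm (g \<xi>)" using tm[OF \<xi>] by (intro S_norm) auto
    also have "\<dots> \<le> C * G" using G[OF \<xi>] C_pos by (intro mult_left_mono) auto
    finally show "norm (S (c + (b - \<xi>) * \<delta>) (g \<xi>)) \<le> C * G" .
  qed auto
  then show ny: "norm y \<le> C * G * (b - a)" using ab by (simp add: mult_ac)
  have "norm (V \<sigma> y) \<le> (C * G / (\<delta> * q0)) * (d / \<sigma>) powr q"
    if \<sigma>: "0 < \<sigma>" "\<sigma> < 1" and q: "q0 \<le> q" "q \<le> 1" for \<sigma> q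
  proof -
    have q': "0 < q" using q q0 by linarith
    have Vy: "V \<sigma> y = integral {a..b} (V \<sigma> \<circ> (\<lambda>\<xi>. S (c + (b - \<xi>) * \<delta>) (g \<xi>)))"
      unfolding y_def by (rule integral_linear[OF int V_bounded_linear[OF \<sigma>(1)], symmetric])
    have l1: "norm (V \<sigma> y) \<le> C * G * (ln (1 + \<delta> * (b - a) / \<sigma>) / \<delta>)"
      unfolding Vy
    proof (rule norm_integral_le_except_finite[OF integrable_linear[OF int V_bounded_linear[OF \<sigma>(1)]] _ finite.emptyI])
      show "((\<lambda>\<xi>. C * G * (1 / (\<sigma> + (b - \<xi>) * \<delta>))) has_integral C * G * (ln (1 + \<delta> * (b - a) / \<sigma>) / \<delta>)) {a..b}"
        by (intro has_integral_mult_right has_integral_inverse_affine) (use \<sigma> \<delta> ab in auto)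
      fix \<xi> assume \<xi>: "\<xi> \<in> {a..b}"
      have p: "0 < \<sigma> + (b - \<xi>) * \<delta>" using \<sigma> \<xi> \<delta> by (intro add_pos_nonneg) auto
      have "norm (V \<sigma> (S (c + (b - \<xi>) * \<delta>) (g \<xi>))) \<le> C / (\<sigma> + (c + (b - \<xi>) * \<delta>)) * norm (g \<xi>)"
        unfolding V_S[OF \<sigma>(1) tm(1)[OF \<xi>]] using \<sigma> tm[OF \<xi>] by (intro V_norm) auto
      also have "\<dots> \<le> C / (\<sigma> + (b - \<xi>) * \<delta>) * G"
        using p c C_pos G[OF \<xi>] by (intro mult_mono divide_left_mono) auto
      finally show "norm ((V \<sigma> \<circ> (\<lambda>\<xi>. S (c + (b - \<xi>) * \<delta>) (g \<xi>))) \<xi>) \<le> C * G * (1 / (\<sigma> + (b - \<xi>) * \<delta>))"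
        by simp
    qed
    have "ln (1 + \<delta> * (b - a) / \<sigma>) \<le> (d / \<sigma>) powr q / q0"
    proof -
      have "ln (1 + d / \<sigma>) \<le> (d / \<sigma>) powr q / q" using d \<sigma> q q' by (intro ln_one_add_le_powr) auto
      also have "\<dots> \<le> (d / \<sigma>) powr q / q0" using q q0 by (intro divide_left_mono) auto
      finally show ?thesis by (simp add: d_def)
    qed
    then have l2: "C * G * (ln (1 + \<delta> * (b - a) / \<sigma>) / \<delta>) \<le> C * G * ((d / \<sigma>) powr q / q0 / \<delta>)"
      using C_pos G0 \<delta> by (intro mult_left_mono divide_right_mono) auto
    have e: "C * G * (x / w / \<delta>) = C * G / (\<delta> * w) * x" for x w by simp
    show ?thesis using order_trans[OF l1 l2] unfolding e .
  qed
  from embed_profile[OF d(1) _ _ this]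
  have Y: "y \<in> Y" and le: "nY y \<le> CE * (norm y + C * G / (\<delta> * q0) * d powr (1 - \<alpha>))"
    using d C_pos G0 \<delta> q0 by auto
  show "y \<in> Y" by (rule Y)
  have "norm y \<le> C * G / \<delta> * d" using ny \<delta> by (simp add: d_def)
  also have "d = d powr (1 - \<alpha>) * d powr \<alpha>" using d by (simp flip: powr_add)
  also have "C * G / \<delta> * (d powr (1 - \<alpha>) * d powr \<alpha>) \<le> C * G / \<delta> * (d powr (1 - \<alpha>) * Tm)"
    using C_pos G0 \<delta> d \<alpha> by (intro mult_left_mono powr_le_Tm) auto
  finally have n: "norm y \<le> C * G / \<delta> * (d powr (1 - \<alpha>) * Tm)" .
  have "C * (Tm + 1 / w) * (G / \<delta>) * x = C * G / \<delta> * (x * Tm) + C * G / (\<delta> * w) * x" for w x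
    by (simp add: algebra_simps)
  from n this[of q0 "d powr (1 - \<alpha>)"]
  have "norm y + C * G / (\<delta> * q0) * d powr (1 - \<alpha>) \<le> C * (Tm + 1 / q0) * (G / \<delta>) * d powr (1 - \<alpha>)"
    by linarith
  then have "CE * (norm y + C * G / (\<delta> * q0) * d powr (1 - \<alpha>)) \<le> CE * (C * (Tm + 1 / q0) * (G / \<delta>) * d powr (1 - \<alpha>))"
    using CE by (rule mult_left_mono)
  with le show "nY y \<le> C2 * (G / \<delta>) * (\<delta> * (b - a)) powr (1 - \<alpha>)"
    by (simp only: C2_def d_def mult.assoc)
qed

definition C4 where "C4 = CE * (Tm + 4 * C)"

text \<open>One half of the time p = \<open>\<sigma> + s\<close> is used for the increment of S, the
  other for the regularity of x. The powers of s then combine to \<open>1 / s\<close>: measuring in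
  the norm of Y costs nothing, because x has the regularity \<open>\<alpha>\<close> itself.\<close>

lemma S_difference:
  assumes K: "0 \<le> K" "\<And>\<sigma>. 0 < \<sigma> \<Longrightarrow> \<sigma> \<le> Tm \<Longrightarrow> norm (V \<sigma> x) \<le> K * \<sigma> powr (\<alpha> - 1)"
    and s: "0 < s" "s \<le> t" "t + 1 \<le> Tm"
  shows "S t x - S s x \<in> Y \<and> nY (S t x - S s x) \<le> C4 * K * ((t - s) / s)"
proof -
  define \<delta> where "\<delta> = t - s"
  have \<delta>: "0 \<le> \<delta>" using s by (simp add: \<delta>_def)
  have n: "norm (S t x - S s x) \<le> K * s powr (\<alpha> - 1) * \<delta>"
    unfolding \<delta>_def
  proof (rule S_diff_const[OF s(1,2)])
    fix r assume r: "r \<in> {s..t}"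
    then have "norm (V r x) \<le> K * r powr (\<alpha> - 1)" using s by (intro K) auto
    also have "\<dots> \<le> K * s powr (\<alpha> - 1)" using r s \<alpha> K by (intro mult_left_mono powr_mono2') auto
    finally show "norm (V r x) \<le> K * s powr (\<alpha> - 1)" .
  qed
  have "norm (V \<sigma> (S t x - S s x)) \<le> (4 * C * K * \<delta> * s powr (\<alpha> - 2)) * (s / \<sigma>) powr q"
    if \<sigma>: "0 < \<sigma>" "\<sigma> < 1" and q: "q0 \<le> q" "q \<le> 1" for \<sigma> q
  proof -
    define p where "p = \<sigma> + s"
    have p: "0 < p" "p + \<delta> \<le> Tm" "s \<le> p" using \<sigma> s by (auto simp: p_def \<delta>_def)
    have "V \<sigma> (S t x - S s x) = V (p + \<delta>) x - V p x"
      using \<sigma> s by (simp add: V_minus V_S p_def \<delta>_def add_diff_eq)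
    also have "\<dots> = S (p / 2 + \<delta>) (V (p / 2) x) - S (p / 2) (V (p / 2) x)"
      using p \<delta> by (simp add: S_V)
    also have "norm \<dots> \<le> C * norm (V (p / 2) x) * (p / 2 + \<delta> - p / 2) / (p / 2)"
      using p \<delta> by (intro S_diff) auto
    also have "\<dots> = 2 * C * \<delta> / p * norm (V (p / 2) x)" by simp
    also have "\<dots> \<le> 2 * C * \<delta> / p * (K * (p / 2) powr (\<alpha> - 1))"
      using p \<delta> C_pos by (intro mult_left_mono K) auto
    also have "(p / 2) powr (\<alpha> - 1) \<le> 2 * p powr (\<alpha> - 1)"
    proof -
      have "(p / 2) powr (\<alpha> - 1) = p powr (\<alpha> - 1) * 2 powr (1 - \<alpha>)"
        using p by (simp add: powr_divide powr_diff field_simps)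
      also have "\<dots> \<le> p powr (\<alpha> - 1) * 2"
        using powr_mono[of "1 - \<alpha>" 1 "2::real"] \<alpha> by (intro mult_left_mono) auto
      finally show ?thesis by simp
    qed
    then have "2 * C * \<delta> / p * (K * (p / 2) powr (\<alpha> - 1)) \<le> 2 * C * \<delta> / p * (K * (2 * p powr (\<alpha> - 1)))"
      using p \<delta> C_pos K by (intro mult_left_mono) auto
    also have "\<dots> = 4 * C * K * \<delta> * (p powr (\<alpha> - 1) / p)" by simp
    also have "p powr (\<alpha> - 1) / p \<le> s powr (\<alpha> - 1) / p"
      using p s \<alpha> by (intro divide_right_mono powr_mono2') auto
    also have "s powr (\<alpha> - 1) / p = s powr (\<alpha> - 2) * (s / (\<sigma> + s))"
    proof -
      have "s powr (\<alpha> - 1) = s powr (\<alpha> - 2) * s powr 1" unfolding powr_add[symmetric] by simp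
      then show ?thesis using s by (simp add: p_def)
    qed
    also have "\<dots> \<le> s powr (\<alpha> - 2) * (s / \<sigma>) powr q"
      using \<sigma> s q q0 by (intro mult_left_mono ratio_le_powr) auto
    finally show ?thesis using C_pos K \<delta> by (simp add: mult.assoc mult_left_mono)
  qed
  from embed_profile[OF s(1) _ _ this]
  have Y: "S t x - S s x \<in> Y" and le: "nY (S t x - S s x) \<le> CE * (norm (S t x - S s x) + 4 * C * K * \<delta> * s powr (\<alpha> - 2) * s powr (1 - \<alpha>))"
    using s C_pos K \<delta> by auto
  have p1: "s powr (\<alpha> - 2) * s powr (1 - \<alpha>) = 1 / s"
    using s by (simp add: powr_minus_divide flip: powr_add)
  have "s powr (\<alpha> - 1) = s powr \<alpha> / s" using s by (simp add: powr_diff)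
  also have "\<dots> \<le> Tm / s" using s \<alpha> by (intro divide_right_mono powr_le_Tm) auto
  finally have "K * s powr (\<alpha> - 1) * \<delta> \<le> K * (Tm / s) * \<delta>" using K \<delta> by (intro mult_right_mono mult_left_mono) auto
  then have "norm (S t x - S s x) + 4 * C * K * \<delta> * s powr (\<alpha> - 2) * s powr (1 - \<alpha>) \<le> (Tm + 4 * C) * K * (\<delta> / s)"
  proof -
    have "4 * C * K * \<delta> * s powr (\<alpha> - 2) * s powr (1 - \<alpha>) = 4 * C * K * (\<delta> / s)"
      using p1 by (simp add: mult.assoc)
    moreover have "(Tm + 4 * C) * K * (\<delta> / s) = K * (Tm / s) * \<delta> + 4 * C * K * (\<delta> / s)"
      by (simp add: algebra_simps)
    ultimately show ?thesis
      using n \<open>K * s powr (\<alpha> - 1) * \<delta> \<le> K * (Tm / s) * \<delta>\<close> by linarith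
  qed
  then have "CE * (norm (S t x - S s x) + 4 * C * K * \<delta> * s powr (\<alpha> - 2) * s powr (1 - \<alpha>)) \<le> CE * ((Tm + 4 * C) * K * (\<delta> / s))"
    using CE by (rule mult_left_mono)
  with le Y show ?thesis by (simp add: C4_def \<delta>_def mult.assoc)
qed

text \<open>With \<open>\<delta> = t - s\<close> and \<open>\<eta> = s - \<xi>\<close>, the
  difference of the kernels in X is of size \<open>min 1 (\<delta> / \<eta>)\<close>, whose integral
  carries a logarithm; the bound \<open>(\<delta> / \<eta>) powr (1 - \<epsilon>)\<close> turns it
  into the factor \<open>1 / \<epsilon>\<close>. After application of \<open>V \<sigma>\<close> the
  kernel is regularised by \<open>\<sigma>\<close> and no logarithm arises, so it enters the norm of
  Y only through \<open>norm y\<close>.\<close>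

lemma convolution_tail:
  assumes st: "0 < s" "s < t" "t + 1 \<le> Tm"
    and int: "(\<lambda>\<xi>. S (t - \<xi>) (g \<xi>) - S (s - \<xi>) (g \<xi>)) integrable_on {0..s}"
    and G: "\<And>\<xi>. \<xi> \<in> {0..s} \<Longrightarrow> norm (g \<xi>) \<le> G"
    and \<epsilon>: "0 < \<epsilon>" "\<epsilon> \<le> 1"
  defines "y \<equiv> integral {0..s} (\<lambda>\<xi>. S (t - \<xi>) (g \<xi>) - S (s - \<xi>) (g \<xi>))"
  shows "norm y \<le> 2 * C * Tm * G * ((t - s) powr (1 - \<epsilon>) / \<epsilon>)"
    and "y \<in> Y" and "nY y \<le> CE * (norm y + 4 * C\<^sup>2 * G / q0 * (t - s) powr (1 - \<alpha>))"
proof -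
  define \<delta> where "\<delta> = t - s"
  have \<delta>: "0 < \<delta>" "\<delta> \<le> Tm" using st by (auto simp: \<delta>_def)
  have G0: "0 \<le> G" using order_trans[OF norm_ge_zero G[of 0]] st by simp
  have "norm y \<le> 2 * C * G * \<delta> powr (1 - \<epsilon>) * (s powr \<epsilon> / \<epsilon>)"
    unfolding y_def
  proof (rule norm_integral_le_except_finite[OF int _ finite.insertI[OF finite.emptyI, of s]])
    show "((\<lambda>\<xi>. 2 * C * G * \<delta> powr (1 - \<epsilon>) * (s - \<xi>) powr (\<epsilon> - 1)) has_integral
        2 * C * G * \<delta> powr (1 - \<epsilon>) * (s powr \<epsilon> / \<epsilon>)) {0..s}"
      by (intro has_integral_mult_right has_integral_powr_reflected) (use st \<epsilon> in auto)
    fix \<xi> assume \<xi>: "\<xi> \<in> {0..s}" "\<xi> \<notin> {s}"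
    define \<eta> where "\<eta> = s - \<xi>"
    have \<eta>: "0 < \<eta>" "\<eta> + \<delta> = t - \<xi>" "\<eta> + \<delta> \<le> Tm" using \<xi> st by (auto simp: \<eta>_def \<delta>_def)
    have "norm (S (\<eta> + \<delta>) (g \<xi>) - S \<eta> (g \<xi>)) \<le> 2 * C * norm (g \<xi>) * (\<delta> / \<eta>) powr (1 - \<epsilon>)"
    proof (cases "\<delta> \<le> \<eta>")
      case True
      have "norm (S (\<eta> + \<delta>) (g \<xi>) - S \<eta> (g \<xi>)) \<le> C * norm (g \<xi>) * (\<eta> + \<delta> - \<eta>) / \<eta>"
        using \<eta> \<delta> by (intro S_diff) auto
      also have "\<dots> = C * norm (g \<xi>) * (\<delta> / \<eta>) powr 1" using \<eta> \<delta> by simp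
      also have "\<dots> \<le> 2 * C * norm (g \<xi>) * (\<delta> / \<eta>) powr (1 - \<epsilon>)"
        using True \<eta> \<delta> \<epsilon> C_pos by (intro mult_mono powr_mono') auto
      finally show ?thesis .
    next
      case False
      have "norm (S (\<eta> + \<delta>) (g \<xi>) - S \<eta> (g \<xi>)) \<le> C * norm (g \<xi>) + C * norm (g \<xi>)"
        using \<eta> \<delta> by (intro norm_triangle_le_diff add_mono S_norm) auto
      also have "\<dots> = 2 * C * norm (g \<xi>) * 1" by simp
      also have "\<dots> \<le> 2 * C * norm (g \<xi>) * (\<delta> / \<eta>) powr (1 - \<epsilon>)"
        using False \<eta> \<epsilon> C_pos by (intro mult_left_mono ge_one_powr_ge_zero) auto
      finally show ?thesis .
    qed
    also have "\<dots> \<le> 2 * C * G * (\<delta> / \<eta>) powr (1 - \<epsilon>)"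
      using G[OF \<xi>(1)] C_pos by (intro mult_right_mono mult_left_mono) auto
    also have "(\<delta> / \<eta>) powr (1 - \<epsilon>) = \<delta> powr (1 - \<epsilon>) * \<eta> powr (\<epsilon> - 1)"
      using \<delta> \<eta> by (simp add: powr_divide powr_diff)
    finally show "norm (S (t - \<xi>) (g \<xi>) - S (s - \<xi>) (g \<xi>)) \<le> 2 * C * G * \<delta> powr (1 - \<epsilon>) * (s - \<xi>) powr (\<epsilon> - 1)"
      by (simp add: \<eta>(2) \<eta>_def[symmetric] mult.assoc)
  qed
  also have "\<dots> \<le> 2 * C * G * \<delta> powr (1 - \<epsilon>) * (Tm / \<epsilon>)"
    using C_pos G0 st \<epsilon> by (intro mult_left_mono divide_right_mono powr_le_Tm) auto
  finally show ny: "norm y \<le> 2 * C * Tm * G * ((t - s) powr (1 - \<epsilon>) / \<epsilon>)"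
    by (simp add: \<delta>_def mult_ac)
  have "norm (V \<sigma> y) \<le> (4 * C\<^sup>2 * G / q0) * (\<delta> / \<sigma>) powr q"
    if \<sigma>: "0 < \<sigma>" "\<sigma> < 1" and q: "q0 \<le> q" "q \<le> 1" for \<sigma> q
  proof -
    have q': "0 < q" using q q0 by linarith
    have Vy: "V \<sigma> y = integral {0..s} (V \<sigma> \<circ> (\<lambda>\<xi>. S (t - \<xi>) (g \<xi>) - S (s - \<xi>) (g \<xi>)))"
      unfolding y_def by (rule integral_linear[OF int V_bounded_linear[OF \<sigma>(1)], symmetric])
    have l1: "norm (V \<sigma> y) \<le> 4 * C\<^sup>2 * G * \<delta> powr q * ((\<sigma> powr - q - (\<sigma> + s) powr - q) / q)"
      unfolding Vy
    proof (rule norm_integral_le_except_finite[OF integrable_linear[OF int V_bounded_linear[OF \<sigma>(1)]] _ finite.emptyI])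
      show "((\<lambda>\<xi>. 4 * C\<^sup>2 * G * \<delta> powr q * (\<sigma> + s - \<xi>) powr (- q - 1)) has_integral
          4 * C\<^sup>2 * G * \<delta> powr q * ((\<sigma> powr - q - (\<sigma> + s) powr - q) / q)) {0..s}"
        by (intro has_integral_mult_right has_integral_powr_shifted) (use \<sigma> st q' in auto)
      fix \<xi> assume \<xi>: "\<xi> \<in> {0..s}"
      have "V \<sigma> (S (t - \<xi>) (g \<xi>) - S (s - \<xi>) (g \<xi>)) = V (\<sigma> + (t - \<xi>)) (g \<xi>) - V (\<sigma> + (s - \<xi>)) (g \<xi>)"
        using \<xi> st \<sigma> by (simp add: V_minus V_S)
      also have "norm \<dots> \<le> 4 * C\<^sup>2 * norm (g \<xi>) * (\<sigma> + (t - \<xi>) - (\<sigma> + (s - \<xi>))) powr q * (\<sigma> + (s - \<xi>)) powr (- q - 1)"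
        using \<xi> st \<sigma> q q' by (intro V_diff_min) auto
      also have "\<dots> \<le> 4 * C\<^sup>2 * G * \<delta> powr q * (\<sigma> + s - \<xi>) powr (- q - 1)"
        unfolding \<delta>_def using G[OF \<xi>] G0 by (intro mult_mono) (auto simp: add_diff_eq)
      finally show "norm ((V \<sigma> \<circ> (\<lambda>\<xi>. S (t - \<xi>) (g \<xi>) - S (s - \<xi>) (g \<xi>))) \<xi>)
          \<le> 4 * C\<^sup>2 * G * \<delta> powr q * (\<sigma> + s - \<xi>) powr (- q - 1)" by simp
    qed
    have l2: "4 * C\<^sup>2 * G * \<delta> powr q * ((\<sigma> powr - q - (\<sigma> + s) powr - q) / q) \<le> 4 * C\<^sup>2 * G * \<delta> powr q * (\<sigma> powr - q / q0)"
      using q q0 G0 by (intro mult_left_mono frac_le) auto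
    have l3: "4 * C\<^sup>2 * G * \<delta> powr q * (\<sigma> powr - q / q0) = (4 * C\<^sup>2 * G / q0) * (\<delta> / \<sigma>) powr q"
      using \<sigma> \<delta> by (simp add: powr_divide powr_minus_divide mult_ac)
    show ?thesis using order_trans[OF l1 l2] unfolding l3 .
  qed
  from embed_profile[OF \<delta> _ this] show "y \<in> Y" "nY y \<le> CE * (norm y + 4 * C\<^sup>2 * G / q0 * (t - s) powr (1 - \<alpha>))"
    using G0 q0 by (auto simp: \<delta>_def)
qed

definition C5 where "C5 = C2 + CE * (2 * C * Tm + 4 * C\<^sup>2 / q0)"

text \<open>The constant does not depend on \<open>\<epsilon>\<close>. For \<open>\<alpha> = 0\<close> the choice \<open>\<epsilon> = 1 / (\<bar>ln \<tau>\<bar> + 1)\<close> produces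
  the logarithm of the error bound.\<close>

lemma convolution_difference:
  assumes st: "0 < s" "s < t" "t \<le> s + 1" "t + 1 \<le> Tm"
    and int: "(\<lambda>\<xi>. S (t - \<xi>) (g \<xi>)) integrable_on {0..t}" "(\<lambda>\<xi>. S (s - \<xi>) (g \<xi>)) integrable_on {0..s}"
    and G: "\<And>\<xi>. \<xi> \<in> {0..t} \<Longrightarrow> norm (g \<xi>) \<le> G"
    and \<epsilon>: "0 < \<epsilon>" "\<epsilon> \<le> 1" "\<alpha> \<le> \<epsilon>"
  defines "z \<equiv> integral {0..t} (\<lambda>\<xi>. S (t - \<xi>) (g \<xi>)) - integral {0..s} (\<lambda>\<xi>. S (s - \<xi>) (g \<xi>))"
  shows "z \<in> Y \<and> nY z \<le> C5 * G * ((t - s) powr (1 - \<epsilon>) / \<epsilon>)"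
proof -
  define \<delta> where "\<delta> = t - s"
  have \<delta>: "0 < \<delta>" "\<delta> \<le> 1" using st by (auto simp: \<delta>_def)
  have G0: "0 \<le> G" using order_trans[OF norm_ge_zero G[of 0]] st by simp
  let ?f = "\<lambda>\<xi>. S (t - \<xi>) (g \<xi>)" and ?h = "\<lambda>\<xi>. S (s - \<xi>) (g \<xi>)"
  have i1: "?f integrable_on {0..s}" "?f integrable_on {s..t}"
    using int(1) st by (auto intro: integrable_subinterval_real)
  have i2: "(\<lambda>\<xi>. ?f \<xi> - ?h \<xi>) integrable_on {0..s}" by (intro integrable_diff i1 int)
  \<comment> \<open>The contribution of the new interval; \<open>y2\<close> below is the change in
    the contribution of the past.\<close>
  define y1 where "y1 = integral {s..t} ?f"
  define y2 where "y2 = integral {0..s} (\<lambda>\<xi>. ?f \<xi> - ?h \<xi>)"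
  have z: "z = y1 + y2"
  proof -
    have "integral {0..t} ?f = integral {0..s} ?f + integral {s..t} ?f"
      using Henstock_Kurzweil_Integration.integral_combine[of 0 s t ?f] st int by simp
    moreover have "y2 = integral {0..s} ?f - integral {0..s} ?h"
      unfolding y2_def by (rule Henstock_Kurzweil_Integration.integral_diff[OF i1(1) int(2)])
    ultimately show ?thesis by (simp only: z_def y1_def) simp
  qed
  have "y1 \<in> Y" "nY y1 \<le> C2 * (G / 1) * (1 * (t - s)) powr (1 - \<alpha>)"
    using convolution_smoothing(2,3)[of 1 0 s t g G] st G i1(2) by (auto simp: y1_def)
  moreover have "y2 \<in> Y" "nY y2 \<le> CE * (norm y2 + 4 * C\<^sup>2 * G / q0 * (t - s) powr (1 - \<alpha>))"
    "norm y2 \<le> 2 * C * Tm * G * ((t - s) powr (1 - \<epsilon>) / \<epsilon>)"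
    unfolding y2_def using convolution_tail[OF st(1,2,4) i2 _ \<epsilon>(1,2), of G] G st by auto
  moreover define X where "X = \<delta> powr (1 - \<epsilon>) / \<epsilon>"
  moreover have "\<delta> powr (1 - \<alpha>) \<le> X"
  proof -
    have "\<delta> powr (1 - \<alpha>) \<le> \<delta> powr (1 - \<epsilon>)" using \<delta> \<epsilon> by (intro powr_mono') auto
    also have "\<dots> \<le> X" unfolding X_def using \<epsilon> divide_left_mono[of \<epsilon> 1 "\<delta> powr (1 - \<epsilon>)"] by simp
    finally show ?thesis .
  qed
  ultimately have Y: "y1 \<in> Y" "y2 \<in> Y" and n: "nY y1 \<le> C2 * G * \<delta> powr (1 - \<alpha>)"
    "nY y2 \<le> CE * (norm y2 + 4 * C\<^sup>2 * G / q0 * \<delta> powr (1 - \<alpha>))" "norm y2 \<le> 2 * C * Tm * G * X"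
    and X: "\<delta> powr (1 - \<alpha>) \<le> X"
    by (auto simp: \<delta>_def)
  have C20: "0 \<le> C2" using CE C_pos Tm_ge_1 q0 by (auto simp: C2_def)
  have "nY y1 \<le> C2 * G * X" using n(1) mult_left_mono[OF X, of "C2 * G"] C20 G0 by simp
  moreover have "nY y2 \<le> CE * (2 * C * Tm * G * X + 4 * C\<^sup>2 * G / q0 * X)"
  proof (rule order_trans[OF n(2)], rule mult_left_mono[OF add_mono[OF n(3)] CE])
    show "4 * C\<^sup>2 * G / q0 * \<delta> powr (1 - \<alpha>) \<le> 4 * C\<^sup>2 * G / q0 * X"
      using X G0 q0 by (intro mult_left_mono) auto
  qed
  ultimately have "nY z \<le> C2 * G * X + CE * (2 * C * Tm * G * X + 4 * C\<^sup>2 * G / q0 * X)"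
    unfolding z using nY_add[OF Y] by linarith
  also have "\<dots> = C5 * G * X" by (simp add: C5_def algebra_simps)
  finally show ?thesis using Y_add[OF Y] by (simp add: z X_def \<delta>_def)
qed

lemma constants_nonneg: "0 \<le> C1" "0 \<le> C2" "0 \<le> C4" "0 \<le> C5"
  using CE C_pos Tm_ge_1 q0 by (auto simp: C1_def C2_def C4_def C5_def)

end

section \<open>Weakly singular sums and the functions \<open>phi k\<close>\<close>

text \<open>Each summand is a right end point value of a decreasing function. The mean value theorem
  for \<open>x powr (1 - a)\<close> bounds it by an increment of the primitive, also in the first
  interval with its singularity at 0, and the increments telescope.\<close>

lemma sum_powr_le:
  fixes \<tau> a :: real
  assumes \<tau>: "0 < \<tau>" and a: "0 \<le> a" "a < 1"
  shows "(\<Sum>j=1..N. \<tau> * (real j * \<tau>) powr - a) \<le> (real N * \<tau>) powr (1 - a) / (1 - a)"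
proof (induction N)
  case (Suc N)
  have step: "\<tau> * (real (Suc N) * \<tau>) powr - a \<le> ((real (Suc N) * \<tau>) powr (1 - a) - (real N * \<tau>) powr (1 - a)) / (1 - a)"
  proof -
    let ?F = "\<lambda>x. x powr (1 - a)"
    let ?x = "real N * \<tau>" and ?y = "real (Suc N) * \<tau>"
    have xy: "?x < ?y" "0 \<le> ?x" using \<tau> by auto
    obtain z where z: "?x < z" "z < ?y" "?F ?y - ?F ?x = (?y - ?x) * ((1 - a) * z powr - a)"
    proof -
      have "\<exists>l z. ?x < z \<and> z < ?y \<and> DERIV ?F z :> l \<and> ?F ?y - ?F ?x = (?y - ?x) * l"
      proof (rule MVT[OF xy(1)])
        show "continuous_on {?x..?y} ?F"
          using xy a by (intro continuous_on_powr' continuous_intros) auto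
        show "?F differentiable (at z)" if "?x < z" "z < ?y" for z
          unfolding real_differentiable_def using xy that
          by (intro exI[of _ "(1 - a) * z powr - a"]) (auto intro!: derivative_eq_intros)
      qed
      then obtain l z where z: "?x < z" "z < ?y" "DERIV ?F z :> l" "?F ?y - ?F ?x = (?y - ?x) * l" by blast
      have "DERIV ?F z :> (1 - a) * z powr - a" using z xy by (auto intro!: derivative_eq_intros)
      with z(3) have "l = (1 - a) * z powr - a" by (rule DERIV_unique)
      with z that show ?thesis by blast
    qed
    have "?y powr - a \<le> z powr - a" using z xy a by (intro powr_mono2') auto
    then have "\<tau> * ?y powr - a \<le> \<tau> * z powr - a" using \<tau> by (intro mult_left_mono) auto
    also have "\<dots> = (?F ?y - ?F ?x) / (1 - a)" 
    proof -
      have "?y - ?x = \<tau>" by (simp add: algebra_simps)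
      then show ?thesis unfolding z(3) using a by simp
    qed
    finally show ?thesis .
  qed
  have "(\<Sum>j=1..Suc N. \<tau> * (real j * \<tau>) powr - a)
      = (\<Sum>j=1..N. \<tau> * (real j * \<tau>) powr - a) + \<tau> * (real (Suc N) * \<tau>) powr - a"
    by simp
  also have "\<dots> \<le> (real N * \<tau>) powr (1 - a) / (1 - a)
      + ((real (Suc N) * \<tau>) powr (1 - a) - (real N * \<tau>) powr (1 - a)) / (1 - a)"
    using Suc.IH step by linarith
  finally show ?case by (simp add: diff_divide_distrib)
qed (use a in simp)

lemma sum_powr_reversed_le:
  fixes \<tau> a :: real
  assumes "0 < \<tau>" "0 \<le> a" "a < 1"
  shows "(\<Sum>n<N. \<tau> * (real (N - n) * \<tau>) powr - a) \<le> (real N * \<tau>) powr (1 - a) / (1 - a)"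
proof -
  have "(\<Sum>n<N. \<tau> * (real (N - n) * \<tau>) powr - a) = (\<Sum>j=1..N. \<tau> * (real j * \<tau>) powr - a)"
    by (rule sum.reindex_bij_witness[where i = "\<lambda>j. N - j" and j = "\<lambda>n. N - n"]) auto
  with sum_powr_le[OF assms] show ?thesis by simp
qed

text \<open>A discrete Beta integral: the two arguments add up to T = N * \<open>\<tau>\<close>, so
  one of them is at least T / 2 and its power may be replaced by that of T at the cost of a factor
  2. The singular index 0, where \<open>powr\<close> returns 0, is left out.\<close>

lemma sum_powr_beta_le:
  fixes \<tau> a b :: real
  assumes \<tau>: "0 < \<tau>" and a: "0 \<le> a" "a < 1" and b: "0 \<le> b" "b < 1"
  shows "(\<Sum>n\<in>{1..<N}. \<tau> * (real (N - n) * \<tau>) powr - a * (real n * \<tau>) powr - b)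
    \<le> (2 / (1 - a) + 2 / (1 - b)) * (real N * \<tau>) powr (1 - a - b)"
proof (cases "N = 0")
  case False
  define T where "T = real N * \<tau>"
  have T: "0 < T" using False \<tau> by (simp add: T_def)
  have half: "(T / 2) powr - c \<le> 2 * T powr - c" if "0 \<le> c" "c < 1" for c
  proof -
    have "(T / 2) powr - c = T powr - c * 2 powr c" using T by (simp add: powr_divide powr_minus field_simps)
    also have "\<dots> \<le> T powr - c * 2" using powr_mono[of c 1 "2::real"] that by (intro mult_left_mono) auto
    finally show ?thesis by simp
  qed
  have summand: "\<tau> * (real (N - n) * \<tau>) powr - a * (real n * \<tau>) powr - b
      \<le> 2 * T powr - a * (\<tau> * (real n * \<tau>) powr - b) + 2 * T powr - b * (\<tau> * (real (N - n) * \<tau>) powr - a)"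
    if n: "n \<in> {1..<N}" for n
  proof -
    let ?x = "real (N - n) * \<tau>" and ?y = "real n * \<tau>"
    have xy: "0 < ?x" "0 < ?y" using n \<tau> by auto
    have sum: "?x + ?y = T" using n by (simp add: T_def of_nat_diff algebra_simps)
    have "?x powr - a * ?y powr - b \<le> 2 * T powr - a * ?y powr - b + 2 * T powr - b * ?x powr - a"
    proof (cases "T / 2 \<le> ?x")
      case True
      have "?x powr - a \<le> (T / 2) powr - a" using True T a by (intro powr_mono2') linarith+
      also have "\<dots> \<le> 2 * T powr - a" by (rule half[OF a])
      finally have "?x powr - a * ?y powr - b \<le> 2 * T powr - a * ?y powr - b" by (intro mult_right_mono) auto
      then show ?thesis by (simp add: add_increasing2)
    next
      case False
      then have "T / 2 \<le> ?y" using sum by linarith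
      then have "?y powr - b \<le> (T / 2) powr - b" using T b by (intro powr_mono2') auto
      also have "\<dots> \<le> 2 * T powr - b" by (rule half[OF b])
      finally have "?x powr - a * ?y powr - b \<le> ?x powr - a * (2 * T powr - b)" by (intro mult_left_mono) auto
      then show ?thesis by (simp add: add_increasing mult_ac)
    qed
    from mult_left_mono[OF this, of \<tau>] \<tau> show ?thesis by (simp add: algebra_simps)
  qed
  have s1: "(\<Sum>n\<in>{1..<N}. \<tau> * (real n * \<tau>) powr - b) \<le> T powr (1 - b) / (1 - b)"
  proof -
    have "(\<Sum>n\<in>{1..<N}. \<tau> * (real n * \<tau>) powr - b) \<le> (\<Sum>n=1..N. \<tau> * (real n * \<tau>) powr - b)"
      using \<tau> by (intro sum_mono2) auto
    with sum_powr_le[OF \<tau> b, of N] show ?thesis by (simp add: T_def)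
  qed
  have s2: "(\<Sum>n\<in>{1..<N}. \<tau> * (real (N - n) * \<tau>) powr - a) \<le> T powr (1 - a) / (1 - a)"
  proof -
    have "(\<Sum>n\<in>{1..<N}. \<tau> * (real (N - n) * \<tau>) powr - a) \<le> (\<Sum>n<N. \<tau> * (real (N - n) * \<tau>) powr - a)"
      using \<tau> by (intro sum_mono2) auto
    with sum_powr_reversed_le[OF \<tau> a, of N] show ?thesis by (simp add: T_def)
  qed
  have "(\<Sum>n\<in>{1..<N}. \<tau> * (real (N - n) * \<tau>) powr - a * (real n * \<tau>) powr - b)
     \<le> (\<Sum>n\<in>{1..<N}. 2 * T powr - a * (\<tau> * (real n * \<tau>) powr - b) + 2 * T powr - b * (\<tau> * (real (N - n) * \<tau>) powr - a))"
    by (intro sum_mono summand)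
  also have "\<dots> = 2 * T powr - a * (\<Sum>n\<in>{1..<N}. \<tau> * (real n * \<tau>) powr - b)
      + 2 * T powr - b * (\<Sum>n\<in>{1..<N}. \<tau> * (real (N - n) * \<tau>) powr - a)"
    by (simp only: sum.distrib sum_distrib_left)
  also have "\<dots> \<le> 2 * T powr - a * (T powr (1 - b) / (1 - b)) + 2 * T powr - b * (T powr (1 - a) / (1 - a))"
    by (intro add_mono mult_left_mono s1 s2) auto
  also have "\<dots> = (2 / (1 - a) + 2 / (1 - b)) * T powr (1 - a - b)"
  proof -
    have "T powr - a * T powr (1 - b) = T powr (1 - a - b)" "T powr - b * T powr (1 - a) = T powr (1 - a - b)"
      using T by (simp_all add: algebra_simps flip: powr_add)
    then have "2 * T powr - a * (T powr (1 - b) / c) + 2 * T powr - b * (T powr (1 - a) / d)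
        = (2 / d + 2 / c) * T powr (1 - a - b)" for c d
      by (simp add: algebra_simps)
    then show ?thesis .
  qed
  finally show ?thesis by (simp add: T_def)
qed simp

text \<open>The means to contract the Gronwall sum. Relative to its value at N the weight is exp (-
  lam x), which is at most \<open>(lam * x) powr - p\<close>; this raises the exponent of the kernel
  to a + p < 1 and yields the factor \<open>lam powr - p\<close>, small for large lam.\<close>

lemma sum_gronwall_weight_le:
  fixes \<tau> a lam T :: real
  assumes \<tau>: "0 < \<tau>" and a: "0 \<le> a" "a < 1" and lam: "0 < lam" and N: "real N * \<tau> \<le> T"
  defines "p \<equiv> (1 - a) / 2"
  shows "(\<Sum>n<N. \<tau> * (real (N - n) * \<tau>) powr - a * exp (lam * (real n * \<tau>)))
    \<le> exp (lam * (real N * \<tau>)) * (lam powr - p * (T powr p / p))"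
proof -
  have p: "0 < p" "p \<le> 1" "a + p < 1" "1 - (a + p) = p" using a by (auto simp: p_def field_simps)
  have e: "exp (- x) \<le> x powr - p" if x: "0 < x" for x :: real
  proof -
    have "x powr p \<le> exp x"
    proof (cases "x \<le> 1")
      case True
      then have "x powr p \<le> 1" using x p by (intro powr_le1) auto
      also have "\<dots> \<le> exp x" using x by simp
      finally show ?thesis .
    next
      case False
      then have "x powr p \<le> x powr 1" using p by (intro powr_mono) auto
      also have "\<dots> \<le> 1 + x" using x by simp
      also have "\<dots> \<le> exp x" by (rule exp_ge_add_one_self)
      finally show ?thesis .
    qed
    then show ?thesis using x by (simp add: exp_minus powr_minus le_imp_inverse_le)
  qed
  have "\<tau> * (real (N - n) * \<tau>) powr - a * exp (lam * (real n * \<tau>))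
      \<le> exp (lam * (real N * \<tau>)) * lam powr - p * (\<tau> * (real (N - n) * \<tau>) powr - (a + p))" if n: "n < N" for n
  proof -
    let ?x = "real (N - n) * \<tau>"
    have x: "0 < ?x" using n \<tau> by simp
    have "exp (lam * (real n * \<tau>)) = exp (lam * (real N * \<tau>)) * exp (- (lam * ?x))"
      using n by (simp add: of_nat_diff algebra_simps flip: exp_add)
    also have "\<dots> \<le> exp (lam * (real N * \<tau>)) * (lam * ?x) powr - p"
      by (rule mult_left_mono[OF e[OF mult_pos_pos[OF lam x]]]) simp
    also have "\<dots> = exp (lam * (real N * \<tau>)) * (lam powr - p * ?x powr - p)"
      using x lam by (simp add: powr_mult)
    finally have "\<tau> * ?x powr - a * exp (lam * (real n * \<tau>))
        \<le> \<tau> * ?x powr - a * (exp (lam * (real N * \<tau>)) * (lam powr - p * ?x powr - p))"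
      using \<tau> by (intro mult_left_mono) auto
    also have "\<dots> = exp (lam * (real N * \<tau>)) * lam powr - p * (\<tau> * (?x powr - a * ?x powr - p))" by simp
    also have "?x powr - a * ?x powr - p = ?x powr - (a + p)" by (simp flip: powr_add)
    finally show ?thesis .
  qed
  then have "(\<Sum>n<N. \<tau> * (real (N - n) * \<tau>) powr - a * exp (lam * (real n * \<tau>)))
      \<le> (\<Sum>n<N. exp (lam * (real N * \<tau>)) * lam powr - p * (\<tau> * (real (N - n) * \<tau>) powr - (a + p)))"
    by (intro sum_mono) auto
  also have "\<dots> = exp (lam * (real N * \<tau>)) * lam powr - p * (\<Sum>n<N. \<tau> * (real (N - n) * \<tau>) powr - (a + p))"
    by (simp only: sum_distrib_left)
  also have "\<dots> \<le> exp (lam * (real N * \<tau>)) * lam powr - p * (T powr p / p)"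
  proof (intro mult_left_mono)
    have "(\<Sum>n<N. \<tau> * (real (N - n) * \<tau>) powr - (a + p)) \<le> (real N * \<tau>) powr p / p"
      using sum_powr_reversed_le[OF \<tau>, of "a + p" N] p a unfolding p(4) by simp
    also have "\<dots> \<le> T powr p / p" using p N \<tau> by (intro divide_right_mono powr_mono2) auto
    finally show "(\<Sum>n<N. \<tau> * (real (N - n) * \<tau>) powr - (a + p)) \<le> T powr p / p" .
  qed auto
  finally show ?thesis by (simp add: mult.assoc)
qed

text \<open>The functions \<open>phi k\<close> are linearly independent: on the positive real axis, \<open>x * phi (k + 1) x \<le> phi k x\<close>,
  so that the first one with nonzero coefficient dominates.\<close>

definition phi_real :: "nat \<Rightarrow> real \<Rightarrow> real" where
  "phi_real k x = (if k = 0 then exp x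
     else integral {0..1} (\<lambda>\<xi>. exp ((1 - \<xi>) * x) * (\<xi> ^ (k - 1) / fact (k - 1))))"

lemma phi_of_real: "phi k (of_real x) = of_real (phi_real k x)"
proof (cases "k = 0")
  case False
  let ?h = "\<lambda>\<xi>. exp ((1 - \<xi>) * x) * (\<xi> ^ (k - 1) / fact (k - 1))"
  have i: "?h integrable_on {0..1}"
    by (intro integrable_continuous_interval continuous_intros) auto
  have pt: "exp (of_real (1 - \<xi>) * of_real x) * of_real (\<xi> ^ (k - 1) / fact (k - 1)) = (of_real (?h \<xi>) :: complex)" for \<xi>
    by (simp only: of_real_mult exp_of_real[symmetric])
  have "phi k (of_real x) = integral {0..1} (\<lambda>\<xi>. of_real (?h \<xi>))"
    using False by (simp only: phi_def if_False pt)
  also have "\<dots> = of_real (integral {0..1} ?h)"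
    using integral_linear[OF i bounded_linear_of_real] by (simp only: o_def)
  also have "integral {0..1} ?h = phi_real k x"
    using False by (simp only: phi_real_def if_False)
  finally show ?thesis .
qed (simp add: phi_def phi_real_def exp_of_real)

lemma phi_real_nonneg: "0 \<le> phi_real k x"
proof (cases "k = 0")
  case False
  have "0 \<le> integral {0..1} (\<lambda>\<xi>. exp ((1 - \<xi>) * x) * (\<xi> ^ (k - 1) / fact (k - 1)))"
    by (rule integral_nonneg) (intro integrable_continuous_interval continuous_intros, auto)
  then show ?thesis using False by (simp only: phi_real_def if_False)
qed (simp add: phi_real_def)

lemma DERIV_power_over_fact:
  "((\<lambda>\<xi>. \<xi> ^ Suc j / fact (Suc j)) has_real_derivative \<xi> ^ j / fact j) (at \<xi> within S)"
proof -
  have "((\<lambda>\<xi>. \<xi> ^ Suc j / fact (Suc j)) has_real_derivative (real (Suc j) * \<xi> ^ j) / fact (Suc j)) (at \<xi> within S)"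
    by (rule DERIV_cdivide, rule DERIV_cong, rule DERIV_pow) simp
  then show ?thesis
    by (rule DERIV_cong) (simp add: fact_Suc del: of_nat_Suc)
qed

text \<open>Integration by parts gives the recurrence x phi_(k+1) = phi_k - 1 / k!, whose last term
  is dropped. The case k = 0 is separate because \<open>phi_real 0\<close> is not an
  integral.\<close>

lemma phi_real_step:
  assumes "0 \<le> x"
  shows "x * phi_real (Suc k) x \<le> phi_real k x"
proof -
  let ?F = "\<lambda>\<xi>. - (exp ((1 - \<xi>) * x) * (\<xi> ^ k / fact k))"
  let ?f = "\<lambda>\<xi>. exp ((1 - \<xi>) * x) * (\<xi> ^ k / fact k)"
  let ?g = "\<lambda>\<xi>. exp ((1 - \<xi>) * x) * (\<xi> ^ (k - 1) / fact (k - 1))"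
  have cont: "?f integrable_on {0..1}" "?g integrable_on {0..1}"
    by (auto intro!: integrable_continuous_interval continuous_intros)
  show ?thesis
  proof (cases k)
    case 0
    have "((\<lambda>\<xi>. x * ?f \<xi>) has_integral (?F 1 - ?F 0)) {0..1}"
      by (intro fundamental_theorem_of_calculus)
        (auto simp: 0 has_real_derivative_iff_has_vector_derivative[symmetric] intro!: derivative_eq_intros)
    then have "x * integral {0..1} ?f = exp x - 1"
      using has_integral_unique[OF has_integral_mult_right[OF integrable_integral[OF cont(1)], of x]] by (simp add: 0)
    then show ?thesis by (simp add: phi_real_def 0)
  next
    case (Suc j)
    have "(?F has_real_derivative x * ?f \<xi> - ?g \<xi>) (at \<xi> within {0..1})" for \<xi>
    proof -
      have "((\<lambda>\<xi>. \<xi> ^ k / fact k) has_real_derivative \<xi> ^ (k - 1) / fact (k - 1)) (at \<xi> within {0..1})"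
        unfolding Suc using DERIV_power_over_fact[of j] by simp
      moreover have "((\<lambda>\<xi>. exp ((1 - \<xi>) * x)) has_real_derivative - x * exp ((1 - \<xi>) * x)) (at \<xi> within {0..1})"
        by (auto intro!: derivative_eq_intros)
      ultimately have "(?F has_real_derivative - (exp ((1 - \<xi>) * x) * (\<xi> ^ (k - 1) / fact (k - 1)) + - x * exp ((1 - \<xi>) * x) * (\<xi> ^ k / fact k))) (at \<xi> within {0..1})"
        by (intro DERIV_minus DERIV_mult')
      then show ?thesis by (rule DERIV_cong) (simp add: algebra_simps)
    qed
    then have "((\<lambda>\<xi>. x * ?f \<xi> - ?g \<xi>) has_integral (?F 1 - ?F 0)) {0..1}"
      by (intro fundamental_theorem_of_calculus) (auto simp: has_real_derivative_iff_has_vector_derivative)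
    moreover have "((\<lambda>\<xi>. x * ?f \<xi> - ?g \<xi>) has_integral (x * integral {0..1} ?f - integral {0..1} ?g)) {0..1}"
      by (intro has_integral_diff has_integral_mult_right integrable_integral cont)
    ultimately have "x * integral {0..1} ?f - integral {0..1} ?g = - (1 / fact k)"
      by (simp add: Suc has_integral_unique)
    moreover have "(0::real) \<le> 1 / fact k" by simp
    ultimately have "x * integral {0..1} ?f \<le> integral {0..1} ?g" by linarith
    then show ?thesis using Suc by (simp add: phi_real_def)
  qed
qed

lemma phi_real_pos: "0 \<le> x \<Longrightarrow> 0 < phi_real k x"
proof (induction k)
  case 0
  show ?case by (simp add: phi_real_def)
next
  case (Suc k)
  let ?f = "\<lambda>\<xi>. exp ((1 - \<xi>) * x) * (\<xi> ^ k / fact k)"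
  have "((\<lambda>\<xi>. \<xi> ^ k / fact k) has_integral (1 ^ Suc k / fact (Suc k) - 0 ^ Suc k / fact (Suc k))) {0..1::real}"
    by (intro fundamental_theorem_of_calculus)
      (simp_all only: has_real_derivative_iff_has_vector_derivative[symmetric] DERIV_power_over_fact zero_le_one)
  then have I: "((\<lambda>\<xi>. \<xi> ^ k / fact k) has_integral (1 / fact (Suc k))) {0..1::real}" by simp
  have "(1::real) / fact (Suc k) \<le> integral {0..1} ?f"
  proof (rule has_integral_le[OF I integrable_integral])
    show "?f integrable_on {0..1}" by (auto intro!: integrable_continuous_interval continuous_intros)
    fix \<xi> :: real assume \<xi>: "\<xi> \<in> {0..1}"
    have "1 * (\<xi> ^ k / fact k) \<le> exp ((1 - \<xi>) * x) * (\<xi> ^ k / fact k)"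
      using \<xi> Suc.prems by (intro mult_right_mono) auto
    then show "\<xi> ^ k / fact k \<le> ?f \<xi>" by simp
  qed
  moreover have "(0::real) < 1 / fact (Suc k)" by simp
  ultimately have "0 < integral {0..1} ?f" by (rule less_le_trans[rotated])
  then show ?case by (simp add: phi_real_def)
qed

lemma phi_real_ratio: "0 < x \<Longrightarrow> phi_real (k + j) x \<le> phi_real k x / x ^ j"
proof (induction j)
  case (Suc j)
  have "phi_real (k + Suc j) x \<le> phi_real (k + j) x / x"
    using phi_real_step[of x "k + j"] Suc.prems by (simp add: field_simps)
  also have "\<dots> \<le> phi_real k x / x ^ j / x" using Suc by (intro divide_right_mono) auto
  finally show ?case by (simp add: mult.commute)
qed simp

lemma phi_linearly_independent:
  fixes c :: "nat \<Rightarrow> complex"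
  assumes "\<And>z. (\<Sum>k\<le>K. c k * phi k z) = 0"
  shows "k \<le> K \<Longrightarrow> c k = 0"
proof (induction k rule: less_induct)
  case (less k)
  define B where "B = (\<Sum>j\<in>{k<..K}. cmod (c j))"
  have B: "0 \<le> B" by (simp add: B_def sum_nonneg)
  have le: "cmod (c k) \<le> B / x" if x: "1 \<le> x" for x :: real
  proof -
    have p: "0 < phi_real k x" using phi_real_pos x by simp
    have "{..K} = insert k ({..<k} \<union> {k<..K})" using less.prems by auto
    then have "0 = (\<Sum>j\<in>insert k ({..<k} \<union> {k<..K}). c j * phi j (of_real x))" using assms[of "of_real x"] by simp
    also have "\<dots> = c k * phi k (of_real x) + ((\<Sum>j<k. c j * phi j (of_real x)) + (\<Sum>j\<in>{k<..K}. c j * phi j (of_real x)))"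
      by (subst sum.insert) (auto intro!: sum.union_disjoint)
    also have "(\<Sum>j<k. c j * phi j (of_real x)) = 0"
      using less.IH less.prems by (intro sum.neutral) auto
    finally have "c k * phi k (of_real x) = - (\<Sum>j\<in>{k<..K}. c j * phi j (of_real x))"
      by (simp add: eq_neg_iff_add_eq_0)
    then have "cmod (c k) * phi_real k x = cmod (\<Sum>j\<in>{k<..K}. c j * phi j (of_real x))"
      using p by (metis abs_of_pos norm_minus_cancel norm_mult norm_of_real phi_of_real)
    also have "\<dots> \<le> (\<Sum>j\<in>{k<..K}. cmod (c j) * (phi_real k x / x))"
    proof (rule sum_norm_le)
      fix j assume j: "j \<in> {k<..K}"
      then obtain i where i: "j = k + Suc i" by (metis greaterThanAtMost_iff less_imp_Suc_add add_Suc_right)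
      have "phi_real j x \<le> phi_real k x / x ^ Suc i" unfolding i using x by (intro phi_real_ratio) simp
      also have "\<dots> \<le> phi_real k x / x"
      proof (rule divide_left_mono)
        show "x \<le> x ^ Suc i" using x mult_left_mono[of 1 "x ^ i" x] by simp
      qed (use x p in auto)
      finally have "cmod (c j) * phi_real j x \<le> cmod (c j) * (phi_real k x / x)"
        by (intro mult_left_mono) auto
      moreover have "cmod (c j * phi j (of_real x)) = cmod (c j) * phi_real j x"
        by (simp add: norm_mult phi_of_real phi_real_nonneg)
      ultimately show "cmod (c j * phi j (of_real x)) \<le> cmod (c j) * (phi_real k x / x)" by (simp only:)
    qed
    also have "\<dots> = B * (phi_real k x / x)" by (simp only: B_def sum_distrib_right)
    finally show ?thesis using p x by (simp add: field_simps)
  qed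
  show "c k = 0"
  proof (rule ccontr)
    assume "c k \<noteq> 0"
    then have pos: "0 < cmod (c k)" by simp
    \<comment> \<open>Large enough for \<open>B / x\<close> to be at most half of
      \<open>cmod (c k)\<close>.\<close>
    define x where "x = max 1 (2 * B / cmod (c k))"
    have x: "1 \<le> x" "2 * B / cmod (c k) \<le> x" by (auto simp: x_def)
    have "cmod (c k) * x \<le> B" using le[OF x(1)] x(1) by (simp add: field_simps)
    moreover have "2 * B \<le> cmod (c k) * x" using x(2) pos by (simp add: field_simps)
    moreover have "0 < cmod (c k) * x" using pos x by simp
    ultimately show False using B by linarith
  qed
qed

text \<open>Equations between coefficients can be applied to operators, an identity between scalar
  functions cannot. K is at least 1 so that phi 1 takes part in the comparison even if
  \<open>maxphi m = 0\<close>, a case which the comparison excludes.\<close>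

lemma sum_b_coefficients:
  assumes "\<forall>z. (\<Sum>i\<in>{1..stages m}. b_fun m i z) = phi 1 z"
  shows "1 \<le> maxphi m" and "k \<le> maxphi m \<Longrightarrow> (\<Sum>i\<in>{1..stages m}. bcoef m i k) = (if k = 1 then 1 else 0)"
proof -
  define K where "K = max 1 (maxphi m)"
  define \<beta> where "\<beta> k = (if k \<le> maxphi m then \<Sum>i\<in>{1..stages m}. bcoef m i k else 0)" for k
  define c where "c k = \<beta> k - (if k = 1 then 1 else 0)" for k
  have "(\<Sum>k\<le>K. c k * phi k z) = 0" for z
  proof -
    have "(\<Sum>k\<le>K. c k * phi k z) = (\<Sum>k\<le>K. \<beta> k * phi k z) - (\<Sum>k\<le>K. (if k = 1 then 1 else 0) * phi k z)"
      by (simp add: c_def left_diff_distrib sum_subtractf)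
    also have "(\<Sum>k\<le>K. (if k = 1 then 1 else 0) * phi k z) = (\<Sum>k\<le>K. if k = 1 then phi k z else 0)"
      by (rule sum.cong) auto
    also have "\<dots> = phi 1 z" by (subst sum.delta) (auto simp: K_def)
    also have "(\<Sum>k\<le>K. \<beta> k * phi k z) = (\<Sum>k\<le>maxphi m. \<beta> k * phi k z)"
      by (rule sum.mono_neutral_right) (auto simp: K_def \<beta>_def)
    also have "\<dots> = (\<Sum>k\<le>maxphi m. \<Sum>i\<in>{1..stages m}. bcoef m i k * phi k z)"
      by (rule sum.cong) (auto simp: \<beta>_def sum_distrib_right)
    also have "\<dots> = (\<Sum>i\<in>{1..stages m}. b_fun m i z)"
      unfolding b_fun_def by (rule sum.swap)
    finally show ?thesis using assms by simp
  qed
  note c0 = phi_linearly_independent[OF this]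
  have "c 1 = 0" by (rule c0) (simp add: K_def)
  then show "1 \<le> maxphi m" by (auto simp: c_def \<beta>_def split: if_splits)
  show "(\<Sum>i\<in>{1..stages m}. bcoef m i k) = (if k = 1 then 1 else 0)" if "k \<le> maxphi m"
    using c0[of k] that by (auto simp: c_def \<beta>_def K_def split: if_splits)
qed

section \<open>Operators of the method and error propagation\<close>

lemma (in smoothing_semigroup) phi_op_add:
  assumes "0 < \<delta>" "\<delta> \<le> Tm"
  shows "phi_op S k \<delta> (x + y) = phi_op S k \<delta> x + phi_op S k \<delta> y"
proof (cases "k = 0")
  case False
  let ?w = "\<lambda>\<xi>. \<xi> ^ (k - 1) / fact (k - 1) :: real"
  have "(\<lambda>\<xi>. ?w \<xi> *\<^sub>R S (0 + (1 - \<xi>) * \<delta>) z) integrable_on {0..1}" for z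
    using assms by (intro integrable_S continuous_intros) auto
  then have i: "(\<lambda>\<xi>. ?w \<xi> *\<^sub>R S ((1 - \<xi>) * \<delta>) z) integrable_on {0..1}" for z
    by (simp only: add_0)
  have "integral {0..1} (\<lambda>\<xi>. ?w \<xi> *\<^sub>R S ((1 - \<xi>) * \<delta>) (x + y))
      = integral {0..1} (\<lambda>\<xi>. ?w \<xi> *\<^sub>R S ((1 - \<xi>) * \<delta>) x + ?w \<xi> *\<^sub>R S ((1 - \<xi>) * \<delta>) y)"
    by (rule Henstock_Kurzweil_Integration.integral_cong) (use assms in \<open>simp add: S_plus scaleR_add_right\<close>)
  also have "\<dots> = integral {0..1} (\<lambda>\<xi>. ?w \<xi> *\<^sub>R S ((1 - \<xi>) * \<delta>) x) + integral {0..1} (\<lambda>\<xi>. ?w \<xi> *\<^sub>R S ((1 - \<xi>) * \<delta>) y)"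
    by (rule Henstock_Kurzweil_Integration.integral_add[OF i i])
  finally show ?thesis using False by (simp only: phi_op_def if_False)
qed (use assms in \<open>simp add: phi_op_def S_plus\<close>)

text \<open>The substitution from the unit interval to the time step exhibits the left-hand operator
  of the method as the variation-of-constants integral of a constant, ready to be subtracted from
  that of the solution.\<close>

lemma (in smoothing_semigroup) scaled_phi_op_1:
  assumes "0 < \<tau>" "\<tau> \<le> Tm"
  shows "((\<lambda>\<xi>. S (t + \<tau> - \<xi>) x) has_integral \<tau> *\<^sub>R phi_op S 1 \<tau> x) {t..t + \<tau>}"
proof -
  have "(\<lambda>\<xi>. 1 *\<^sub>R S (0 + (t + \<tau> - \<xi>) * 1) x) integrable_on {t..t + \<tau>}"
    by (rule integrable_S) (use assms in auto)
  then obtain I where I: "((\<lambda>\<xi>. S (t + \<tau> - \<xi>) x) has_integral I) (cbox t (t + \<tau>))"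
    by (auto simp: integrable_on_def)
  from has_integral_affinity'[OF this assms(1), of t]
  have "((\<lambda>\<xi>. S (t + \<tau> - (\<tau> * \<xi> + t)) x) has_integral (1 / \<tau>) *\<^sub>R I) {0..1}"
    using assms by (simp add: inverse_eq_divide)
  then have "((\<lambda>\<xi>. S ((1 - \<xi>) * \<tau>) x) has_integral (1 / \<tau>) *\<^sub>R I) {0..1}"
    by (simp add: algebra_simps)
  then have "phi_op S 1 \<tau> x = (1 / \<tau>) *\<^sub>R I" by (simp add: phi_op_def integral_unique)
  then show ?thesis using I assms by simp
qed

section \<open>Operators of the method in the intermediate norm and propagation of residuals\<close>

context intermediate_scale
begin

text \<open>Bounded in X, and of norm \<open>\<tau> powr - \<alpha>\<close> from X to Y. The
  operators \<open>S (c * \<tau>)\<close> in front are those which the stages apply to the error; c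
  = 0 gives the bound for B itself.\<close>

definition tame :: "real \<Rightarrow> real \<Rightarrow> ('a \<Rightarrow> 'a) \<Rightarrow> bool" where
  "tame P \<tau> B \<longleftrightarrow> (\<forall>x. norm (B x) \<le> P * norm x \<and>
     (\<forall>c. 0 \<le> c \<and> c \<le> 1 \<longrightarrow> S (c * \<tau>) (B x) \<in> Y \<and> nY (S (c * \<tau>) (B x)) \<le> P * \<tau> powr - \<alpha> * norm x))"

lemma tame_sum:
  assumes \<tau>: "0 \<le> \<tau>" and B: "\<And>i. i \<in> I \<Longrightarrow> tame (P i) \<tau> (B i)"
  shows "tame (\<Sum>i\<in>I. P i) \<tau> (\<lambda>x. \<Sum>i\<in>I. B i x)"
  unfolding tame_def
proof (intro allI conjI impI)
  fix x
  have "norm (\<Sum>i\<in>I. B i x) \<le> (\<Sum>i\<in>I. P i * norm x)"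
    by (rule sum_norm_le) (use B in \<open>auto simp: tame_def\<close>)
  then show "norm (\<Sum>i\<in>I. B i x) \<le> (\<Sum>i\<in>I. P i) * norm x" by (simp add: sum_distrib_right)
  fix c :: real assume c: "0 \<le> c \<and> c \<le> 1"
  have eq: "S (c * \<tau>) (\<Sum>i\<in>I. B i x) = (\<Sum>i\<in>I. S (c * \<tau>) (B i x))"
    using c \<tau> by (intro S_sum) auto
  have Y: "S (c * \<tau>) (B i x) \<in> Y" "nY (S (c * \<tau>) (B i x)) \<le> P i * \<tau> powr - \<alpha> * norm x" if "i \<in> I" for i
    using B[OF that] c by (auto simp: tame_def)
  show "S (c * \<tau>) (\<Sum>i\<in>I. B i x) \<in> Y" unfolding eq by (intro Y_sum Y)
  have "nY (\<Sum>i\<in>I. S (c * \<tau>) (B i x)) \<le> (\<Sum>i\<in>I. nY (S (c * \<tau>) (B i x)))" by (intro nY_sum Y)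
  also have "\<dots> \<le> (\<Sum>i\<in>I. P i * \<tau> powr - \<alpha> * norm x)" by (intro sum_mono Y)
  finally show "nY (S (c * \<tau>) (\<Sum>i\<in>I. B i x)) \<le> (\<Sum>i\<in>I. P i) * \<tau> powr - \<alpha> * norm x"
    unfolding eq by (simp add: sum_distrib_right)
qed

lemma tame_add:
  assumes "0 \<le> \<tau>" "tame P \<tau> B" "tame P' \<tau> B'"
  shows "tame (P + P') \<tau> (\<lambda>x. B x + B' x)"
  using tame_sum[of \<tau> "{True, False}" "\<lambda>b. if b then P else P'" "\<lambda>b. if b then B else B'"] assms by simp

lemma tame_scaleC:
  assumes \<tau>: "0 \<le> \<tau>" and B: "tame P \<tau> B"
  shows "tame (cmod z * P) \<tau> (\<lambda>x. z *\<^sub>C B x)"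
  unfolding tame_def
proof (intro allI conjI impI)
  fix x
  show "norm (z *\<^sub>C B x) \<le> cmod z * P * norm x"
    using B by (simp add: tame_def norm_scaleC mult.assoc mult_left_mono)
  fix c :: real assume c: "0 \<le> c \<and> c \<le> 1"
  have eq: "S (c * \<tau>) (z *\<^sub>C B x) = z *\<^sub>C S (c * \<tau>) (B x)" using c \<tau> by (intro S_scaleC) auto
  have Y: "S (c * \<tau>) (B x) \<in> Y" "nY (S (c * \<tau>) (B x)) \<le> P * \<tau> powr - \<alpha> * norm x"
    using B c by (auto simp: tame_def)
  show "S (c * \<tau>) (z *\<^sub>C B x) \<in> Y" unfolding eq by (intro Y_scaleC Y)
  show "nY (S (c * \<tau>) (z *\<^sub>C B x)) \<le> cmod z * P * \<tau> powr - \<alpha> * norm x"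
    unfolding eq nY_scaleC[OF Y(1)] using mult_left_mono[OF Y(2), of "cmod z"] by (simp add: mult.assoc)
qed

text \<open>For k = 0 the operator belongs to the semigroup. For larger k it is a convolution over
  the unit interval with a weight of modulus at most 1, to which
  \<open>convolution_smoothing\<close> applies at the scale \<open>d * \<tau>\<close>. The factor
  \<open>d powr - \<alpha>\<close> restores the scale \<open>\<tau>\<close>; this is where positive
  nodes are essential.\<close>

lemma tame_phi_op:
  assumes \<tau>: "0 < \<tau>" "\<tau> \<le> 1" and d: "0 < d" "d \<le> 1" and Tm: "3 \<le> Tm"
  shows "tame ((C + C1 + C2) * d powr - \<alpha>) \<tau> (phi_op S k (d * \<tau>))"
  unfolding tame_def
proof (intro allI conjI impI)
  fix x
  define \<delta> where "\<delta> = d * \<tau>"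
  have \<delta>: "0 < \<delta>" "\<delta> \<le> 1" using \<tau> d by (auto simp: \<delta>_def mult_le_one)
  let ?w = "\<lambda>\<xi>. \<xi> ^ (k - 1) / fact (k - 1) :: real"
  have w: "\<bar>?w \<xi>\<bar> \<le> 1" if "\<xi> \<in> {0..1}" for \<xi>
  proof -
    have "\<xi> ^ (k - 1) \<le> 1" using that by (intro power_le_one) auto
    moreover have "(1::real) \<le> fact (k - 1)" by (rule fact_ge_1)
    ultimately show ?thesis using that by (simp add: divide_le_eq order_trans)
  qed
  have main: "norm (phi_op S k \<delta> x) \<le> C * norm x \<and>
     (0 \<le> c \<and> c \<le> 1 \<longrightarrow> S (c * \<tau>) (phi_op S k \<delta> x) \<in> Y \<and> nY (S (c * \<tau>) (phi_op S k \<delta> x)) \<le> (C1 + C2) * \<delta> powr - \<alpha> * norm x)" for c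
  proof (cases "k = 0")
    case True
    have "S (c * \<tau>) (S \<delta> x) \<in> Y \<and> nY (S (c * \<tau>) (S \<delta> x)) \<le> (C1 + C2) * \<delta> powr - \<alpha> * norm x" if c: "0 \<le> c \<and> c \<le> 1"
    proof -
      have ct: "0 \<le> c * \<tau>" "c * \<tau> \<le> 1" using c \<tau> by (auto simp: mult_le_one)
      have eq: "S (c * \<tau>) (S \<delta> x) = S (c * \<tau> + \<delta>) x" using ct \<delta> by (simp add: S_add)
      have s: "S (c * \<tau> + \<delta>) x \<in> Y" "nY (S (c * \<tau> + \<delta>) x) \<le> C1 * (c * \<tau> + \<delta>) powr - \<alpha> * norm x"
        using S_smoothing[of "c * \<tau> + \<delta>" x] ct \<delta> Tm by auto
      have "(c * \<tau> + \<delta>) powr - \<alpha> \<le> \<delta> powr - \<alpha>" using ct \<delta> \<alpha> by (intro powr_mono2') auto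
      then have "C1 * (c * \<tau> + \<delta>) powr - \<alpha> * norm x \<le> (C1 + C2) * \<delta> powr - \<alpha> * norm x"
        using constants_nonneg by (intro mult_right_mono mult_mono) auto
      with s show ?thesis unfolding eq by linarith
    qed
    then show ?thesis using True S_norm[of \<delta> x] \<delta> Tm by (simp add: phi_op_def)
  next
    case False
    have phi: "phi_op S k \<delta> x = integral {0..1} (\<lambda>\<xi>. ?w \<xi> *\<^sub>R S (0 + (1 - \<xi>) * \<delta>) x)"
      using False by (simp only: phi_op_def if_False add_0)
    have i: "(\<lambda>\<xi>. ?w \<xi> *\<^sub>R S (e + (1 - \<xi>) * \<delta>) x) integrable_on {0..1}" if "0 \<le> e" "e \<le> 1" for e
      using \<delta> that Tm by (intro integrable_S continuous_intros) auto
    have sm: "S (e + (1 - \<xi>) * \<delta>) (?w \<xi> *\<^sub>R x) = ?w \<xi> *\<^sub>R S (e + (1 - \<xi>) * \<delta>) x" if "\<xi> \<in> {0..1}" "0 \<le> e" for \<xi> e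
      using that \<delta> by (intro S_scaleR) auto
    have i': "(\<lambda>\<xi>. S (e + (1 - \<xi>) * \<delta>) (?w \<xi> *\<^sub>R x)) integrable_on {0..1}" if "0 \<le> e" "e \<le> 1" for e
      using i[OF that] by (rule integrable_eq) (use sm that in auto)
    have eqi: "integral {0..1} (\<lambda>\<xi>. ?w \<xi> *\<^sub>R S (e + (1 - \<xi>) * \<delta>) x) = integral {0..1} (\<lambda>\<xi>. S (e + (1 - \<xi>) * \<delta>) (?w \<xi> *\<^sub>R x))"
      if "0 \<le> e" for e
      by (rule Henstock_Kurzweil_Integration.integral_cong) (use sm that in auto)
    have g: "norm (?w \<xi> *\<^sub>R x) \<le> norm x" if "\<xi> \<in> {0..1}" for \<xi>
      unfolding norm_scaleR by (rule mult_left_le_one_le) (use w[OF that] in auto)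
    have n: "norm (phi_op S k \<delta> x) \<le> C * norm x"
      unfolding phi eqi[OF order_refl]
      using convolution_smoothing(1)[OF \<delta>(1) order_refl zero_less_one _ i'[OF order_refl zero_le_one] g] \<delta> Tm by simp
    moreover have "S (c * \<tau>) (phi_op S k \<delta> x) \<in> Y \<and> nY (S (c * \<tau>) (phi_op S k \<delta> x)) \<le> (C1 + C2) * \<delta> powr - \<alpha> * norm x"
      if c: "0 \<le> c \<and> c \<le> 1"
    proof -
      have ct: "0 \<le> c * \<tau>" "c * \<tau> \<le> 1" using c \<tau> by (auto simp: mult_le_one)
      have "S (c * \<tau>) (phi_op S k \<delta> x) = integral {0..1} (S (c * \<tau>) \<circ> (\<lambda>\<xi>. ?w \<xi> *\<^sub>R S (0 + (1 - \<xi>) * \<delta>) x))"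
        unfolding phi by (rule integral_linear[OF i[OF order_refl zero_le_one] S_bounded_linear[OF ct(1)], symmetric])
      also have "\<dots> = integral {0..1} (\<lambda>\<xi>. S (c * \<tau> + (1 - \<xi>) * \<delta>) (?w \<xi> *\<^sub>R x))"
        by (rule Henstock_Kurzweil_Integration.integral_cong) (use ct \<delta> in \<open>simp add: S_scaleR S_add\<close>)
      finally have eq: "S (c * \<tau>) (phi_op S k \<delta> x) = integral {0..1} (\<lambda>\<xi>. S (c * \<tau> + (1 - \<xi>) * \<delta>) (?w \<xi> *\<^sub>R x))" .
      have "c * \<tau> + \<delta> * (1 - 0) + 1 \<le> Tm" using ct \<delta> Tm by simp
      note cs = convolution_smoothing(2,3)[OF \<delta>(1) ct(1) zero_less_one this i'[OF ct] g]
      have "C2 * (norm x / \<delta>) * (\<delta> * (1 - 0)) powr (1 - \<alpha>) = C2 * \<delta> powr - \<alpha> * norm x"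
        using \<delta> powr_add[of \<delta> 1 "- \<alpha>"] by simp
      also have "\<dots> \<le> (C1 + C2) * \<delta> powr - \<alpha> * norm x"
        using constants_nonneg by (intro mult_right_mono) auto
      finally show ?thesis using cs unfolding eq by simp
    qed
    ultimately show ?thesis by blast
  qed
  have d1: "1 \<le> d powr - \<alpha>" using d \<alpha> powr_mono2'[of "- \<alpha>" d 1] by simp
  have "C * norm x \<le> (C + C1 + C2) * d powr - \<alpha> * norm x"
  proof (rule mult_right_mono)
    have "C * 1 \<le> (C + C1 + C2) * d powr - \<alpha>" using d1 C_pos constants_nonneg by (intro mult_mono) auto
    then show "C \<le> (C + C1 + C2) * d powr - \<alpha>" by simp
  qed simp
  then show "norm (phi_op S k (d * \<tau>) x) \<le> (C + C1 + C2) * d powr - \<alpha> * norm x"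
    using main unfolding \<delta>_def by (metis order_trans)
  fix c :: real assume c: "0 \<le> c \<and> c \<le> 1"
  then show "S (c * \<tau>) (phi_op S k (d * \<tau>) x) \<in> Y" using main unfolding \<delta>_def by blast
  have "(C1 + C2) * \<delta> powr - \<alpha> * norm x \<le> (C + C1 + C2) * \<delta> powr - \<alpha> * norm x"
    using C_pos by (intro mult_right_mono) auto
  also have "\<dots> = (C + C1 + C2) * d powr - \<alpha> * \<tau> powr - \<alpha> * norm x"
    using d \<tau> by (simp add: \<delta>_def powr_mult)
  finally have le: "(C1 + C2) * \<delta> powr - \<alpha> * norm x \<le> (C + C1 + C2) * d powr - \<alpha> * \<tau> powr - \<alpha> * norm x" .
  have "nY (S (c * \<tau>) (phi_op S k \<delta> x)) \<le> (C1 + C2) * \<delta> powr - \<alpha> * norm x"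
    using main c by blast
  from order_trans[OF this le]
  show "nY (S (c * \<tau>) (phi_op S k (d * \<tau>) x)) \<le> (C + C1 + C2) * d powr - \<alpha> * \<tau> powr - \<alpha> * norm x"
    by (simp only: \<delta>_def)
qed

lemma tame_b_op:
  assumes "3 \<le> Tm"
  shows "\<exists>P. \<forall>\<tau>. 0 < \<tau> \<and> \<tau> \<le> 1 \<longrightarrow> tame P \<tau> (b_op S m i \<tau>)"
proof (intro exI allI impI)
  fix \<tau> :: real assume \<tau>: "0 < \<tau> \<and> \<tau> \<le> 1"
  have "tame ((C + C1 + C2) * 1 powr - \<alpha>) \<tau> (phi_op S k (1 * \<tau>))" for k
    by (rule tame_phi_op) (use \<tau> assms in auto)
  then show "tame (\<Sum>k\<le>maxphi m. cmod (bcoef m i k) * ((C + C1 + C2) * 1 powr - \<alpha>)) \<tau> (b_op S m i \<tau>)"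
    unfolding b_op_def using \<tau> by (intro tame_sum tame_scaleC) auto
qed

lemma tame_a_op:
  assumes "3 \<le> Tm" and m: "eerk_method m"
  shows "\<exists>P. \<forall>\<tau>. 0 < \<tau> \<and> \<tau> \<le> 1 \<longrightarrow> tame P \<tau> (a_op S m i j \<tau>)"
proof (intro exI allI impI)
  fix \<tau> :: real assume \<tau>: "0 < \<tau> \<and> \<tau> \<le> 1"
  have 1: "tame ((C + C1 + C2) * 1 powr - \<alpha>) \<tau> (phi_op S k (1 * \<tau>))" for k
    by (rule tame_phi_op) (use \<tau> assms in auto)
  have 2: "tame ((C + C1 + C2) * node m l powr - \<alpha>) \<tau> (phi_op S k (node m l * \<tau>))"
    if "l \<in> {l \<in> {1..stages m}. 0 < node m l}" for k l
    by (rule tame_phi_op) (use \<tau> assms that in \<open>auto simp: eerk_method_def\<close>)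
  show "tame (\<Sum>k\<le>maxphi m. cmod (acoef m i j k) * ((C + C1 + C2) * 1 powr - \<alpha>) +
      (\<Sum>l\<in>{l \<in> {1..stages m}. 0 < node m l}. cmod (ccoef m i j l k) * ((C + C1 + C2) * node m l powr - \<alpha>))) \<tau> (a_op S m i j \<tau>)"
    unfolding a_op_def using \<tau> 1 2 by (intro tame_sum tame_scaleC tame_add) auto
qed

lemma tame_mono: "tame P \<tau> B \<Longrightarrow> P \<le> P' \<Longrightarrow> tame P' \<tau> B"
  unfolding tame_def by (meson mult_right_mono norm_ge_zero order_trans powr_ge_zero)

lemma tame_uniform:
  assumes "finite I" and "\<And>i. i \<in> I \<Longrightarrow> \<exists>P. \<forall>\<tau>. 0 < \<tau> \<and> \<tau> \<le> 1 \<longrightarrow> tame P \<tau> (B i \<tau>)"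
  shows "\<exists>P\<ge>0. \<forall>i\<in>I. \<forall>\<tau>. 0 < \<tau> \<and> \<tau> \<le> 1 \<longrightarrow> tame P \<tau> (B i \<tau>)"
proof -
  obtain p where p: "\<And>i \<tau>. i \<in> I \<Longrightarrow> 0 < \<tau> \<Longrightarrow> \<tau> \<le> 1 \<Longrightarrow> tame (p i) \<tau> (B i \<tau>)"
    using assms(2) by metis
  show ?thesis
  proof (intro exI[of _ "\<Sum>i\<in>I. \<bar>p i\<bar>"] conjI ballI allI impI)
    show "0 \<le> (\<Sum>i\<in>I. \<bar>p i\<bar>)" by (simp add: sum_nonneg)
    fix i \<tau> assume i: "i \<in> I" and \<tau>: "0 < \<tau> \<and> \<tau> \<le> (1::real)"
    have "\<bar>p i\<bar> \<le> (\<Sum>i\<in>I. \<bar>p i\<bar>)" by (rule member_le_sum) (use assms i in auto)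
    then have "p i \<le> (\<Sum>i\<in>I. \<bar>p i\<bar>)" by linarith
    with p[OF i] \<tau> show "tame (\<Sum>i\<in>I. \<bar>p i\<bar>) \<tau> (B i \<tau>)" by (blast intro: tame_mono)
  qed
qed

text \<open>The residual is needed in two norms. The bound in X has the full order
  \<open>\<tau> * \<rho>\<close> and is used where later steps still smooth; the bound in Y loses
  \<open>\<tau> powr - \<alpha>\<close> and serves the last step.\<close>

lemma local_error:
  assumes \<tau>: "0 < \<tau>" "\<tau> \<le> 1" and Tm: "3 \<le> Tm"
    and B: "\<And>i. i \<in> I \<Longrightarrow> tame P \<tau> (B i)" and P: "0 \<le> P"
    and h: "\<And>i. i \<in> I \<Longrightarrow> norm (h i) \<le> \<rho>" and \<rho>: "0 \<le> \<rho>"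
    and int: "(\<lambda>\<xi>. S (t + \<tau> - \<xi>) (g \<xi>)) integrable_on {t..t + \<tau>}"
    and g: "\<And>\<xi>. \<xi> \<in> {t..t + \<tau>} \<Longrightarrow> norm (g \<xi>) \<le> \<rho>"
  defines "r \<equiv> \<tau> *\<^sub>R (\<Sum>i\<in>I. B i (h i)) + integral {t..t + \<tau>} (\<lambda>\<xi>. S (t + \<tau> - \<xi>) (g \<xi>))"
  shows "norm r \<le> (real (card I) * P + C + C2) * (\<tau> * \<rho>)"
    and "0 \<le> c \<Longrightarrow> c \<le> 1 \<Longrightarrow> S (c * \<tau>) r \<in> Y \<and> nY (S (c * \<tau>) r) \<le> (real (card I) * P + C + C2) * (\<tau> powr (1 - \<alpha>) * \<rho>)"
proof -
  define y where "y = integral {t..t + \<tau>} (\<lambda>\<xi>. S (t + \<tau> - \<xi>) (g \<xi>))"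
  define B1 where "B1 = (\<Sum>i\<in>I. B i (h i))"
  have n1: "norm B1 \<le> real (card I) * P * \<rho>"
  proof -
    have "norm B1 \<le> (\<Sum>i\<in>I. P * \<rho>)" unfolding B1_def
    proof (rule sum_norm_le)
      fix i assume i: "i \<in> I"
      have "norm (B i (h i)) \<le> P * norm (h i)" using B[OF i] by (simp add: tame_def)
      also have "\<dots> \<le> P * \<rho>" using h[OF i] P by (rule mult_left_mono)
      finally show "norm (B i (h i)) \<le> P * \<rho>" .
    qed
    then show ?thesis by simp
  qed
  have n2: "norm y \<le> C * \<rho> * \<tau>"
    using convolution_smoothing(1)[of 1 0 t "t + \<tau>" g \<rho>] \<tau> Tm int g by (simp add: y_def)
  have "norm r \<le> \<tau> * norm B1 + norm y"
    unfolding r_def B1_def[symmetric] y_def[symmetric] using norm_triangle_ineq[of "\<tau> *\<^sub>R B1" y] \<tau> by simp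
  also have "\<dots> \<le> \<tau> * (real (card I) * P * \<rho>) + C * \<rho> * \<tau>"
    using \<tau> by (intro add_mono mult_left_mono n1 n2) auto
  also have "\<dots> = (real (card I) * P + C) * (\<tau> * \<rho>)" by (simp add: algebra_simps)
  also have "\<dots> \<le> (real (card I) * P + C + C2) * (\<tau> * \<rho>)"
    using \<tau> \<rho> constants_nonneg by (intro mult_right_mono) auto
  finally show "norm r \<le> (real (card I) * P + C + C2) * (\<tau> * \<rho>)" .
  assume c: "0 \<le> c" "c \<le> 1"
  have ct: "0 \<le> c * \<tau>" "c * \<tau> \<le> 1" using c \<tau> by (auto simp: mult_le_one)
  have p: "\<tau> * \<tau> powr - \<alpha> = \<tau> powr (1 - \<alpha>)" using \<tau> powr_add[of \<tau> 1 "- \<alpha>"] by simp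
  have eq: "S (c * \<tau>) r = \<tau> *\<^sub>R (\<Sum>i\<in>I. S (c * \<tau>) (B i (h i))) + S (c * \<tau>) y"
    unfolding r_def y_def[symmetric] using ct by (simp add: S_plus S_scaleR S_sum)
  have Y1: "S (c * \<tau>) (B i (h i)) \<in> Y" "nY (S (c * \<tau>) (B i (h i))) \<le> P * \<tau> powr - \<alpha> * \<rho>" if i: "i \<in> I" for i
  proof -
    show "S (c * \<tau>) (B i (h i)) \<in> Y" using B[OF i] c by (simp add: tame_def)
    have "nY (S (c * \<tau>) (B i (h i))) \<le> P * \<tau> powr - \<alpha> * norm (h i)" using B[OF i] c by (simp add: tame_def)
    also have "\<dots> \<le> P * \<tau> powr - \<alpha> * \<rho>" using h[OF i] P by (intro mult_left_mono) auto
    finally show "nY (S (c * \<tau>) (B i (h i))) \<le> P * \<tau> powr - \<alpha> * \<rho>" .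
  qed
  have "S (c * \<tau>) y = integral {t..t + \<tau>} (S (c * \<tau>) \<circ> (\<lambda>\<xi>. S (t + \<tau> - \<xi>) (g \<xi>)))"
    unfolding y_def by (rule integral_linear[OF int S_bounded_linear[OF ct(1)], symmetric])
  also have "\<dots> = integral {t..t + \<tau>} (\<lambda>\<xi>. S (c * \<tau> + (t + \<tau> - \<xi>) * 1) (g \<xi>))"
    by (rule Henstock_Kurzweil_Integration.integral_cong) (use ct in \<open>simp add: S_add\<close>)
  finally have yeq: "S (c * \<tau>) y = integral {t..t + \<tau>} (\<lambda>\<xi>. S (c * \<tau> + (t + \<tau> - \<xi>) * 1) (g \<xi>))" .
  have "(\<lambda>\<xi>. S (c * \<tau> + (t + \<tau> - \<xi>) * 1) (g \<xi>)) integrable_on {t..t + \<tau>}"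
    using integrable_linear[OF int S_bounded_linear[OF ct(1)]]
    by (rule integrable_eq) (use ct in \<open>simp add: S_add\<close>)
  from convolution_smoothing(2,3)[OF zero_less_one ct(1) _ _ this g]
  have Y2: "S (c * \<tau>) y \<in> Y" "nY (S (c * \<tau>) y) \<le> C2 * \<rho> * \<tau> powr (1 - \<alpha>)"
    unfolding yeq using \<tau> ct Tm by auto
  have Ys: "(\<Sum>i\<in>I. S (c * \<tau>) (B i (h i))) \<in> Y" by (intro Y_sum Y1)
  have "nY (\<Sum>i\<in>I. S (c * \<tau>) (B i (h i))) \<le> (\<Sum>i\<in>I. nY (S (c * \<tau>) (B i (h i))))" by (intro nY_sum Y1)
  also have "\<dots> \<le> (\<Sum>i\<in>I. P * \<tau> powr - \<alpha> * \<rho>)" by (intro sum_mono Y1)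
  finally have s: "nY (\<Sum>i\<in>I. S (c * \<tau>) (B i (h i))) \<le> real (card I) * (P * \<tau> powr - \<alpha> * \<rho>)" by simp
  have "nY (S (c * \<tau>) r) \<le> nY (\<tau> *\<^sub>R (\<Sum>i\<in>I. S (c * \<tau>) (B i (h i)))) + nY (S (c * \<tau>) y)"
    unfolding eq by (intro nY_add Y_scaleR Ys Y2)
  also have "\<dots> \<le> \<tau> * (real (card I) * (P * \<tau> powr - \<alpha> * \<rho>)) + C2 * \<rho> * \<tau> powr (1 - \<alpha>)"
    unfolding nY_scaleR[OF Ys] using \<tau> s Y2 by (intro add_mono) (auto intro: mult_left_mono)
  also have "\<dots> = (real (card I) * P + C2) * (\<tau> powr (1 - \<alpha>) * \<rho>)"
    unfolding p[symmetric] by (simp add: algebra_simps)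
  also have "\<dots> \<le> (real (card I) * P + C + C2) * (\<tau> powr (1 - \<alpha>) * \<rho>)"
    using \<rho> C_pos by (intro mult_right_mono) auto
  finally show "S (c * \<tau>) r \<in> Y \<and> nY (S (c * \<tau>) r) \<le> (real (card I) * P + C + C2) * (\<tau> powr (1 - \<alpha>) * \<rho>)"
    unfolding eq by (auto intro!: Y_add Y_scaleR Ys Y2)
qed

text \<open>Discrete variation of constants: the global error is \<open>e N = (\<Sum>n<N. S ((N - 1 - n) * \<tau>) (r n))\<close>.
  Bounding \<open>S (c * \<tau>) (e N)\<close> for all \<open>c\<close> in \<open>[0, 1]\<close> avoids any boundedness of \<open>S\<close> on \<open>Y\<close>.\<close>

lemma global_error:
  assumes \<tau>: "0 < \<tau>" "\<tau> \<le> 1" and N: "real N * \<tau> + 2 \<le> Tm"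
    and e0: "e 0 = 0" and eS: "\<And>n. n < N \<Longrightarrow> e (Suc n) = S \<tau> (e n) + r n"
    and P: "0 \<le> P" and \<rho>: "\<And>n. n < N \<Longrightarrow> 0 \<le> \<rho> n"
    and r: "\<And>n. n < N \<Longrightarrow> norm (r n) \<le> P * (\<tau> * \<rho> n)"
      "\<And>n c. n < N \<Longrightarrow> 0 \<le> c \<Longrightarrow> c \<le> 1 \<Longrightarrow> S (c * \<tau>) (r n) \<in> Y \<and> nY (S (c * \<tau>) (r n)) \<le> P * (\<tau> powr (1 - \<alpha>) * \<rho> n)"
    and c: "0 \<le> c" "c \<le> 1"
  shows "S (c * \<tau>) (e N) \<in> Y \<and>
     nY (S (c * \<tau>) (e N)) \<le> P * (1 + 2 * C1) * (\<Sum>n<N. \<tau> * (real (N - n) * \<tau>) powr - \<alpha> * \<rho> n)"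
proof -
  have ct: "0 \<le> c * \<tau>" "c * \<tau> \<le> 1" using c \<tau> by (auto simp: mult_le_one)
  have rep: "e n = (\<Sum>k<n. S (real (n - 1 - k) * \<tau>) (r k))" if "n \<le> N" for n
    using that
  proof (induction n)
    case (Suc n)
    have "e (Suc n) = S \<tau> (\<Sum>k<n. S (real (n - 1 - k) * \<tau>) (r k)) + r n"
      using Suc eS by simp
    also have "S \<tau> (\<Sum>k<n. S (real (n - 1 - k) * \<tau>) (r k)) = (\<Sum>k<n. S (real (Suc n - 1 - k) * \<tau>) (r k))"
    proof -
      have "S \<tau> (S (real (n - 1 - k) * \<tau>) (r k)) = S (real (Suc n - 1 - k) * \<tau>) (r k)" if "k < n" for k
      proof -
        have eq: "real (Suc n - 1 - k) * \<tau> = \<tau> + real (n - 1 - k) * \<tau>"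
        proof -
          have "Suc n - 1 - k = Suc (n - 1 - k)" using that by simp
          then show ?thesis by (simp add: algebra_simps)
        qed
        show ?thesis unfolding eq by (rule S_add[symmetric]) (use \<tau> in auto)
      qed
      then show ?thesis using \<tau> by (simp add: S_sum)
    qed
    also have "r n = S (real (Suc n - 1 - n) * \<tau>) (r n)" by simp
    finally show ?case by simp
  qed (simp add: e0)
  have eq: "S (c * \<tau>) (e N) = (\<Sum>n<N. S (c * \<tau>) (S (real (N - 1 - n) * \<tau>) (r n)))"
    unfolding rep[OF order_refl] using ct by (intro S_sum)
  have tm: "S (c * \<tau>) (S (real (N - 1 - n) * \<tau>) (r n)) \<in> Y \<and>
      nY (S (c * \<tau>) (S (real (N - 1 - n) * \<tau>) (r n))) \<le> P * (1 + 2 * C1) * (\<tau> * (real (N - n) * \<tau>) powr - \<alpha> * \<rho> n)"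
    if n: "n < N" for n
  proof (cases "n = N - 1")
    \<comment> \<open>The latest residual has only the time \<open>c * \<tau>\<close> in front,
      possibly 0, so its own bound in Y is used.\<close>
    case True
    then have "N - n = 1" using n by simp
    then have "\<tau> * (real (N - n) * \<tau>) powr - \<alpha> = \<tau> powr (1 - \<alpha>)"
      using \<tau> powr_add[of \<tau> 1 "- \<alpha>"] by simp
    moreover have "P * (\<tau> powr (1 - \<alpha>) * \<rho> n) \<le> P * (1 + 2 * C1) * (\<tau> powr (1 - \<alpha>) * \<rho> n)"
      using P \<rho>[OF n] constants_nonneg by (intro mult_right_mono) (auto simp: mult_le_cancel_left1)
    ultimately show ?thesis using r(2)[OF n c] True by (simp add: order_trans)
  next
    case False
    define j where "j = N - 1 - n"
    have j: "1 \<le> j" "N - n = j + 1" "j < N" using n False by (auto simp: j_def)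
    define s where "s = c * \<tau> + real j * \<tau>"
    have jt: "0 < real j * \<tau>" "real j * \<tau> \<le> s" using j \<tau> ct by (auto simp: s_def)
    have "real j * \<tau> \<le> real N * \<tau>" using j \<tau> by (intro mult_right_mono) auto
    then have s: "0 < s" "s + 1 \<le> Tm" using jt ct N by (auto simp: s_def)
    have eq1: "S (c * \<tau>) (S (real (N - 1 - n) * \<tau>) (r n)) = S s (r n)"
      unfolding s_def j_def[symmetric] by (rule S_add[symmetric]) (use ct jt in auto)
    have s1: "S s (r n) \<in> Y" "nY (S s (r n)) \<le> C1 * s powr - \<alpha> * norm (r n)"
      using S_smoothing[OF s] by auto
    \<comment> \<open>The available time is \<open>j * \<tau>\<close> although the kernel asks for
      \<open>(j + 1) * \<tau>\<close>; since j is at least 1, this costs a factor 2 at most.\<close>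
    have "s powr - \<alpha> \<le> 2 * (real (N - n) * \<tau>) powr - \<alpha>"
    proof -
      have p: "0 < real (N - n) * \<tau>" "real (N - n) * \<tau> / 2 \<le> s"
      proof -
        show "0 < real (N - n) * \<tau>" using n \<tau> by simp
        have "real (N - n) * \<tau> = real j * \<tau> + \<tau>" using j by (simp add: algebra_simps)
        also have "\<dots> \<le> 2 * (real j * \<tau>)" using j \<tau> mult_right_mono[of 1 "real j" \<tau>] by simp
        finally show "real (N - n) * \<tau> / 2 \<le> s" using jt by linarith
      qed
      have "s powr - \<alpha> \<le> (real (N - n) * \<tau> / 2) powr - \<alpha>" using p \<alpha> by (intro powr_mono2') linarith+
      also have "\<dots> = (real (N - n) * \<tau>) powr - \<alpha> * 2 powr \<alpha>"
      proof -
        have "(x / 2) powr - \<alpha> = x powr - \<alpha> * 2 powr \<alpha>" if "0 < x" for x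
          using that by (simp add: powr_divide powr_minus field_simps)
        from this[OF p(1)] show ?thesis .
      qed
      also have "\<dots> \<le> (real (N - n) * \<tau>) powr - \<alpha> * 2"
        using powr_mono[of \<alpha> 1 "2::real"] \<alpha> by (intro mult_left_mono) auto
      finally show ?thesis by simp
    qed
    then have "C1 * s powr - \<alpha> * norm (r n) \<le> C1 * (2 * (real (N - n) * \<tau>) powr - \<alpha>) * (P * (\<tau> * \<rho> n))"
      using constants_nonneg r(1)[OF n] by (intro mult_mono mult_nonneg_nonneg) auto
    also have "\<dots> = P * (2 * C1) * (\<tau> * (real (N - n) * \<tau>) powr - \<alpha> * \<rho> n)" by simp
    also have "\<dots> \<le> P * (1 + 2 * C1) * (\<tau> * (real (N - n) * \<tau>) powr - \<alpha> * \<rho> n)"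
      using P \<rho>[OF n] \<tau> by (intro mult_right_mono mult_left_mono) auto
    finally show ?thesis unfolding eq1 using s1 by linarith
  qed
  have "nY (S (c * \<tau>) (e N)) \<le> (\<Sum>n<N. nY (S (c * \<tau>) (S (real (N - 1 - n) * \<tau>) (r n))))"
    unfolding eq by (rule nY_sum) (use tm in auto)
  also have "\<dots> \<le> (\<Sum>n<N. P * (1 + 2 * C1) * (\<tau> * (real (N - n) * \<tau>) powr - \<alpha> * \<rho> n))"
    by (rule sum_mono) (use tm in auto)
  also have "\<dots> = P * (1 + 2 * C1) * (\<Sum>n<N. \<tau> * (real (N - n) * \<tau>) powr - \<alpha> * \<rho> n)"
    by (simp only: sum_distrib_left)
  finally have "nY (S (c * \<tau>) (e N)) \<le> P * (1 + 2 * C1) * (\<Sum>n<N. \<tau> * (real (N - n) * \<tau>) powr - \<alpha> * \<rho> n)" .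
  moreover have "S (c * \<tau>) (e N) \<in> Y" unfolding eq by (rule Y_sum) (use tm in auto)
  ultimately show ?thesis by simp
qed

end

section \<open>The mild solution and the local error\<close>

text \<open>The margin in \<open>T + 3 \<le> Tm\<close> accommodates the times beyond T in the
  estimates: \<open>\<sigma> < 1\<close> from the interpolation norm and
  \<open>c * \<tau> \<le> 1\<close> from the stages. \<open>Ku\<close> expresses the regularity of
  u0: the second embedding of Y if \<open>\<alpha> > 0\<close>, mere smoothing of the semigroup if
  \<open>\<alpha> = 0\<close>.\<close>

locale semilinear = intermediate_scale S V Tm C \<alpha> Y nY CE
  for S V :: "real \<Rightarrow> 'a::complex_banach \<Rightarrow> 'a" and Tm C \<alpha> :: real and Y :: "'a set" and nY :: "'a \<Rightarrow> real" and CE :: real +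
  fixes f :: "real \<Rightarrow> 'a \<Rightarrow> 'a" and T :: real and u0 :: 'a and u :: "real \<Rightarrow> 'a" and Ku :: real
  assumes T: "0 < T" "T + 3 \<le> Tm"
    and lip: "\<forall>R>0. \<exists>L. \<forall>t1\<in>{0..T}. \<forall>t2\<in>{0..T}. \<forall>v1\<in>Y. \<forall>v2\<in>Y. max (nY v1) (nY v2) \<le> R \<longrightarrow>
           norm (f t1 v1 - f t2 v2) \<le> L * (\<bar>t1 - t2\<bar> + nY (v1 - v2))"
    and u0: "u0 \<in> Y"
    and mild: "mild_solution S Y nY f u0 T u"
    and Ku: "0 \<le> Ku" "\<And>\<sigma>. 0 < \<sigma> \<Longrightarrow> \<sigma> \<le> Tm \<Longrightarrow> norm (V \<sigma> u0) \<le> Ku * \<sigma> powr (\<alpha> - 1)"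
begin

definition g :: "real \<Rightarrow> 'a" where "g \<xi> = f \<xi> (u \<xi>)"

lemma u_in_Y: "t \<in> {0..T} \<Longrightarrow> u t \<in> Y"
  using mild by (simp add: mild_solution_def)

lemma u_mild: "t \<in> {0..T} \<Longrightarrow> ((\<lambda>\<xi>. S (t - \<xi>) (g \<xi>)) has_integral (u t - S t u0)) {0..t}"
  using mild by (simp add: mild_solution_def g_def)

lemma u_zero: "u 0 = u0"
proof -
  have "((\<lambda>\<xi>. S (0 - \<xi>) (g \<xi>)) has_integral (u 0 - S 0 u0)) {0..0}" using u_mild[of 0] T by simp
  moreover have "((\<lambda>\<xi>. S (0 - \<xi>) (g \<xi>)) has_integral 0) {0..0}"
    using has_integral_refl(1)[of "\<lambda>\<xi>. S (0 - \<xi>) (g \<xi>)" 0] by simp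
  ultimately have "u 0 - S 0 u0 = 0" by (rule has_integral_unique)
  then show ?thesis by simp
qed

text \<open>The essential bound holds at points arbitrarily close to t from the left, and continuity
  at t > 0 transfers it up to an additional 1; the time 0 is covered by u0.\<close>

lemma u_bounded: "\<exists>R\<ge>0. \<forall>t\<in>{0..T}. nY (u t) \<le> R"
proof -
  obtain K where K: "AE t in lebesgue_on {0<..<T}. nY (u t) \<le> K"
    and cont: "\<And>t. t \<in> {0<..T} \<Longrightarrow> ((\<lambda>s. nY (u s - u t)) \<longlongrightarrow> 0) (at t within {0<..T})"
    using mild unfolding mild_solution_def by blast
  have pos: "nY (u t) \<le> K + 1" if t: "t \<in> {0<..T}" for t
  proof -
    from order_tendstoD(2)[OF cont[OF t], of 1]
    obtain d where d: "0 < d" "\<And>s. s \<in> {0<..T} \<Longrightarrow> s \<noteq> t \<Longrightarrow> dist s t < d \<Longrightarrow> nY (u s - u t) < 1"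
      unfolding eventually_at by auto
    obtain s where s: "s \<in> {max 0 (t - d)<..<t}" "nY (u s) \<le> K"
      using AE_lebesgue_on_ex[OF K, of "max 0 (t - d)" t] t d by auto
    have su: "u s \<in> Y" "u t \<in> Y" using s t by (auto intro!: u_in_Y)
    have "nY (u t) = nY (u s - (u s - u t))" by simp
    also have "\<dots> \<le> nY (u s) + nY (u s - u t)" by (intro nY_diff su Y_diff)
    also have "\<dots> \<le> K + 1"
      using s d(2)[of s] t by (auto simp: dist_real_def)
    finally show ?thesis .
  qed
  have "\<forall>t\<in>{0..T}. nY (u t) \<le> max (nY u0) (max (K + 1) 0)"
  proof
    fix t assume t: "t \<in> {0..T}"
    show "nY (u t) \<le> max (nY u0) (max (K + 1) 0)"
    proof (cases "t = 0")
      case True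
      then show ?thesis by (simp add: u_zero)
    next
      case False
      with t have "t \<in> {0<..T}" by simp
      from pos[OF this] show ?thesis by simp
    qed
  qed
  then show ?thesis by (intro exI[of _ "max (nY u0) (max (K + 1) 0)"]) auto
qed

definition Ru where "Ru = (SOME R. 0 \<le> R \<and> (\<forall>t\<in>{0..T}. nY (u t) \<le> R))"

lemma Ru: "0 \<le> Ru" "t \<in> {0..T} \<Longrightarrow> nY (u t) \<le> Ru"
proof -
  have "\<exists>R. 0 \<le> R \<and> (\<forall>t\<in>{0..T}. nY (u t) \<le> R)" using u_bounded by blast
  from someI_ex[OF this] show "0 \<le> Ru" "t \<in> {0..T} \<Longrightarrow> nY (u t) \<le> Ru" by (auto simp: Ru_def)
qed

text \<open>The radius exceeds \<open>Ru\<close> by one unit for the global error and one for the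
  stage error, so that all arguments of f lie in the ball.\<close>

definition L where "L = (SOME L. 0 \<le> L \<and> (\<forall>t1\<in>{0..T}. \<forall>t2\<in>{0..T}. \<forall>v1\<in>Y. \<forall>v2\<in>Y. max (nY v1) (nY v2) \<le> Ru + 2 \<longrightarrow>
           norm (f t1 v1 - f t2 v2) \<le> L * (\<bar>t1 - t2\<bar> + nY (v1 - v2))))"

lemma L: "0 \<le> L"
  and f_lipschitz: "t1 \<in> {0..T} \<Longrightarrow> t2 \<in> {0..T} \<Longrightarrow> v1 \<in> Y \<Longrightarrow> v2 \<in> Y \<Longrightarrow> nY v1 \<le> Ru + 2 \<Longrightarrow> nY v2 \<le> Ru + 2
    \<Longrightarrow> norm (f t1 v1 - f t2 v2) \<le> L * (\<bar>t1 - t2\<bar> + nY (v1 - v2))"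
proof -
  have "0 < Ru + 2" using Ru(1) by simp
  with lip obtain L' where L': "\<forall>t1\<in>{0..T}. \<forall>t2\<in>{0..T}. \<forall>v1\<in>Y. \<forall>v2\<in>Y. max (nY v1) (nY v2) \<le> Ru + 2 \<longrightarrow>
           norm (f t1 v1 - f t2 v2) \<le> L' * (\<bar>t1 - t2\<bar> + nY (v1 - v2))" by blast
  have "\<exists>L. 0 \<le> L \<and> (\<forall>t1\<in>{0..T}. \<forall>t2\<in>{0..T}. \<forall>v1\<in>Y. \<forall>v2\<in>Y. max (nY v1) (nY v2) \<le> Ru + 2 \<longrightarrow>
           norm (f t1 v1 - f t2 v2) \<le> L * (\<bar>t1 - t2\<bar> + nY (v1 - v2)))"
  proof (intro exI[of _ "max L' 0"] conjI ballI impI)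
    fix t1 t2 v1 v2 assume a: "t1 \<in> {0..T}" "t2 \<in> {0..T}" "v1 \<in> Y" "v2 \<in> Y" "max (nY v1) (nY v2) \<le> Ru + 2"
    have "norm (f t1 v1 - f t2 v2) \<le> L' * (\<bar>t1 - t2\<bar> + nY (v1 - v2))" using L' a by blast
    also have "\<dots> \<le> max L' 0 * (\<bar>t1 - t2\<bar> + nY (v1 - v2))"
      using a nY_nonneg[OF Y_diff] by (intro mult_right_mono) auto
    finally show "norm (f t1 v1 - f t2 v2) \<le> max L' 0 * (\<bar>t1 - t2\<bar> + nY (v1 - v2))" .
  qed simp
  from someI_ex[OF this]
  show "0 \<le> L" "t1 \<in> {0..T} \<Longrightarrow> t2 \<in> {0..T} \<Longrightarrow> v1 \<in> Y \<Longrightarrow> v2 \<in> Y \<Longrightarrow> nY v1 \<le> Ru + 2 \<Longrightarrow> nY v2 \<le> Ru + 2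
    \<Longrightarrow> norm (f t1 v1 - f t2 v2) \<le> L * (\<bar>t1 - t2\<bar> + nY (v1 - v2))"
    unfolding L_def by auto
qed

definition G where "G = norm (f 0 0) + L * (T + (Ru + 2))"

lemma G_nonneg: "0 \<le> G"
  using L T Ru(1) by (simp add: G_def)

lemma f_bounded:
  assumes "t \<in> {0..T}" "v \<in> Y" "nY v \<le> Ru + 2"
  shows "norm (f t v) \<le> G"
proof -
  have "norm (f t v - f 0 0) \<le> L * (\<bar>t - 0\<bar> + nY (v - 0))"
    using assms T Ru(1) zero_in_Y nY_zero by (intro f_lipschitz) auto
  also have "\<dots> \<le> L * (T + (Ru + 2))"
    using assms L by (intro mult_left_mono add_mono) auto
  finally show ?thesis unfolding G_def using norm_triangle_sub[of "f t v" "f 0 0"] by linarith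
qed

lemma g_bounded: "t \<in> {0..T} \<Longrightarrow> norm (g t) \<le> G"
  unfolding g_def using Ru(2)[of t] by (intro f_bounded u_in_Y) auto

lemma g_lipschitz:
  assumes "s \<in> {0..T}" "t \<in> {0..T}"
  shows "norm (g s - g t) \<le> L * (\<bar>s - t\<bar> + nY (u s - u t))"
  unfolding g_def using Ru(2)[OF assms(1)] Ru(2)[OF assms(2)] by (intro f_lipschitz u_in_Y assms) auto

text \<open>Applying \<open>S \<sigma>\<close> to the mild formula at t and subtracting it from the
  formula at \<open>t + \<sigma>\<close> restarts the solution at t.\<close>

lemma u_flow:
  assumes "0 \<le> t" "0 \<le> \<sigma>" "t + \<sigma> \<le> T"
  shows "((\<lambda>\<xi>. S (t + \<sigma> - \<xi>) (g \<xi>)) has_integral (u (t + \<sigma>) - S \<sigma> (u t))) {t..t + \<sigma>}"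
proof -
  let ?h = "\<lambda>\<xi>. S (t + \<sigma> - \<xi>) (g \<xi>)"
  have I: "(?h has_integral (u (t + \<sigma>) - S (t + \<sigma>) u0)) {0..t + \<sigma>}" using u_mild[of "t + \<sigma>"] assms by simp
  have "((S \<sigma> \<circ> (\<lambda>\<xi>. S (t - \<xi>) (g \<xi>))) has_integral S \<sigma> (u t - S t u0)) {0..t}"
    by (rule has_integral_linear[OF u_mild S_bounded_linear]) (use assms in auto)
  then have I1: "(?h has_integral S \<sigma> (u t - S t u0)) {0..t}"
  proof (rule has_integral_eq[rotated])
    fix \<xi> assume "\<xi> \<in> {0..t}"
    then show "(S \<sigma> \<circ> (\<lambda>\<xi>. S (t - \<xi>) (g \<xi>))) \<xi> = ?h \<xi>"
      using assms S_add[of \<sigma> "t - \<xi>" "g \<xi>"] by (simp add: algebra_simps)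
  qed
  have i2: "?h integrable_on {t..t + \<sigma>}"
    using assms by (intro integrable_subinterval_real[OF has_integral_integrable[OF I]]) auto
  have "integral {0..t} ?h + integral {t..t + \<sigma>} ?h = integral {0..t + \<sigma>} ?h"
    using assms has_integral_integrable[OF I] by (intro Henstock_Kurzweil_Integration.integral_combine) auto
  then have "integral {t..t + \<sigma>} ?h = (u (t + \<sigma>) - S (t + \<sigma>) u0) - S \<sigma> (u t - S t u0)"
    unfolding integral_unique[OF I] integral_unique[OF I1] by (simp add: eq_diff_eq add.commute)
  also have "\<dots> = u (t + \<sigma>) - S \<sigma> (u t)"
    using assms S_add[of \<sigma> t u0] by (simp add: S_minus add.commute)
  finally show ?thesis using i2 by (simp add: has_integral_iff)
qed

lemma u_difference:
  assumes st: "0 < s" "s < t" "t \<le> s + 1" "t \<le> T" and \<epsilon>: "0 < \<epsilon>" "\<epsilon> \<le> 1" "\<alpha> \<le> \<epsilon>"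
  shows "nY (u t - u s) \<le> C4 * Ku * ((t - s) / s) + C5 * G * ((t - s) powr (1 - \<epsilon>) / \<epsilon>)"
proof -
  let ?I = "\<lambda>r. integral {0..r} (\<lambda>\<xi>. S (r - \<xi>) (g \<xi>))"
  have 1: "S t u0 - S s u0 \<in> Y \<and> nY (S t u0 - S s u0) \<le> C4 * Ku * ((t - s) / s)"
    by (rule S_difference[OF Ku]) (use st T in auto)
  have 2: "?I t - ?I s \<in> Y \<and> nY (?I t - ?I s) \<le> C5 * G * ((t - s) powr (1 - \<epsilon>) / \<epsilon>)"
    by (rule convolution_difference[OF st(1-3)])
      (use st T \<epsilon> u_mild[of t] u_mild[of s] g_bounded in \<open>auto simp: has_integral_iff\<close>)
  have "u r = S r u0 + ?I r" if "r \<in> {0..T}" for r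
    using u_mild[OF that] by (simp add: has_integral_iff)
  from this[of t] this[of s] st have "u t - u s = (S t u0 - S s u0) + (?I t - ?I s)" by simp
  with 1 2 show ?thesis using nY_add[of "S t u0 - S s u0" "?I t - ?I s"] by simp
qed

end

section \<open>Internal stages and one step of the method\<close>

locale eerk_problem = semilinear S V Tm C \<alpha> Y nY CE f T u0 u Ku
  for S V :: "real \<Rightarrow> 'a::complex_banach \<Rightarrow> 'a" and Tm C \<alpha> :: real and Y :: "'a set" and nY :: "'a \<Rightarrow> real" and CE :: real
    and f :: "real \<Rightarrow> 'a \<Rightarrow> 'a" and T :: real and u0 :: 'a and u :: "real \<Rightarrow> 'a" and Ku :: real +
  fixes m :: eerk
  assumes m: "eerk_method m" and weights: "\<forall>z. (\<Sum>i\<in>{1..stages m}. b_fun m i z) = phi 1 z"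
begin

abbreviation "stg \<equiv> {1..stages m}"

lemma node: "i \<in> stg \<Longrightarrow> 0 \<le> node m i" "i \<in> stg \<Longrightarrow> node m i \<le> 1"
  using m by (auto simp: eerk_method_def)

definition Pm where "Pm = (SOME P. 0 \<le> P \<and> (\<forall>i\<in>stg. \<forall>\<tau>. 0 < \<tau> \<and> \<tau> \<le> 1 \<longrightarrow> tame P \<tau> (b_op S m i \<tau>)) \<and>
    (\<forall>i\<in>stg. \<forall>j\<in>stg. \<forall>\<tau>. 0 < \<tau> \<and> \<tau> \<le> 1 \<longrightarrow> tame P \<tau> (a_op S m i j \<tau>)))"

lemma Pm: "0 \<le> Pm"
  and tame_b: "i \<in> stg \<Longrightarrow> 0 < \<tau> \<Longrightarrow> \<tau> \<le> 1 \<Longrightarrow> tame Pm \<tau> (b_op S m i \<tau>)"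
  and tame_a: "i \<in> stg \<Longrightarrow> j \<in> stg \<Longrightarrow> 0 < \<tau> \<Longrightarrow> \<tau> \<le> 1 \<Longrightarrow> tame Pm \<tau> (a_op S m i j \<tau>)"
proof -
  have Tm3: "3 \<le> Tm" using T by simp
  obtain P1 where P1: "0 \<le> P1" "\<forall>i\<in>stg. \<forall>\<tau>. 0 < \<tau> \<and> \<tau> \<le> 1 \<longrightarrow> tame P1 \<tau> (b_op S m i \<tau>)"
    using tame_uniform[of stg "b_op S m"] tame_b_op[OF Tm3] by auto
  obtain P2 where P2: "0 \<le> P2" "\<forall>p\<in>stg \<times> stg. \<forall>\<tau>. 0 < \<tau> \<and> \<tau> \<le> 1 \<longrightarrow> tame P2 \<tau> (a_op S m (fst p) (snd p) \<tau>)"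
    using tame_uniform[of "stg \<times> stg" "\<lambda>p. a_op S m (fst p) (snd p)"] tame_a_op[OF Tm3 m] by auto
  have "0 \<le> P1 + P2 \<and> (\<forall>i\<in>stg. \<forall>\<tau>. 0 < \<tau> \<and> \<tau> \<le> 1 \<longrightarrow> tame (P1 + P2) \<tau> (b_op S m i \<tau>)) \<and>
    (\<forall>i\<in>stg. \<forall>j\<in>stg. \<forall>\<tau>. 0 < \<tau> \<and> \<tau> \<le> 1 \<longrightarrow> tame (P1 + P2) \<tau> (a_op S m i j \<tau>))"
  proof (intro conjI ballI allI impI)
    show "tame (P1 + P2) \<tau> (b_op S m i \<tau>)" if "i \<in> stg" "0 < \<tau> \<and> \<tau> \<le> 1" for i \<tau>
      by (rule tame_mono[of P1]) (use P1 P2 that in auto)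
    show "tame (P1 + P2) \<tau> (a_op S m i j \<tau>)" if "i \<in> stg" "j \<in> stg" "0 < \<tau> \<and> \<tau> \<le> 1" for i j \<tau>
      by (rule tame_mono[of P2]) (use P1(1) P2(2)[rule_format, of "(i, j)" \<tau>] that in auto)
  qed (use P1 P2 in auto)
  from someI[of "\<lambda>P. 0 \<le> P \<and> (\<forall>i\<in>stg. \<forall>\<tau>. 0 < \<tau> \<and> \<tau> \<le> 1 \<longrightarrow> tame P \<tau> (b_op S m i \<tau>)) \<and>
    (\<forall>i\<in>stg. \<forall>j\<in>stg. \<forall>\<tau>. 0 < \<tau> \<and> \<tau> \<le> 1 \<longrightarrow> tame P \<tau> (a_op S m i j \<tau>))", OF this]
  show "0 \<le> Pm" "i \<in> stg \<Longrightarrow> 0 < \<tau> \<Longrightarrow> \<tau> \<le> 1 \<Longrightarrow> tame Pm \<tau> (b_op S m i \<tau>)"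
    "i \<in> stg \<Longrightarrow> j \<in> stg \<Longrightarrow> 0 < \<tau> \<Longrightarrow> \<tau> \<le> 1 \<Longrightarrow> tame Pm \<tau> (a_op S m i j \<tau>)"
    unfolding Pm_def by auto
qed

definition Cst where "Cst = real (stages m) * Pm * G + C2 * G"

lemma Cst_nonneg: "0 \<le> Cst"
  using Pm G_nonneg constants_nonneg by (simp add: Cst_def)

text \<open>A crude comparison suffices: the sum over earlier stages and the exact convolution are
  not subtracted but bounded separately by multiples of \<open>\<tau> powr (1 - \<alpha>)\<close>,
  the two summands of \<open>Cst\<close>. The induction over the stages supplies
  \<open>norm (F j) \<le> G\<close>, because earlier stages lie in the ball of radius
  \<open>Ru + 2\<close>.\<close>

lemma stage_error:
  assumes \<tau>: "0 < \<tau>" "\<tau> \<le> 1" and t: "0 \<le> t" "t + \<tau> \<le> T"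
    and X: "X \<le> 1" and small: "Cst * \<tau> powr (1 - \<alpha>) \<le> 1"
    and w: "\<And>c. 0 \<le> c \<Longrightarrow> c \<le> 1 \<Longrightarrow> S (c * \<tau>) (w - u t) \<in> Y \<and> nY (S (c * \<tau>) (w - u t)) \<le> X"
    and i: "i \<in> stg"
  shows "eerk_stage S f m \<tau> t w i \<in> Y
    \<and> nY (eerk_stage S f m \<tau> t w i - u (t + node m i * \<tau>)) \<le> X + Cst * \<tau> powr (1 - \<alpha>)
    \<and> nY (eerk_stage S f m \<tau> t w i) \<le> Ru + 2"
  using i
proof (induction i rule: less_induct)
  case (less i)
  let ?U = "eerk_stage S f m \<tau> t w"
  define c where "c = node m i * \<tau>"
  have nd: "0 \<le> node m i" "node m i \<le> 1" using node less.prems by auto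
  have c: "0 \<le> c" "c \<le> \<tau>" using nd \<tau> by (auto simp: c_def mult_left_le_one_le)
  define F where "F j = f (t + node m j * \<tau>) (?U j)" for j
  have ndt: "t + node m j * \<tau> \<in> {0..T}" if "j \<in> stg" for j
  proof -
    have "node m j * \<tau> \<le> 1 * \<tau>" using node[OF that] \<tau> by (intro mult_right_mono) auto
    moreover have "0 \<le> node m j * \<tau>" using node[OF that] \<tau> by simp
    ultimately have "t + node m j * \<tau> \<le> T" "0 \<le> t + node m j * \<tau>" using t by linarith+
    then show ?thesis by simp
  qed
  have F: "norm (F j) \<le> G" if j: "j \<in> {1..<i}" for j
  proof -
    have "j \<in> stg" "j < i" using j less.prems by auto
    then show ?thesis unfolding F_def using less.IH[of j] ndt[of j] by (intro f_bounded) auto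
  qed
  have A: "a_op S m i j \<tau> (F j) \<in> Y \<and> nY (a_op S m i j \<tau> (F j)) \<le> Pm * \<tau> powr - \<alpha> * G" if j: "j \<in> {1..<i}" for j
  proof -
    have "j \<in> stg" using j less.prems by auto
    from tame_a[OF less.prems this \<tau>] have "a_op S m i j \<tau> (F j) \<in> Y \<and> nY (a_op S m i j \<tau> (F j)) \<le> Pm * \<tau> powr - \<alpha> * norm (F j)"
      unfolding tame_def by (metis S_zero mult_zero_left order_refl zero_le_one)
    moreover have "Pm * \<tau> powr - \<alpha> * norm (F j) \<le> Pm * \<tau> powr - \<alpha> * G" using F[OF j] Pm by (intro mult_left_mono) auto
    ultimately show ?thesis by auto
  qed
  define I where "I = integral {t..t + c} (\<lambda>\<xi>. S (t + c - \<xi>) (g \<xi>))"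
  have flow: "((\<lambda>\<xi>. S (t + c - \<xi>) (g \<xi>)) has_integral (u (t + c) - S c (u t))) {t..t + c}"
    by (rule u_flow) (use t c in auto)
  have I: "I \<in> Y \<and> nY I \<le> C2 * G * \<tau> powr (1 - \<alpha>)"
  proof (cases "c = 0")
    case True
    then have "I = 0" by (simp add: I_def)
    then show ?thesis using zero_in_Y nY_zero constants_nonneg G_nonneg by simp
  next
    case False
    have "I \<in> Y" "nY I \<le> C2 * (G / 1) * (1 * (t + c - t)) powr (1 - \<alpha>)"
      using convolution_smoothing(2,3)[of 1 0 t "t + c" g G] False c t \<tau> T g_bounded has_integral_integrable[OF flow]
      by (auto simp: I_def)
    moreover have "c powr (1 - \<alpha>) \<le> \<tau> powr (1 - \<alpha>)" using c \<alpha> by (intro powr_mono2) auto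
    then have "C2 * G * c powr (1 - \<alpha>) \<le> C2 * G * \<tau> powr (1 - \<alpha>)"
      using constants_nonneg G_nonneg by (intro mult_left_mono) auto
    ultimately show ?thesis by simp
  qed
  have U: "?U i = S c w + \<tau> *\<^sub>R (\<Sum>j\<in>{1..<i}. a_op S m i j \<tau> (F j))"
    by (subst eerk_stage.simps) (simp add: c_def F_def)
  have uc: "u (t + c) = S c (u t) + I" using integral_unique[OF flow] by (simp add: I_def)
  have eq: "?U i - u (t + c) = S c (w - u t) + (\<tau> *\<^sub>R (\<Sum>j\<in>{1..<i}. a_op S m i j \<tau> (F j)) - I)"
    unfolding U uc using c by (simp add: S_minus)
  have Ys: "(\<Sum>j\<in>{1..<i}. a_op S m i j \<tau> (F j)) \<in> Y" using A by (intro Y_sum) auto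
  have "nY (\<Sum>j\<in>{1..<i}. a_op S m i j \<tau> (F j)) \<le> (\<Sum>j\<in>{1..<i}. nY (a_op S m i j \<tau> (F j)))" using A by (intro nY_sum) auto
  also have "\<dots> \<le> (\<Sum>j\<in>{1..<i}. Pm * \<tau> powr - \<alpha> * G)" using A by (intro sum_mono) auto
  also have "\<dots> = real (i - 1) * (Pm * \<tau> powr - \<alpha> * G)" by simp
  also have "\<dots> \<le> real (stages m) * (Pm * \<tau> powr - \<alpha> * G)"
    using less.prems Pm G_nonneg by (intro mult_right_mono) auto
  finally have "nY (\<tau> *\<^sub>R (\<Sum>j\<in>{1..<i}. a_op S m i j \<tau> (F j))) \<le> \<tau> * (real (stages m) * (Pm * \<tau> powr - \<alpha> * G))"
    unfolding nY_scaleR[OF Ys] using \<tau> by (auto intro: mult_left_mono)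
  also have "\<dots> = real (stages m) * Pm * G * \<tau> powr (1 - \<alpha>)"
    using \<tau> powr_add[of \<tau> 1 "- \<alpha>"] by simp
  finally have n1: "nY (\<tau> *\<^sub>R (\<Sum>j\<in>{1..<i}. a_op S m i j \<tau> (F j))) \<le> real (stages m) * Pm * G * \<tau> powr (1 - \<alpha>)" .
  have Sw: "S c (w - u t) \<in> Y \<and> nY (S c (w - u t)) \<le> X" using w[OF nd] by (simp add: c_def)
  have D: "?U i - u (t + c) \<in> Y" unfolding eq using Sw Ys I by (intro Y_add Y_diff Y_scaleR) auto
  have "nY (?U i - u (t + c)) \<le> nY (S c (w - u t)) + (nY (\<tau> *\<^sub>R (\<Sum>j\<in>{1..<i}. a_op S m i j \<tau> (F j))) + nY I)"
    unfolding eq using Sw Ys I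
    by (intro order_trans[OF nY_add] add_left_mono nY_diff Y_diff Y_scaleR) auto
  also have "\<dots> \<le> X + (real (stages m) * Pm * G * \<tau> powr (1 - \<alpha>) + C2 * G * \<tau> powr (1 - \<alpha>))"
    using Sw n1 I by (intro add_mono) auto
  also have "\<dots> = X + Cst * \<tau> powr (1 - \<alpha>)" by (simp add: Cst_def distrib_right)
  finally have n: "nY (?U i - u (t + c)) \<le> X + Cst * \<tau> powr (1 - \<alpha>)" .
  have ut: "u (t + c) \<in> Y" "nY (u (t + c)) \<le> Ru" using t c by (auto intro!: u_in_Y Ru)
  have e: "?U i = (?U i - u (t + c)) + u (t + c)" by simp
  have "?U i \<in> Y" by (subst e) (intro Y_add D ut)
  moreover have "nY (?U i) \<le> nY (?U i - u (t + c)) + nY (u (t + c))"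
    by (subst e) (intro nY_add D ut)
  then have "nY (?U i) \<le> Ru + 2" using n X small ut by linarith
  ultimately show ?case using n by (simp add: c_def)
qed

text \<open>Exchanging the sums leaves the column sums of the coefficients, which vanish except for
  k = 1.\<close>

lemma sum_b_op:
  assumes "0 < \<tau>" "\<tau> \<le> Tm"
  shows "(\<Sum>i\<in>stg. b_op S m i \<tau> x) = phi_op S 1 \<tau> x"
proof -
  have "(\<Sum>i\<in>stg. b_op S m i \<tau> x) = (\<Sum>k\<le>maxphi m. \<Sum>i\<in>stg. bcoef m i k *\<^sub>C phi_op S k \<tau> x)"
    unfolding b_op_def by (rule sum.swap)
  also have "\<dots> = (\<Sum>k\<le>maxphi m. (\<Sum>i\<in>stg. bcoef m i k) *\<^sub>C phi_op S k \<tau> x)"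
    by (simp only: scaleC.sum_left)
  also have "\<dots> = (\<Sum>k\<le>maxphi m. if k = 1 then phi_op S k \<tau> x else 0)"
  proof (rule sum.cong[OF refl])
    fix k assume "k \<in> {..maxphi m}"
    then have "(\<Sum>i\<in>stg. bcoef m i k) = (if k = 1 then 1 else 0)"
      using sum_b_coefficients(2)[OF weights] by (simp only: atMost_iff)
    then show "(\<Sum>i\<in>stg. bcoef m i k) *\<^sub>C phi_op S k \<tau> x = (if k = 1 then phi_op S k \<tau> x else 0)"
      by (simp only:) (simp add: scaleC.zero_left)
  qed
  also have "\<dots> = phi_op S 1 \<tau> x"
    using sum_b_coefficients(1)[OF weights] by (subst sum.delta) auto
  finally show ?thesis .
qed

lemma b_op_minus:
  assumes "0 < \<tau>" "\<tau> \<le> Tm"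
  shows "b_op S m i \<tau> x = b_op S m i \<tau> (x - y) + b_op S m i \<tau> y"
proof -
  have "phi_op S k \<tau> x = phi_op S k \<tau> (x - y) + phi_op S k \<tau> y" for k
    using phi_op_add[OF assms, of k "x - y" y] by simp
  then show ?thesis by (simp add: b_op_def scaleC_add_right sum.distrib[symmetric])
qed

text \<open>The condition \<open>\<Sum>i. b i z = phi 1 z\<close> makes the method exact for constant right-hand sides, so that
  only differences with \<open>g t\<close> enter the local error.\<close>

lemma step_error:
  assumes \<tau>: "0 < \<tau>" "\<tau> \<le> 1" and t: "0 \<le> t" "t + \<tau> \<le> T"
    and X: "0 \<le> X" "X \<le> 1" and small: "Cst * \<tau> powr (1 - \<alpha>) \<le> 1"
    and w: "\<And>c. 0 \<le> c \<Longrightarrow> c \<le> 1 \<Longrightarrow> S (c * \<tau>) (w - u t) \<in> Y \<and> nY (S (c * \<tau>) (w - u t)) \<le> X"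
    and \<delta>: "\<And>\<xi>. \<xi> \<in> {t..t + \<tau>} \<Longrightarrow> norm (g \<xi> - g t) \<le> \<delta>"
    and \<rho>: "L * (X + Cst * \<tau> powr (1 - \<alpha>)) + \<delta> \<le> \<rho>"
  shows "\<exists>h k. (\<forall>i\<in>stg. norm (h i) \<le> \<rho>) \<and> (\<forall>\<xi>\<in>{t..t + \<tau>}. norm (k \<xi>) \<le> \<rho>) \<and>
     (\<lambda>\<xi>. S (t + \<tau> - \<xi>) (k \<xi>)) integrable_on {t..t + \<tau>} \<and>
     eerk_step S f m \<tau> t w - u (t + \<tau>) = S \<tau> (w - u t) +
       (\<tau> *\<^sub>R (\<Sum>i\<in>stg. b_op S m i \<tau> (h i)) + integral {t..t + \<tau>} (\<lambda>\<xi>. S (t + \<tau> - \<xi>) (k \<xi>)))"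
proof -
  define F where "F i = f (t + node m i * \<tau>) (eerk_stage S f m \<tau> t w i)" for i
  define h where "h i = F i - g t" for i
  define k where "k \<xi> = g t - g \<xi>" for \<xi>
  have \<tau>m: "\<tau> \<le> Tm" using \<tau> T by simp
  have Lc: "0 \<le> L * (X + Cst * \<tau> powr (1 - \<alpha>))" using L X Cst_nonneg by simp
  have h: "norm (h i) \<le> \<rho>" if i: "i \<in> stg" for i
  proof -
    define c where "c = node m i * \<tau>"
    have c: "0 \<le> c" "c \<le> \<tau>" using node[OF i] \<tau> by (auto simp: c_def mult_left_le_one_le)
    note st = stage_error[OF \<tau> t X(2) small w i]
    have "norm (F i - g (t + c)) \<le> L * (\<bar>(t + c) - (t + c)\<bar> + nY (eerk_stage S f m \<tau> t w i - u (t + c)))"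
      unfolding F_def g_def c_def[symmetric] using st c t Ru(2)[of "t + c"] by (intro f_lipschitz u_in_Y) auto
    also have "\<dots> \<le> L * (X + Cst * \<tau> powr (1 - \<alpha>))"
      using st L by (intro mult_left_mono) (auto simp: c_def)
    finally have 1: "norm (F i - g (t + c)) \<le> L * (X + Cst * \<tau> powr (1 - \<alpha>))" .
    have 2: "norm (g (t + c) - g t) \<le> \<delta>" by (rule \<delta>) (use c in auto)
    have "h i = (F i - g (t + c)) + (g (t + c) - g t)" by (simp add: h_def)
    then have "norm (h i) \<le> norm (F i - g (t + c)) + norm (g (t + c) - g t)"
      using norm_triangle_ineq[of "F i - g (t + c)" "g (t + c) - g t"] by simp
    with 1 2 \<rho> show ?thesis by linarith
  qed
  have k: "norm (k \<xi>) \<le> \<rho>" if "\<xi> \<in> {t..t + \<tau>}" for \<xi>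
    using \<delta>[OF that] \<rho> Lc by (simp add: k_def norm_minus_commute)
  have flow: "((\<lambda>\<xi>. S (t + \<tau> - \<xi>) (g \<xi>)) has_integral (u (t + \<tau>) - S \<tau> (u t))) {t..t + \<tau>}"
    by (rule u_flow) (use t \<tau> in auto)
  have const: "((\<lambda>\<xi>. S (t + \<tau> - \<xi>) (g t)) has_integral \<tau> *\<^sub>R phi_op S 1 \<tau> (g t)) {t..t + \<tau>}"
    by (rule scaled_phi_op_1[OF \<tau>(1) \<tau>m])
  have diff: "((\<lambda>\<xi>. S (t + \<tau> - \<xi>) (k \<xi>)) has_integral (\<tau> *\<^sub>R phi_op S 1 \<tau> (g t) - (u (t + \<tau>) - S \<tau> (u t)))) {t..t + \<tau>}"
    by (rule has_integral_eq[OF _ has_integral_diff[OF const flow]]) (simp add: k_def S_minus)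
  have "eerk_step S f m \<tau> t w = S \<tau> w + \<tau> *\<^sub>R (\<Sum>i\<in>stg. b_op S m i \<tau> (F i))"
    by (simp add: eerk_step_def F_def)
  also have "(\<Sum>i\<in>stg. b_op S m i \<tau> (F i)) = (\<Sum>i\<in>stg. b_op S m i \<tau> (h i) + b_op S m i \<tau> (g t))"
    unfolding h_def using b_op_minus[OF \<tau>(1) \<tau>m] by (intro sum.cong) auto
  also have "\<dots> = (\<Sum>i\<in>stg. b_op S m i \<tau> (h i)) + phi_op S 1 \<tau> (g t)"
    unfolding sum.distrib sum_b_op[OF \<tau>(1) \<tau>m] ..
  finally have "eerk_step S f m \<tau> t w - u (t + \<tau>) = S \<tau> (w - u t) +
       (\<tau> *\<^sub>R (\<Sum>i\<in>stg. b_op S m i \<tau> (h i)) + integral {t..t + \<tau>} (\<lambda>\<xi>. S (t + \<tau> - \<xi>) (k \<xi>)))"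
    unfolding integral_unique[OF diff] using \<tau> by (simp add: S_minus scaleR_add_right)
  with h k has_integral_integrable[OF diff] show ?thesis by blast
qed

end

section \<open>The error recursion\<close>

text \<open>Stated for an arbitrary intermediate space, since the same data h and k have to yield
  the error bound in the norm of Y and later in that of Yg.\<close>

lemma (in intermediate_scale) error_from_local:
  assumes \<tau>: "0 < \<tau>" "\<tau> \<le> 1" and Tm: "3 \<le> Tm" and N: "real N * \<tau> + 2 \<le> Tm"
    and B: "\<And>i. i \<in> I \<Longrightarrow> tame P \<tau> (B i)" and P: "0 \<le> P"
    and e0: "e 0 = 0" and \<rho>: "\<And>n. n < N \<Longrightarrow> 0 \<le> \<rho> n"
    and e: "\<And>n. n < N \<Longrightarrow> \<exists>h k. (\<forall>i\<in>I. norm (h i) \<le> \<rho> n) \<and>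
       (\<forall>\<xi>\<in>{real n * \<tau>..real n * \<tau> + \<tau>}. norm (k \<xi>) \<le> \<rho> n) \<and>
       (\<lambda>\<xi>. S (real n * \<tau> + \<tau> - \<xi>) (k \<xi>)) integrable_on {real n * \<tau>..real n * \<tau> + \<tau>} \<and>
       e (Suc n) = S \<tau> (e n) + (\<tau> *\<^sub>R (\<Sum>i\<in>I. B i (h i)) +
         integral {real n * \<tau>..real n * \<tau> + \<tau>} (\<lambda>\<xi>. S (real n * \<tau> + \<tau> - \<xi>) (k \<xi>)))"
    and c: "0 \<le> c" "c \<le> 1"
  shows "S (c * \<tau>) (e N) \<in> Y \<and> nY (S (c * \<tau>) (e N)) \<le>
     (real (card I) * P + C + C2) * (1 + 2 * C1) * (\<Sum>n<N. \<tau> * (real (N - n) * \<tau>) powr - \<alpha> * \<rho> n)"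
proof (rule global_error[where r = "\<lambda>n. e (Suc n) - S \<tau> (e n)" and \<rho> = \<rho> and \<tau> = \<tau> and N = N])
  show "real N * \<tau> + 2 \<le> Tm" by (rule N)
  show "0 \<le> \<rho> n" if "n < N" for n using that by (rule \<rho>)
  show "0 \<le> real (card I) * P + C + C2" using P C_pos constants_nonneg by simp
  fix n assume n: "n < N"
  from e[OF n] obtain h k where h: "\<And>i. i \<in> I \<Longrightarrow> norm (h i) \<le> \<rho> n"
    and k: "\<And>\<xi>. \<xi> \<in> {real n * \<tau>..real n * \<tau> + \<tau>} \<Longrightarrow> norm (k \<xi>) \<le> \<rho> n"
    and i: "(\<lambda>\<xi>. S (real n * \<tau> + \<tau> - \<xi>) (k \<xi>)) integrable_on {real n * \<tau>..real n * \<tau> + \<tau>}"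
    and eq: "e (Suc n) = S \<tau> (e n) + (\<tau> *\<^sub>R (\<Sum>i\<in>I. B i (h i)) +
         integral {real n * \<tau>..real n * \<tau> + \<tau>} (\<lambda>\<xi>. S (real n * \<tau> + \<tau> - \<xi>) (k \<xi>)))"
    by blast
  note le = local_error[OF \<tau> Tm B P h \<rho>[OF n] i k]
  have r: "e (Suc n) - S \<tau> (e n) = \<tau> *\<^sub>R (\<Sum>i\<in>I. B i (h i)) +
         integral {real n * \<tau>..real n * \<tau> + \<tau>} (\<lambda>\<xi>. S (real n * \<tau> + \<tau> - \<xi>) (k \<xi>))"
    unfolding eq by simp
  show "norm (e (Suc n) - S \<tau> (e n)) \<le> (real (card I) * P + C + C2) * (\<tau> * \<rho> n)"
    unfolding r by (rule le(1))
  show "S (c * \<tau>) (e (Suc n) - S \<tau> (e n)) \<in> Y \<and>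
      nY (S (c * \<tau>) (e (Suc n) - S \<tau> (e n))) \<le> (real (card I) * P + C + C2) * (\<tau> powr (1 - \<alpha>) * \<rho> n)"
    if "0 \<le> c" "c \<le> 1" for c
    unfolding r by (rule le(2)[OF _ _ _ that])
qed (use \<tau> e0 c in auto)

section \<open>Local residuals and the discrete Gronwall argument\<close>

context eerk_problem
begin

definition err :: "real \<Rightarrow> nat \<Rightarrow> 'a" where
  "err \<tau> n = eerk_solution S f m \<tau> u0 n - u (real n * \<tau>)"

text \<open>The residual is recorded through the arguments h and k of the operators, measured in X,
  and not through its own size, so that it can be evaluated in every intermediate space.\<close>

definition local_rep :: "real \<Rightarrow> nat \<Rightarrow> real \<Rightarrow> bool" where
  "local_rep \<tau> n \<rho> \<longleftrightarrow> (\<exists>h k. (\<forall>i\<in>stg. norm (h i) \<le> \<rho>) \<and>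
     (\<forall>\<xi>\<in>{real n * \<tau>..real n * \<tau> + \<tau>}. norm (k \<xi>) \<le> \<rho>) \<and>
     (\<lambda>\<xi>. S (real n * \<tau> + \<tau> - \<xi>) (k \<xi>)) integrable_on {real n * \<tau>..real n * \<tau> + \<tau>} \<and>
     err \<tau> (Suc n) = S \<tau> (err \<tau> n) + (\<tau> *\<^sub>R (\<Sum>i\<in>stg. b_op S m i \<tau> (h i)) +
       integral {real n * \<tau>..real n * \<tau> + \<tau>} (\<lambda>\<xi>. S (real n * \<tau> + \<tau> - \<xi>) (k \<xi>))))"

lemma local_rep_mono: "local_rep \<tau> n \<rho> \<Longrightarrow> \<rho> \<le> \<rho>' \<Longrightarrow> local_rep \<tau> n \<rho>'"
  unfolding local_rep_def by (elim exE conjE, intro exI conjI) (auto intro: order_trans)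

text \<open>\<open>regular Z \<kappa> \<tau> N\<close> is the quantitative regularity of the mild solution that enters the error
  estimate; it is used with \<open>Z = O(\<tau> powr (1 - \<alpha>))\<close>, up to a logarithm if \<open>\<alpha> = 0\<close>.\<close>

definition regular :: "real \<Rightarrow> real \<Rightarrow> real \<Rightarrow> nat \<Rightarrow> bool" where
  "regular Z \<kappa> \<tau> N \<longleftrightarrow> (\<forall>n. 1 \<le> n \<and> n < N \<longrightarrow> (\<forall>\<xi>\<in>{real n * \<tau>..real n * \<tau> + \<tau>}.
     nY (u \<xi> - u (real n * \<tau>)) \<le> Z * (\<kappa> * (real n * \<tau>) powr (\<kappa> - 1) + 1)))"

text \<open>Bounds the variation of g over step n. In the first step, where the solution may be
  irregular, only \<open>2 * G\<close> is available; as a single term it still contributes no more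
  than \<open>\<tau> powr (1 - a)\<close>. The summand 2 adds the time increment, at most
  \<open>\<tau> \<le> Z\<close>, to the 1 in \<open>regular\<close>.\<close>

definition dl :: "real \<Rightarrow> real \<Rightarrow> real \<Rightarrow> nat \<Rightarrow> real" where
  "dl Z \<kappa> \<tau> n = (if n = 0 then 2 * G else L * Z * (\<kappa> * (real n * \<tau>) powr (\<kappa> - 1) + 2))"

lemma dl_nonneg: "0 \<le> Z \<Longrightarrow> 0 \<le> \<kappa> \<Longrightarrow> 0 \<le> dl Z \<kappa> \<tau> n"
  using L G_nonneg by (simp add: dl_def)

text \<open>The factor \<open>\<kappa>\<close> in \<open>dl\<close> cancels the
  \<open>1 / \<kappa>\<close> of the weakly singular sum. The constants are therefore uniform in
  \<open>\<kappa>\<close>, which is indispensable if \<open>\<kappa>\<close> tends to 0 with the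
  step size, as for \<open>\<alpha> = 0\<close>.\<close>

lemma sum_dl:
  assumes \<tau>: "0 < \<tau>" "\<tau> \<le> 1" and a: "0 \<le> a" "a < 1" and \<kappa>: "0 < \<kappa>" "\<kappa> \<le> 1" and Z: "0 \<le> Z"
    and n: "1 \<le> n" "real n * \<tau> \<le> T"
  shows "(\<Sum>k<n. \<tau> * (real (n - k) * \<tau>) powr - a * dl Z \<kappa> \<tau> k)
    \<le> 2 * G * \<tau> powr (1 - a) + 2 * L * Tm / (1 - a) * Z + L * (2 / (1 - a) + 2) * (Z * (real n * \<tau>) powr (\<kappa> - a))"
proof -
  have LZ: "0 \<le> L * Z" using L Z by simp
  have split: "{..<n} = insert 0 {1..<n}" using n by auto
  have 0: "\<tau> * (real (n - 0) * \<tau>) powr - a * dl Z \<kappa> \<tau> 0 \<le> 2 * G * \<tau> powr (1 - a)"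
  proof -
    have "\<tau> \<le> real n * \<tau>" using n \<tau> mult_right_mono[of 1 "real n" \<tau>] by simp
    then have "(real n * \<tau>) powr - a \<le> \<tau> powr - a" using \<tau> a by (intro powr_mono2') auto
    then have "\<tau> * (real n * \<tau>) powr - a * (2 * G) \<le> \<tau> * \<tau> powr - a * (2 * G)"
      using \<tau> G_nonneg by (intro mult_right_mono mult_left_mono) auto
    also have "\<tau> * \<tau> powr - a = \<tau> powr (1 - a)" using \<tau> powr_add[of \<tau> 1 "- a"] by simp
    finally show ?thesis by (simp add: dl_def mult.commute)
  qed
  have "(\<Sum>k\<in>{1..<n}. \<tau> * (real (n - k) * \<tau>) powr - a * dl Z \<kappa> \<tau> k)
      = (\<Sum>k\<in>{1..<n}. L * Z * \<kappa> * (\<tau> * (real (n - k) * \<tau>) powr - a * (real k * \<tau>) powr - (1 - \<kappa>))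
          + 2 * (L * Z) * (\<tau> * (real (n - k) * \<tau>) powr - a))"
    by (rule sum.cong) (auto simp: dl_def algebra_simps)
  also have "\<dots> = L * Z * \<kappa> * (\<Sum>k\<in>{1..<n}. \<tau> * (real (n - k) * \<tau>) powr - a * (real k * \<tau>) powr - (1 - \<kappa>))
      + 2 * (L * Z) * (\<Sum>k\<in>{1..<n}. \<tau> * (real (n - k) * \<tau>) powr - a)"
    by (simp only: sum.distrib sum_distrib_left)
  also have "\<dots> \<le> L * Z * \<kappa> * ((2 / (1 - a) + 2 / \<kappa>) * (real n * \<tau>) powr (\<kappa> - a)) + 2 * (L * Z) * (Tm / (1 - a))"
  proof (intro add_mono mult_left_mono)
    have "1 - a - (1 - \<kappa>) = \<kappa> - a" "1 - (1 - \<kappa>) = \<kappa>" by auto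
    then show "(\<Sum>k\<in>{1..<n}. \<tau> * (real (n - k) * \<tau>) powr - a * (real k * \<tau>) powr - (1 - \<kappa>))
        \<le> (2 / (1 - a) + 2 / \<kappa>) * (real n * \<tau>) powr (\<kappa> - a)"
      using sum_powr_beta_le[OF \<tau>(1) a, of "1 - \<kappa>" n] \<kappa> by (simp only:)
    have "(\<Sum>k\<in>{1..<n}. \<tau> * (real (n - k) * \<tau>) powr - a) \<le> (\<Sum>k<n. \<tau> * (real (n - k) * \<tau>) powr - a)"
      using \<tau> by (intro sum_mono2) auto
    also have "\<dots> \<le> (real n * \<tau>) powr (1 - a) / (1 - a)" by (rule sum_powr_reversed_le[OF \<tau>(1) a])
    also have "\<dots> \<le> Tm / (1 - a)" using n \<tau> T a by (intro divide_right_mono powr_le_Tm) auto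
    finally show "(\<Sum>k\<in>{1..<n}. \<tau> * (real (n - k) * \<tau>) powr - a) \<le> Tm / (1 - a)" .
  qed (use LZ \<kappa> in auto)
  also have "\<dots> \<le> L * (2 / (1 - a) + 2) * (Z * (real n * \<tau>) powr (\<kappa> - a)) + 2 * L * Tm / (1 - a) * Z"
  proof -
    have "\<kappa> * (2 / (1 - a) + 2 / \<kappa>) \<le> 2 / (1 - a) + 2"
      using \<kappa> a mult_right_mono[of \<kappa> 1 "2 / (1 - a)"] by (simp add: distrib_left)
    then have "L * Z * (\<kappa> * (2 / (1 - a) + 2 / \<kappa>)) * (real n * \<tau>) powr (\<kappa> - a) \<le> L * Z * (2 / (1 - a) + 2) * (real n * \<tau>) powr (\<kappa> - a)"
      using LZ by (intro mult_right_mono mult_left_mono) auto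
    then show ?thesis by (simp add: mult_ac)
  qed
  finally have "(\<Sum>k\<in>{1..<n}. \<tau> * (real (n - k) * \<tau>) powr - a * dl Z \<kappa> \<tau> k)
    \<le> L * (2 / (1 - a) + 2) * (Z * (real n * \<tau>) powr (\<kappa> - a)) + 2 * L * Tm / (1 - a) * Z" .
  moreover have "(\<Sum>k<n. \<tau> * (real (n - k) * \<tau>) powr - a * dl Z \<kappa> \<tau> k)
     = \<tau> * (real (n - 0) * \<tau>) powr - a * dl Z \<kappa> \<tau> 0 + (\<Sum>k\<in>{1..<n}. \<tau> * (real (n - k) * \<tau>) powr - a * dl Z \<kappa> \<tau> k)"
    unfolding split by (rule sum.insert) auto
  ultimately show ?thesis using 0 by linarith
qed

text \<open>\<open>P2\<close> is the constant of the error propagation; \<open>lam\<close> is the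
  exponential weight for which the Lipschitz terms of the Gronwall sum take up at most half of the
  majorant; \<open>KB\<close> collects the coefficients of all terms of size Z.\<close>

definition P2 where "P2 = (real (card stg) * Pm + C + C2) * (1 + 2 * C1)"
definition lam where "lam = (2 * P2 * L * (T powr q0 / q0) + 1) powr (1 / q0)"
definition KB where "KB = 2 * G + (L * Cst * Tm / (1 - \<alpha>) + 2 * L * Tm / (1 - \<alpha>)) + L * (2 / (1 - \<alpha>) + 2) * Tm"

lemma P2_nonneg: "0 \<le> P2"
  using Pm C_pos constants_nonneg by (simp add: P2_def)

lemma KB_nonneg: "0 \<le> KB"
  using G_nonneg L Cst_nonneg T \<alpha> by (simp add: KB_def)

lemma lam: "0 < lam" "P2 * L * (lam powr - q0 * (T powr q0 / q0)) \<le> 1 / 2"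
proof -
  define W where "W = P2 * L * (T powr q0 / q0)"
  have W: "0 \<le> W" using P2_nonneg L q0 by (simp add: W_def)
  have lamW: "lam = (2 * W + 1) powr (1 / q0)" by (simp add: lam_def W_def)
  show "0 < lam" using W by (simp add: lamW)
  have "(x powr (1 / q)) powr - q = x powr - 1" if "q \<noteq> 0" for x q :: real
    using that by (simp add: powr_powr)
  from this[of q0 "2 * W + 1"] have "lam powr - q0 = (2 * W + 1) powr - 1" unfolding lamW using q0 by simp
  also have "\<dots> = 1 / (2 * W + 1)" using W by (simp add: powr_minus_divide)
  finally have "P2 * L * (lam powr - q0 * (T powr q0 / q0)) = W / (2 * W + 1)" by (simp add: W_def)
  also have "\<dots> \<le> 1 / 2" using W by (simp add: field_simps)
  finally show "P2 * L * (lam powr - q0 * (T powr q0 / q0)) \<le> 1 / 2" .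
qed

text \<open>The first summand is the majorant of the error at time T, divided by Z. The second lets
  \<open>PM * Z \<le> 1\<close> control the stage error too.\<close>

definition PM where "PM = 2 * P2 * KB * exp (lam * T) + Cst"

lemma PM: "0 \<le> PM" "Cst \<le> PM" "2 * P2 * KB * exp (lam * T) \<le> PM"
  using P2_nonneg KB_nonneg Cst_nonneg by (auto simp: PM_def)

lemma g_difference:
  assumes \<tau>: "0 < \<tau>" "\<tau> \<le> 1" and Z: "\<tau> \<le> Z" and \<kappa>: "0 < \<kappa>" and reg: "regular Z \<kappa> \<tau> N"
    and n: "n < N" "real N * \<tau> \<le> T" and \<xi>: "\<xi> \<in> {real n * \<tau>..real n * \<tau> + \<tau>}"
  shows "norm (g \<xi> - g (real n * \<tau>)) \<le> dl Z \<kappa> \<tau> n"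
proof -
  have "real (Suc n) * \<tau> \<le> real N * \<tau>" using n \<tau> by (intro mult_right_mono) auto
  then have tn: "real n * \<tau> + \<tau> \<le> T" using n by (simp add: algebra_simps)
  have mem: "\<xi> \<in> {0..T}" "real n * \<tau> \<in> {0..T}" using \<xi> tn \<tau> by (auto intro: order_trans[rotated])
  show ?thesis
  proof (cases "n = 0")
    case True
    have "norm (g \<xi> - g (real n * \<tau>)) \<le> G + G"
      by (intro norm_triangle_le_diff add_mono g_bounded mem)
    then show ?thesis using True by (simp add: dl_def)
  next
    case False
    let ?K = "\<kappa> * (real n * \<tau>) powr (\<kappa> - 1)"
    have "nY (u \<xi> - u (real n * \<tau>)) \<le> Z * (?K + 1)"
      using reg \<xi> n False by (auto simp: regular_def)
    moreover have "\<bar>\<xi> - real n * \<tau>\<bar> \<le> Z" using \<xi> Z by auto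
    ultimately have "\<bar>\<xi> - real n * \<tau>\<bar> + nY (u \<xi> - u (real n * \<tau>)) \<le> Z * (?K + 2)" by (simp add: algebra_simps)
    then have "L * (\<bar>\<xi> - real n * \<tau>\<bar> + nY (u \<xi> - u (real n * \<tau>))) \<le> L * (Z * (?K + 2))"
      using L by (rule mult_left_mono)
    with g_lipschitz[OF mem] False show ?thesis by (simp add: dl_def mult.assoc)
  qed
qed

text \<open>The smallness \<open>PM * Z \<le> 1\<close> keeps the majorant X n below 1 and so the
  numerical values in the ball where \<open>L\<close> is valid; this makes the local representation
  of all earlier steps available in the induction. The claim concerns
  \<open>S (c * \<tau>) (err \<tau> n)\<close> for all c, as the stages require.\<close>

lemma main_bound:
  assumes \<tau>: "0 < \<tau>" "\<tau> \<le> 1" and \<kappa>: "0 < \<kappa>" "\<kappa> \<le> 1" "\<alpha> \<le> \<kappa>" and Z: "\<tau> powr (1 - \<alpha>) \<le> Z" "PM * Z \<le> 1"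
    and N: "real N * \<tau> \<le> T" and reg: "regular Z \<kappa> \<tau> N"
  shows "n \<le> N \<Longrightarrow> err \<tau> n \<in> Y \<and> nY (err \<tau> n) \<le> PM * Z"
    and "n < N \<Longrightarrow> local_rep \<tau> n (L * (PM * Z + Cst * Z) + dl Z \<kappa> \<tau> n)"
proof -
  have Z0: "0 \<le> Z" using order_trans[OF powr_ge_zero Z(1)] .
  have \<tau>Z: "\<tau> \<le> Z"
  proof -
    have "\<tau> = \<tau> powr 1" using \<tau> by simp
    also have "\<dots> \<le> \<tau> powr (1 - \<alpha>)" using \<tau> \<alpha> by (intro powr_mono') auto
    finally show ?thesis using Z(1) by linarith
  qed
  have nT: "real n * \<tau> \<le> T" if "n \<le> N" for n
  proof -
    have "real n * \<tau> \<le> real N * \<tau>" using that \<tau> by (intro mult_right_mono) auto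
    with N show ?thesis by simp
  qed
  \<comment> \<open>The factor 2 is there because one half of X n absorbs the Lipschitz terms and
    the other half the terms of size Z.\<close>
  define X where "X n = 2 * P2 * KB * Z * exp (lam * (real n * \<tau>))" for n
  have X0: "0 \<le> X n" for n using P2_nonneg KB_nonneg Z0 by (simp add: X_def)
  have XP: "X n \<le> PM * Z" if "n \<le> N" for n
  proof -
    have "real n * \<tau> \<le> T" using that by (rule nT)
    then have "exp (lam * (real n * \<tau>)) \<le> exp (lam * T)" using lam(1) by simp
    then have "X n \<le> 2 * P2 * KB * Z * exp (lam * T)"
      unfolding X_def using P2_nonneg KB_nonneg Z0 by (intro mult_left_mono) auto
    also have "\<dots> = (2 * P2 * KB * exp (lam * T)) * Z" by simp
    also have "\<dots> \<le> PM * Z" using PM(3) Z0 by (rule mult_right_mono)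
    finally show ?thesis .
  qed
  have "Cst * Z \<le> PM * Z" using PM(2) Z0 by (rule mult_right_mono)
  moreover have CZ: "Cst * \<tau> powr (1 - \<alpha>) \<le> Cst * Z" using Z(1) Cst_nonneg by (rule mult_left_mono)
  ultimately have small: "Cst * \<tau> powr (1 - \<alpha>) \<le> 1" using Z(2) by linarith
  have rep: "local_rep \<tau> n (L * (X n + Cst * Z) + dl Z \<kappa> \<tau> n)"
    if n: "n < N" and IH: "\<And>c. 0 \<le> c \<Longrightarrow> c \<le> 1 \<Longrightarrow> S (c * \<tau>) (err \<tau> n) \<in> Y \<and> nY (S (c * \<tau>) (err \<tau> n)) \<le> X n" for n
  proof -
    have t: "0 \<le> real n * \<tau>" "real n * \<tau> + \<tau> \<le> T"
      using \<tau> nT[of "Suc n"] n by (auto simp: algebra_simps)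
    have X1: "X n \<le> 1" using XP[of n] Z(2) n by simp
    have dl': "norm (g \<xi> - g (real n * \<tau>)) \<le> dl Z \<kappa> \<tau> n" if "\<xi> \<in> {real n * \<tau>..real n * \<tau> + \<tau>}" for \<xi>
      by (rule g_difference[OF \<tau> \<tau>Z \<kappa>(1) reg n N that])
    have \<rho>: "L * (X n + Cst * \<tau> powr (1 - \<alpha>)) + dl Z \<kappa> \<tau> n \<le> L * (X n + Cst * Z) + dl Z \<kappa> \<tau> n"
      using Z(1) Cst_nonneg L by (intro add_right_mono mult_left_mono add_left_mono) auto
    have Suc: "real (Suc n) * \<tau> = real n * \<tau> + \<tau>" by (simp add: algebra_simps)
    show ?thesis
      using step_error[OF \<tau> t X0 X1 small IH[unfolded err_def] dl' \<rho>]
      unfolding local_rep_def err_def Suc by simp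
  qed
  have claim: "n \<le> N \<longrightarrow> (\<forall>c. 0 \<le> c \<and> c \<le> 1 \<longrightarrow> S (c * \<tau>) (err \<tau> n) \<in> Y \<and> nY (S (c * \<tau>) (err \<tau> n)) \<le> X n)" for n
  proof (induction n rule: less_induct)
    case (less n)
    show ?case
    proof (intro impI allI)
      fix c :: real assume n: "n \<le> N" and c: "0 \<le> c \<and> c \<le> 1"
      let ?\<rho> = "\<lambda>k. L * (X k + Cst * Z) + dl Z \<kappa> \<tau> k"
      have r: "local_rep \<tau> k (?\<rho> k)" if "k < n" for k
        by (rule rep) (use less.IH[OF that] n that in auto)
      have \<rho>0: "0 \<le> ?\<rho> k" for k
        using L X0 Cst_nonneg Z0 dl_nonneg[OF Z0] \<kappa> by simp
      have nTm: "real n * \<tau> + 2 \<le> Tm" using nT[OF n] T by simp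
      have "S (c * \<tau>) (err \<tau> n) \<in> Y \<and> nY (S (c * \<tau>) (err \<tau> n)) \<le>
          (real (card stg) * Pm + C + C2) * (1 + 2 * C1) * (\<Sum>k<n. \<tau> * (real (n - k) * \<tau>) powr - \<alpha> * ?\<rho> k)"
      proof (rule error_from_local[OF \<tau> _ nTm tame_b[OF _ \<tau>] Pm])
        show "err \<tau> 0 = 0" by (simp add: err_def u_zero)
        show "0 \<le> ?\<rho> k" for k by (rule \<rho>0)
      qed (use T c r[unfolded local_rep_def] in auto)
      then have Y: "S (c * \<tau>) (err \<tau> n) \<in> Y"
        and le: "nY (S (c * \<tau>) (err \<tau> n)) \<le> P2 * (\<Sum>k<n. \<tau> * (real (n - k) * \<tau>) powr - \<alpha> * ?\<rho> k)"
        by (auto simp: P2_def)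
      have "P2 * (\<Sum>k<n. \<tau> * (real (n - k) * \<tau>) powr - \<alpha> * ?\<rho> k) \<le> X n"
      proof (cases "n = 0")
        case True
        then show ?thesis using X0 by simp
      next
        case False
        have e1: "(\<Sum>k<n. \<tau> * (real (n - k) * \<tau>) powr - \<alpha> * X k) \<le> 2 * P2 * KB * Z * (exp (lam * (real n * \<tau>)) * (lam powr - q0 * (T powr q0 / q0)))"
        proof -
          have "(\<Sum>k<n. \<tau> * (real (n - k) * \<tau>) powr - \<alpha> * X k) =
              2 * P2 * KB * Z * (\<Sum>k<n. \<tau> * (real (n - k) * \<tau>) powr - \<alpha> * exp (lam * (real k * \<tau>)))"
            unfolding X_def sum_distrib_left by (rule sum.cong) auto
          also have "\<dots> \<le> 2 * P2 * KB * Z * (exp (lam * (real n * \<tau>)) * (lam powr - q0 * (T powr q0 / q0)))"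
            using P2_nonneg KB_nonneg Z0 by (intro mult_left_mono sum_gronwall_weight_le[OF \<tau>(1) \<alpha> lam(1) nT[OF n]]) auto
          finally show ?thesis .
        qed
        have e2: "(\<Sum>k<n. \<tau> * (real (n - k) * \<tau>) powr - \<alpha>) \<le> Tm / (1 - \<alpha>)"
        proof -
          have "(\<Sum>k<n. \<tau> * (real (n - k) * \<tau>) powr - \<alpha>) \<le> (real n * \<tau>) powr (1 - \<alpha>) / (1 - \<alpha>)"
            by (rule sum_powr_reversed_le[OF \<tau>(1) \<alpha>])
          also have "\<dots> \<le> Tm / (1 - \<alpha>)" using nT[OF n] \<tau> T \<alpha> by (intro divide_right_mono powr_le_Tm) auto
          finally show ?thesis .
        qed
        have e3: "(\<Sum>k<n. \<tau> * (real (n - k) * \<tau>) powr - \<alpha> * dl Z \<kappa> \<tau> k)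
            \<le> 2 * G * Z + 2 * L * Tm / (1 - \<alpha>) * Z + L * (2 / (1 - \<alpha>) + 2) * (Z * Tm)"
        proof -
          have "(\<Sum>k<n. \<tau> * (real (n - k) * \<tau>) powr - \<alpha> * dl Z \<kappa> \<tau> k)
            \<le> 2 * G * \<tau> powr (1 - \<alpha>) + 2 * L * Tm / (1 - \<alpha>) * Z + L * (2 / (1 - \<alpha>) + 2) * (Z * (real n * \<tau>) powr (\<kappa> - \<alpha>))"
            by (rule sum_dl[OF \<tau> \<alpha> \<kappa>(1,2) Z0]) (use False nT[OF n] in auto)
          also have "\<dots> \<le> 2 * G * Z + 2 * L * Tm / (1 - \<alpha>) * Z + L * (2 / (1 - \<alpha>) + 2) * (Z * Tm)"
          proof (intro add_mono mult_left_mono order_refl)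
            show "(real n * \<tau>) powr (\<kappa> - \<alpha>) \<le> Tm" using nT[OF n] \<tau> T \<kappa> \<alpha> by (intro powr_le_Tm) auto
          qed (use G_nonneg Z Z0 L \<alpha> Tm_ge_1 in auto)
          finally show ?thesis .
        qed
        have "(\<Sum>k<n. \<tau> * (real (n - k) * \<tau>) powr - \<alpha> * ?\<rho> k) =
            L * (\<Sum>k<n. \<tau> * (real (n - k) * \<tau>) powr - \<alpha> * X k)
            + L * Cst * Z * (\<Sum>k<n. \<tau> * (real (n - k) * \<tau>) powr - \<alpha>)
            + (\<Sum>k<n. \<tau> * (real (n - k) * \<tau>) powr - \<alpha> * dl Z \<kappa> \<tau> k)"
          unfolding sum_distrib_left sum.distrib[symmetric] by (rule sum.cong) (auto simp: algebra_simps)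
        also have "\<dots> \<le> L * (2 * P2 * KB * Z * (exp (lam * (real n * \<tau>)) * (lam powr - q0 * (T powr q0 / q0))))
            + L * Cst * Z * (Tm / (1 - \<alpha>))
            + (2 * G * Z + 2 * L * Tm / (1 - \<alpha>) * Z + L * (2 / (1 - \<alpha>) + 2) * (Z * Tm))"
          using L Cst_nonneg Z0 by (intro add_mono mult_left_mono e1 e2 e3) auto
        also have "\<dots> = L * (2 * P2 * KB * Z * (exp (lam * (real n * \<tau>)) * (lam powr - q0 * (T powr q0 / q0)))) + KB * Z"
          unfolding KB_def by (simp add: algebra_simps)
        finally have "P2 * (\<Sum>k<n. \<tau> * (real (n - k) * \<tau>) powr - \<alpha> * ?\<rho> k)
            \<le> P2 * (L * (2 * P2 * KB * Z * (exp (lam * (real n * \<tau>)) * (lam powr - q0 * (T powr q0 / q0)))) + KB * Z)"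
          using P2_nonneg by (rule mult_left_mono)
        also have "\<dots> = X n * (P2 * L * (lam powr - q0 * (T powr q0 / q0))) + P2 * KB * Z"
          unfolding X_def distrib_left by (simp only: mult_ac)
        also have "\<dots> \<le> X n * (1 / 2) + X n * (1 / 2)"
        proof (intro add_mono mult_left_mono lam(2) X0)
          have "1 \<le> exp (lam * (real n * \<tau>))" using lam(1) \<tau> by simp
          then have "P2 * KB * Z * 1 \<le> P2 * KB * Z * exp (lam * (real n * \<tau>))"
            using P2_nonneg KB_nonneg Z0 by (intro mult_left_mono) auto
          then show "P2 * KB * Z \<le> X n * (1 / 2)" by (simp add: X_def)
        qed
        finally show ?thesis by simp
      qed
      with Y le show "S (c * \<tau>) (err \<tau> n) \<in> Y \<and> nY (S (c * \<tau>) (err \<tau> n)) \<le> X n" by simp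
    qed
  qed
  show "err \<tau> n \<in> Y \<and> nY (err \<tau> n) \<le> PM * Z" if "n \<le> N"
    using claim[of n, rule_format, OF that, of 0] XP[OF that] by auto
  show "local_rep \<tau> n (L * (PM * Z + Cst * Z) + dl Z \<kappa> \<tau> n)" if n: "n < N"
  proof (rule local_rep_mono[OF rep[OF n]])
    show "S (c * \<tau>) (err \<tau> n) \<in> Y \<and> nY (S (c * \<tau>) (err \<tau> n)) \<le> X n" if "0 \<le> c" "c \<le> 1" for c
      using claim[of n] n that by simp
    show "L * (X n + Cst * Z) + dl Z \<kappa> \<tau> n \<le> L * (PM * Z + Cst * Z) + dl Z \<kappa> \<tau> n"
      using XP[of n] n L by (intro add_right_mono mult_left_mono) auto
  qed
qed

text \<open>The Gronwall argument is not repeated: \<open>main_bound\<close> has already bounded the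
  local data in X, and only their propagation is evaluated with the exponent
  \<open>\<gamma>\<close>. Since \<open>\<kappa> \<le> \<gamma>\<close>, the power
  \<open>(real n * \<tau>) powr (\<kappa> - \<gamma>)\<close> is largest for n = 1, which gives the
  last term.\<close>

lemma stronger_norm_bound:
  assumes sc: "intermediate_scale S V Tm C \<gamma> Yg ng CEg"
  shows "\<exists>P\<ge>0. \<forall>\<tau> Z \<kappa> N n. 0 < \<tau> \<longrightarrow> \<tau> \<le> 1 \<longrightarrow> 0 < \<kappa> \<longrightarrow> \<kappa> \<le> 1 \<longrightarrow> \<alpha> \<le> \<kappa> \<longrightarrow> \<kappa> \<le> \<gamma> \<longrightarrow>
    \<tau> powr (1 - \<alpha>) \<le> Z \<longrightarrow> PM * Z \<le> 1 \<longrightarrow> real N * \<tau> \<le> T \<longrightarrow> regular Z \<kappa> \<tau> N \<longrightarrow> n \<le> N \<longrightarrow>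
    err \<tau> n \<in> Yg \<and> ng (err \<tau> n) \<le> P * (\<tau> powr (1 - \<gamma>) + Z + Z * \<tau> powr (\<kappa> - \<gamma>))"
proof -
  interpret g: intermediate_scale S V Tm C \<gamma> Yg ng CEg by (rule sc)
  have Tm3: "3 \<le> Tm" using T by simp
  obtain Pg where Pg: "0 \<le> Pg" "\<forall>i\<in>stg. \<forall>\<tau>. 0 < \<tau> \<and> \<tau> \<le> 1 \<longrightarrow> g.tame Pg \<tau> (b_op S m i \<tau>)"
    using g.tame_uniform[of stg "b_op S m"] g.tame_b_op[OF Tm3] by auto
  define Q where "Q = (real (card stg) * Pg + C + g.C2) * (1 + 2 * g.C1)"
  have Q: "0 \<le> Q" using Pg C_pos g.constants_nonneg by (simp add: Q_def)
  define K where "K = (L * (PM + Cst) * Tm / (1 - \<gamma>) + 2 * L * Tm / (1 - \<gamma>)) + 2 * G + L * (2 / (1 - \<gamma>) + 2)"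
  have parts: "0 \<le> L * (PM + Cst) * Tm / (1 - \<gamma>) + 2 * L * Tm / (1 - \<gamma>)" "0 \<le> 2 * G" "0 \<le> L * (2 / (1 - \<gamma>) + 2)"
    using L PM Cst_nonneg T G_nonneg g.\<alpha> by auto
  have K: "0 \<le> K" using parts by (simp add: K_def)
  show ?thesis
  proof (intro exI[of _ "Q * K"] conjI allI impI)
    show "0 \<le> Q * K" using Q K by simp
    fix \<tau> Z \<kappa> :: real and N n :: nat
    assume \<tau>: "0 < \<tau>" "\<tau> \<le> 1" and \<kappa>: "0 < \<kappa>" "\<kappa> \<le> 1" "\<alpha> \<le> \<kappa>" "\<kappa> \<le> \<gamma>" and Z: "\<tau> powr (1 - \<alpha>) \<le> Z" "PM * Z \<le> 1"
      and N: "real N * \<tau> \<le> T" and reg: "regular Z \<kappa> \<tau> N" and n: "n \<le> N"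
    have Z0: "0 \<le> Z" using order_trans[OF powr_ge_zero Z(1)] .
    have "real n * \<tau> \<le> real N * \<tau>" using n \<tau> by (intro mult_right_mono) auto
    with N have nT: "real n * \<tau> \<le> T" by simp
    let ?W = "\<tau> powr (1 - \<gamma>) + Z + Z * \<tau> powr (\<kappa> - \<gamma>)"
    have W: "0 \<le> ?W" using Z0 by simp
    let ?\<rho> = "\<lambda>k. L * (PM * Z + Cst * Z) + dl Z \<kappa> \<tau> k"
    have \<rho>0: "0 \<le> ?\<rho> k" for k
      using L PM Cst_nonneg Z0 dl_nonneg[OF Z0] \<kappa> by simp
    have r: "local_rep \<tau> k (?\<rho> k)" if "k < n" for k
      by (rule main_bound(2)[OF \<tau> \<kappa>(1-3) Z N reg]) (use that n in simp)
    have nTm: "real n * \<tau> + 2 \<le> Tm" using nT T by simp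
    have "S (0 * \<tau>) (err \<tau> n) \<in> Yg \<and> ng (S (0 * \<tau>) (err \<tau> n)) \<le>
          (real (card stg) * Pg + C + g.C2) * (1 + 2 * g.C1) * (\<Sum>k<n. \<tau> * (real (n - k) * \<tau>) powr - \<gamma> * ?\<rho> k)"
    proof (rule g.error_from_local[OF \<tau> Tm3 nTm _ Pg(1), where B = "\<lambda>i. b_op S m i \<tau>"])
      show "err \<tau> 0 = 0" by (simp add: err_def u_zero)
      show "0 \<le> ?\<rho> k" for k by (rule \<rho>0)
    qed (use \<tau> Pg r[unfolded local_rep_def] in auto)
    then have Y: "err \<tau> n \<in> Yg"
      and le: "ng (err \<tau> n) \<le> Q * (\<Sum>k<n. \<tau> * (real (n - k) * \<tau>) powr - \<gamma> * ?\<rho> k)"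
      by (auto simp: Q_def)
    have "(\<Sum>k<n. \<tau> * (real (n - k) * \<tau>) powr - \<gamma> * ?\<rho> k) \<le> K * ?W"
    proof (cases "n = 0")
      case True
      then show ?thesis using K W by simp
    next
      case False
      have e2: "(\<Sum>k<n. \<tau> * (real (n - k) * \<tau>) powr - \<gamma>) \<le> Tm / (1 - \<gamma>)"
      proof -
        have "(\<Sum>k<n. \<tau> * (real (n - k) * \<tau>) powr - \<gamma>) \<le> (real n * \<tau>) powr (1 - \<gamma>) / (1 - \<gamma>)"
          by (rule sum_powr_reversed_le[OF \<tau>(1) g.\<alpha>])
        also have "\<dots> \<le> Tm / (1 - \<gamma>)" using nT \<tau> T g.\<alpha> by (intro divide_right_mono powr_le_Tm) auto
        finally show ?thesis .
      qed
      have "\<tau> \<le> real n * \<tau>" using False \<tau> mult_right_mono[of 1 "real n" \<tau>] by simp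
      then have pw: "(real n * \<tau>) powr (\<kappa> - \<gamma>) \<le> \<tau> powr (\<kappa> - \<gamma>)" using \<tau> \<kappa> by (intro powr_mono2') auto
      have "(\<Sum>k<n. \<tau> * (real (n - k) * \<tau>) powr - \<gamma> * ?\<rho> k) =
            L * (PM * Z + Cst * Z) * (\<Sum>k<n. \<tau> * (real (n - k) * \<tau>) powr - \<gamma>)
            + (\<Sum>k<n. \<tau> * (real (n - k) * \<tau>) powr - \<gamma> * dl Z \<kappa> \<tau> k)"
        unfolding sum_distrib_left sum.distrib[symmetric] by (rule sum.cong) (auto simp: algebra_simps)
      also have "\<dots> \<le> L * (PM * Z + Cst * Z) * (Tm / (1 - \<gamma>))
          + (2 * G * \<tau> powr (1 - \<gamma>) + 2 * L * Tm / (1 - \<gamma>) * Z + L * (2 / (1 - \<gamma>) + 2) * (Z * (real n * \<tau>) powr (\<kappa> - \<gamma>)))"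
        using False nT L PM Cst_nonneg Z0
        by (intro add_mono mult_left_mono e2 sum_dl[OF \<tau> g.\<alpha> \<kappa>(1,2) Z0]) auto
      also have "\<dots> \<le> L * (PM * Z + Cst * Z) * (Tm / (1 - \<gamma>))
          + (2 * G * \<tau> powr (1 - \<gamma>) + 2 * L * Tm / (1 - \<gamma>) * Z + L * (2 / (1 - \<gamma>) + 2) * (Z * \<tau> powr (\<kappa> - \<gamma>)))"
        using pw parts Z0 by (intro add_left_mono mult_left_mono) auto
      also have "\<dots> = (L * (PM + Cst) * Tm / (1 - \<gamma>) + 2 * L * Tm / (1 - \<gamma>)) * Z + 2 * G * \<tau> powr (1 - \<gamma>)
          + L * (2 / (1 - \<gamma>) + 2) * (Z * \<tau> powr (\<kappa> - \<gamma>))"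
        by (simp add: algebra_simps add_divide_distrib)
      also have "\<dots> \<le> (L * (PM + Cst) * Tm / (1 - \<gamma>) + 2 * L * Tm / (1 - \<gamma>)) * ?W + 2 * G * ?W + L * (2 / (1 - \<gamma>) + 2) * ?W"
        using parts Z0 by (intro add_mono mult_left_mono) auto
      also have "\<dots> = K * ?W" by (simp only: K_def distrib_right)
      finally show ?thesis .
    qed
    then have "Q * (\<Sum>k<n. \<tau> * (real (n - k) * \<tau>) powr - \<gamma> * ?\<rho> k) \<le> Q * (K * ?W)" using Q by (rule mult_left_mono)
    with le Y show "err \<tau> n \<in> Yg" "ng (err \<tau> n) \<le> Q * K * ?W" by (auto simp: mult.assoc)
  qed
qed

end

section \<open>Regularity of the mild solution and convergence\<close>

lemma small_powr:
  fixes b K :: real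
  assumes b: "0 < b" and K: "0 \<le> K"
  shows "\<exists>\<tau>0>0. \<tau>0 \<le> 1 \<and> (\<forall>\<tau>. 0 < \<tau> \<and> \<tau> < \<tau>0 \<longrightarrow> K * \<tau> powr b \<le> 1)"
proof (intro exI[of _ "(1 / (K + 1)) powr (1 / b)"] conjI allI impI)
  show "0 < (1 / (K + 1)) powr (1 / b)" using K by simp
  show "(1 / (K + 1)) powr (1 / b) \<le> 1" using K b by (intro powr_le1) auto
  fix \<tau> assume \<tau>: "0 < \<tau> \<and> \<tau> < (1 / (K + 1)) powr (1 / b)"
  then have "\<tau> powr b \<le> ((1 / (K + 1)) powr (1 / b)) powr b" using b by (intro powr_mono2) auto
  also have "\<dots> = 1 / (K + 1)" unfolding powr_powr using b K by simp
  finally have "K * \<tau> powr b \<le> K * (1 / (K + 1))" using K by (rule mult_left_mono)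
  also have "\<dots> \<le> 1" using K by simp
  finally show "K * \<tau> powr b \<le> 1" .
qed

lemma abs_ln_le_powr:
  fixes b \<tau> :: real
  assumes b: "0 < b" "b \<le> 1" and \<tau>: "0 < \<tau>" "\<tau> \<le> 1"
  shows "\<bar>ln \<tau>\<bar> + 1 \<le> (1 / b + 1) * \<tau> powr - b"
proof -
  have "\<bar>ln \<tau>\<bar> = ln (1 / \<tau>)" using \<tau> by (simp add: ln_div)
  also have "\<dots> \<le> ln (1 + 1 / \<tau>)" using \<tau> by (intro ln_mono) (auto intro: add_pos_pos)
  also have "\<dots> \<le> ((1 / \<tau>) powr b) / b" using b \<tau> by (intro ln_one_add_le_powr) auto
  also have "(1 / \<tau>) powr b = \<tau> powr - b" using \<tau> by (simp add: powr_divide powr_minus_divide)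
  finally have "\<bar>ln \<tau>\<bar> \<le> \<tau> powr - b / b" .
  moreover have "1 \<le> \<tau> powr - b" using powr_mono2'[of "- b" \<tau> 1] b \<tau> by simp
  ultimately show ?thesis by (simp add: distrib_right)
qed

text \<open>At this exponent \<open>\<epsilon>\<close> the two effects balance:
  \<open>1 / \<epsilon>\<close> is the logarithm of the error bound, while
  \<open>\<tau> powr - \<epsilon>\<close> stays bounded.\<close>

lemma powr_log_exponent:
  fixes \<tau> :: real
  assumes \<tau>: "0 < \<tau>"
  shows "\<tau> powr - (1 / (\<bar>ln \<tau>\<bar> + 1)) \<le> exp 1"
proof -
  have "- (1 / (\<bar>ln \<tau>\<bar> + 1)) * ln \<tau> = (- ln \<tau>) / (\<bar>ln \<tau>\<bar> + 1)" by simp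
  also have "\<dots> \<le> \<bar>ln \<tau>\<bar> / (\<bar>ln \<tau>\<bar> + 1)" by (intro divide_right_mono) auto
  also have "\<dots> \<le> 1" by simp
  finally show ?thesis using \<tau> by (simp add: powr_def)
qed

context semilinear
begin

lemma u_split:
  "t \<in> {0..T} \<Longrightarrow> u t = S t u0 + integral {0..t} (\<lambda>\<xi>. S (t - \<xi>) (g \<xi>))"
  "t \<in> {0..T} \<Longrightarrow> (\<lambda>\<xi>. S (t - \<xi>) (g \<xi>)) integrable_on {0..t}"
  using u_mild[of t] by (auto simp: has_integral_iff)

lemma u_in_scale:
  assumes "intermediate_scale S V Tm C \<gamma> Yg ng CEg" and ug: "u0 \<in> Yg" and t: "t \<in> {0..T}"
  shows "u t \<in> Yg"
proof -
  interpret sg: intermediate_scale S V Tm C \<gamma> Yg ng CEg by fact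
  show ?thesis
  proof (cases "t = 0")
    case True
    then show ?thesis using ug by (simp add: u_zero)
  next
    case False
    with t have t0: "0 < t" "t \<le> T" by auto
    have "S t u0 \<in> Yg" using sg.S_smoothing[of t u0] t0 T by simp
    moreover have "integral {0..t} (\<lambda>\<xi>. S (0 + (t - \<xi>) * 1) (g \<xi>)) \<in> Yg"
      by (rule sg.convolution_smoothing(2)[where G = G]) (use t0 T u_split(2)[OF t] g_bounded in auto)
    ultimately show ?thesis using u_split(1)[OF t] sg.Y_add by simp
  qed
qed

text \<open>The bound \<open>K * r powr (\<gamma> - 1)\<close> on the derivative is either replaced
  by its value at s, giving a weighted Lipschitz estimate, or integrated, giving a Hoelder estimate
  uniform in s.\<close>

lemma norm_S_difference_smooth:
  assumes \<gamma>: "0 < \<gamma>" "\<gamma> \<le> 1"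
    and K: "0 \<le> K" "\<And>\<sigma>. 0 < \<sigma> \<Longrightarrow> \<sigma> \<le> Tm \<Longrightarrow> norm (V \<sigma> x) \<le> K * \<sigma> powr (\<gamma> - 1)"
    and s: "0 < s" "s < t" "t \<le> Tm"
  shows "norm (S t x - S s x) \<le> K * (s powr (\<gamma> - 1) * (t - s))"
    and "norm (S t x - S s x) \<le> K / \<gamma> * (t - s) powr \<gamma>"
proof -
  have "norm (S t x - S s x) \<le> K * s powr (\<gamma> - 1) * (t - s)"
  proof (rule S_diff_const)
    fix r assume r: "r \<in> {s..t}"
    then have "norm (V r x) \<le> K * r powr (\<gamma> - 1)" using s by (intro K) auto
    also have "\<dots> \<le> K * s powr (\<gamma> - 1)" using r s \<gamma> K by (intro mult_left_mono powr_mono2') auto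
    finally show "norm (V r x) \<le> K * s powr (\<gamma> - 1)" .
  qed (use s in auto)
  then show "norm (S t x - S s x) \<le> K * (s powr (\<gamma> - 1) * (t - s))" by (simp add: mult.assoc)
  have "norm (S t x - S s x) \<le> K / \<gamma> * t powr \<gamma> - K / \<gamma> * s powr \<gamma>"
  proof (rule S_diff_general[where \<phi>' = "\<lambda>r. K * r powr (\<gamma> - 1)" and \<phi> = "\<lambda>r. K / \<gamma> * r powr \<gamma>"])
    show "((\<lambda>r. K / \<gamma> * r powr \<gamma>) has_real_derivative K * r powr (\<gamma> - 1)) (at r)" if "r \<in> {s..t}" for r
      using that s \<gamma> by (auto intro!: derivative_eq_intros)
  qed (use s K in auto)
  also have "\<dots> = K / \<gamma> * (t powr \<gamma> - s powr \<gamma>)" by (simp add: right_diff_distrib)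
  also have "\<dots> \<le> K / \<gamma> * (t - s) powr \<gamma>" using K \<gamma> s by (intro mult_left_mono powr_diff_le) auto
  finally show "norm (S t x - S s x) \<le> K / \<gamma> * (t - s) powr \<gamma>" .
qed

lemma norm_integral_S_le:
  assumes "0 \<le> a" "a \<le> b" "b \<le> t" "t \<le> Tm" "(\<lambda>\<xi>. S (t - \<xi>) (h \<xi>)) integrable_on {a..b}"
    and "\<And>\<xi>. \<xi> \<in> {a..b} \<Longrightarrow> norm (h \<xi>) \<le> B"
  shows "norm (integral {a..b} (\<lambda>\<xi>. S (t - \<xi>) (h \<xi>))) \<le> C * B * (b - a)"
proof -
  have "norm (S (t - \<xi>) (h \<xi>)) \<le> C * B" if "\<xi> \<in> {a..b}" for \<xi>
  proof -
    have "norm (S (t - \<xi>) (h \<xi>)) \<le> C * norm (h \<xi>)" using that assms by (intro S_norm) auto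
    also have "\<dots> \<le> C * B" using that assms C_pos by (intro mult_left_mono) auto
    finally show ?thesis .
  qed
  then have "norm (integral {a..b} (\<lambda>\<xi>. S (t - \<xi>) (h \<xi>))) \<le> integral {a..b} (\<lambda>_. C * B)"
    by (intro integral_norm_bound_integral assms) auto
  with assms show ?thesis by (simp add: mult_ac)
qed

text \<open>In \<open>X\<close> itself the solution is Lipschitz continuous away from \<open>0\<close> without logarithm: splitting off
  \<open>g s\<close> in the convolution integral, its Hoelder continuity removes the singularity of \<open>V (s - \<xi>)\<close>.\<close>

lemma u_difference_smooth:
  assumes \<alpha>0: "\<alpha> = 0" and nY: "nY = norm"
    and \<gamma>: "0 < \<gamma>" "\<gamma> < 1"
    and K: "0 \<le> K" "\<And>\<sigma>. 0 < \<sigma> \<Longrightarrow> \<sigma> \<le> Tm \<Longrightarrow> norm (V \<sigma> u0) \<le> K * \<sigma> powr (\<gamma> - 1)"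
  shows "\<exists>Z\<ge>0. \<forall>s t. 0 < s \<longrightarrow> s < t \<longrightarrow> t \<le> s + 1 \<longrightarrow> t \<le> T \<longrightarrow>
    norm (u t - u s) \<le> Z * ((t - s) * (s powr (\<gamma> - 1) + 1))"
proof -
  let ?I = "\<lambda>r. integral {0..r} (\<lambda>\<xi>. S (r - \<xi>) (g \<xi>))"
  \<comment> \<open>The first summand is the Hoelder constant for distances up to 1, the second
    covers larger distances.\<close>
  define H where "H = L * (1 + K / \<gamma> + C5 * G / (1 - \<gamma>)) + 2 * G"
  have parts: "0 \<le> K / \<gamma>" "0 \<le> C5 * G / (1 - \<gamma>)" using K \<gamma> constants_nonneg G_nonneg by auto
  have L1: "0 \<le> L * (1 + K / \<gamma> + C5 * G / (1 - \<gamma>))" using parts L by simp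
  have H0: "0 \<le> H" using L1 G_nonneg by (simp add: H_def)
  have holder: "norm (g \<xi> - g s) \<le> H * (s - \<xi>) powr \<gamma>" if \<xi>: "0 < \<xi>" "\<xi> < s" "s \<le> T" for \<xi> s
  proof -
    have mem: "\<xi> \<in> {0..T}" "s \<in> {0..T}" using \<xi> by auto
    show ?thesis
    proof (cases "s - \<xi> \<le> 1")
      case True
      define p where "p = (s - \<xi>) powr \<gamma>"
      have 1: "norm (S s u0 - S \<xi> u0) \<le> K / \<gamma> * p"
        unfolding p_def by (rule norm_S_difference_smooth(2)) (use K \<gamma> \<xi> T in auto)
      \<comment> \<open>Taken with \<open>\<epsilon> = 1 - \<gamma>\<close>: the increment gets the
        exponent \<open>\<gamma>\<close>, and the factor \<open>1 / (1 - \<gamma>)\<close> is a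
        fixed constant.\<close>
      have "?I s - ?I \<xi> \<in> Y \<and> nY (?I s - ?I \<xi>) \<le> C5 * G * ((s - \<xi>) powr (1 - (1 - \<gamma>)) / (1 - \<gamma>))"
        by (rule convolution_difference[OF \<xi>(1,2) _ _ u_split(2)[OF mem(2)] u_split(2)[OF mem(1)] g_bounded])
          (use \<xi> True T \<gamma> \<alpha>0 in auto)
      then have 2: "norm (?I s - ?I \<xi>) \<le> C5 * G / (1 - \<gamma>) * p" by (simp add: nY p_def)
      have "u s - u \<xi> = (S s u0 - S \<xi> u0) + (?I s - ?I \<xi>)"
        unfolding u_split(1)[OF mem(1)] u_split(1)[OF mem(2)] by simp
      then have "norm (u \<xi> - u s) \<le> K / \<gamma> * p + C5 * G / (1 - \<gamma>) * p"
        unfolding norm_minus_commute[of "u \<xi>"] using 1 2 by (simp add: norm_triangle_le)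
      moreover have "\<bar>\<xi> - s\<bar> \<le> 1 * p"
      proof -
        have "\<bar>\<xi> - s\<bar> = (s - \<xi>) powr 1" using \<xi> by simp
        also have "\<dots> \<le> 1 * p" unfolding p_def mult_1 using \<xi> True \<gamma> by (intro powr_mono') auto
        finally show ?thesis .
      qed
      ultimately have "\<bar>\<xi> - s\<bar> + nY (u \<xi> - u s) \<le> (1 + K / \<gamma> + C5 * G / (1 - \<gamma>)) * p"
        unfolding nY distrib_right by linarith
      then have "L * (\<bar>\<xi> - s\<bar> + nY (u \<xi> - u s)) \<le> L * ((1 + K / \<gamma> + C5 * G / (1 - \<gamma>)) * p)"
        using L by (rule mult_left_mono)
      with g_lipschitz[OF mem] have "norm (g \<xi> - g s) \<le> L * (1 + K / \<gamma> + C5 * G / (1 - \<gamma>)) * p"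
        by (simp add: mult.assoc)
      also have "\<dots> \<le> H * p" using G_nonneg by (intro mult_right_mono) (auto simp: H_def p_def)
      finally show ?thesis by (simp add: p_def)
    next
      case False
      have "norm (g \<xi> - g s) \<le> G + G" by (intro norm_triangle_le_diff add_mono g_bounded mem)
      also have "\<dots> \<le> H * 1" using L1 by (simp add: H_def)
      also have "\<dots> \<le> H * (s - \<xi>) powr \<gamma>"
        using False \<gamma> H0 by (intro mult_left_mono ge_one_powr_ge_zero) auto
      finally show ?thesis .
    qed
  qed
  \<comment> \<open>Three integrals over intervals of length \<open>\<delta>\<close> give the middle
    term, the regularised difference over the past the last one.\<close>
  define Z where "Z = K + 3 * C * G + C * H * (Tm / \<gamma>)"
  have CG: "0 \<le> C * G" "0 \<le> C * H * (Tm / \<gamma>)" using C_pos G_nonneg H0 T \<gamma> by auto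
  show ?thesis
  proof (intro exI[of _ Z] conjI allI impI)
    show "0 \<le> Z" using K CG by (simp add: Z_def)
    fix s t :: real assume st: "0 < s" "s < t" "t \<le> s + 1" "t \<le> T"
    define \<delta> where "\<delta> = t - s"
    have \<delta>: "0 < \<delta>" "\<delta> < t" using st by (auto simp: \<delta>_def)
    have mem: "s \<in> {0..T}" "t \<in> {0..T}" using st by auto
    define x where "x = g s"
    let ?F = "\<lambda>\<xi>. S (t - \<xi>) x" and ?f = "\<lambda>\<xi>. S (t - \<xi>) (g \<xi>)" and ?h = "\<lambda>\<xi>. S (s - \<xi>) (g \<xi>)" and ?k = "\<lambda>\<xi>. S (s - \<xi>) x"
    have xG: "norm x \<le> G" using g_bounded[OF mem(1)] by (simp add: x_def)
    have F: "?F integrable_on {0..t}"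
      using integrable_S[of 1 0 t 0 "\<lambda>_. 1" x] st T by simp
    have Fs: "?F integrable_on {a..b}" if "0 \<le> a" "b \<le> t" for a b
      using that by (intro integrable_subinterval_real[OF F]) auto
    have f: "?f integrable_on {0..t}" and h: "?h integrable_on {0..s}" using u_split(2) mem by auto
    have fs: "?f integrable_on {0..s}" "?f integrable_on {s..t}"
      using st by (auto intro!: integrable_subinterval_real[OF f])
    \<comment> \<open>Translation by \<open>\<delta>\<close> turns the integral of \<open>?k\<close>
      over [0, s] into that of \<open>?F\<close> over [\<open>\<delta>\<close>, t]. The difference
      of the integrals with frozen x thus reduces to [0, \<open>\<delta>\<close>] and
      [s, t].\<close>
    have "(?F has_integral integral {\<delta>..t} ?F) {\<delta>..t}" using \<delta> by (intro integrable_integral Fs) auto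
    then have "((\<lambda>\<xi>. ?F (\<xi> + \<delta>)) has_integral integral {\<delta>..t} ?F) {\<delta> - \<delta>..t - \<delta>}"
      by (rule has_integral_shift_real_ivl)
    then have kI: "(?k has_integral integral {\<delta>..t} ?F) {0..s}" by (simp add: \<delta>_def algebra_simps)
    have c1: "integral {0..s} ?F + integral {s..t} ?F = integral {0..t} ?F"
      and c2: "integral {0..\<delta>} ?F + integral {\<delta>..t} ?F = integral {0..t} ?F"
      and c3: "integral {0..s} ?f + integral {s..t} ?f = integral {0..t} ?f"
      using st \<delta> F f by (auto intro!: Henstock_Kurzweil_Integration.integral_combine)
    let ?d = "\<lambda>\<xi>. (?f \<xi> - ?h \<xi>) - (?F \<xi> - ?k \<xi>)"
    have F0s: "?F integrable_on {0..s}" using st by (intro Fs) auto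
    have di: "?d integrable_on {0..s}"
      using kI F0s by (intro integrable_diff fs h) (auto simp: has_integral_iff)
    have dI: "integral {0..s} ?d = (integral {0..s} ?f - integral {0..s} ?h) - (integral {0..s} ?F - integral {\<delta>..t} ?F)"
      by (intro integral_unique has_integral_diff integrable_integral fs h F0s kI)
    have eq: "u t - u s = (S t u0 - S s u0) + (integral {s..t} ?f + integral {0..s} ?d + (integral {0..\<delta>} ?F - integral {s..t} ?F))"
      unfolding u_split(1)[OF mem(1)] u_split(1)[OF mem(2)] dI c3[symmetric]
      using c1 c2 by (simp add: algebra_simps)
    have n0: "norm (S t u0 - S s u0) \<le> K * (s powr (\<gamma> - 1) * \<delta>)"
      unfolding \<delta>_def by (rule norm_S_difference_smooth(1)) (use K \<gamma> st T in auto)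
    have n1: "norm (integral {s..t} ?f) \<le> C * G * (t - s)"
      by (rule norm_integral_S_le) (use st T fs g_bounded in auto)
    have n3: "norm (integral {0..\<delta>} ?F) \<le> C * G * (\<delta> - 0)"
      by (rule norm_integral_S_le) (use st T \<delta> xG in \<open>auto intro!: Fs\<close>)
    have n4: "norm (integral {s..t} ?F) \<le> C * G * (t - s)"
      by (rule norm_integral_S_le) (use st T \<delta> xG in \<open>auto intro!: Fs\<close>)
    have n2: "norm (integral {0..s} ?d) \<le> C * H * \<delta> * (s powr \<gamma> / \<gamma>)"
    \<comment> \<open>The Hoelder bound is available for \<open>\<xi> > 0\<close>, and at s the
      majorant has the default value 0.\<close>
    proof (rule norm_integral_le_except_finite[where F = "{0, s}", OF di has_integral_mult_right[OF has_integral_powr_reflected]])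
      fix \<xi> assume "\<xi> \<in> {0..s}" "\<xi> \<notin> {0, s}"
      then have \<xi>: "0 < \<xi>" "\<xi> < s" by auto
      have "?d \<xi> = S (t - \<xi>) (g \<xi> - x) - S (s - \<xi>) (g \<xi> - x)"
        using \<xi> st by (simp add: S_minus)
      also have "norm \<dots> \<le> C * norm (g \<xi> - x) * ((t - \<xi>) - (s - \<xi>)) / (s - \<xi>)"
        using \<xi> st T by (intro S_diff) auto
      also have "\<dots> = C * \<delta> / (s - \<xi>) * norm (g \<xi> - x)" by (simp add: \<delta>_def)
      also have "\<dots> \<le> C * \<delta> / (s - \<xi>) * (H * (s - \<xi>) powr \<gamma>)"
        unfolding x_def using \<xi> st C_pos \<delta> by (intro mult_left_mono holder) auto
      also have "\<dots> = C * H * \<delta> * (s - \<xi>) powr (\<gamma> - 1)" using \<xi> by (simp add: powr_diff)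
      finally show "norm (?d \<xi>) \<le> C * H * \<delta> * (s - \<xi>) powr (\<gamma> - 1)" .
    qed (use st \<gamma> in auto)
    also have "\<dots> \<le> C * H * \<delta> * (Tm / \<gamma>)"
      using st T \<gamma> C_pos H0 \<delta> by (intro mult_left_mono divide_right_mono powr_le_Tm) auto
    finally have n2': "norm (integral {0..s} ?d) \<le> C * H * (Tm / \<gamma>) * \<delta>" by (simp add: mult_ac)
    have "norm (u t - u s) \<le> norm (S t u0 - S s u0) + (norm (integral {s..t} ?f) + norm (integral {0..s} ?d)
        + (norm (integral {0..\<delta>} ?F) + norm (integral {s..t} ?F)))"
      unfolding eq by (intro norm_triangle_mono norm_triangle_ineq4 order_refl)
    also have "\<dots> \<le> K * (s powr (\<gamma> - 1) * \<delta>) + (C * G * \<delta> + C * H * (Tm / \<gamma>) * \<delta> + (C * G * \<delta> + C * G * \<delta>))"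
      by (intro add_mono n0 n2' n1[folded \<delta>_def] n3[unfolded diff_zero] n4[folded \<delta>_def])
    also have "\<dots> = K * (\<delta> * s powr (\<gamma> - 1)) + (3 * C * G + C * H * (Tm / \<gamma>)) * \<delta>"
      by (simp add: algebra_simps)
    also have "\<dots> \<le> Z * (\<delta> * s powr (\<gamma> - 1)) + Z * \<delta>"
      using \<delta> CG K by (intro add_mono mult_right_mono) (auto simp: Z_def)
    also have "\<dots> = Z * (\<delta> * (s powr (\<gamma> - 1) + 1))" by (simp add: algebra_simps)
    finally show "norm (u t - u s) \<le> Z * ((t - s) * (s powr (\<gamma> - 1) + 1))" by (simp add: \<delta>_def)
  qed
qed

end

section \<open>Quantitative regularity and the convergence estimates\<close>

context eerk_problem
begin

lemma regularI:
  assumes \<tau>: "0 < \<tau>" "\<tau> \<le> 1" and N: "real N * \<tau> \<le> T" and Z: "0 \<le> Z" "0 \<le> \<kappa>"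
    and le: "\<And>s \<xi>. \<tau> \<le> s \<Longrightarrow> s < \<xi> \<Longrightarrow> \<xi> \<le> s + \<tau> \<Longrightarrow> \<xi> \<le> T \<Longrightarrow> nY (u \<xi> - u s) \<le> Z * (\<kappa> * s powr (\<kappa> - 1) + 1)"
  shows "regular Z \<kappa> \<tau> N"
  unfolding regular_def
proof (intro allI impI ballI)
  fix n \<xi> assume n: "1 \<le> n \<and> n < N" and \<xi>: "\<xi> \<in> {real n * \<tau>..real n * \<tau> + \<tau>}"
  have "1 * \<tau> \<le> real n * \<tau>" using n \<tau> by (intro mult_right_mono) auto
  moreover have "real (Suc n) * \<tau> \<le> real N * \<tau>" using n \<tau> by (intro mult_right_mono) auto
  ultimately have "\<tau> \<le> real n * \<tau>" "\<xi> \<le> T" using \<xi> N by (auto simp: algebra_simps)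
  then show "nY (u \<xi> - u (real n * \<tau>)) \<le> Z * (\<kappa> * (real n * \<tau>) powr (\<kappa> - 1) + 1)"
    using le[of "real n * \<tau>" \<xi>] \<xi> Z by (cases "\<xi> = real n * \<tau>") (auto simp: nY_zero)
qed

text \<open>Since \<open>\<xi> - s \<le> \<tau> \<le> s\<close>, the quotient
  \<open>(\<xi> - s) / s\<close> is at most its power with exponent \<open>1 - \<epsilon>\<close>,
  which splits into a power of the step and \<open>s powr (\<epsilon> - 1)\<close>. Both parts of
  \<open>u_difference\<close> become multiples of
  \<open>\<tau> powr (1 - \<epsilon>) / \<epsilon>\<close>, the singular one with the factor
  \<open>\<epsilon>\<close> that \<open>regular\<close> demands.\<close>

lemma regular_exponent:
  assumes \<tau>: "0 < \<tau>" "\<tau> \<le> 1" and N: "real N * \<tau> \<le> T" and \<epsilon>: "0 < \<epsilon>" "\<epsilon> \<le> 1" "\<alpha> \<le> \<epsilon>"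
    and Z: "(C4 * Ku + C5 * G) * (\<tau> powr (1 - \<epsilon>) / \<epsilon>) \<le> Z"
  shows "regular Z \<epsilon> \<tau> N"
proof -
  have nn: "0 \<le> C4 * Ku" "0 \<le> C5 * G" using constants_nonneg Ku G_nonneg by auto
  define W where "W = \<tau> powr (1 - \<epsilon>) / \<epsilon>"
  have W: "0 \<le> W" using \<epsilon> by (simp add: W_def)
  have ZW: "C4 * Ku * W + C5 * G * W \<le> Z" using Z by (simp only: W_def distrib_right)
  have Z1: "C4 * Ku * W \<le> Z" "C5 * G * W \<le> Z" "0 \<le> Z"
    using ZW mult_nonneg_nonneg[OF nn(1) W] mult_nonneg_nonneg[OF nn(2) W] by auto
  show ?thesis
  proof (rule regularI[OF \<tau> N Z1(3)])
    fix s \<xi> assume s: "\<tau> \<le> s" "s < \<xi>" "\<xi> \<le> s + \<tau>" "\<xi> \<le> T"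
    define \<delta> where "\<delta> = \<xi> - s"
    have \<delta>: "0 < \<delta>" "\<delta> \<le> \<tau>" using s by (auto simp: \<delta>_def)
    have s0: "0 < s" using s \<tau> by simp
    have p: "\<delta> powr (1 - \<epsilon>) \<le> \<tau> powr (1 - \<epsilon>)" using \<delta> \<epsilon> by (intro powr_mono2) auto
    have "\<delta> / s = (\<delta> / s) powr 1" using \<delta> s0 by simp
    also have "\<dots> \<le> (\<delta> / s) powr (1 - \<epsilon>)" using \<delta> s s0 \<epsilon> by (intro powr_mono') auto
    also have "\<dots> = \<delta> powr (1 - \<epsilon>) * s powr (\<epsilon> - 1)"
      using \<delta> s0 by (simp add: powr_divide powr_diff)
    also have "\<dots> \<le> \<tau> powr (1 - \<epsilon>) * s powr (\<epsilon> - 1)" using p by (intro mult_right_mono) auto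
    also have "\<dots> = W * (\<epsilon> * s powr (\<epsilon> - 1))" using \<epsilon> by (simp add: W_def)
    finally have q: "\<delta> / s \<le> W * (\<epsilon> * s powr (\<epsilon> - 1))" .
    have "nY (u \<xi> - u s) \<le> C4 * Ku * (\<delta> / s) + C5 * G * (\<delta> powr (1 - \<epsilon>) / \<epsilon>)"
      unfolding \<delta>_def by (rule u_difference) (use s s0 \<tau> \<epsilon> in auto)
    also have "\<dots> \<le> C4 * Ku * (W * (\<epsilon> * s powr (\<epsilon> - 1))) + C5 * G * W"
      unfolding W_def using q[unfolded W_def] p \<epsilon> by (intro add_mono mult_left_mono nn divide_right_mono) auto
    also have "\<dots> = C4 * Ku * W * (\<epsilon> * s powr (\<epsilon> - 1)) + C5 * G * W" by (simp only: mult.assoc)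
    also have "\<dots> \<le> Z * (\<epsilon> * s powr (\<epsilon> - 1)) + Z"
      using Z1 \<epsilon> by (intro add_mono mult_right_mono) auto
    also have "\<dots> = Z * (\<epsilon> * s powr (\<epsilon> - 1) + 1)" by (simp add: distrib_left)
    finally show "nY (u \<xi> - u s) \<le> Z * (\<epsilon> * s powr (\<epsilon> - 1) + 1)" .
  qed (use \<epsilon> in auto)
qed

text \<open>For \<open>\<alpha> = 0\<close> the exponent varies with the step size, which is why
  \<open>\<kappa>\<close> is chosen after \<open>\<tau>\<close>. For \<open>\<alpha> > 0\<close> the
  fixed choice \<open>\<kappa> = \<alpha>\<close> works, and the logarithmic factor is at least
  1.\<close>

lemma regular_log:
  "\<exists>C0\<ge>1. \<forall>\<tau>. 0 < \<tau> \<longrightarrow> \<tau> \<le> 1 \<longrightarrow> (\<exists>\<kappa>>0. \<kappa> \<le> 1 \<and> \<alpha> \<le> \<kappa> \<and>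
     (\<forall>N. real N * \<tau> \<le> T \<longrightarrow> regular (C0 * \<tau> powr (1 - \<alpha>) * (\<bar>ln \<tau>\<bar> + 1)) \<kappa> \<tau> N))"
proof -
  define B where "B = C4 * Ku + C5 * G"
  have B: "0 \<le> B" using constants_nonneg Ku G_nonneg by (simp add: B_def)
  show ?thesis
  proof (cases "\<alpha> = 0")
    case True
    show ?thesis
    proof (rule exI[of _ "B * exp 1 + 1"], intro conjI allI impI)
      show "1 \<le> B * exp 1 + 1" using B by simp
      fix \<tau> :: real assume \<tau>: "0 < \<tau>" "\<tau> \<le> 1"
      define \<epsilon> where "\<epsilon> = 1 / (\<bar>ln \<tau>\<bar> + 1)"
      have \<epsilon>: "0 < \<epsilon>" "\<epsilon> \<le> 1" by (auto simp: \<epsilon>_def)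
      have "\<tau> powr (1 - \<epsilon>) = \<tau> * \<tau> powr - \<epsilon>" using \<tau> powr_add[of \<tau> 1 "- \<epsilon>"] by simp
      also have "\<dots> \<le> \<tau> * exp 1" unfolding \<epsilon>_def using \<tau> by (intro mult_left_mono powr_log_exponent) auto
      finally have "\<tau> powr (1 - \<epsilon>) * (\<bar>ln \<tau>\<bar> + 1) \<le> \<tau> * exp 1 * (\<bar>ln \<tau>\<bar> + 1)" by (intro mult_right_mono) auto
      moreover have "\<tau> powr (1 - \<epsilon>) / \<epsilon> = \<tau> powr (1 - \<epsilon>) * (\<bar>ln \<tau>\<bar> + 1)" by (simp add: \<epsilon>_def)
      ultimately have "B * (\<tau> powr (1 - \<epsilon>) / \<epsilon>) \<le> B * (\<tau> * exp 1 * (\<bar>ln \<tau>\<bar> + 1))"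
        using B by (intro mult_left_mono) auto
      also have "\<dots> = B * exp 1 * (\<tau> powr (1 - \<alpha>) * (\<bar>ln \<tau>\<bar> + 1))" using True \<tau> by simp
      also have "\<dots> \<le> (B * exp 1 + 1) * (\<tau> powr (1 - \<alpha>) * (\<bar>ln \<tau>\<bar> + 1))" by (intro mult_right_mono) auto
      finally have Z: "(C4 * Ku + C5 * G) * (\<tau> powr (1 - \<epsilon>) / \<epsilon>) \<le> (B * exp 1 + 1) * \<tau> powr (1 - \<alpha>) * (\<bar>ln \<tau>\<bar> + 1)"
        by (simp only: B_def mult.assoc)
      show "\<exists>\<kappa>>0. \<kappa> \<le> 1 \<and> \<alpha> \<le> \<kappa> \<and>
        (\<forall>N. real N * \<tau> \<le> T \<longrightarrow> regular ((B * exp 1 + 1) * \<tau> powr (1 - \<alpha>) * (\<bar>ln \<tau>\<bar> + 1)) \<kappa> \<tau> N)"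
        using \<epsilon> True regular_exponent[OF \<tau> _ \<epsilon> _ Z] by (intro exI[of _ \<epsilon>]) auto
    qed
  next
    case False
    with \<alpha> have \<alpha>0: "0 < \<alpha>" by simp
    have BA: "0 \<le> B / \<alpha>" using B \<alpha>0 by simp
    show ?thesis
    proof (rule exI[of _ "B / \<alpha> + 1"], intro conjI allI impI)
      show "1 \<le> B / \<alpha> + 1" using BA by simp
      fix \<tau> :: real assume \<tau>: "0 < \<tau>" "\<tau> \<le> 1"
      have "B * (\<tau> powr (1 - \<alpha>) / \<alpha>) = B / \<alpha> * \<tau> powr (1 - \<alpha>) * 1" by simp
      also have "\<dots> \<le> (B / \<alpha> + 1) * \<tau> powr (1 - \<alpha>) * (\<bar>ln \<tau>\<bar> + 1)"
        using BA by (intro mult_mono) auto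
      finally have Z: "(C4 * Ku + C5 * G) * (\<tau> powr (1 - \<alpha>) / \<alpha>) \<le> (B / \<alpha> + 1) * \<tau> powr (1 - \<alpha>) * (\<bar>ln \<tau>\<bar> + 1)"
        by (simp only: B_def)
      show "\<exists>\<kappa>>0. \<kappa> \<le> 1 \<and> \<alpha> \<le> \<kappa> \<and>
        (\<forall>N. real N * \<tau> \<le> T \<longrightarrow> regular ((B / \<alpha> + 1) * \<tau> powr (1 - \<alpha>) * (\<bar>ln \<tau>\<bar> + 1)) \<kappa> \<tau> N)"
        using \<alpha>0 \<alpha> regular_exponent[OF \<tau> _ \<alpha>0 _ _ Z] by (intro exI[of _ \<alpha>]) auto
    qed
  qed
qed

text \<open>For \<open>\<alpha> > 0\<close> the exponent \<open>\<kappa> = \<alpha>\<close> already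
  avoids the logarithm. For \<open>\<alpha> = 0\<close> one takes
  \<open>\<kappa> = \<gamma>\<close>, and dividing by the fixed \<open>\<gamma>\<close> provides the
  factor \<open>\<kappa>\<close> in \<open>regular\<close>.\<close>

lemma regular_smooth:
  assumes \<gamma>: "\<alpha> < \<gamma>" "\<gamma> < 1" and nY: "\<alpha> = 0 \<Longrightarrow> nY = norm"
    and K: "0 \<le> K" "\<And>\<sigma>. 0 < \<sigma> \<Longrightarrow> \<sigma> \<le> Tm \<Longrightarrow> norm (V \<sigma> u0) \<le> K * \<sigma> powr (\<gamma> - 1)"
  shows "\<exists>C0\<ge>1. \<exists>\<kappa>>0. \<alpha> \<le> \<kappa> \<and> \<kappa> \<le> \<gamma> \<and>
    (\<forall>\<tau> N. 0 < \<tau> \<longrightarrow> \<tau> \<le> 1 \<longrightarrow> real N * \<tau> \<le> T \<longrightarrow> regular (C0 * \<tau> powr (1 - \<alpha>)) \<kappa> \<tau> N)"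
proof (cases "\<alpha> = 0")
  case True
  with \<gamma> have \<gamma>0: "0 < \<gamma>" by simp
  from u_difference_smooth[OF True nY[OF True] \<gamma>0 \<gamma>(2) K] obtain Z where Z: "0 \<le> Z"
    "\<And>s t. 0 < s \<Longrightarrow> s < t \<Longrightarrow> t \<le> s + 1 \<Longrightarrow> t \<le> T \<Longrightarrow> norm (u t - u s) \<le> Z * ((t - s) * (s powr (\<gamma> - 1) + 1))"
    by blast
  have Z1: "0 \<le> Z / \<gamma>" using Z \<gamma>0 by simp
  have "regular ((Z / \<gamma> + 1) * \<tau> powr (1 - \<alpha>)) \<gamma> \<tau> N"
    if \<tau>: "0 < \<tau>" "\<tau> \<le> 1" and N: "real N * \<tau> \<le> T" for \<tau> N
  proof (rule regularI[OF \<tau> N])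
    fix s \<xi> assume s: "\<tau> \<le> s" "s < \<xi>" "\<xi> \<le> s + \<tau>" "\<xi> \<le> T"
    have "nY (u \<xi> - u s) \<le> Z * ((\<xi> - s) * (s powr (\<gamma> - 1) + 1))"
      unfolding nY[OF True] by (rule Z(2)) (use s \<tau> in auto)
    also have "\<dots> \<le> Z * (\<tau> * (s powr (\<gamma> - 1) + 1 / \<gamma>))"
      using s \<tau> Z(1) \<gamma>0 \<gamma> by (intro mult_left_mono mult_mono add_left_mono) auto
    also have "\<dots> = Z / \<gamma> * (\<tau> * (\<gamma> * s powr (\<gamma> - 1) + 1))" using \<gamma>0 by (simp add: field_simps)
    also have "\<dots> \<le> (Z / \<gamma> + 1) * (\<tau> * (\<gamma> * s powr (\<gamma> - 1) + 1))"
      using \<tau> \<gamma>0 by (intro mult_right_mono) auto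
    finally show "nY (u \<xi> - u s) \<le> (Z / \<gamma> + 1) * \<tau> powr (1 - \<alpha>) * (\<gamma> * s powr (\<gamma> - 1) + 1)"
      using True \<tau> by (simp add: mult.assoc)
  qed (use Z1 \<gamma>0 in auto)
  with Z1 \<gamma>0 True show ?thesis by (intro exI[of _ "Z / \<gamma> + 1"] conjI exI[of _ \<gamma>]) auto
next
  case False
  with \<alpha> have \<alpha>0: "0 < \<alpha>" by simp
  define B where "B = (C4 * Ku + C5 * G) / \<alpha>"
  have B: "0 \<le> B" using constants_nonneg Ku G_nonneg \<alpha>0 by (simp add: B_def)
  have "regular ((B + 1) * \<tau> powr (1 - \<alpha>)) \<alpha> \<tau> N"
    if \<tau>: "0 < \<tau>" "\<tau> \<le> 1" and N: "real N * \<tau> \<le> T" for \<tau> N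
  proof (rule regular_exponent[OF \<tau> N \<alpha>0])
    have "(C4 * Ku + C5 * G) * (\<tau> powr (1 - \<alpha>) / \<alpha>) = B * \<tau> powr (1 - \<alpha>)" by (simp add: B_def)
    also have "\<dots> \<le> (B + 1) * \<tau> powr (1 - \<alpha>)" by (intro mult_right_mono) auto
    finally show "(C4 * Ku + C5 * G) * (\<tau> powr (1 - \<alpha>) / \<alpha>) \<le> (B + 1) * \<tau> powr (1 - \<alpha>)" .
  qed (use \<alpha> in auto)
  with B \<alpha>0 \<gamma> show ?thesis by (intro exI[of _ "B + 1"] conjI exI[of _ \<alpha>]) auto
qed

lemma solution_in_Y:
  assumes "0 < \<tau>" "real n * \<tau> \<le> T" "err \<tau> n \<in> Y"
  shows "eerk_solution S f m \<tau> u0 n \<in> Y"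
  using Y_add[OF assms(3) u_in_Y[of "real n * \<tau>"]] assms by (simp add: err_def)

lemma convergence_log:
  "\<exists>K. \<exists>\<tau>0>0. \<forall>\<tau>. 0 < \<tau> \<and> \<tau> < \<tau>0 \<longrightarrow> (\<forall>n. real n * \<tau> \<le> T \<longrightarrow>
     eerk_solution S f m \<tau> u0 n \<in> Y \<and> nY (err \<tau> n) \<le> K * \<tau> powr (1 - \<alpha>) * (\<bar>ln \<tau>\<bar> + 1))"
proof -
  obtain C0 where C0: "1 \<le> C0" "\<And>\<tau>. 0 < \<tau> \<Longrightarrow> \<tau> \<le> 1 \<Longrightarrow> \<exists>\<kappa>>0. \<kappa> \<le> 1 \<and> \<alpha> \<le> \<kappa> \<and>
     (\<forall>N. real N * \<tau> \<le> T \<longrightarrow> regular (C0 * \<tau> powr (1 - \<alpha>) * (\<bar>ln \<tau>\<bar> + 1)) \<kappa> \<tau> N)"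
    using regular_log by blast
  \<comment> \<open>The logarithm is absorbed by half of the exponent:
    \<open>1 - \<alpha> - q0 = q0\<close>, so that
    \<open>PM * Z \<le> B * \<tau> powr q0\<close>.\<close>
  define B where "B = PM * C0 * (1 / q0 + 1)"
  have q: "0 < 1 / q0" using q0 by simp
  have B: "0 \<le> B" using C0 PM q by (simp add: B_def)
  from small_powr[OF q0(1) B] obtain \<tau>0 where \<tau>0: "0 < \<tau>0" "\<tau>0 \<le> 1"
    "\<And>\<tau>. 0 < \<tau> \<Longrightarrow> \<tau> < \<tau>0 \<Longrightarrow> B * \<tau> powr q0 \<le> 1" by blast
  show ?thesis
  proof (rule exI[of _ "PM * C0"], rule exI[of _ \<tau>0], intro conjI allI impI)
    fix \<tau> :: real and n :: nat assume \<tau>': "0 < \<tau> \<and> \<tau> < \<tau>0" and n: "real n * \<tau> \<le> T"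
    have \<tau>: "0 < \<tau>" "\<tau> \<le> 1" "B * \<tau> powr q0 \<le> 1" using \<tau>' \<tau>0 by auto
    define Z where "Z = C0 * \<tau> powr (1 - \<alpha>) * (\<bar>ln \<tau>\<bar> + 1)"
    obtain \<kappa> where \<kappa>: "0 < \<kappa>" "\<kappa> \<le> 1" "\<alpha> \<le> \<kappa>" and reg: "regular Z \<kappa> \<tau> n"
      using C0(2)[OF \<tau>(1,2)] n unfolding Z_def by blast
    have "1 * \<tau> powr (1 - \<alpha>) * 1 \<le> Z" unfolding Z_def using C0 by (intro mult_mono) auto
    then have Z1: "\<tau> powr (1 - \<alpha>) \<le> Z" by simp
    have "Z \<le> C0 * \<tau> powr (1 - \<alpha>) * ((1 / q0 + 1) * \<tau> powr - q0)"
      unfolding Z_def using C0 \<tau> q0 by (intro mult_left_mono abs_ln_le_powr) auto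
    then have "PM * Z \<le> PM * (C0 * \<tau> powr (1 - \<alpha>) * ((1 / q0 + 1) * \<tau> powr - q0))"
      using PM(1) by (rule mult_left_mono)
    also have "\<dots> = B * (\<tau> powr (1 - \<alpha>) * \<tau> powr - q0)" by (simp only: B_def mult_ac)
    also have "\<tau> powr (1 - \<alpha>) * \<tau> powr - q0 = \<tau> powr q0"
      unfolding powr_add[symmetric] by (rule arg_cong[of _ _ "\<lambda>x. \<tau> powr x"]) (simp add: field_simps)
    finally have Z2: "PM * Z \<le> 1" using \<tau> by linarith
    have e: "err \<tau> n \<in> Y \<and> nY (err \<tau> n) \<le> PM * Z"
      by (rule main_bound(1)[OF \<tau>(1,2) \<kappa> Z1 Z2 n reg]) simp
    then show "eerk_solution S f m \<tau> u0 n \<in> Y" using solution_in_Y \<tau> n by simp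
    show "nY (err \<tau> n) \<le> PM * C0 * \<tau> powr (1 - \<alpha>) * (\<bar>ln \<tau>\<bar> + 1)"
      using e by (simp add: Z_def mult.assoc)
  qed (use \<tau>0 in simp)
qed

lemma convergence_smooth:
  assumes sc: "intermediate_scale S V Tm C \<gamma> Yg ng CEg" and ug: "u0 \<in> Yg" and \<gamma>: "\<alpha> < \<gamma>"
    and nY: "\<alpha> = 0 \<Longrightarrow> nY = norm"
    and K: "0 \<le> K" "\<And>\<sigma>. 0 < \<sigma> \<Longrightarrow> \<sigma> \<le> Tm \<Longrightarrow> norm (V \<sigma> u0) \<le> K * \<sigma> powr (\<gamma> - 1)"
  shows "\<exists>K. \<exists>\<tau>0>0. \<forall>\<tau>. 0 < \<tau> \<and> \<tau> < \<tau>0 \<longrightarrow> (\<forall>n. real n * \<tau> \<le> T \<longrightarrow>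
     eerk_solution S f m \<tau> u0 n \<in> Y \<and> eerk_solution S f m \<tau> u0 n \<in> Yg \<and> u (real n * \<tau>) \<in> Yg \<and>
     nY (err \<tau> n) \<le> K * \<tau> powr (1 - \<alpha>) \<and> ng (err \<tau> n) \<le> K * \<tau> powr (1 - \<gamma>))"
proof -
  interpret sg: intermediate_scale S V Tm C \<gamma> Yg ng CEg by (rule sc)
  obtain C0 \<kappa> where C0: "1 \<le> C0" and \<kappa>: "0 < \<kappa>" "\<alpha> \<le> \<kappa>" "\<kappa> \<le> \<gamma>"
    and reg: "\<And>\<tau> N. 0 < \<tau> \<Longrightarrow> \<tau> \<le> 1 \<Longrightarrow> real N * \<tau> \<le> T \<Longrightarrow> regular (C0 * \<tau> powr (1 - \<alpha>)) \<kappa> \<tau> N"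
    using regular_smooth[OF \<gamma> sg.\<alpha>(2) nY K] by blast
  have \<kappa>1: "\<kappa> \<le> 1" using \<kappa> sg.\<alpha> by simp
  obtain P where P: "0 \<le> P" and bound: "\<And>\<tau> Z \<kappa> N n. 0 < \<tau> \<Longrightarrow> \<tau> \<le> 1 \<Longrightarrow> 0 < \<kappa> \<Longrightarrow> \<kappa> \<le> 1 \<Longrightarrow> \<alpha> \<le> \<kappa> \<Longrightarrow> \<kappa> \<le> \<gamma> \<Longrightarrow>
    \<tau> powr (1 - \<alpha>) \<le> Z \<Longrightarrow> PM * Z \<le> 1 \<Longrightarrow> real N * \<tau> \<le> T \<Longrightarrow> regular Z \<kappa> \<tau> N \<Longrightarrow> n \<le> N \<Longrightarrow>
    err \<tau> n \<in> Yg \<and> ng (err \<tau> n) \<le> P * (\<tau> powr (1 - \<gamma>) + Z + Z * \<tau> powr (\<kappa> - \<gamma>))"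
    using stronger_norm_bound[OF sc] by blast
  have a: "0 < 1 - \<alpha>" and B: "0 \<le> PM * C0" using \<alpha> PM C0 by auto
  from small_powr[OF a B] obtain \<tau>0 where \<tau>0: "0 < \<tau>0" "\<tau>0 \<le> 1"
    "\<And>\<tau>. 0 < \<tau> \<Longrightarrow> \<tau> < \<tau>0 \<Longrightarrow> PM * C0 * \<tau> powr (1 - \<alpha>) \<le> 1" by blast
  define K' where "K' = PM * C0 + P * (1 + 2 * C0)"
  have K': "PM * C0 \<le> K'" "P * (1 + 2 * C0) \<le> K'" using P C0 B by (auto simp: K'_def)
  show ?thesis
  proof (rule exI[of _ K'], rule exI[of _ \<tau>0], intro conjI allI impI)
    fix \<tau> :: real and n :: nat assume \<tau>': "0 < \<tau> \<and> \<tau> < \<tau>0" and n: "real n * \<tau> \<le> T"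
    have \<tau>: "0 < \<tau>" "\<tau> \<le> 1" using \<tau>' \<tau>0 by auto
    define Z where "Z = C0 * \<tau> powr (1 - \<alpha>)"
    have "1 * \<tau> powr (1 - \<alpha>) \<le> Z" unfolding Z_def using C0 by (intro mult_right_mono) auto
    then have Z1: "\<tau> powr (1 - \<alpha>) \<le> Z" by simp
    have Z2: "PM * Z \<le> 1" using \<tau>0(3)[of \<tau>] \<tau>' by (simp add: Z_def mult.assoc)
    have rg: "regular Z \<kappa> \<tau> n" unfolding Z_def by (rule reg[OF \<tau> n])
    have e: "err \<tau> n \<in> Y \<and> nY (err \<tau> n) \<le> PM * Z"
      by (rule main_bound(1)[OF \<tau> \<kappa>(1) \<kappa>1 \<kappa>(2) Z1 Z2 n rg]) simp
    have eg: "err \<tau> n \<in> Yg \<and> ng (err \<tau> n) \<le> P * (\<tau> powr (1 - \<gamma>) + Z + Z * \<tau> powr (\<kappa> - \<gamma>))"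
      by (rule bound[OF \<tau> \<kappa>(1) \<kappa>1 \<kappa>(2,3) Z1 Z2 n rg]) simp
    show "eerk_solution S f m \<tau> u0 n \<in> Y" using solution_in_Y e \<tau> n by simp
    show ut: "u (real n * \<tau>) \<in> Yg" by (rule u_in_scale[OF sc ug]) (use \<tau> n in auto)
    show "eerk_solution S f m \<tau> u0 n \<in> Yg"
      using sg.Y_add[OF conjunct1[OF eg] ut] by (simp add: err_def)
    have "PM * C0 * \<tau> powr (1 - \<alpha>) \<le> K' * \<tau> powr (1 - \<alpha>)" using K'(1) by (rule mult_right_mono) simp
    with e show "nY (err \<tau> n) \<le> K' * \<tau> powr (1 - \<alpha>)" by (simp add: Z_def mult.assoc)
    have "\<tau> powr (1 - \<alpha>) \<le> \<tau> powr (1 - \<gamma>)" using \<tau> \<gamma> by (intro powr_mono') auto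
    then have 1: "Z \<le> C0 * \<tau> powr (1 - \<gamma>)" unfolding Z_def using C0 by (intro mult_left_mono) auto
    \<comment> \<open>The exponent is at least \<open>1 - \<gamma>\<close> because
      \<open>\<alpha> \<le> \<kappa>\<close>: the singularity in time costs no more than the
      stronger norm.\<close>
    have "Z * \<tau> powr (\<kappa> - \<gamma>) = C0 * \<tau> powr (1 - \<alpha> + (\<kappa> - \<gamma>))" by (simp add: Z_def powr_add)
    also have "\<dots> \<le> C0 * \<tau> powr (1 - \<gamma>)" using \<tau> \<kappa> C0 by (intro mult_left_mono powr_mono') auto
    finally have 2: "Z * \<tau> powr (\<kappa> - \<gamma>) \<le> C0 * \<tau> powr (1 - \<gamma>)" .
    have "\<tau> powr (1 - \<gamma>) + Z + Z * \<tau> powr (\<kappa> - \<gamma>) \<le> (1 + 2 * C0) * \<tau> powr (1 - \<gamma>)"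
      using 1 2 unfolding distrib_right by linarith
    then have "P * (\<tau> powr (1 - \<gamma>) + Z + Z * \<tau> powr (\<kappa> - \<gamma>)) \<le> P * ((1 + 2 * C0) * \<tau> powr (1 - \<gamma>))"
      using P by (rule mult_left_mono)
    moreover have "P * (1 + 2 * C0) * \<tau> powr (1 - \<gamma>) \<le> K' * \<tau> powr (1 - \<gamma>)" using K'(2) by (rule mult_right_mono) simp
    ultimately show "ng (err \<tau> n) \<le> K' * \<tau> powr (1 - \<gamma>)" using eg by (simp add: mult.assoc)
  qed (use \<tau>0 in simp)
qed

end

text \<open>For \<open>\<beta> = 0\<close> this is the smoothing of the semigroup itself, for
  \<open>\<beta> > 0\<close> the embedding into the space with p =
  \<open>\<infinity>\<close>.\<close>

lemma intermediate_space_smoothing: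
  fixes D :: "'a::complex_banach set"
  assumes sg: "smoothing_semigroup (analytic_semigroup D A) (\<lambda>t x. A (analytic_semigroup D A t x)) Tm C"
    and \<beta>: "0 \<le> \<beta>" "\<beta> < 1" and Tm1: "1 \<le> Tm" and Y: "intermediate_space D A \<beta> Y nY" and x: "x \<in> Y"
  shows "\<exists>K\<ge>0. \<forall>\<sigma>. 0 < \<sigma> \<and> \<sigma> \<le> Tm \<longrightarrow> norm (A (analytic_semigroup D A \<sigma> x)) \<le> K * \<sigma> powr (\<beta> - 1)"
proof -
  interpret smoothing_semigroup "analytic_semigroup D A" "\<lambda>t x. A (analytic_semigroup D A t x)" Tm C by (rule sg)
  show ?thesis
  proof (cases "\<beta> = 0")
    case True
    have "norm (A (analytic_semigroup D A \<sigma> x)) \<le> C * norm x * \<sigma> powr (\<beta> - 1)" if "0 < \<sigma> \<and> \<sigma> \<le> Tm" for \<sigma>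
      using V_norm[of \<sigma> x] that True by (simp add: powr_minus_divide)
    then show ?thesis using C_pos by (intro exI[of _ "C * norm x"]) auto
  next
    case False
    then have "x \<in> interp_space D A \<beta> \<infinity>"
      using Y x by (auto simp: intermediate_space_def continuously_embedded_def)
    from interp_space_infinity_bound[OF refl refl Tm1 \<beta> this] show ?thesis .
  qed
qed

theorem theorem4p1:
  fixes D :: "'a::complex_banach set" and A :: "'a \<Rightarrow> 'a"
    and \<alpha> T :: real
    and Xa :: "'a set" and na :: "'a \<Rightarrow> real"
    and f :: "real \<Rightarrow> 'a \<Rightarrow> 'a" and u0 :: 'a and u :: "real \<Rightarrow> 'a"
    and m :: eerk
  assumes "sectorial UNIV norm D A"
    and "0 \<le> \<alpha>" and "\<alpha> < 1"
    and "intermediate_space D A \<alpha> Xa na"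
    and "sectorial Xa na (part_domain D A Xa) A"
    and "0 < T"
    and "\<forall>R>0. \<exists>L. \<forall>t1\<in>{0..T}. \<forall>t2\<in>{0..T}. \<forall>v1\<in>Xa. \<forall>v2\<in>Xa. max (na v1) (na v2) \<le> R \<longrightarrow>
           norm (f t1 v1 - f t2 v2) \<le> L * (\<bar>t1 - t2\<bar> + na (v1 - v2))"
    and "u0 \<in> Xa"
    and "mild_solution (analytic_semigroup D A) Xa na f u0 T u"
    and "eerk_method m"
    and "\<forall>z. (\<Sum>i\<in>{1..stages m}. b_fun m i z) = phi 1 z"
  shows "let un = (\<lambda>\<tau>. eerk_solution (analytic_semigroup D A) f m \<tau> u0) in
     (\<exists>C. \<exists>\<tau>0>0. \<forall>\<tau>. 0 < \<tau> \<and> \<tau> < \<tau>0 \<longrightarrow> (\<forall>n. real n * \<tau> \<le> T \<longrightarrow>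
            un \<tau> n \<in> Xa \<and>
            na (un \<tau> n - u (real n * \<tau>)) \<le> C * \<tau> powr (1 - \<alpha>) * (\<bar>ln \<tau>\<bar> + 1)))
    \<and> (\<forall>\<gamma> Xg ng. \<alpha> < \<gamma> \<and> \<gamma> < 1 \<and> intermediate_space D A \<gamma> Xg ng \<and>
          sectorial Xg ng (part_domain D A Xg) A \<and> u0 \<in> Xg \<longrightarrow>
        (\<exists>C. \<exists>\<tau>0>0. \<forall>\<tau>. 0 < \<tau> \<and> \<tau> < \<tau>0 \<longrightarrow> (\<forall>n. real n * \<tau> \<le> T \<longrightarrow>
            un \<tau> n \<in> Xa \<and> un \<tau> n \<in> Xg \<and> u (real n * \<tau>) \<in> Xg \<and>
            na (un \<tau> n - u (real n * \<tau>)) \<le> C * \<tau> powr (1 - \<alpha>) \<and>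
            ng (un \<tau> n - u (real n * \<tau>)) \<le> C * \<tau> powr (1 - \<gamma>))))"
proof -
  \<comment> \<open>The constants of the semigroup are fixed on an interval longer than [0, T], with
    exactly the margin that \<open>semilinear\<close> asks for.\<close>
  define Tm where "Tm = T + 3"
  have TmT: "0 < Tm" "1 \<le> Tm" "T + 3 \<le> Tm" using \<open>0 < T\<close> by (auto simp: Tm_def)
  obtain C where sg: "smoothing_semigroup (analytic_semigroup D A) (\<lambda>t x. A (analytic_semigroup D A t x)) Tm C"
    using sectorial_smoothing_semigroup[OF assms(1) TmT(1)] by blast
  obtain CE where sc: "intermediate_scale (analytic_semigroup D A) (\<lambda>t x. A (analytic_semigroup D A t x)) Tm C \<alpha> Xa na CE"
    using intermediate_scale_ex[OF sg assms(2,3) TmT(2) assms(4)] by blast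
  obtain Ku where Ku: "0 \<le> Ku"
    "\<And>\<sigma>. 0 < \<sigma> \<Longrightarrow> \<sigma> \<le> Tm \<Longrightarrow> norm (A (analytic_semigroup D A \<sigma> u0)) \<le> Ku * \<sigma> powr (\<alpha> - 1)"
    using intermediate_space_smoothing[OF sg assms(2,3) TmT(2) assms(4) \<open>u0 \<in> Xa\<close>] by blast
  interpret eerk_problem "analytic_semigroup D A" "\<lambda>t x. A (analytic_semigroup D A t x)" Tm C \<alpha> Xa na CE f T u0 u Ku m
    by (intro eerk_problem.intro semilinear.intro semilinear_axioms.intro eerk_problem_axioms.intro sc)
      (use assms TmT Ku in auto)
  have na: "na = norm" if "\<alpha> = 0" using assms(4) that by (simp add: intermediate_space_def)
  have smooth: "\<exists>K. \<exists>\<tau>0>0. \<forall>\<tau>. 0 < \<tau> \<and> \<tau> < \<tau>0 \<longrightarrow> (\<forall>n. real n * \<tau> \<le> T \<longrightarrow>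
     eerk_solution (analytic_semigroup D A) f m \<tau> u0 n \<in> Xa \<and> eerk_solution (analytic_semigroup D A) f m \<tau> u0 n \<in> Xg \<and>
     u (real n * \<tau>) \<in> Xg \<and> na (err \<tau> n) \<le> K * \<tau> powr (1 - \<alpha>) \<and> ng (err \<tau> n) \<le> K * \<tau> powr (1 - \<gamma>))"
    if \<gamma>: "\<alpha> < \<gamma>" "\<gamma> < 1" and Xg: "intermediate_space D A \<gamma> Xg ng" and ug: "u0 \<in> Xg" for \<gamma> Xg ng
  proof -
    have \<gamma>0: "0 \<le> \<gamma>" using \<gamma> assms(2) by simp
    obtain CEg where scg: "intermediate_scale (analytic_semigroup D A) (\<lambda>t x. A (analytic_semigroup D A t x)) Tm C \<gamma> Xg ng CEg"
      using intermediate_scale_ex[OF sg \<gamma>0 \<gamma>(2) TmT(2) Xg] by blast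
    obtain Kg where Kg: "0 \<le> Kg"
      "\<And>\<sigma>. 0 < \<sigma> \<Longrightarrow> \<sigma> \<le> Tm \<Longrightarrow> norm (A (analytic_semigroup D A \<sigma> u0)) \<le> Kg * \<sigma> powr (\<gamma> - 1)"
      using intermediate_space_smoothing[OF sg \<gamma>0 \<gamma>(2) TmT(2) Xg ug] by blast
    show ?thesis by (rule convergence_smooth[OF scg ug \<gamma>(1) na Kg])
  qed
  show ?thesis
    unfolding Let_def using convergence_log smooth unfolding err_def by blast
qed

end
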